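(* Let $\Omega$ be a bounded Lipschitz domain, $1<p<\infty$ and $u\in W^{1,p}_{\phi_\varepsilon,0}(\Omega_\varepsilon)$. (i) If $1<p<d$ and $\frac1{p^*}=\frac1p-\frac1d$, then $\|\phi_\varepsilon u\|_{L^{p^*}(\Omega_\varepsilon)}\le C\|\phi_\varepsilon\nabla u\|_{L^p(\Omega_\varepsilon)}$. (ii) If $p>d$, then $\|\phi_\varepsilon u\|_{L^\infty(\Omega_\varepsilon)}\le C\|\phi_\varepsilon\nabla u\|_{L^p(\Omega_\varepsilon)}$. The constants $C$ are independent of $\varepsilon\in(0,1)$.
   Context: Let $Y=(-1/2,1/2)^d$ and $\tau_1,\dots,\tau_m\subset Y$ mutually disjoint open sets with smooth connected boundaries, $\mathrm{dist}(\tau_i,\partial Y)\ge c_0$, $\mathrm{dist}(\tau_i,\tau_j)\ge c_0$; $T=\bigcup_i\overline{\tau_i}$, $T_\varepsilon=\bigcup_{z\in\mathbb Z^d}\varepsilon(z+T)$, $\Omega_\varepsilon=\Omega\setminus T_\varepsilon$ ($0<\varepsilon<1$), with $\mathrm{dist}(\partial\Omega,\partial T_\varepsilon)\ge c_0\varepsilon$. Extended holes: smooth open $\tau_i'\supset\tau_i$ with $\mathrm{dist}(\tau_i',\tau_j')\ge c_0/4$, $\mathrm{dist}(\tau_i',\partial Y)\ge c_0/4$, $\mathrm{dist}(\partial\tau_i',\tau_i)\ge c_0/4$; $T'=\bigcup_i\overline{\tau_i'}$; it is assumed that the sets $\varepsilon(z+T')$, $z\in\mathbb Z^d$, do not intersect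 $\partial\Omega$. The weight $\phi>0$ is $\mathbb Z^d$-periodic on $\mathbb R^d\setminus\bigcup_z(z+T)$ with $c\,\mathrm{dist}(y,T)\le\phi(y)\le C\,\mathrm{dist}(y,T)$ on $Y$, $\phi\in C^{1,\alpha}(\overline{Y\setminus T})$; $\phi_\varepsilon(x)=\phi(x/\varepsilon)$. $W^{1,p}_{\phi_\varepsilon}(\Omega_\varepsilon)=\{v\in L^1_{loc}(\Omega_\varepsilon):\phi_\varepsilon v\in L^p,\ \phi_\varepsilon\nabla v\in L^p\}$, and $W^{1,p}_{\phi_\varepsilon,0}(\Omega_\varepsilon)$ is its subspace of functions vanishing on $\partial\Omega$. *)

theory Defs
  imports "HOL-Analysis.Analysis"
begin

fun Ck :: "nat \<Rightarrow> 'a::euclidean_space set \<Rightarrow> ('a \<Rightarrow> real) \<Rightarrow> bool" where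
  "Ck 0 S f = continuous_on S f"
| "Ck (Suc k) S f = (f differentiable_on S \<and>
      (\<forall>v. Ck k S (\<lambda>x. frechet_derivative f (at x) v)))"

definition smooth_on :: "'a::euclidean_space set \<Rightarrow> ('a \<Rightarrow> real) \<Rightarrow> bool" where
  "smooth_on S f \<longleftrightarrow> (\<forall>k. Ck k S f)"

definition C1_alpha_closure :: "real \<Rightarrow> 'a::euclidean_space set \<Rightarrow> ('a \<Rightarrow> real) \<Rightarrow> bool" where
  "C1_alpha_closure \<alpha> D f \<longleftrightarrow>
     Ck 1 D f \<and> continuous_on (closure D) f \<and>
     (\<exists>L. \<forall>b\<in>Basis. \<forall>x\<in>D. \<forall>y\<in>D.
        \<bar>frechet_derivative f (at x) b - frechet_derivative f (at y) b\<bar> \<le> L * dist x y powr \<alpha>)"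

text \<open>Boundary locally the subgraph of a function g (constant along the normal direction n,
  i.e. a function of the remaining d-1 coordinates) satisfying property P.\<close>
definition boundary_locally_graph :: "(('a::euclidean_space \<Rightarrow> real) \<Rightarrow> bool) \<Rightarrow> 'a set \<Rightarrow> bool" where
  "boundary_locally_graph P U \<longleftrightarrow>
     (\<forall>x\<in>frontier U. \<exists>r>0. \<exists>n g. norm n = 1 \<and> P g \<and> (\<forall>y t. g (y + t *\<^sub>R n) = g y) \<and>
        U \<inter> ball x r = {y \<in> ball x r. y \<bullet> n < g y})"

definition lipschitz_domain :: "'a::euclidean_space set \<Rightarrow> bool" where
  "lipschitz_domain U \<longleftrightarrow> open U \<and> connected U \<and> U \<noteq> {} \<and>
     boundary_locally_graph (\<lambda>g. \<exists>L. L-lipschitz_on UNIV g) U"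

definition smooth_boundary :: "'a::euclidean_space set \<Rightarrow> bool" where
  "smooth_boundary U \<longleftrightarrow> boundary_locally_graph (smooth_on UNIV) U"

definition Ycell :: "'a::euclidean_space set" where
  "Ycell = box (-(1/2) *\<^sub>R One) ((1/2) *\<^sub>R One)"

definition lattice :: "'a::euclidean_space set" where
  "lattice = {z. \<forall>b\<in>Basis. z \<bullet> b \<in> \<int>}"

definition holes_union :: "nat \<Rightarrow> (nat \<Rightarrow> 'a::euclidean_space set) \<Rightarrow> 'a set" where
  "holes_union m \<tau> = (\<Union>i<m. closure (\<tau> i))"

definition scaled_copy :: "real \<Rightarrow> 'a::euclidean_space \<Rightarrow> 'a set \<Rightarrow> 'a set" where
  "scaled_copy \<epsilon> z A = (\<lambda>t. \<epsilon> *\<^sub>R (z + t)) ` A"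

definition perforation :: "real \<Rightarrow> 'a::euclidean_space set \<Rightarrow> 'a set" where
  "perforation \<epsilon> T = (\<Union>z\<in>lattice. scaled_copy \<epsilon> z T)"

definition phi_eps :: "('a::euclidean_space \<Rightarrow> real) \<Rightarrow> real \<Rightarrow> 'a \<Rightarrow> real" where
  "phi_eps \<phi> \<epsilon> x = \<phi> ((1/\<epsilon>) *\<^sub>R x)"

definition admissible_eps :: "real \<Rightarrow> 'a::euclidean_space set \<Rightarrow> 'a set \<Rightarrow> 'a set \<Rightarrow> real \<Rightarrow> bool" where
  "admissible_eps c0 \<Omega> T T' \<epsilon> \<longleftrightarrow>
     setdist (frontier \<Omega>) (frontier (perforation \<epsilon> T)) \<ge> c0 * \<epsilon> \<and>
     (\<forall>z\<in>lattice. scaled_copy \<epsilon> z T' \<inter> frontier \<Omega> = {})"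

definition test_function :: "'a::euclidean_space set \<Rightarrow> ('a \<Rightarrow> real) \<Rightarrow> bool" where
  "test_function S \<psi> \<longleftrightarrow> smooth_on UNIV \<psi> \<and>
     compact (closure {x. \<psi> x \<noteq> 0}) \<and> closure {x. \<psi> x \<noteq> 0} \<subseteq> S"

definition weak_gradient :: "'a::euclidean_space set \<Rightarrow> ('a \<Rightarrow> real) \<Rightarrow> ('a \<Rightarrow> 'a) \<Rightarrow> bool" where
  "weak_gradient S u G \<longleftrightarrow>
     (\<forall>K. compact K \<and> K \<subseteq> S \<longrightarrow>
        set_integrable lebesgue K u \<and> (\<forall>b\<in>Basis. set_integrable lebesgue K (\<lambda>x. G x \<bullet> b))) \<and>
     (\<forall>\<psi>. test_function S \<psi> \<longrightarrow> (\<forall>b\<in>Basis.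
        (LINT x:S|lebesgue. u x * frechet_derivative \<psi> (at x) b) =
          - (LINT x:S|lebesgue. (G x \<bullet> b) * \<psi> x)))"

text \<open>u in W^{1,p}_{w,0}(Omega \ Te) with weak gradient G: u in L^1_loc, w u and w grad u in L^p,
  and u vanishes on dOmega, expressed as: the zero extension of u (outside Omega \ Te)
  has the zero extension of G as weak gradient in R^d \ Te.\<close>
definition W1p_weighted_0 ::
  "real \<Rightarrow> ('a::euclidean_space \<Rightarrow> real) \<Rightarrow> 'a set \<Rightarrow> 'a set \<Rightarrow> ('a \<Rightarrow> real) \<Rightarrow> ('a \<Rightarrow> 'a) \<Rightarrow> bool" where
  "W1p_weighted_0 p w \<Omega> Te u G \<longleftrightarrow>
     weak_gradient (\<Omega> - Te) u G \<and>
     set_integrable lebesgue (\<Omega> - Te) (\<lambda>x. \<bar>w x * u x\<bar> powr p) \<and>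
     set_integrable lebesgue (\<Omega> - Te) (\<lambda>x. (\<bar>w x\<bar> * norm (G x)) powr p) \<and>
     weak_gradient (UNIV - Te)
        (\<lambda>x. if x \<in> \<Omega> - Te then u x else 0) (\<lambda>x. if x \<in> \<Omega> - Te then G x else 0)"

end

(*
Write T for the periodic union of all holes. The weight is comparable to dist(., T), so it suffices to
bound dist(x, T) |u(x)|, at unit scale and for compactly supported u, by a constant times the Riesz
potential of order one of dist(., T) |grad u|; the constant is scale invariant, hence independent of
epsilon. Near T the complement of the holes contains, at each point x, a cone along which the distance
to T grows linearly; averaging the fundamental theorem of calculus over that cone bounds u(x) by cell
averages plus a potential. The complement of T is connected, so the averages over neighbouring cells
differ by a potential as well, and smoothing the cell averages at unit scale reduces them to a compactly
supported function on the whole space. The theorem follows from the Hardy-Littlewood-Sobolev inequality if p < d,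
and from the Hoelder inequality on a bounded support if p > d.
*)
theory Submission
  imports Defs
begin

section \<open>Riesz potentials and the Hardy-Littlewood-Sobolev inequality\<close>

text \<open>The weight vanishes on the holes, so traces on their boundaries need not exist and the
  function is not continued across them: every path along which it is followed must keep a
  controlled distance from T. Therefore each estimate uses the gradient cut off to {y. k \<le>
  dist(y, T)}. At a point x the level k can be a fixed fraction of dist(x, T), because the cones
  leave T at linear speed; on the cut-off set k is at most dist(y, T), so the factor dist(x, T)
  moves under the potential at the cost of a constant. The same cut-off pays for regularisation:
  mollifying at scale r is legitimate only at a distance of order r from the holes, which is all
  that an estimate at x needs when r is small against the distance of x. Scale invariance is the
  homogeneity of the kernel |x - y|^(1 - d), which matches the chain rule for a gradient. Averaging
  the density of a potential over balls of fixed radius costs only a constant; this is used both for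
  the smoothed cell averages and for the mollified gradient.\<close>

lemma nn_integral_powr_from_0:
  fixes e r :: real
  assumes "-1 < e" "0 \<le> r"
  shows "(\<integral>\<^sup>+t\<in>{0<..r}. ennreal (t powr e) \<partial>lborel) = ennreal (r powr (e + 1) / (e + 1))"
proof -
  have "(\<integral>\<^sup>+t\<in>{0<..r}. ennreal (t powr e) \<partial>lborel) = (\<integral>\<^sup>+t\<in>{0..r}. ennreal (t powr e) \<partial>lborel)"
    by (intro nn_integral_cong) (auto simp: indicator_def)
  also have "\<dots> = ennreal (r powr (e + 1) / (e + 1))"
    by (intro nn_integral_has_integral_lebesgue' has_integral_powr_from_0 assms) auto
  finally show ?thesis .
qed

lemma nn_integral_powr_to_inf:
  fixes e r :: real
  assumes "e < -1" "0 < r"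
  shows "(\<integral>\<^sup>+t\<in>{r..}. ennreal (t powr e) \<partial>lborel) = ennreal (r powr (e + 1) / (-(e + 1)))"
proof -
  have "(\<integral>\<^sup>+t\<in>{r..}. ennreal (t powr e) \<partial>lborel) = ennreal (-(r powr (e + 1)) / (e + 1))"
    using assms by (intro nn_integral_has_integral_lebesgue' has_integral_powr_to_inf) auto
  moreover have "-(r powr (e + 1)) / (e + 1) = r powr (e + 1) / (-(e + 1))"
    by (simp only: divide_minus_right minus_divide_left)
  ultimately show ?thesis by simp
qed

lemma cball_measurable [measurable]: "cball (x::'a::euclidean_space) t \<in> sets borel"
  by (simp add: borel_closed)

section \<open>The potential of order one in layer-cake form\<close>

definition ball_mass :: "('a::euclidean_space \<Rightarrow> ennreal) \<Rightarrow> 'a \<Rightarrow> real \<Rightarrow> ennreal" where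
  "ball_mass f x t = (\<integral>\<^sup>+y\<in>cball x t. f y \<partial>lborel)"

text \<open>For d \<ge> 2, Fubini turns this into 1/(d - 1) times the integral of |x - y|^(1 - d)
  f(y). In the layer-cake form the kernel never appears: estimates reduce to comparing the masses of
  balls.\<close>

definition riesz :: "('a::euclidean_space \<Rightarrow> ennreal) \<Rightarrow> 'a \<Rightarrow> ennreal" where
  "riesz f x = (\<integral>\<^sup>+t\<in>{0<..}. ennreal (t powr - real DIM('a)) * ball_mass f x t \<partial>lborel)"

lemma ball_mass_measurable [measurable]:
  fixes f :: "'a::euclidean_space \<Rightarrow> ennreal"
  assumes [measurable]: "f \<in> borel_measurable borel" "g \<in> borel_measurable M" "h \<in> borel_measurable M"
  shows "(\<lambda>z. ball_mass f (g z) (h z)) \<in> borel_measurable M"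
proof -
  have "(\<lambda>z. \<integral>\<^sup>+y. (if dist (g z) y \<le> h z then f y else 0) \<partial>lborel) \<in> borel_measurable M"
    by measurable
  moreover have "(\<lambda>z. ball_mass f (g z) (h z)) = (\<lambda>z. \<integral>\<^sup>+y. (if dist (g z) y \<le> h z then f y else 0) \<partial>lborel)"
    unfolding ball_mass_def by (intro ext nn_integral_cong) (auto simp: indicator_def)
  ultimately show ?thesis by simp
qed

lemma ball_mass_mono:
  assumes "\<And>y. f y \<le> g y" "s \<le> t"
  shows "ball_mass f x s \<le> ball_mass g x t"
  unfolding ball_mass_def using assms
  by (intro nn_integral_mono mult_mono) (auto simp: indicator_def)

lemma ball_mass_subset:
  assumes "dist x y + s \<le> t"
  shows "ball_mass f y s \<le> ball_mass f x t"
  unfolding ball_mass_def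
proof (intro nn_integral_mono mult_left_mono)
  show "indicator (cball y s) z \<le> (indicator (cball x t) z :: ennreal)" for z
    using assms dist_triangle[of x z y] by (auto simp: indicator_def)
qed simp

lemma ball_mass_cmult:
  assumes [measurable]: "f \<in> borel_measurable borel"
  shows "ball_mass (\<lambda>y. c * f y) x t = c * ball_mass f x t"
  unfolding ball_mass_def by (subst nn_integral_cmult[symmetric]) (auto simp: mult.assoc)

lemma riesz_mono: "(\<And>y. f y \<le> g y) \<Longrightarrow> riesz f x \<le> riesz g x"
  unfolding riesz_def by (intro nn_integral_mono mult_mono ball_mass_mono) auto

lemma riesz_cmult:
  assumes [measurable]: "f \<in> borel_measurable borel"
  shows "riesz (\<lambda>y. c * f y) x = c * riesz f x"
  unfolding riesz_def ball_mass_cmult[OF assms]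
  by (subst nn_integral_cmult[symmetric]) (auto simp: ac_simps)

text \<open>The part t \<ge> r of the defining integral suffices: there the ball mass is at least
  that of radius r, and t^(-d) integrates over it to r^(1 - d)/(d - 1).\<close>

lemma riesz_ge_ball_mass:
  fixes f :: "'a::euclidean_space \<Rightarrow> ennreal"
  assumes d: "2 \<le> DIM('a)" and r: "0 < r"
  shows "ball_mass f x r \<le> ennreal ((real DIM('a) - 1) * r powr (real DIM('a) - 1)) * riesz f x"
proof -
  let ?d = "real DIM('a)"
  have "riesz f x \<ge> (\<integral>\<^sup>+t. (ennreal (t powr - ?d) * indicator {r..} t) * ball_mass f x r \<partial>lborel)"
    unfolding riesz_def
  proof (intro nn_integral_mono)
    fix t :: real
    show "ennreal (t powr - ?d) * indicator {r..} t * ball_mass f x r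
        \<le> ennreal (t powr - ?d) * ball_mass f x t * indicator {0<..} t"
      using r ball_mass_mono[of f f r t x] by (auto simp: indicator_def intro!: mult_left_mono)
  qed
  also have "(\<integral>\<^sup>+t. (ennreal (t powr - ?d) * indicator {r..} t) * ball_mass f x r \<partial>lborel)
     = ennreal (r powr (-?d + 1) / (?d - 1)) * ball_mass f x r"
    using d r by (subst nn_integral_multc) (auto simp: nn_integral_powr_to_inf)
  finally have *: "ennreal (r powr (-?d + 1) / (?d - 1)) * ball_mass f x r \<le> riesz f x" .
  have "r powr (?d - 1) * r powr (-?d + 1) = 1" using r by (simp add: powr_add[symmetric])
  then have 1: "(?d - 1) * r powr (?d - 1) * (r powr (-?d + 1) / (?d - 1)) = 1"
    using d by simp
  have "ball_mass f x r = ennreal ((?d - 1) * r powr (?d - 1)) * (ennreal (r powr (-?d + 1) / (?d - 1)) * ball_mass f x r)"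
    using d unfolding mult.assoc[symmetric] by (subst ennreal_mult[symmetric]) (simp_all only: 1 mult_1_left ennreal_1, auto)
  also have "\<dots> \<le> ennreal ((?d - 1) * r powr (?d - 1)) * riesz f x"
    by (intro mult_left_mono *) auto
  finally show ?thesis .
qed

lemma emeasure_cball_ge:
  assumes "0 \<le> t"
  shows "emeasure lborel (cball (x::'a::euclidean_space) t) = ennreal (unit_ball_vol DIM('a)) * ennreal (t powr DIM('a))"
  using assms by (simp add: emeasure_cball powr_realpow' ennreal_mult)

text \<open>A substitute for Hoelder's inequality: above the threshold s, f = f^p f^(1 - p), and the
  exponent 1 - p is negative.\<close>

lemma le_plus_powr:
  fixes f s p :: real
  assumes "0 \<le> f" "0 < s" "1 < p"
  shows "f \<le> s + f powr p * s powr (1 - p)"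
proof (cases "f \<le> s")
  case False
  then have "f = f powr p * f powr (1 - p)" using assms by (simp add: powr_add[symmetric])
  also have "\<dots> \<le> f powr p * s powr (1 - p)"
    using False assms by (intro mult_left_mono powr_mono2') auto
  finally show ?thesis using assms by simp
qed (use assms in \<open>auto intro: add_increasing2\<close>)

text \<open>Integrate \<open>le_plus_powr\<close> over the ball. The threshold s = t^(-d/p) balances
  the two terms: both s t^d and s^(1 - p) equal t^(d - d/p).\<close>

lemma ball_mass_Lp:
  fixes f :: "'a::euclidean_space \<Rightarrow> real" and p :: real
  assumes [measurable]: "f \<in> borel_measurable borel" and f0: "\<And>y. 0 \<le> f y" and p: "1 < p" and t: "0 < t"
    and P: "(\<integral>\<^sup>+y. ennreal (f y powr p) \<partial>lborel) \<le> 1"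
  shows "ball_mass f x t \<le> ennreal ((unit_ball_vol DIM('a) + 1) * t powr (DIM('a) - DIM('a) / p))"
proof -
  let ?d = "real DIM('a)" let ?w = "unit_ball_vol ?d"
  let ?s = "t powr (- ?d / p)"
  have "ball_mass f x t \<le> (\<integral>\<^sup>+y. ennreal ?s * indicator (cball x t) y + ennreal (f y powr p) * ennreal (?s powr (1 - p)) \<partial>lborel)"
    unfolding ball_mass_def
  proof (intro nn_integral_mono)
    fix y
    have "ennreal (f y) \<le> ennreal (?s + f y powr p * ?s powr (1 - p))"
      using le_plus_powr[of "f y" ?s p] f0 p t by (intro ennreal_leI) auto
    then show "ennreal (f y) * indicator (cball x t) y \<le>
        ennreal ?s * indicator (cball x t) y + ennreal (f y powr p) * ennreal (?s powr (1 - p))"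
      by (auto simp: indicator_def ennreal_plus ennreal_mult)
  qed
  also have "\<dots> = ennreal ?s * emeasure lborel (cball x t) + (\<integral>\<^sup>+y. ennreal (f y powr p) \<partial>lborel) * ennreal (?s powr (1 - p))"
    by (subst nn_integral_add) (auto simp: nn_integral_cmult_indicator nn_integral_multc)
  also have "\<dots> \<le> ennreal ?s * emeasure lborel (cball x t) + 1 * ennreal (?s powr (1 - p))"
    by (intro add_mono mult_right_mono P) auto
  also have "\<dots> = ennreal (?s * (?w * t powr ?d) + ?s powr (1 - p))"
    using t by (simp add: emeasure_cball_ge ennreal_mult ennreal_plus)
  also have "?s * (?w * t powr ?d) + ?s powr (1 - p) = (?w + 1) * t powr (?d - ?d / p)"
  proof -
    have "?s * t powr ?d = t powr (?d - ?d / p)" using t by (simp add: powr_add[symmetric])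
    moreover have "(- ?d / p) * (1 - p) = ?d - ?d / p" using p by (simp add: field_simps)
    then have "?s powr (1 - p) = t powr (?d - ?d / p)" by (simp only: powr_powr)
    ultimately show ?thesis by (simp add: algebra_simps)
  qed
  finally show ?thesis .
qed

section \<open>Mapping properties of the potential\<close>

lemma riesz_split:
  fixes f :: "'a::euclidean_space \<Rightarrow> ennreal"
  assumes [measurable]: "f \<in> borel_measurable borel" and "0 < r"
  shows "riesz f x = (\<integral>\<^sup>+t\<in>{0<..r}. ennreal (t powr - real DIM('a)) * ball_mass f x t \<partial>lborel)
       + (\<integral>\<^sup>+t\<in>{r<..}. ennreal (t powr - real DIM('a)) * ball_mass f x t \<partial>lborel)"
  unfolding riesz_def using assms
  by (subst nn_integral_add[symmetric]) (auto intro!: nn_integral_cong simp: indicator_def)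

text \<open>For t \<le> R the Hoelder bound leaves t^(-d/p), integrable at 0 because p > d. For t >
  R the ball mass no longer grows, since the support lies in \<open>cball x R\<close>, and t^(-d) is
  integrable at infinity because d \<ge> 2.\<close>

lemma riesz_bound_of_support:
  fixes f :: "'a::euclidean_space \<Rightarrow> real" and p :: real
  assumes [measurable]: "f \<in> borel_measurable borel" and f0: "\<And>y. 0 \<le> f y" and p: "1 < p" "DIM('a) < p"
    and d: "2 \<le> DIM('a)" and R: "0 < R"
    and P: "(\<integral>\<^sup>+y. ennreal (f y powr p) \<partial>lborel) \<le> 1"
    and supp: "\<And>y. y \<notin> cball x R \<Longrightarrow> f y = 0"
  shows "riesz f x \<le> ennreal ((unit_ball_vol DIM('a) + 1) * (1 / (1 - DIM('a) / p) + 1 / (real DIM('a) - 1)) * R powr (1 - DIM('a) / p))"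
proof -
  let ?d = "real DIM('a)" let ?w = "unit_ball_vol ?d + 1"
  have w: "?w \<ge> 0" by (simp add: unit_ball_vol_nonneg)
  have m: "ball_mass f x t \<le> ennreal (?w * t powr (?d - ?d / p))" if "0 < t" for t
    using ball_mass_Lp[OF assms(1) f0 p(1) that P] by simp
  have mR: "ball_mass f x t \<le> ball_mass f x R" for t
    unfolding ball_mass_def using supp by (intro nn_integral_mono) (auto simp: indicator_def)
  have "riesz f x = (\<integral>\<^sup>+t\<in>{0<..R}. ennreal (t powr - ?d) * ball_mass f x t \<partial>lborel)
       + (\<integral>\<^sup>+t\<in>{R<..}. ennreal (t powr - ?d) * ball_mass f x t \<partial>lborel)"
    by (rule riesz_split) (auto simp: R)
  also have "\<dots> \<le> (\<integral>\<^sup>+t. ennreal ?w * (ennreal (t powr - (?d / p)) * indicator {0<..R} t) \<partial>lborel)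
       + (\<integral>\<^sup>+t. ennreal (?w * R powr (?d - ?d / p)) * (ennreal (t powr - ?d) * indicator {R..} t) \<partial>lborel)"
  proof (intro add_mono nn_integral_mono)
    fix t :: real
    show "ennreal (t powr - ?d) * ball_mass f x t * indicator {0<..R} t
       \<le> ennreal ?w * (ennreal (t powr - (?d / p)) * indicator {0<..R} t)"
    proof (cases "0 < t \<and> t \<le> R")
      case True
      then have "ennreal (t powr - ?d) * ball_mass f x t \<le> ennreal (t powr - ?d) * ennreal (?w * t powr (?d - ?d / p))"
        by (intro mult_left_mono m) auto
      also have "\<dots> = ennreal (?w * t powr - (?d / p))"
        using w True by (subst ennreal_mult[symmetric]) (auto simp: powr_add[symmetric] mult.left_commute)
      finally show ?thesis using True w by (auto simp: ennreal_mult)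
    qed auto
    show "ennreal (t powr - ?d) * ball_mass f x t * indicator {R<..} t
       \<le> ennreal (?w * R powr (?d - ?d / p)) * (ennreal (t powr - ?d) * indicator {R..} t)"
    proof (cases "R < t")
      case True
      have "ennreal (t powr - ?d) * ball_mass f x t \<le> ennreal (t powr - ?d) * ennreal (?w * R powr (?d - ?d / p))"
        using mR[of t] m[OF R] by (intro mult_left_mono) auto
      then show ?thesis using True by (auto simp: ac_simps)
    qed auto
  qed
  also have "\<dots> = ennreal ?w * ennreal (R powr (1 - ?d / p) / (1 - ?d / p))
      + ennreal (?w * R powr (?d - ?d / p)) * ennreal (R powr (1 - ?d) / (?d - 1))"
    using R p d by (subst (1 2) nn_integral_cmult) (auto simp: nn_integral_powr_from_0 nn_integral_powr_to_inf)
  also have "\<dots> = ennreal (?w * (R powr (1 - ?d / p) / (1 - ?d / p))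
      + (?w * R powr (?d - ?d / p)) * (R powr (1 - ?d) / (?d - 1)))"
  proof -
    have "ennreal W * ennreal A + ennreal (W * B) * ennreal C = ennreal (W * A + (W * B) * C)"
      if "0 \<le> W" "0 \<le> A" "0 \<le> B" "0 \<le> C" for W A B C
      using that by (simp add: ennreal_mult ennreal_plus)
    from this[OF w] show ?thesis using p d by simp
  qed
  also have "?w * (R powr (1 - ?d / p) / (1 - ?d / p)) + (?w * R powr (?d - ?d / p)) * (R powr (1 - ?d) / (?d - 1))
     = ?w * (1 / (1 - ?d / p) + 1 / (?d - 1)) * R powr (1 - ?d / p)"
  proof -
    have "R powr (?d - ?d / p) * R powr (1 - ?d) = R powr (1 - ?d / p)" using R by (simp add: powr_add[symmetric])
    then show ?thesis by (simp add: algebra_simps add_divide_distrib)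
  qed
  finally show ?thesis .
qed

lemma nn_integral_lborel_shift:
  fixes f :: "'a::euclidean_space \<Rightarrow> ennreal"
  assumes [measurable]: "f \<in> borel_measurable borel" and c: "c \<noteq> 0"
  shows "(\<integral>\<^sup>+x. f (t + c *\<^sub>R x) \<partial>lborel) = ennreal (\<bar>c\<bar> powr - real DIM('a)) * (\<integral>\<^sup>+x. f x \<partial>lborel)"
proof -
  have "(\<integral>\<^sup>+x. f x \<partial>lborel) = ennreal (\<bar>c\<bar> ^ DIM('a)) * (\<integral>\<^sup>+x. f (t + c *\<^sub>R x) \<partial>lborel)"
    by (subst lborel_affine[OF c, of t]) (simp add: nn_integral_density nn_integral_distr nn_integral_cmult)
  then have "ennreal (\<bar>c\<bar> powr - real DIM('a)) * (\<integral>\<^sup>+x. f x \<partial>lborel)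
     = ennreal (\<bar>c\<bar> powr - real DIM('a)) * ennreal (\<bar>c\<bar> ^ DIM('a)) * (\<integral>\<^sup>+x. f (t + c *\<^sub>R x) \<partial>lborel)"
    by (simp add: mult.assoc)
  also have "ennreal (\<bar>c\<bar> powr - real DIM('a)) * ennreal (\<bar>c\<bar> ^ DIM('a)) = 1"
    using c by (subst ennreal_mult[symmetric]) (auto simp: powr_minus powr_realpow)
  finally show ?thesis by simp
qed

text \<open>By Fubini each y is counted once for every x in \<open>cball y t\<close>, a set whose
  volume is proportional to t^d and cancels t^(-d). What remains is constant on (0, r].\<close>

lemma nn_integral_truncated_riesz:
  fixes g :: "'a::euclidean_space \<Rightarrow> ennreal"
  assumes [measurable]: "g \<in> borel_measurable borel" and r: "0 < r"
  shows "(\<integral>\<^sup>+x. (\<integral>\<^sup>+t\<in>{0<..r}. ennreal (t powr - real DIM('a)) * ball_mass g x t \<partial>lborel) \<partial>lborel)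
     = ennreal (unit_ball_vol DIM('a) * r) * (\<integral>\<^sup>+y. g y \<partial>lborel)"
proof -
  let ?d = "real DIM('a)" let ?w = "unit_ball_vol ?d"
  have mass: "(\<integral>\<^sup>+x. ball_mass g x t \<partial>lborel) = ennreal ?w * ennreal (t powr ?d) * (\<integral>\<^sup>+y. g y \<partial>lborel)" if "0 < t" for t
  proof -
    have "(\<integral>\<^sup>+x. ball_mass g x t \<partial>lborel) = (\<integral>\<^sup>+x. \<integral>\<^sup>+y. g y * indicator (cball y t) x \<partial>lborel \<partial>lborel)"
      unfolding ball_mass_def by (intro nn_integral_cong) (auto simp: indicator_def dist_commute)
    also have "\<dots> = (\<integral>\<^sup>+x. \<integral>\<^sup>+y. (if dist y x \<le> t then g y else 0) \<partial>lborel \<partial>lborel)"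
      by (intro nn_integral_cong) (auto simp: indicator_def)
    also have "\<dots> = (\<integral>\<^sup>+y. \<integral>\<^sup>+x. (if dist y x \<le> t then g y else 0) \<partial>lborel \<partial>lborel)"
      by (rule lborel_pair.Fubini') measurable
    also have "\<dots> = (\<integral>\<^sup>+y. g y * emeasure lborel (cball y t) \<partial>lborel)"
    proof (intro nn_integral_cong)
      fix y
      have "(\<integral>\<^sup>+x. (if dist y x \<le> t then g y else 0) \<partial>lborel) = (\<integral>\<^sup>+x. g y * indicator (cball y t) x \<partial>lborel)"
        by (intro nn_integral_cong) (auto simp: indicator_def)
      then show "(\<integral>\<^sup>+x. (if dist y x \<le> t then g y else 0) \<partial>lborel) = g y * emeasure lborel (cball y t)"
        by (simp add: nn_integral_cmult_indicator)
    qed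
    also have "\<dots> = ennreal ?w * ennreal (t powr ?d) * (\<integral>\<^sup>+y. g y \<partial>lborel)"
      using that by (simp add: emeasure_cball_ge nn_integral_multc) (simp add: ac_simps)
    finally show ?thesis .
  qed
  have "(\<integral>\<^sup>+x. (\<integral>\<^sup>+t\<in>{0<..r}. ennreal (t powr - ?d) * ball_mass g x t \<partial>lborel) \<partial>lborel)
     = (\<integral>\<^sup>+t. (\<integral>\<^sup>+x. ennreal (t powr - ?d) * ball_mass g x t * indicator {0<..r} t \<partial>lborel) \<partial>lborel)"
    by (rule lborel_pair.Fubini') measurable
  also have "\<dots> = (\<integral>\<^sup>+t. (ennreal ?w * (\<integral>\<^sup>+y. g y \<partial>lborel)) * indicator {0<..r} t \<partial>lborel)"
  proof (intro nn_integral_cong)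
    fix t :: real
    show "(\<integral>\<^sup>+x. ennreal (t powr - ?d) * ball_mass g x t * indicator {0<..r} t \<partial>lborel)
       = ennreal ?w * (\<integral>\<^sup>+y. g y \<partial>lborel) * indicator {0<..r} t"
    proof (cases "0 < t \<and> t \<le> r")
      case True
      have "ennreal (t powr - ?d) * ennreal (t powr ?d) = 1"
        using True by (subst ennreal_mult[symmetric]) (auto simp: powr_add[symmetric])
      moreover have "(\<integral>\<^sup>+x. ennreal (t powr - ?d) * ball_mass g x t * indicator {0<..r} t \<partial>lborel)
         = ennreal (t powr - ?d) * (\<integral>\<^sup>+x. ball_mass g x t \<partial>lborel)"
        using True by (simp add: nn_integral_cmult)
      moreover have "ennreal (t powr - ?d) * (ennreal ?w * ennreal (t powr ?d) * I) = (ennreal (t powr - ?d) * ennreal (t powr ?d)) * (ennreal ?w * I)" for I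
        by (simp only: ac_simps)
      ultimately show ?thesis using True mass[of t] by simp
    qed auto
  qed
  also have "\<dots> = ennreal (?w * r) * (\<integral>\<^sup>+y. g y \<partial>lborel)"
    using r by (subst nn_integral_cmult_indicator) (auto simp: ennreal_mult ac_simps)
  finally show ?thesis .
qed


text \<open>Strong type directly, by a truncation that depends on the level, as in Marcinkiewicz
  interpolation. At level l, f is split at a height s(l) such that the low part and the far part of
  the potential together stay below l/2. Markov's inequality then bounds the set where the potential
  exceeds l by the L^1 norm of the high part, and integrating in l leaves f f^(p - 1).\<close>

lemma riesz_HLS:
  fixes p :: real
  assumes p: "1 < p" "p < DIM('a::euclidean_space)"
  defines "q \<equiv> 1 / (1 / p - 1 / DIM('a))"
  shows "\<exists>K\<ge>0. \<forall>(f :: 'a \<Rightarrow> real) (u :: 'a \<Rightarrow> real). f \<in> borel_measurable borel \<longrightarrow> u \<in> borel_measurable borel \<longrightarrow>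
      (\<forall>y. 0 \<le> f y) \<longrightarrow> (\<forall>y. 0 \<le> u y) \<longrightarrow> (\<integral>\<^sup>+y. ennreal (f y powr p) \<partial>lborel) \<le> 1 \<longrightarrow>
      (AE x in lborel. ennreal (u x) \<le> riesz f x) \<longrightarrow> (\<integral>\<^sup>+x. ennreal (u x powr q) \<partial>lborel) \<le> ennreal K"
proof -
  let ?d = "real DIM('a)"
  define w where "w = unit_ball_vol ?d"
  define k where "k = ?d / p - 1"
  \<comment> \<open>The coefficient of r^(-k) when the low part up to radius r and the far part
    beyond r are added.\<close>
  define A where "A = w + (w + 1) / k"
  \<comment> \<open>The power of l left in the layer-cake integral: q - 1 from the measure, -1 from
    Markov's inequality, -1/k from the radius r(l).\<close>
  define e where "e = q - 2 - 1 / k"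
  define K where "K = 2 * q * w * (2 * A) powr (1 / k) * ((2 * A) powr (e + 1) / (e + 1))"
  have w: "0 < w" by (simp add: w_def)
  have k: "0 < k" using p by (simp add: k_def)
  have A: "0 < A" using w k by (simp add: A_def add_pos_pos)
  have q: "q = ?d * p / (?d - p)" using p by (simp add: q_def divide_simps)
  have k': "k = (?d - p) / p" using p by (simp add: k_def field_simps)
  have ke: "1 / k = p / (?d - p)" by (simp add: k')
  have "e + 1 = ?d * p / (?d - p) - (?d - p) / (?d - p) - p / (?d - p)"
    using p by (simp add: e_def q ke)
  then have "e + 1 = (?d * p - (?d - p) - p) / (?d - p)" by (simp only: diff_divide_distrib)
  then have e1: "e + 1 = ?d * (p - 1) / (?d - p)" by (simp add: algebra_simps)
  have e: "0 < e + 1" using p by (simp add: e1)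
  have q0: "0 < q" using p by (simp add: q)
  \<comment> \<open>Integrating l^e up to a multiple of f^(k p/d) leaves exactly f^(p - 1).\<close>
  have ek: "(k * p / ?d) * (e + 1) = p - 1" using p by (simp add: e1 k')
  have K: "0 \<le> K" using w A e q0 by (simp add: K_def)
  show ?thesis
  proof (intro exI[of _ K] conjI K allI impI)
    fix f u :: "'a \<Rightarrow> real"
    assume [measurable]: "f \<in> borel_measurable borel" "u \<in> borel_measurable borel"
      and f0: "\<forall>y. 0 \<le> f y" and u0: "\<forall>y. 0 \<le> u y" and P: "(\<integral>\<^sup>+y. ennreal (f y powr p) \<partial>lborel) \<le> 1"
      and le: "AE x in lborel. ennreal (u x) \<le> riesz f x"
    \<comment> \<open>The radius with A r^(-k) = l/2. With s = r^(-d/p) the product s r, which the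
      low part contributes, is again r^(-k).\<close>
    define r where "r l = (l / (2 * A)) powr (- 1 / k)" for l :: real
    define s where "s l = r l powr (- ?d / p)" for l :: real
    define fh where "fh l y = (if s l < f y then ennreal (f y) else 0)" for l y
    define J where "J l x = (\<integral>\<^sup>+t\<in>{0<..r l}. ennreal (t powr - ?d) * ball_mass (fh l) x t \<partial>lborel)" for l x
    have fhm[measurable]: "fh l \<in> borel_measurable borel" for l unfolding fh_def by measurable
    have split: "riesz f x \<le> ennreal (l / 2) + J l x" if l: "0 < l" for l x
    proof -
      have r: "0 < r l" using l A by (simp add: r_def)
      have s: "0 < s l" using r by (simp add: s_def)
      have m: "ball_mass f x t \<le> ennreal (s l * (w * t powr ?d)) + ball_mass (fh l) x t" if "0 < t" for t
      proof -
        have "ball_mass f x t \<le> (\<integral>\<^sup>+y. ennreal (s l) * indicator (cball x t) y + fh l y * indicator (cball x t) y \<partial>lborel)"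
          unfolding ball_mass_def
          by (intro nn_integral_mono) (auto simp: indicator_def fh_def ennreal_leI)
        also have "\<dots> = ennreal (s l * (w * t powr ?d)) + ball_mass (fh l) x t"
          using that s w unfolding ball_mass_def
          by (subst nn_integral_add)
             (auto simp: nn_integral_cmult_indicator emeasure_cball_ge w_def[symmetric] ennreal_mult)
        finally show ?thesis .
      qed
      have m2: "ball_mass f x t \<le> ennreal ((w + 1) * t powr (?d - ?d / p))" if "0 < t" for t
        using ball_mass_Lp[of f p t x] f0 p that P by (simp add: w_def)
      have "riesz f x = (\<integral>\<^sup>+t\<in>{0<..r l}. ennreal (t powr - ?d) * ball_mass f x t \<partial>lborel)
         + (\<integral>\<^sup>+t\<in>{r l<..}. ennreal (t powr - ?d) * ball_mass f x t \<partial>lborel)"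
        by (rule riesz_split) (auto simp: r)
      also have "\<dots> \<le> (\<integral>\<^sup>+t. ennreal (s l * w) * indicator {0<..r l} t + ennreal (t powr - ?d) * ball_mass (fh l) x t * indicator {0<..r l} t \<partial>lborel)
         + (\<integral>\<^sup>+t. ennreal (w + 1) * (ennreal (t powr (- ?d / p)) * indicator {r l..} t) \<partial>lborel)"
      proof (intro add_mono nn_integral_mono)
        fix t :: real
        show "ennreal (t powr - ?d) * ball_mass f x t * indicator {0<..r l} t
          \<le> ennreal (s l * w) * indicator {0<..r l} t + ennreal (t powr - ?d) * ball_mass (fh l) x t * indicator {0<..r l} t"
        proof (cases "0 < t \<and> t \<le> r l")
          case True
          have "ennreal (t powr - ?d) * ball_mass f x t \<le> ennreal (t powr - ?d) * (ennreal (s l * (w * t powr ?d)) + ball_mass (fh l) x t)"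
            using True by (intro mult_left_mono m) auto
          also have "\<dots> = ennreal (s l * w * (t powr - ?d * t powr ?d)) + ennreal (t powr - ?d) * ball_mass (fh l) x t"
            using s w by (simp add: distrib_left ennreal_mult[symmetric] ac_simps)
          also have "t powr - ?d * t powr ?d = 1" using True by (simp add: powr_add[symmetric])
          finally show ?thesis using True by auto
        qed auto
        show "ennreal (t powr - ?d) * ball_mass f x t * indicator {r l<..} t
          \<le> ennreal (w + 1) * (ennreal (t powr (- ?d / p)) * indicator {r l..} t)"
        proof (cases "r l < t")
          case True
          then have t: "0 < t" using r by simp
          have "ennreal (t powr - ?d) * ball_mass f x t \<le> ennreal (t powr - ?d) * ennreal ((w + 1) * t powr (?d - ?d / p))"
            by (intro mult_left_mono m2 t) auto
          also have "\<dots> = ennreal ((w + 1) * (t powr - ?d * t powr (?d - ?d / p)))"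
            using w by (simp add: ennreal_mult[symmetric] ac_simps)
          also have "t powr - ?d * t powr (?d - ?d / p) = t powr (- ?d / p)" using t by (simp add: powr_add[symmetric])
          finally show ?thesis using True w by (simp add: ennreal_mult)
        qed auto
      qed
      also have "\<dots> = ennreal (s l * w * r l) + J l x + ennreal ((w + 1) * (r l powr (1 - ?d / p) / k))"
      proof -
        have 1: "(\<integral>\<^sup>+t. ennreal (s l * w) * indicator {0<..r l} t + ennreal (t powr - ?d) * ball_mass (fh l) x t * indicator {0<..r l} t \<partial>lborel)
           = ennreal (s l * w * r l) + J l x"
          using r s w unfolding J_def
          by (subst nn_integral_add) (auto simp: nn_integral_cmult_indicator ennreal_mult)
        have "(\<integral>\<^sup>+t\<in>{r l..}. ennreal (t powr (- ?d / p)) \<partial>lborel) = ennreal (r l powr (1 - ?d / p) / k)"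
          using nn_integral_powr_to_inf[of "- ?d / p" "r l"] r p by (simp add: k_def)
        then have 2: "(\<integral>\<^sup>+t. ennreal (w + 1) * (ennreal (t powr (- ?d / p)) * indicator {r l..} t) \<partial>lborel)
           = ennreal ((w + 1) * (r l powr (1 - ?d / p) / k))"
          using w k by (subst nn_integral_cmult) (auto simp: ennreal_mult[symmetric] simp del: ennreal_plus)
        show ?thesis unfolding 1 2 ..
      qed
      also have "\<dots> = ennreal (s l * w * r l + (w + 1) * (r l powr (1 - ?d / p) / k)) + J l x"
      proof -
        have "ennreal a + b + ennreal c = ennreal (a + c) + b" if "0 \<le> a" "0 \<le> c" for a b c
          using that by (simp add: ennreal_plus ac_simps)
        then show ?thesis using s w r k by simp
      qed
      also have "s l * w * r l + (w + 1) * (r l powr (1 - ?d / p) / k) = A * r l powr (- k)"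
      proof -
        have "s l * r l = r l powr (- ?d / p) * r l powr 1" using r by (simp add: s_def)
        also have "\<dots> = r l powr (- k)" using r unfolding powr_add[symmetric] by (simp add: k_def)
        finally have "s l * r l = r l powr (- k)" .
        moreover have "1 - ?d / p = - k" by (simp add: k_def)
        ultimately show ?thesis by (simp only: A_def) (simp add: algebra_simps)
      qed
      also have "A * r l powr (- k) = l / 2" using l A k by (simp add: r_def powr_powr)
      finally show ?thesis .
    qed
    have dist: "emeasure lborel {x. l \<le> u x} \<le> ennreal (2 / l * (w * r l)) * (\<integral>\<^sup>+y. fh l y \<partial>lborel)" if l: "0 < l" for l
    proof -
      have r: "0 < r l" using l A by (simp add: r_def)
      have Jm[measurable]: "J l \<in> borel_measurable borel" unfolding J_def by measurable
      have "emeasure lborel {x. l \<le> u x} \<le> emeasure lborel {x\<in>space lborel. 1 \<le> ennreal (2 / l) * J l x}"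
      proof (intro emeasure_mono_AE)
        show "AE x in lborel. x \<in> {x. l \<le> u x} \<longrightarrow> x \<in> {x\<in>space lborel. 1 \<le> ennreal (2 / l) * J l x}"
          using le
        proof eventually_elim
          case (elim x)
          show ?case
          proof clarsimp
            assume "l \<le> u x"
            then have "ennreal l \<le> ennreal (l / 2) + J l x"
              using elim split[OF l, of x] ennreal_leI[of l "u x"] by (meson order_trans)
            moreover have "ennreal l = ennreal (l / 2) + ennreal (l / 2)" using l by (subst ennreal_plus[symmetric]) auto
            ultimately have "ennreal (l / 2) \<le> J l x" by simp
            then have "ennreal (2 / l) * ennreal (l / 2) \<le> ennreal (2 / l) * J l x" by (intro mult_left_mono) auto
            then show "1 \<le> ennreal (2 / l) * J l x" using l by (simp add: ennreal_mult[symmetric])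
          qed
        qed
      qed measurable
      also have "\<dots> \<le> ennreal (2 / l) * (\<integral>\<^sup>+x\<in>UNIV. J l x \<partial>lborel)"
        by (rule order_trans[OF _ nn_integral_Markov_inequality]) (auto intro!: eq_refl arg_cong[where f="emeasure lborel"])
      also have "(\<integral>\<^sup>+x\<in>UNIV. J l x \<partial>lborel) = ennreal (w * r l) * (\<integral>\<^sup>+y. fh l y \<partial>lborel)"
        using nn_integral_truncated_riesz[of "fh l" "r l"] r by (simp add: J_def w_def)
      finally have "emeasure lborel {x. l \<le> u x} \<le> ennreal (2 / l) * (ennreal (w * r l) * (\<integral>\<^sup>+y. fh l y \<partial>lborel))" .
      moreover have "ennreal (2 / l * (w * r l)) = ennreal (2 / l) * ennreal (w * r l)"
        using l w r by (intro ennreal_mult) auto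
      ultimately show ?thesis by (simp only: mult.assoc)
    qed
    have key: "(\<integral>\<^sup>+x. ennreal (u x powr q) \<partial>lborel)
       = (\<integral>\<^sup>+l. ennreal (q * l powr (q - 1)) * emeasure lborel {x. l \<le> u x} * indicator {0<..} l \<partial>lborel)"
    proof -
      have "(\<integral>\<^sup>+x. ennreal (u x powr q) \<partial>lborel) = (\<integral>\<^sup>+x. \<integral>\<^sup>+l. (if 0 < l \<and> l \<le> u x then ennreal (q * l powr (q - 1)) else 0) \<partial>lborel \<partial>lborel)"
      proof (intro nn_integral_cong)
        fix x
        have "(\<integral>\<^sup>+l. (if 0 < l \<and> l \<le> u x then ennreal (q * l powr (q - 1)) else 0) \<partial>lborel)
           = (\<integral>\<^sup>+l. ennreal q * (ennreal (l powr (q - 1)) * indicator {0<..u x} l) \<partial>lborel)"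
          using q0 by (intro nn_integral_cong) (auto simp: ennreal_mult indicator_def)
        also have "\<dots> = ennreal q * ennreal (u x powr q / q)"
          using q0 u0 by (subst nn_integral_cmult) (auto simp: nn_integral_powr_from_0)
        also have "\<dots> = ennreal (u x powr q)" using q0 by (simp add: ennreal_mult[symmetric])
        finally show "ennreal (u x powr q) = (\<integral>\<^sup>+l. (if 0 < l \<and> l \<le> u x then ennreal (q * l powr (q - 1)) else 0) \<partial>lborel)" ..
      qed
      also have "\<dots> = (\<integral>\<^sup>+l. \<integral>\<^sup>+x. (if 0 < l \<and> l \<le> u x then ennreal (q * l powr (q - 1)) else 0) \<partial>lborel \<partial>lborel)"
        by (rule lborel_pair.Fubini') measurable
      also have "\<dots> = (\<integral>\<^sup>+l. ennreal (q * l powr (q - 1)) * emeasure lborel {x. l \<le> u x} * indicator {0<..} l \<partial>lborel)"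
      proof (intro nn_integral_cong)
        fix l :: real
        have "(\<integral>\<^sup>+x. (if 0 < l \<and> l \<le> u x then ennreal (q * l powr (q - 1)) else 0) \<partial>lborel)
          = (\<integral>\<^sup>+x. (ennreal (q * l powr (q - 1)) * indicator {0<..} l) * indicator {x. l \<le> u x} x \<partial>lborel)"
          by (intro nn_integral_cong) (auto simp: indicator_def)
        then show "(\<integral>\<^sup>+x. (if 0 < l \<and> l \<le> u x then ennreal (q * l powr (q - 1)) else 0) \<partial>lborel)
          = ennreal (q * l powr (q - 1)) * emeasure lborel {x. l \<le> u x} * indicator {0<..} l"
          by (subst (asm) nn_integral_cmult_indicator) (auto simp: indicator_def)
      qed
      finally show ?thesis .
    qed
    \<comment> \<open>The distribution function is replaced by a double integral over l and y, which
      is then integrated in l first.\<close>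
    also have "\<dots> \<le> (\<integral>\<^sup>+l. \<integral>\<^sup>+y. (if 0 < l \<and> l \<le> 2 * A * f y powr (k * p / ?d) then ennreal (f y * (2 * q * w * (2 * A) powr (1 / k)) * l powr e) else 0) \<partial>lborel \<partial>lborel)"
    proof (intro nn_integral_mono)
      fix l :: real
      show "ennreal (q * l powr (q - 1)) * emeasure lborel {x. l \<le> u x} * indicator {0<..} l
        \<le> (\<integral>\<^sup>+y. (if 0 < l \<and> l \<le> 2 * A * f y powr (k * p / ?d) then ennreal (f y * (2 * q * w * (2 * A) powr (1 / k)) * l powr e) else 0) \<partial>lborel)"
      proof (cases "0 < l")
        case l: True
        have r: "0 < r l" using l A by (simp add: r_def)
        have c: "q * l powr (q - 1) * (2 / l * (w * r l)) = (2 * q * w * (2 * A) powr (1 / k)) * l powr e"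
        proof -
          have "r l = l powr (- 1 / k) * (2 * A) powr (1 / k)"
            using l A by (simp add: r_def powr_divide powr_minus_divide)
          moreover have "l powr (q - 1) * (1 / l) * l powr (- 1 / k) = l powr (q - 1) * l powr (-1) * l powr (- 1 / k)"
            using l by (simp add: powr_minus_divide)
          moreover have "\<dots> = l powr e" unfolding powr_add[symmetric] by (simp add: e_def)
          ultimately have "r l = l powr (- 1 / k) * (2 * A) powr (1 / k)"
            and L: "l powr e = l powr (q - 1) * (1 / l) * l powr (- 1 / k)" by (simp_all only:)
          then show ?thesis by (simp only: L) simp
        qed
        have "ennreal (q * l powr (q - 1)) * emeasure lborel {x. l \<le> u x} * indicator {0<..} l
          \<le> ennreal (q * l powr (q - 1)) * (ennreal (2 / l * (w * r l)) * (\<integral>\<^sup>+y. fh l y \<partial>lborel))"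
          using l dist[OF l] by (auto intro!: mult_left_mono)
        also have "\<dots> = (\<integral>\<^sup>+y. ennreal ((2 * q * w * (2 * A) powr (1 / k)) * l powr e) * fh l y \<partial>lborel)"
        proof -
          have "ennreal (q * l powr (q - 1) * (2 / l * (w * r l))) = ennreal (q * l powr (q - 1)) * ennreal (2 / l * (w * r l))"
            using l q0 w r by (intro ennreal_mult) auto
          moreover have "(\<integral>\<^sup>+y. ennreal ((2 * q * w * (2 * A) powr (1 / k)) * l powr e) * fh l y \<partial>lborel)
             = ennreal ((2 * q * w * (2 * A) powr (1 / k)) * l powr e) * (\<integral>\<^sup>+y. fh l y \<partial>lborel)"
            by (rule nn_integral_cmult) simp
          ultimately show ?thesis unfolding c by (metis mult.assoc)
        qed
        also have "\<dots> \<le> (\<integral>\<^sup>+y. (if 0 < l \<and> l \<le> 2 * A * f y powr (k * p / ?d) then ennreal (f y * (2 * q * w * (2 * A) powr (1 / k)) * l powr e) else 0) \<partial>lborel)"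
        proof (intro nn_integral_mono)
          fix y
          \<comment> \<open>The condition s(l) < f(y) solved for l, since s(l) is the power d/(p k)
            of l/(2 A).\<close>
          have "l \<le> 2 * A * f y powr (k * p / ?d)" if "s l < f y"
          proof -
            have "s l = (l / (2 * A)) powr (?d / p / k)" by (simp add: s_def r_def powr_powr mult.commute)
            then have "s l powr (k * p / ?d) = l / (2 * A)" using k p l A by (simp add: powr_powr)
            moreover have "s l powr (k * p / ?d) \<le> f y powr (k * p / ?d)"
              using that k p by (intro powr_mono2) (auto simp: s_def)
            ultimately have "2 * A * (l / (2 * A)) \<le> 2 * A * f y powr (k * p / ?d)"
              using A by (intro mult_left_mono) auto
            then show ?thesis using A by simp
          qed
          then show "ennreal ((2 * q * w * (2 * A) powr (1 / k)) * l powr e) * fh l y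
             \<le> (if 0 < l \<and> l \<le> 2 * A * f y powr (k * p / ?d) then ennreal (f y * (2 * q * w * (2 * A) powr (1 / k)) * l powr e) else 0)"
            using l f0 q0 w by (auto simp: fh_def ennreal_mult[symmetric] ac_simps)
        qed
        finally show ?thesis .
      qed auto
    qed
    also have "\<dots> = (\<integral>\<^sup>+y. \<integral>\<^sup>+l. (if 0 < l \<and> l \<le> 2 * A * f y powr (k * p / ?d) then ennreal (f y * (2 * q * w * (2 * A) powr (1 / k)) * l powr e) else 0) \<partial>lborel \<partial>lborel)"
      by (rule lborel_pair.Fubini') measurable
    also have "\<dots> = (\<integral>\<^sup>+y. ennreal K * ennreal (f y powr p) \<partial>lborel)"
    proof (intro nn_integral_cong)
      fix y
      let ?L = "2 * A * f y powr (k * p / ?d)" let ?c = "f y * (2 * q * w * (2 * A) powr (1 / k))"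
      have c: "0 \<le> ?c" using f0 q0 w by simp
      have "(\<integral>\<^sup>+l. (if 0 < l \<and> l \<le> ?L then ennreal (?c * l powr e) else 0) \<partial>lborel)
         = (\<integral>\<^sup>+l. ennreal ?c * (ennreal (l powr e) * indicator {0<..?L} l) \<partial>lborel)"
        using c by (intro nn_integral_cong) (auto simp: indicator_def ennreal_mult')
      also have "\<dots> = ennreal ?c * ennreal (?L powr (e + 1) / (e + 1))"
        using e A by (subst nn_integral_cmult) (auto simp: nn_integral_powr_from_0)
      also have "\<dots> = ennreal (?c * (?L powr (e + 1) / (e + 1)))"
        using c e by (intro ennreal_mult[symmetric]) auto
      also have "?c * (?L powr (e + 1) / (e + 1)) = K * f y powr p"
      proof -
        have "?L powr (e + 1) = (2 * A) powr (e + 1) * f y powr (p - 1)"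
        proof -
          have "(f y powr (k * p / ?d)) powr (e + 1) = f y powr (p - 1)" by (simp only: powr_powr ek)
          then show ?thesis using A by (simp add: powr_mult)
        qed
        moreover have "f y * f y powr (p - 1) = f y powr p"
          using f0[rule_format, of y] p by (cases "f y = 0") (auto simp: powr_mult_base)
        ultimately show ?thesis by (simp add: K_def)
      qed
      finally show "(\<integral>\<^sup>+l. (if 0 < l \<and> l \<le> ?L then ennreal (?c * l powr e) else 0) \<partial>lborel) = ennreal K * ennreal (f y powr p)"
        using K by (simp add: ennreal_mult)
    qed
    also have "\<dots> = ennreal K * (\<integral>\<^sup>+y. ennreal (f y powr p) \<partial>lborel)" by (rule nn_integral_cmult) measurable
    also have "\<dots> \<le> ennreal K * 1" by (intro mult_left_mono P) auto
    finally show "(\<integral>\<^sup>+x. ennreal (u x powr q) \<partial>lborel) \<le> ennreal K" by simp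
  qed
qed


text \<open>The potential of a unit-scale average is controlled by the potential itself: only the
  volume of \<open>cball x t \<inter> cball z r\<close> enters, and it is at most a constant times \<open>min t r ^ d\<close>.\<close>
lemma riesz_ball_mass:
  fixes f :: "'a::euclidean_space \<Rightarrow> ennreal"
  assumes [measurable]: "f \<in> borel_measurable borel" and d: "2 \<le> DIM('a)" and r: "0 < r"
  shows "riesz (\<lambda>y. ball_mass f y r) x
    \<le> ennreal (unit_ball_vol DIM('a) * (r * (real DIM('a) - 1) * (2 * r) powr (real DIM('a) - 1) + 2 powr (real DIM('a) - 1) * r powr DIM('a))) * riesz f x"
proof -
  let ?d = "real DIM('a)" let ?w = "unit_ball_vol ?d"
  have w: "0 \<le> ?w" by simp
  have swap: "ball_mass (\<lambda>y. ball_mass f y r) x t \<le> ennreal (?w * min t r powr ?d) * ball_mass f x (t + r)" if t: "0 < t" for t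
  proof -
    have "ball_mass (\<lambda>y. ball_mass f y r) x t = (\<integral>\<^sup>+y. \<integral>\<^sup>+z. (if dist x y \<le> t \<and> dist y z \<le> r then f z else 0) \<partial>lborel \<partial>lborel)"
      unfolding ball_mass_def
    proof (intro nn_integral_cong)
      fix y
      have "(\<integral>\<^sup>+z\<in>cball y r. f z \<partial>lborel) * indicator (cball x t) y = (\<integral>\<^sup>+z. f z * indicator (cball y r) z * indicator (cball x t) y \<partial>lborel)"
        by (subst nn_integral_multc) auto
      then show "(\<integral>\<^sup>+z\<in>cball y r. f z \<partial>lborel) * indicator (cball x t) y = (\<integral>\<^sup>+z. (if dist x y \<le> t \<and> dist y z \<le> r then f z else 0) \<partial>lborel)"
        by (auto intro!: nn_integral_cong simp: indicator_def)
    qed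
    also have "\<dots> = (\<integral>\<^sup>+z. \<integral>\<^sup>+y. (if dist x y \<le> t \<and> dist y z \<le> r then f z else 0) \<partial>lborel \<partial>lborel)"
      by (rule lborel_pair.Fubini') measurable
    also have "\<dots> \<le> (\<integral>\<^sup>+z. ennreal (?w * min t r powr ?d) * (f z * indicator (cball x (t + r)) z) \<partial>lborel)"
    proof (intro nn_integral_mono)
      fix z
      have "emeasure lborel (cball x t \<inter> cball z r) \<le> ennreal (?w * min t r powr ?d)"
      proof (cases "t \<le> r")
        case True
        have "emeasure lborel (cball x t \<inter> cball z r) \<le> emeasure lborel (cball x t)" by (intro emeasure_mono) auto
        then show ?thesis using True t w by (simp add: emeasure_cball_ge ennreal_mult)
      next
        case False
        have "emeasure lborel (cball x t \<inter> cball z r) \<le> emeasure lborel (cball z r)" by (intro emeasure_mono) auto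
        then show ?thesis using False r w by (simp add: emeasure_cball_ge ennreal_mult)
      qed
      note em = this
      show "(\<integral>\<^sup>+y. (if dist x y \<le> t \<and> dist y z \<le> r then f z else 0) \<partial>lborel)
         \<le> ennreal (?w * min t r powr ?d) * (f z * indicator (cball x (t + r)) z)"
      proof (cases "dist x z \<le> t + r")
        case True
        have "(\<integral>\<^sup>+y. (if dist x y \<le> t \<and> dist y z \<le> r then f z else 0) \<partial>lborel)
           = (\<integral>\<^sup>+y. f z * indicator (cball x t \<inter> cball z r) y \<partial>lborel)"
          by (intro nn_integral_cong) (auto simp: indicator_def dist_commute)
        also have "\<dots> = f z * emeasure lborel (cball x t \<inter> cball z r)"
          by (subst nn_integral_cmult_indicator) auto
        also have "\<dots> \<le> f z * ennreal (?w * min t r powr ?d)" by (intro mult_left_mono em) auto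
        finally show ?thesis using True by (simp add: ac_simps)
      next
        case False
        then have "\<not> (dist x y \<le> t \<and> dist y z \<le> r)" for y using dist_triangle[of x z y] by auto
        then have "(if dist x y \<le> t \<and> dist y z \<le> r then f z else 0) = 0" for y by auto
        then have "(\<integral>\<^sup>+y. (if dist x y \<le> t \<and> dist y z \<le> r then f z else 0) \<partial>lborel) = (\<integral>\<^sup>+y. 0 \<partial>(lborel :: 'a measure))"
          by (intro nn_integral_cong)
        then show ?thesis by (simp only: nn_integral_const) simp
      qed
    qed
    also have "\<dots> = ennreal (?w * min t r powr ?d) * ball_mass f x (t + r)"
      unfolding ball_mass_def by (subst nn_integral_cmult) auto
    finally show ?thesis .
  qed
  let ?c = "2 powr (?d - 1) * r powr ?d"
  have "riesz (\<lambda>y. ball_mass f y r) x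
     \<le> (\<integral>\<^sup>+t. (ennreal ?w * ball_mass f x (2 * r)) * indicator {0<..r} t + ennreal (?w * r powr ?d) * (ennreal (t powr - ?d) * ball_mass f x (2 * t) * indicator {0<..} t) \<partial>lborel)"
    unfolding riesz_def
  proof (intro nn_integral_mono)
    fix t :: real
    show "ennreal (t powr - ?d) * ball_mass (\<lambda>y. ball_mass f y r) x t * indicator {0<..} t
       \<le> (ennreal ?w * ball_mass f x (2 * r)) * indicator {0<..r} t + ennreal (?w * r powr ?d) * (ennreal (t powr - ?d) * ball_mass f x (2 * t) * indicator {0<..} t)"
    proof (cases "0 < t")
      case t: True
      have 1: "ennreal (t powr - ?d) * ball_mass (\<lambda>y. ball_mass f y r) x t \<le> ennreal (t powr - ?d) * (ennreal (?w * min t r powr ?d) * ball_mass f x (t + r))"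
        by (intro mult_left_mono swap t) auto
      \<comment> \<open>For t \<le> r the overlap volume t^d cancels t^(-d), and the mass of radius
        2 r is later bounded by \<open>riesz_ge_ball_mass\<close>. For t > r the volume is r^d and t
        + r \<le> 2 t, so the potential with doubled radii appears.\<close>
      show ?thesis
      proof (cases "t \<le> r")
        case True
        have "ennreal (t powr - ?d) * (ennreal (?w * min t r powr ?d) * ball_mass f x (t + r)) = ennreal (?w * (t powr - ?d * t powr ?d)) * ball_mass f x (t + r)"
          using True w by (simp add: ennreal_mult ac_simps)
        also have "t powr - ?d * t powr ?d = 1" using t by (simp add: powr_add[symmetric])
        also have "ennreal (?w * 1) * ball_mass f x (t + r) \<le> ennreal ?w * ball_mass f x (2 * r)"
          using True by (auto intro!: mult_left_mono ball_mass_mono)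
        finally show ?thesis using 1 True t by (auto intro: order_trans add_increasing2)
      next
        case False
        have "ennreal (t powr - ?d) * (ennreal (?w * min t r powr ?d) * ball_mass f x (t + r)) \<le> ennreal (t powr - ?d) * (ennreal (?w * r powr ?d) * ball_mass f x (2 * t))"
          using False by (intro mult_left_mono mult_mono ball_mass_mono) auto
        then show ?thesis using 1 False t by (auto intro: order_trans simp: ac_simps)
      qed
    qed auto
  qed
  also have "\<dots> = ennreal ?w * ball_mass f x (2 * r) * ennreal r + ennreal (?w * r powr ?d) * (\<integral>\<^sup>+t. ennreal (t powr - ?d) * ball_mass f x (2 * t) * indicator {0<..} t \<partial>lborel)"
    using r by (subst nn_integral_add) (auto simp: nn_integral_cmult_indicator nn_integral_cmult)
  also have "(\<integral>\<^sup>+t. ennreal (t powr - ?d) * ball_mass f x (2 * t) * indicator {0<..} t \<partial>lborel) = ennreal (2 powr (?d - 1)) * riesz f x"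
    unfolding riesz_def
  proof (subst nn_integral_real_affine[where c=2 and t=0 and f="\<lambda>t. ennreal (t powr - ?d) * ball_mass f x t * indicator {0<..} t"])
    have 1: "ennreal (2 powr (?d - 1)) * (ennreal \<bar>2\<bar> * ennreal (2 powr - ?d)) = 1"
    proof -
      have "2 powr (?d - 1) * (\<bar>2\<bar> * 2 powr - ?d) = 1" by (simp add: powr_diff powr_minus)
      then show ?thesis
        by (metis abs_ge_zero ennreal_1 ennreal_mult mult_nonneg_nonneg powr_ge_zero)
    qed
    have "(\<integral>\<^sup>+t. ennreal ((0 + 2 * t) powr - ?d) * ball_mass f x (0 + 2 * t) * indicator {0<..} (0 + 2 * t) \<partial>lborel)
       = (\<integral>\<^sup>+t. ennreal (2 powr - ?d) * (ennreal (t powr - ?d) * ball_mass f x (2 * t) * indicator {0<..} t) \<partial>lborel)"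
      by (intro nn_integral_cong) (auto simp: indicator_def powr_mult ennreal_mult mult.assoc)
    also have "\<dots> = ennreal (2 powr - ?d) * (\<integral>\<^sup>+t. ennreal (t powr - ?d) * ball_mass f x (2 * t) * indicator {0<..} t \<partial>lborel)"
      by (subst nn_integral_cmult) auto
    finally show "(\<integral>\<^sup>+t\<in>{0<..}. ennreal (t powr - ?d) * ball_mass f x (2 * t) \<partial>lborel)
      = ennreal (2 powr (?d - 1)) * (ennreal \<bar>2\<bar> * (\<integral>\<^sup>+t. ennreal ((0 + 2 * t) powr - ?d) * ball_mass f x (0 + 2 * t) * indicator {0<..} (0 + 2 * t) \<partial>lborel))"
      by (simp only: mult.assoc[symmetric] 1[unfolded mult.assoc[symmetric]] mult_1_left)
  qed auto
  also have "ennreal ?w * ball_mass f x (2 * r) * ennreal r + ennreal (?w * r powr ?d) * (ennreal (2 powr (?d - 1)) * riesz f x)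
     \<le> ennreal ?w * (ennreal ((?d - 1) * (2 * r) powr (?d - 1)) * riesz f x) * ennreal r + ennreal (?w * r powr ?d) * (ennreal (2 powr (?d - 1)) * riesz f x)"
    using r d by (intro add_mono mult_right_mono mult_left_mono riesz_ge_ball_mass) auto
  also have "\<dots> = ennreal (?w * (r * (?d - 1) * (2 * r) powr (?d - 1) + ?c)) * riesz f x"
  proof -
    have "ennreal W * (ennreal B * R) * ennreal r + ennreal (W * D) * (ennreal E * R) = ennreal (W * (r * B + E * D)) * R"
      if "0 \<le> W" "0 \<le> B" "0 \<le> D" "0 \<le> E" for W B D E R
      using that r by (simp add: ennreal_mult ennreal_plus distrib_right distrib_left ac_simps)
    from this[OF w, of "(?d - 1) * (2 * r) powr (?d - 1)" "r powr ?d" "2 powr (?d - 1)"] show ?thesis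
      using d by (simp add: mult.assoc)
  qed
  finally show ?thesis .
qed

section \<open>Behaviour under translations and dilations\<close>

lemma ball_mass_affine:
  fixes f :: "'a::euclidean_space \<Rightarrow> ennreal"
  assumes [measurable]: "f \<in> borel_measurable borel" and c: "0 < c"
  shows "ball_mass (\<lambda>y. f (z + c *\<^sub>R y)) x t = ennreal (c powr - real DIM('a)) * ball_mass f (z + c *\<^sub>R x) (c * t)"
proof -
  have *: "indicator (cball x t) y = (indicator (cball (z + c *\<^sub>R x) (c * t)) (z + c *\<^sub>R y) :: ennreal)" for y
  proof -
    have "dist (z + c *\<^sub>R x) (z + c *\<^sub>R y) = c * dist x y"
      using c by (simp add: dist_norm scaleR_diff_right[symmetric])
    then show ?thesis using c by (simp add: indicator_def)
  qed
  show ?thesis unfolding ball_mass_def *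
    using nn_integral_lborel_shift[of "\<lambda>y. f y * indicator (cball (z + c *\<^sub>R x) (c * t)) y" c z] c by auto
qed

text \<open>Homogeneity of order one: the factor c is the one that the chain rule produces for a
  gradient, so passing between the scale \<epsilon> and the unit scale does not change the
  constants.\<close>

lemma riesz_affine:
  fixes f :: "'a::euclidean_space \<Rightarrow> ennreal"
  assumes [measurable]: "f \<in> borel_measurable borel" and c: "0 < c"
  shows "riesz (\<lambda>y. ennreal c * f (z + c *\<^sub>R y)) x = riesz f (z + c *\<^sub>R x)"
proof -
  let ?d = "real DIM('a)"
  have "riesz (\<lambda>y. ennreal c * f (z + c *\<^sub>R y)) x = ennreal c * riesz (\<lambda>y. f (z + c *\<^sub>R y)) x"
    by (rule riesz_cmult) measurable
  also have "riesz (\<lambda>y. f (z + c *\<^sub>R y)) x = (\<integral>\<^sup>+t. ennreal ((0 + c * t) powr - ?d) * ball_mass f (z + c *\<^sub>R x) (0 + c * t) * indicator {0<..} (0 + c * t) \<partial>lborel)"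
    unfolding riesz_def ball_mass_affine[OF assms]
    using c by (intro nn_integral_cong) (auto simp: indicator_def powr_mult ennreal_mult zero_less_mult_iff ac_simps)
  also have "ennreal c * \<dots> = riesz f (z + c *\<^sub>R x)"
    unfolding riesz_def using c
    by (subst (2) nn_integral_real_affine[where c=c and t=0]) auto
  finally show ?thesis .
qed

section \<open>Mollification\<close>

text \<open>The family exp(-1/t)/t^n, extended by 0, is closed under differentiation up to linear
  combinations, so the derivatives of every order at t = 0 are settled at once.\<close>

definition expf :: "nat \<Rightarrow> real \<Rightarrow> real" where
  "expf n t = (if 0 < t then exp (- (1 / t)) / t ^ n else 0)"

lemma power_le_fact_exp:
  fixes x :: real assumes "0 \<le> x"
  shows "x ^ n \<le> fact n * exp x"
proof -
  have s: "(\<lambda>k. x ^ k / fact k) sums exp x"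
    using exp_converges[of x] by (simp add: field_simps)
  have "(\<Sum>k\<in>{n}. x ^ k / fact k) \<le> (\<Sum>k. x ^ k / fact k)"
    using s assms by (intro sum_le_suminf) (auto simp: sums_iff)
  also have "\<dots> = exp x" using s by (simp add: sums_iff)
  finally show ?thesis by (simp add: field_simps)
qed

text \<open>From x^(n + 2) \<le> (n + 2)! exp(x) at x = 1/t. The quadratic bound makes the
  difference quotient at 0 tend to 0.\<close>

lemma expf_le: "\<bar>expf n t\<bar> \<le> fact (n + 2) * t ^ 2"
proof (cases "0 < t")
  case True
  have "(1 / t) ^ (n + 2) \<le> fact (n + 2) * exp (1 / t)" using True by (intro power_le_fact_exp) auto
  then have "(1 / t) ^ (n + 2) * exp (- (1 / t)) \<le> fact (n + 2) * exp (1 / t) * exp (- (1 / t))"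
    by (intro mult_right_mono) auto
  moreover have "fact (n + 2) * exp (1 / t) * exp (- (1 / t)) = fact (n + 2)"
    by (simp only: mult.assoc exp_add[symmetric]) simp
  ultimately have "exp (- (1 / t)) / t ^ (n + 2) \<le> fact (n + 2)"
    by (simp only: power_divide) simp
  then have "exp (- (1 / t)) / t ^ (n + 2) * t ^ 2 \<le> fact (n + 2) * t ^ 2" by (intro mult_right_mono) auto
  moreover have "exp (- (1 / t)) / t ^ (n + 2) * t ^ 2 = exp (- (1 / t)) / t ^ n"
    using True by (simp add: power_add power2_eq_square)
  ultimately show ?thesis using True by (simp add: expf_def)
qed (simp add: expf_def)

lemma expf_deriv: "(expf n has_real_derivative (expf (n + 2) t - real n * expf (n + 1) t)) (at t)"
proof -
  consider "t < 0" | "t = 0" | "0 < t" by linarith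
  then show ?thesis
  proof cases
    case 1
    have "((\<lambda>_. 0) has_real_derivative 0) (at t)" by simp
    then have "(expf n has_real_derivative 0) (at t)"
      by (rule has_field_derivative_transform_within_open[where S="{..<0}"]) (use 1 in \<open>auto simp: expf_def\<close>)
    then show ?thesis using 1 by (simp add: expf_def)
  next
    case 2
    have "(\<lambda>h. (expf n (0 + h) - expf n 0) / h) \<midarrow>0\<rightarrow> 0"
    proof (rule Lim_null_comparison)
      show "\<forall>\<^sub>F h in at 0. norm ((expf n (0 + h) - expf n 0) / h) \<le> fact (n + 2) * \<bar>h\<bar>"
      proof (rule eventually_at_filter[THEN iffD2], rule always_eventually, intro allI impI)
        fix h :: real assume h: "h \<noteq> 0"
        have "norm ((expf n (0 + h) - expf n 0) / h) = \<bar>expf n h\<bar> / \<bar>h\<bar>" by (simp add: expf_def)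
        also have "\<dots> \<le> fact (n + 2) * h ^ 2 / \<bar>h\<bar>" by (intro divide_right_mono expf_le) auto
        also have "\<dots> = fact (n + 2) * \<bar>h\<bar>" using h by (simp add: power2_eq_square abs_if)
        finally show "norm ((expf n (0 + h) - expf n 0) / h) \<le> fact (n + 2) * \<bar>h\<bar>" .
      qed
      show "(\<lambda>h. fact (n + 2) * \<bar>h\<bar>) \<midarrow>0\<rightarrow> (0::real)"
        by (intro tendsto_mult_right_zero tendsto_rabs_zero tendsto_ident_at)
    qed
    then have "(expf n has_real_derivative 0) (at 0)" by (simp add: DERIV_def)
    then show ?thesis using 2 by (simp add: expf_def)
  next
    case 3
    have "((\<lambda>t. exp (- (1 / t)) / t ^ n) has_real_derivative (expf (n + 2) t - real n * expf (n + 1) t)) (at t)"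
    proof (cases n)
      case 0
      then show ?thesis
        using 3 by (auto intro!: derivative_eq_intros simp: expf_def field_simps power2_eq_square)
    next
      case (Suc m)
      then show ?thesis
        using 3
        apply (cases m)
         apply (auto intro!: derivative_eq_intros simp: expf_def field_simps power2_eq_square)
        subgoal for k by (cases k) auto
        done
    qed
    then show ?thesis
      by (rule has_field_derivative_transform_within_open[where S="{0<..}"]) (use 3 in \<open>auto simp: expf_def\<close>)
  qed
qed

text \<open>Generated so that directional derivatives of members are again members: an induction
  over the rules and one over the order then yield \<open>Ck\<close> for every order, without a
  general calculus of \<open>Ck\<close> functions.\<close>

inductive smooth_gen :: "real \<Rightarrow> 'a::euclidean_space \<Rightarrow> ('a \<Rightarrow> real) \<Rightarrow> bool" for k x0 where
  const: "smooth_gen k x0 (\<lambda>_. c)"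
| lin: "smooth_gen k x0 (\<lambda>y. y \<bullet> v)"
| expf: "smooth_gen k x0 (\<lambda>y. expf n (1 - k * ((y - x0) \<bullet> (y - x0))))"
| add: "smooth_gen k x0 f \<Longrightarrow> smooth_gen k x0 g \<Longrightarrow> smooth_gen k x0 (\<lambda>y. f y + g y)"
| mult: "smooth_gen k x0 f \<Longrightarrow> smooth_gen k x0 g \<Longrightarrow> smooth_gen k x0 (\<lambda>y. f y * g y)"

lemma smooth_gen_derivative:
  assumes "smooth_gen k x0 f"
  shows "\<exists>f'. (\<forall>y. (f has_derivative f' y) (at y)) \<and> (\<forall>v. smooth_gen k x0 (\<lambda>y. f' y v))"
  using assms
proof induction
  case (const c)
  show ?case by (intro exI[of _ "\<lambda>_ _. 0"]) (auto intro: smooth_gen.const)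
next
  case (lin v)
  show ?case
    by (intro exI[of _ "\<lambda>_ h. h \<bullet> v"]) (auto intro!: smooth_gen.const derivative_eq_intros)
next
  case (expf n)
  let ?q = "\<lambda>y. 1 - k * ((y - x0) \<bullet> (y - x0))"
  let ?f' = "\<lambda>y h. (expf (n + 2) (?q y) + (- real n) * expf (n + 1) (?q y)) * ((- 2 * k) * (y \<bullet> h + (- (x0 \<bullet> h))))"
  have "((\<lambda>y. expf n (?q y)) has_derivative ?f' y) (at y)" for y
  proof -
    have q: "(?q has_derivative (\<lambda>h. (- 2 * k) * (y \<bullet> h + (- (x0 \<bullet> h))))) (at y)"
      by (auto intro!: derivative_eq_intros simp: algebra_simps inner_commute)
    have "((\<lambda>y. expf n (?q y)) has_derivative (\<lambda>h. ((- 2 * k) * (y \<bullet> h + (- (x0 \<bullet> h)))) * (expf (n + 2) (?q y) - real n * expf (n + 1) (?q y)))) (at y)"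
      by (rule DERIV_compose_FDERIV[OF expf_deriv q])
    then show ?thesis by (simp add: mult.commute)
  qed
  then show ?case
    by (intro exI[of _ ?f'] conjI allI smooth_gen.intros)
next
  case (add f g)
  then obtain f' g' where "\<forall>y. (f has_derivative f' y) (at y)" "\<forall>v. smooth_gen k x0 (\<lambda>y. f' y v)"
    "\<forall>y. (g has_derivative g' y) (at y)" "\<forall>v. smooth_gen k x0 (\<lambda>y. g' y v)" by blast
  then show ?case
    by (intro exI[of _ "\<lambda>y h. f' y h + g' y h"]) (auto intro!: smooth_gen.add derivative_intros)
next
  case (mult f g)
  then obtain f' g' where "\<forall>y. (f has_derivative f' y) (at y)" "\<forall>v. smooth_gen k x0 (\<lambda>y. f' y v)"
    "\<forall>y. (g has_derivative g' y) (at y)" "\<forall>v. smooth_gen k x0 (\<lambda>y. g' y v)" by blast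
  with mult show ?case
    by (intro exI[of _ "\<lambda>y h. f y * g' y h + f' y h * g y"])
       (auto intro!: smooth_gen.add smooth_gen.mult derivative_intros)
qed

lemma smooth_gen_Ck: "smooth_gen k x0 f \<Longrightarrow> Ck m UNIV f"
proof (induction m arbitrary: f)
  case 0
  then obtain f' where "\<forall>y. (f has_derivative f' y) (at y)" using smooth_gen_derivative by blast
  then show ?case by (auto intro!: continuous_at_imp_continuous_on has_derivative_continuous)
next
  case (Suc m)
  then obtain f' where f': "\<forall>y. (f has_derivative f' y) (at y)" "\<forall>v. smooth_gen k x0 (\<lambda>y. f' y v)"
    using smooth_gen_derivative by blast
  then have "frechet_derivative f (at y) = f' y" for y
    by (metis frechet_derivative_at)
  then show ?case using f' Suc.IH by (auto simp: differentiable_on_def differentiable_def)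
qed

text \<open>The usual exp(-1/(1 - |y|^2/r^2)) on the ball of radius r, left unnormalised;
  mollification divides by its integral.\<close>

definition bump :: "real \<Rightarrow> 'a::euclidean_space \<Rightarrow> real" where
  "bump r y = expf 0 (1 - (1 / r\<^sup>2) * (y \<bullet> y))"

lemma smooth_gen_bump: "smooth_gen (1 / r\<^sup>2) x (\<lambda>y. bump r (y - x))"
  unfolding bump_def by (rule smooth_gen.expf)

lemma bump_nonneg: "0 \<le> bump r y" and bump_le_1: "bump r y \<le> 1"
  by (simp_all add: bump_def expf_def)

lemma bump_pos_iff:
  assumes "0 < r"
  shows "0 < bump r y \<longleftrightarrow> norm y < r"
proof -
  have "0 < bump r y \<longleftrightarrow> (norm y)\<^sup>2 < r\<^sup>2"
    using assms by (simp add: bump_def expf_def power2_norm_eq_inner field_simps)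
  also have "\<dots> \<longleftrightarrow> norm y < r" using assms
    by (metis less_eq_real_def norm_ge_zero power2_less_imp_less power_strict_mono zero_less_numeral)
  finally show ?thesis .
qed

lemma bump_eq_0:
  assumes "0 < r" "r \<le> norm y"
  shows "bump r y = 0"
  using bump_pos_iff[OF assms(1), of y] bump_nonneg[of r y] assms by simp

lemma bump_scale: "0 < r \<Longrightarrow> bump r (r *\<^sub>R y) = bump 1 y"
  by (simp add: bump_def power2_eq_square)

lemma test_function_bump:
  assumes "0 < r" "cball x r \<subseteq> S"
  shows "test_function S (\<lambda>y. bump r (y - x))"
proof -
  have "{y. bump r (y - x) \<noteq> 0} \<subseteq> cball x r"
  proof
    fix y assume "y \<in> {y. bump r (y - x) \<noteq> 0}"
    then have "\<not> r \<le> norm (y - x)" using bump_eq_0[OF assms(1), of "y - x"] by auto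
    then show "y \<in> cball x r" by (simp add: dist_norm norm_minus_commute)
  qed
  then have "closure {y. bump r (y - x) \<noteq> 0} \<subseteq> cball x r" by (simp add: closure_minimal)
  moreover from this have "compact (closure {y. bump r (y - x) \<noteq> 0})"
    by (auto simp: compact_eq_bounded_closed intro: bounded_subset[OF bounded_cball])
  moreover have "smooth_on UNIV (\<lambda>y. bump r (y - x))"
    unfolding smooth_on_def using smooth_gen_Ck[OF smooth_gen_bump] by blast
  ultimately show ?thesis using assms(2) unfolding test_function_def by blast
qed


lemma has_derivative_0_outside:
  assumes "(f has_derivative f') (at y)" "\<And>z. z \<notin> cball x r \<Longrightarrow> f z = 0" "y \<notin> cball x r"
  shows "f' = (\<lambda>_. 0)"
proof -
  have "((\<lambda>_. 0) has_derivative (\<lambda>_. 0)) (at y)" by simp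
  then have "(f has_derivative (\<lambda>_. 0)) (at y)"
    by (rule has_derivative_transform_within_open[where s="- cball x r"]) (use assms(2,3) in auto)
  then show ?thesis using has_derivative_unique assms(1) by blast
qed

lemma bounded_of_compact_support:
  fixes f :: "'a::euclidean_space \<Rightarrow> real"
  assumes "continuous_on UNIV f" "\<And>y. y \<notin> cball x r \<Longrightarrow> f y = 0"
  shows "\<exists>M\<ge>0. \<forall>y. \<bar>f y\<bar> \<le> M"
proof -
  have "bounded (f ` cball x r)"
    by (intro compact_imp_bounded compact_continuous_image continuous_on_subset[OF assms(1)]) auto
  then obtain M where M: "\<forall>z\<in>f ` cball x r. norm z \<le> M" unfolding bounded_iff by blast
  have "\<bar>f y\<bar> \<le> max M 0" for y
  proof (cases "y \<in> cball x r")
    case True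
    then have "norm (f y) \<le> M" using M by blast
    then show ?thesis by simp
  qed (simp add: assms(2))
  then show ?thesis by (intro exI[of _ "max M 0"]) auto
qed

text \<open>The partial derivatives are again in the class and keep the compact support, so they and
  their own derivatives are bounded. Bounded second derivatives make the gradient Lipschitz, which
  the differentiation of convolutions relies on.\<close>

lemma smooth_gen_gradient:
  fixes f :: "'a::euclidean_space \<Rightarrow> real"
  assumes f: "smooth_gen k x0 f" and supp: "\<And>y. y \<notin> cball x r \<Longrightarrow> f y = 0"
  shows "\<exists>g L M. (\<forall>y. (f has_derivative (\<lambda>h. g y \<bullet> h)) (at y)) \<and> (\<forall>y z. norm (g y - g z) \<le> L * norm (y - z))
     \<and> (\<forall>y. norm (g y) \<le> M) \<and> (\<forall>y. y \<notin> cball x r \<longrightarrow> g y = 0)"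
proof -
  obtain f' where f': "\<And>y. (f has_derivative f' y) (at y)" "\<And>v. smooth_gen k x0 (\<lambda>y. f' y v)"
    using smooth_gen_derivative[OF f] by blast
  have f'0: "f' y v = 0" if "y \<notin> cball x r" for y v
    using has_derivative_0_outside[OF f'(1) supp that] by simp
  define g where "g y = (\<Sum>b\<in>Basis. f' y b *\<^sub>R b)" for y
  have lin: "linear (f' y)" for y using f'(1) has_derivative_linear by blast
  have g: "f' y h = g y \<bullet> h" for y h
  proof -
    have "f' y h = f' y (\<Sum>b\<in>Basis. (h \<bullet> b) *\<^sub>R b)" by (simp add: euclidean_representation)
    also have "\<dots> = (\<Sum>b\<in>Basis. (h \<bullet> b) * f' y b)"
      using lin by (simp add: linear_sum linear_scale)
    also have "\<dots> = h \<bullet> g y" by (simp add: g_def inner_sum_right mult.commute)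
    also have "\<dots> = g y \<bullet> h" by (rule inner_commute)
    finally show ?thesis .
  qed
  have "\<exists>L. \<forall>y z. norm (f' y b - f' z b) \<le> L * norm (y - z)" for b
  proof -
    obtain h where h: "\<And>y. ((\<lambda>y. f' y b) has_derivative h y) (at y)" "\<And>v. smooth_gen k x0 (\<lambda>y. h y v)"
      using smooth_gen_derivative[OF f'(2)] by blast
    have h0: "h y v = 0" if "y \<notin> cball x r" for y v
      using has_derivative_0_outside[OF h(1) f'0 that] by simp
    have "\<exists>M\<ge>0. \<forall>y. \<bar>h y c\<bar> \<le> M" for c
    proof (rule bounded_of_compact_support[of _ x r])
      show "continuous_on UNIV (\<lambda>y. h y c)" using smooth_gen_Ck[OF h(2), of 0 c] by simp
    qed (use h0 in auto)
    then obtain M where M: "\<And>c. 0 \<le> M c" "\<And>c y. \<bar>h y c\<bar> \<le> M c" by metis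
    have "norm (h y v) \<le> (\<Sum>c\<in>Basis. M c) * norm v" for y v
    proof -
      have lh: "linear (h y)" using h(1) has_derivative_linear by blast
      have "h y v = h y (\<Sum>c\<in>Basis. (v \<bullet> c) *\<^sub>R c)" by (simp add: euclidean_representation)
      also have "\<dots> = (\<Sum>c\<in>Basis. (v \<bullet> c) * h y c)" using lh by (simp add: linear_sum linear_scale)
      finally have "norm (h y v) \<le> (\<Sum>c\<in>Basis. \<bar>(v \<bullet> c) * h y c\<bar>)" by (simp add: sum_abs)
      also have "\<dots> \<le> (\<Sum>c\<in>Basis. norm v * M c)"
        unfolding abs_mult using M Basis_le_norm by (intro sum_mono mult_mono) auto
      finally show ?thesis by (simp add: sum_distrib_left mult.commute)
    qed
    then have "onorm (h y) \<le> (\<Sum>c\<in>Basis. M c)" for y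
      by (intro onorm_le)
    then have "norm (f' y b - f' z b) \<le> (\<Sum>c\<in>Basis. M c) * norm (y - z)" for y z
      using differentiable_bound[of UNIV "\<lambda>y. f' y b" h] h(1) by auto
    then show ?thesis by blast
  qed
  then obtain L where L: "\<And>b y z. norm (f' y b - f' z b) \<le> L b * norm (y - z)" by metis
  have "\<exists>M\<ge>0. \<forall>y. \<bar>f' y b\<bar> \<le> M" for b
  proof (rule bounded_of_compact_support[of _ x r])
    show "continuous_on UNIV (\<lambda>y. f' y b)" using smooth_gen_Ck[OF f'(2), of 0 b] by simp
  qed (use f'0 in auto)
  then obtain M where M: "\<And>b y. \<bar>f' y b\<bar> \<le> M b" by metis
  show ?thesis
  proof (intro exI conjI allI impI)
    fix y z
    show "(f has_derivative (\<lambda>h. g y \<bullet> h)) (at y)" using f'(1)[of y] g by (metis ext)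
    have "g y - g z = (\<Sum>b\<in>Basis. (f' y b - f' z b) *\<^sub>R b)"
      by (simp add: g_def sum_subtractf scaleR_diff_left)
    then have "norm (g y - g z) \<le> (\<Sum>b\<in>Basis. norm ((f' y b - f' z b) *\<^sub>R b))" by (simp only: norm_sum)
    also have "\<dots> \<le> (\<Sum>b\<in>Basis. L b * norm (y - z))" using L by (intro sum_mono) auto
    finally show "norm (g y - g z) \<le> (\<Sum>b\<in>Basis. L b) * norm (y - z)" by (simp add: sum_distrib_right)
    have "norm (g y) \<le> (\<Sum>b\<in>Basis. norm (f' y b *\<^sub>R b))" unfolding g_def by (rule norm_sum)
    also have "\<dots> \<le> (\<Sum>b\<in>Basis. M b)" using M by (intro sum_mono) auto
    finally show "norm (g y) \<le> (\<Sum>b\<in>Basis. M b)" .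
    show "g y = 0" if "y \<notin> cball x r" using f'0[OF that] by (simp add: g_def)
  qed
qed

text \<open>A Lipschitz gradient gives a Taylor remainder of second order, uniform in the base
  point. Integrated against |u| it stays of order |h|^2, so the difference quotient converges
  without an exchange of limits. The minus sign comes from the argument \<open>y - x\<close> of
  \<beta>.\<close>

lemma has_derivative_convolution:
  fixes u \<beta> :: "'a::euclidean_space \<Rightarrow> real" and g :: "'a \<Rightarrow> 'a"
  assumes u: "integrable lborel u"
    and \<beta>: "\<And>y. (\<beta> has_derivative (\<lambda>h. g y \<bullet> h)) (at y)" "\<And>y. \<bar>\<beta> y\<bar> \<le> B"
    and g: "\<And>y z. norm (g y - g z) \<le> L * norm (y - z)" "\<And>y. norm (g y) \<le> M"
  shows "((\<lambda>x. LINT y|lborel. u y * \<beta> (y - x)) has_derivative (\<lambda>h. (LINT y|lborel. u y *\<^sub>R (- g (y - x))) \<bullet> h)) (at x)"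
    and "continuous_on UNIV (\<lambda>x. LINT y|lborel. u y *\<^sub>R (- g (y - x)))"
    and "integrable lborel (\<lambda>y. u y * \<beta> (y - x))"
    and "integrable lborel (\<lambda>y. u y *\<^sub>R (- g (y - x)))"
proof -
  have [measurable]: "u \<in> borel_measurable borel" using u by auto
  have "continuous_on UNIV \<beta>"
    using \<beta>(1) has_derivative_continuous by (intro continuous_at_imp_continuous_on) blast
  then have [measurable]: "\<beta> \<in> borel_measurable borel" by (rule borel_measurable_continuous_onI)
  have L0: "0 \<le> L" 
  proof -
    obtain b :: 'a where "b \<in> Basis" using nonempty_Basis by blast
    then show ?thesis using order_trans[OF norm_ge_zero g(1)[of b 0]] by simp
  qed
  have "continuous_on UNIV g"
    by (rule lipschitz_on_continuous_on[of L]) (auto simp: lipschitz_on_def dist_norm g L0)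
  then have [measurable]: "g \<in> borel_measurable borel" by (rule borel_measurable_continuous_onI)
  have i1: "integrable lborel (\<lambda>y. u y * \<beta> (y - x))" for x
  proof (rule Bochner_Integration.integrable_bound[OF integrable_mult_right[OF integrable_abs[OF u], of B]])
    show "AE y in lborel. norm (u y * \<beta> (y - x)) \<le> norm (B * \<bar>u y\<bar>)"
    proof (intro AE_I2)
      fix y
      have "\<bar>u y\<bar> * \<bar>\<beta> (y - x)\<bar> \<le> \<bar>u y\<bar> * \<bar>B\<bar>"
        using \<beta>(2)[of "y - x"] by (intro mult_left_mono) auto
      then show "norm (u y * \<beta> (y - x)) \<le> norm (B * \<bar>u y\<bar>)" by (simp add: abs_mult mult.commute)
    qed
  qed measurable
  have i2: "integrable lborel (\<lambda>y. u y *\<^sub>R (- g (y - x)))" for x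
  proof (rule Bochner_Integration.integrable_bound[OF integrable_mult_right[OF integrable_abs[OF u], of M]])
    show "AE y in lborel. norm (u y *\<^sub>R (- g (y - x))) \<le> norm (M * \<bar>u y\<bar>)"
    proof (intro AE_I2)
      fix y
      have "\<bar>u y\<bar> * norm (g (y - x)) \<le> \<bar>u y\<bar> * \<bar>M\<bar>"
        using g(2)[of "y - x"] by (intro mult_left_mono) auto
      then show "norm (u y *\<^sub>R (- g (y - x))) \<le> norm (M * \<bar>u y\<bar>)" by (simp add: abs_mult mult.commute)
    qed
  qed measurable
  show "integrable lborel (\<lambda>y. u y * \<beta> (y - x))" "integrable lborel (\<lambda>y. u y *\<^sub>R (- g (y - x)))" by (fact i1 i2)+
  define I where "I = (LINT y|lborel. \<bar>u y\<bar>)"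
  have I: "0 \<le> I" unfolding I_def by simp
  have Lu: "integrable lborel (\<lambda>y. C * \<bar>u y\<bar>)" for C using u by simp
  show "continuous_on UNIV (\<lambda>x. LINT y|lborel. u y *\<^sub>R (- g (y - x)))"
  proof (rule lipschitz_on_continuous_on[of "L * I"], rule lipschitz_onI)
    fix x z :: 'a
    have "dist (LINT y|lborel. u y *\<^sub>R (- g (y - x))) (LINT y|lborel. u y *\<^sub>R (- g (y - z)))
       = norm (LINT y|lborel. u y *\<^sub>R (- g (y - x)) - u y *\<^sub>R (- g (y - z)))"
      unfolding dist_norm by (subst Bochner_Integration.integral_diff[OF i2 i2]) simp
    also have "\<dots> \<le> (LINT y|lborel. norm (u y *\<^sub>R (- g (y - x)) - u y *\<^sub>R (- g (y - z))))" by (rule integral_norm_bound)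
    also have "\<dots> \<le> (LINT y|lborel. (L * dist x z) * \<bar>u y\<bar>)"
    proof (intro integral_mono Lu integrable_norm Bochner_Integration.integrable_diff i2)
      fix y
      have "norm (u y *\<^sub>R (- g (y - x)) - u y *\<^sub>R (- g (y - z))) = \<bar>u y\<bar> * norm (g (y - z) - g (y - x))"
        by (simp add: scaleR_diff_right[symmetric] norm_minus_commute del: scaleR_minus_right)
      also have "\<dots> \<le> \<bar>u y\<bar> * (L * norm ((y - z) - (y - x)))" by (intro mult_left_mono g) auto
      finally show "norm (u y *\<^sub>R (- g (y - x)) - u y *\<^sub>R (- g (y - z))) \<le> (L * dist x z) * \<bar>u y\<bar>"
        by (simp add: dist_norm mult.commute)
    qed
    finally show "dist (LINT y|lborel. u y *\<^sub>R (- g (y - x))) (LINT y|lborel. u y *\<^sub>R (- g (y - z))) \<le> L * I * dist x z"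
      by (simp add: I_def mult_ac)
  qed (use L0 I in auto)
  have rem: "\<bar>\<beta> (z + k) - \<beta> z - g z \<bullet> k\<bar> \<le> L * norm k * norm k" for z k
  proof -
    have "norm (\<beta> (z + k) - \<beta> z - (\<lambda>h. g z \<bullet> h) (z + k - z)) \<le> norm (z + k - z) * (L * norm k)"
    proof (rule differentiable_bound_linearization[where f=\<beta> and a=z and b="z + k" and f'="\<lambda>y h. g y \<bullet> h" and S="cball z (norm k)"])
      show "z + t *\<^sub>R (z + k - z) \<in> cball z (norm k)" if "t \<in> {0..1}" for t
        using that by (simp add: dist_norm mult_left_le_one_le)
      show "onorm ((\<lambda>h. g y \<bullet> h) - (\<lambda>h. g z \<bullet> h)) \<le> L * norm k" if "y \<in> cball z (norm k)" for y
        unfolding fun_diff_def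
      proof (rule onorm_le)
        fix h
        have "norm (g y \<bullet> h - g z \<bullet> h) = \<bar>(g y - g z) \<bullet> h\<bar>" by (simp add: inner_diff_left)
        also have "\<dots> \<le> norm (g y - g z) * norm h" by (rule Cauchy_Schwarz_ineq2)
        also have "\<dots> \<le> L * norm (y - z) * norm h" by (intro mult_right_mono g) auto
        also have "\<dots> \<le> L * norm k * norm h" using that L0
          by (intro mult_right_mono mult_left_mono) (auto simp: dist_norm norm_minus_commute)
        finally show "norm (g y \<bullet> h - g z \<bullet> h) \<le> L * norm k * norm h" .
      qed
      show "(\<beta> has_derivative (\<lambda>h. g y \<bullet> h)) (at y within cball z (norm k))" for y
        by (rule has_derivative_at_withinI[OF \<beta>(1)])
    qed simp
    then show ?thesis by (simp add: mult_ac)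
  qed
  let ?G = "\<lambda>x. LINT y|lborel. u y *\<^sub>R (- g (y - x))"
  let ?V = "\<lambda>x. LINT y|lborel. u y * \<beta> (y - x)"
  have R: "\<bar>?V (x + h) - ?V x - ?G x \<bullet> h\<bar> \<le> L * I * norm h * norm h" for h
  proof -
    have "?V (x + h) - ?V x - ?G x \<bullet> h = (LINT y|lborel. u y * \<beta> (y - (x + h)) - u y * \<beta> (y - x) - (u y *\<^sub>R (- g (y - x))) \<bullet> h)"
      by (simp only: Bochner_Integration.integral_diff[OF Bochner_Integration.integrable_diff[OF i1 i1] integrable_inner_left[OF i2]]
          Bochner_Integration.integral_diff[OF i1 i1] integral_inner_left[OF i2])
    then have "\<bar>?V (x + h) - ?V x - ?G x \<bullet> h\<bar> \<le> (LINT y|lborel. \<bar>u y * \<beta> (y - (x + h)) - u y * \<beta> (y - x) - (u y *\<^sub>R (- g (y - x))) \<bullet> h\<bar>)"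
      by (simp only: integral_abs_bound)
    also have "\<dots> \<le> (LINT y|lborel. (L * norm h * norm h) * \<bar>u y\<bar>)"
    proof (intro integral_mono Lu integrable_abs Bochner_Integration.integrable_diff i1 integrable_inner_left i2)
      fix y
      have "u y * \<beta> (y - (x + h)) - u y * \<beta> (y - x) - (u y *\<^sub>R (- g (y - x))) \<bullet> h
         = u y * (\<beta> ((y - x) + (- h)) - \<beta> (y - x) - g (y - x) \<bullet> (- h))"
        by (simp add: algebra_simps)
      then show "\<bar>u y * \<beta> (y - (x + h)) - u y * \<beta> (y - x) - (u y *\<^sub>R (- g (y - x))) \<bullet> h\<bar> \<le> (L * norm h * norm h) * \<bar>u y\<bar>"
        using mult_left_mono[OF rem[of "y - x" "- h"] abs_ge_zero[of "u y"]] by (simp add: abs_mult mult_ac)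
    qed
    finally show ?thesis by (simp add: I_def mult_ac)
  qed
  show "(?V has_derivative (\<lambda>h. ?G x \<bullet> h)) (at x)"
  proof (rule has_derivativeI_sandwich[of 1])
    show "bounded_linear (\<lambda>h. ?G x \<bullet> h)" by (rule bounded_linear_inner_right)
    show "norm (?V y - ?V x - ?G x \<bullet> (y - x)) / norm (y - x) \<le> L * I * norm (y - x)" if "y \<noteq> x" for y
      using R[of "y - x"] that by (simp add: field_simps)
    have "((\<lambda>y. L * I * norm (y - x)) \<longlongrightarrow> L * I * norm (x - x)) (at x)" by (intro tendsto_intros)
    then show "((\<lambda>y. L * I * norm (y - x)) \<longlongrightarrow> 0) (at x)" by simp
  qed simp
qed

section \<open>The fundamental theorem of calculus on cones\<close>

text \<open>Allows the potential to absorb an enlargement of all balls by the factor 2.\<close>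

lemma riesz_double:
  fixes f :: "'a::euclidean_space \<Rightarrow> ennreal"
  assumes [measurable]: "f \<in> borel_measurable borel"
  shows "(\<integral>\<^sup>+t\<in>{0<..}. ennreal (t powr - real DIM('a)) * ball_mass f x (2 * t) \<partial>lborel)
     = ennreal (2 powr (real DIM('a) - 1)) * riesz f x"
  unfolding riesz_def
proof (subst nn_integral_real_affine[where c=2 and t=0 and f="\<lambda>t. ennreal (t powr - real DIM('a)) * ball_mass f x t * indicator {0<..} t"])
  let ?d = "real DIM('a)"
  have 1: "ennreal (2 powr (?d - 1)) * (ennreal \<bar>2\<bar> * ennreal (2 powr - ?d)) = 1"
  proof -
    have "2 powr (?d - 1) * (\<bar>2\<bar> * 2 powr - ?d) = 1" by (simp add: powr_diff powr_minus)
    then show ?thesis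
      by (metis abs_ge_zero ennreal_1 ennreal_mult mult_nonneg_nonneg powr_ge_zero)
  qed
  have "(\<integral>\<^sup>+t. ennreal ((0 + 2 * t) powr - ?d) * ball_mass f x (0 + 2 * t) * indicator {0<..} (0 + 2 * t) \<partial>lborel)
     = (\<integral>\<^sup>+t. ennreal (2 powr - ?d) * (ennreal (t powr - ?d) * ball_mass f x (2 * t) * indicator {0<..} t) \<partial>lborel)"
    by (intro nn_integral_cong) (auto simp: indicator_def powr_mult ennreal_mult mult.assoc)
  also have "\<dots> = ennreal (2 powr - ?d) * (\<integral>\<^sup>+t. ennreal (t powr - ?d) * ball_mass f x (2 * t) * indicator {0<..} t \<partial>lborel)"
    by (subst nn_integral_cmult) auto
  finally show "(\<integral>\<^sup>+t\<in>{0<..}. ennreal (t powr - ?d) * ball_mass f x (2 * t) \<partial>lborel)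
    = ennreal (2 powr (?d - 1)) * (ennreal \<bar>2\<bar> * (\<integral>\<^sup>+t. ennreal ((0 + 2 * t) powr - ?d) * ball_mass f x (0 + 2 * t) * indicator {0<..} (0 + 2 * t) \<partial>lborel))"
    by (simp only: mult.assoc[symmetric] 1[unfolded mult.assoc[symmetric]] mult_1_left)
qed auto

definition has_grad_on :: "('a::euclidean_space \<Rightarrow> real) \<Rightarrow> ('a \<Rightarrow> 'a) \<Rightarrow> 'a set \<Rightarrow> bool" where
  "has_grad_on V g S \<longleftrightarrow> (\<forall>x\<in>S. (V has_derivative (\<lambda>h. g x \<bullet> h)) (at x)) \<and> continuous_on S g"

lemma has_grad_on_continuous: "has_grad_on V g S \<Longrightarrow> continuous_on S V"
  unfolding has_grad_on_def
  by (meson continuous_at_imp_continuous_on has_derivative_continuous)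

text \<open>The majorant f stands in for the norm of g because later f is the gradient cut off away
  from the holes, which dominates only along the segments actually used. The half-open interval
  matches the integration domain of \<open>riesz\<close>.\<close>

lemma diff_le_nn_integral_line:
  fixes V :: "'a::euclidean_space \<Rightarrow> real"
  assumes V: "has_grad_on V g S" and seg: "\<And>t. 0 \<le> t \<Longrightarrow> t \<le> T \<Longrightarrow> x + t *\<^sub>R v \<in> S" and T: "0 \<le> T"
    and f: "\<And>t. 0 \<le> t \<Longrightarrow> t \<le> T \<Longrightarrow> ennreal (norm (g (x + t *\<^sub>R v))) \<le> f (x + t *\<^sub>R v)"
    and v: "norm v \<le> N"
  shows "ennreal \<bar>V (x + T *\<^sub>R v) - V x\<bar> \<le> (\<integral>\<^sup>+t\<in>{0<..T}. ennreal N * f (x + t *\<^sub>R v) \<partial>lborel)"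
proof -
  let ?l = "\<lambda>t. x + t *\<^sub>R v"
  have N: "0 \<le> N" using v norm_ge_zero order_trans by blast
  have d: "((\<lambda>t. V (?l t)) has_vector_derivative (g (?l t) \<bullet> v)) (at t within {0..T})" if "t \<in> {0..T}" for t
  proof -
    have l: "(?l has_derivative (\<lambda>h. h *\<^sub>R v)) (at t within {0..T})"
      by (auto intro!: derivative_eq_intros)
    have "(V has_derivative (\<lambda>h. g (?l t) \<bullet> h)) (at (?l t) within ?l ` {0..T})"
      using V seg that unfolding has_grad_on_def by (auto intro: has_derivative_at_withinI)
    from has_derivative_in_compose[OF l this] show ?thesis
      by (simp add: has_vector_derivative_def inner_scaleR_right)
  qed
  have I: "((\<lambda>t. g (?l t) \<bullet> v) has_integral (V (?l T) - V (?l 0))) {0..T}"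
    by (rule fundamental_theorem_of_calculus[OF T d])
  have cg: "continuous_on {0..T} (\<lambda>t. g (?l t))"
    by (rule continuous_on_compose2[of S g]) (use V seg in \<open>auto simp: has_grad_on_def intro!: continuous_intros\<close>)
  have J: "(\<lambda>t. N * norm (g (?l t))) integrable_on {0..T}"
    by (intro integrable_continuous_real continuous_intros cg)
  have "norm (integral {0..T} (\<lambda>t. g (?l t) \<bullet> v)) \<le> integral {0..T} (\<lambda>t. N * norm (g (?l t)))"
  proof (rule integral_norm_bound_integral[OF _ J])
    show "(\<lambda>t. g (?l t) \<bullet> v) integrable_on {0..T}" using I by blast
    fix t assume "t \<in> {0..T}"
    have "norm (g (?l t) \<bullet> v) \<le> norm (g (?l t)) * norm v" by (rule Cauchy_Schwarz_ineq2[folded real_norm_def])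
    also have "\<dots> \<le> norm (g (?l t)) * N" using v by (intro mult_left_mono) auto
    finally show "norm (g (?l t) \<bullet> v) \<le> N * norm (g (?l t))" by (simp add: mult.commute)
  qed
  then have "ennreal \<bar>V (?l T) - V x\<bar> \<le> ennreal (integral {0..T} (\<lambda>t. N * norm (g (?l t))))"
    using I by (intro ennreal_leI) (simp add: integral_unique)
  also have "\<dots> = (\<integral>\<^sup>+t\<in>{0..T}. ennreal (N * norm (g (?l t))) \<partial>lborel)"
    using N integrable_integral[OF J] by (intro nn_integral_has_integral_lebesgue'[symmetric]) auto
  also have "\<dots> = (\<integral>\<^sup>+t\<in>{0<..T}. ennreal (N * norm (g (?l t))) \<partial>lborel)"
    using AE_lborel_singleton[of "0::real"] by (intro nn_integral_cong_AE) (auto simp: indicator_def elim!: eventually_mono)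
  also have "\<dots> \<le> (\<integral>\<^sup>+t\<in>{0<..T}. ennreal N * f (?l t) \<partial>lborel)"
    using f N by (intro nn_integral_mono) (auto simp: indicator_def ennreal_mult intro!: mult_left_mono)
  finally show ?thesis .
qed

text \<open>Averaging over the cone with vertex \<open>x\<close> and axis \<open>n\<close> turns the fundamental theorem of
  calculus into a bound by the Riesz potential.\<close>
lemma cone_estimate:
  fixes V :: "'a::euclidean_space \<Rightarrow> real" and f :: "'a \<Rightarrow> ennreal"
  assumes V: "has_grad_on V g S" and [measurable]: "f \<in> borel_measurable borel" "V \<in> borel_measurable borel"
    and n: "norm n \<le> 1" and c: "0 < c" "c \<le> 1" and T: "0 \<le> T"
    and S: "\<And>t s. 0 \<le> t \<Longrightarrow> t \<le> T \<Longrightarrow> norm s \<le> 1 \<Longrightarrow> x + t *\<^sub>R (n + c *\<^sub>R s) \<in> S"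
    and f: "\<And>t s. 0 \<le> t \<Longrightarrow> t \<le> T \<Longrightarrow> norm s \<le> 1 \<Longrightarrow>
        ennreal (norm (g (x + t *\<^sub>R (n + c *\<^sub>R s)))) \<le> f (x + t *\<^sub>R (n + c *\<^sub>R s))"
  shows "(\<integral>\<^sup>+s\<in>cball 0 1. ennreal \<bar>V (x + T *\<^sub>R (n + c *\<^sub>R s)) - V x\<bar> \<partial>lborel)
      \<le> ennreal (c powr - real DIM('a) * 2 powr real DIM('a)) * riesz f x"
proof -
  let ?d = "real DIM('a)"
  have "(\<integral>\<^sup>+s\<in>cball 0 1. ennreal \<bar>V (x + T *\<^sub>R (n + c *\<^sub>R s)) - V x\<bar> \<partial>lborel)
     \<le> (\<integral>\<^sup>+s. \<integral>\<^sup>+t. ennreal 2 * f (x + t *\<^sub>R (n + c *\<^sub>R s)) * indicator {0<..T} t * indicator (cball 0 1) s \<partial>lborel \<partial>lborel)"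
  proof (intro nn_integral_mono)
    fix s :: 'a
    show "ennreal \<bar>V (x + T *\<^sub>R (n + c *\<^sub>R s)) - V x\<bar> * indicator (cball 0 1) s
       \<le> (\<integral>\<^sup>+t. ennreal 2 * f (x + t *\<^sub>R (n + c *\<^sub>R s)) * indicator {0<..T} t * indicator (cball 0 1) s \<partial>lborel)"
    proof (cases "norm s \<le> 1")
      case True
      have "norm (n + c *\<^sub>R s) \<le> 1 + 1 * 1"
        using n c True by (intro norm_triangle_mono) (auto intro: mult_le_one)
      then have "ennreal \<bar>V (x + T *\<^sub>R (n + c *\<^sub>R s)) - V x\<bar> \<le> (\<integral>\<^sup>+t\<in>{0<..T}. ennreal 2 * f (x + t *\<^sub>R (n + c *\<^sub>R s)) \<partial>lborel)"
        using True by (intro diff_le_nn_integral_line[OF V] S f T) auto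
      then show ?thesis using True by simp
    qed auto
  qed
  also have "\<dots> = (\<integral>\<^sup>+t. \<integral>\<^sup>+s. ennreal 2 * f (x + t *\<^sub>R (n + c *\<^sub>R s)) * indicator {0<..T} t * indicator (cball 0 1) s \<partial>lborel \<partial>lborel)"
    by (rule lborel_pair.Fubini') measurable
  \<comment> \<open>The section of the cone at parameter t is a ball of radius t c about x + t n,
    inside \<open>cball x (2 * t)\<close>. Its parametrisation by s contributes (t c)^(-d), and this
    is where the weight t^(-d) of the potential comes from.\<close>
  also have "\<dots> \<le> (\<integral>\<^sup>+t. ennreal (2 * c powr - ?d) * (ennreal (t powr - ?d) * ball_mass f x (2 * t) * indicator {0<..} t) \<partial>lborel)"
  proof (intro nn_integral_mono)
    fix t :: real
    show "(\<integral>\<^sup>+s. ennreal 2 * f (x + t *\<^sub>R (n + c *\<^sub>R s)) * indicator {0<..T} t * indicator (cball 0 1) s \<partial>lborel)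
      \<le> ennreal (2 * c powr - ?d) * (ennreal (t powr - ?d) * ball_mass f x (2 * t) * indicator {0<..} t)"
    proof (cases "0 < t \<and> t \<le> T")
      case True
      have "(\<integral>\<^sup>+s. ennreal 2 * f (x + t *\<^sub>R (n + c *\<^sub>R s)) * indicator {0<..T} t * indicator (cball 0 1) s \<partial>lborel)
         = ennreal 2 * ball_mass (\<lambda>s. f ((x + t *\<^sub>R n) + (t * c) *\<^sub>R s)) 0 1"
        unfolding ball_mass_def using True
        by (subst nn_integral_cmult[symmetric]) (auto simp: algebra_simps intro!: nn_integral_cong)
      also have "\<dots> = ennreal 2 * (ennreal ((t * c) powr - ?d) * ball_mass f (x + t *\<^sub>R n) (t * c))"
        using True c by (subst ball_mass_affine) auto
      also have "\<dots> \<le> ennreal 2 * (ennreal ((t * c) powr - ?d) * ball_mass f x (2 * t))"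
      proof (intro mult_left_mono ball_mass_subset)
        have "t * norm n \<le> t * 1" "t * c \<le> t * 1" using True n c by (intro mult_left_mono; simp)+
        moreover have "dist x (x + t *\<^sub>R n) = t * norm n" using True by (simp add: dist_norm)
        ultimately show "dist x (x + t *\<^sub>R n) + t * c \<le> 2 * t" by linarith
      qed auto
      finally show ?thesis using True c
        by (simp add: powr_mult ennreal_mult ac_simps)
    qed (auto simp: indicator_def)
  qed
  also have "\<dots> = ennreal (2 * c powr - ?d) * (ennreal (2 powr (?d - 1)) * riesz f x)"
    by (subst nn_integral_cmult) (auto simp: riesz_double)
  also have "\<dots> = ennreal (c powr - ?d * 2 powr ?d) * riesz f x"
  proof -
    have "2 * c powr - ?d * 2 powr (?d - 1) = c powr - ?d * 2 powr ?d" by (simp add: powr_diff)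
    moreover have "ennreal (2 * c powr - ?d) * ennreal (2 powr (?d - 1)) = ennreal (2 * c powr - ?d * 2 powr (?d - 1))"
      by (intro ennreal_mult[symmetric]) auto
    ultimately show ?thesis by (simp only: mult.assoc[symmetric])
  qed
  finally show ?thesis .
qed

lemma emeasure_cball_finite: "emeasure lborel (cball (x::'a::euclidean_space) r) < \<infinity>"
  by (rule emeasure_bounded_finite) auto

text \<open>Each pair is joined through its midpoint, and only the half of the segment next to y is
  integrated: there the map y to w + (1/2 + t)(y - w) contracts by a factor no smaller than 1/2, so
  the change of variables costs at most 2^d. The half next to w follows by exchanging y and
  w.\<close>

lemma poincare_ball:
  fixes V :: "'a::euclidean_space \<Rightarrow> real" and f :: "'a \<Rightarrow> ennreal"
  assumes V: "has_grad_on V g S" and [measurable]: "f \<in> borel_measurable borel" "V \<in> borel_measurable borel"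
    and r: "0 < r" and S: "cball p r \<subseteq> S"
    and f: "\<And>y. y \<in> cball p r \<Longrightarrow> ennreal (norm (g y)) \<le> f y"
  shows "(\<integral>\<^sup>+y. \<integral>\<^sup>+w. ennreal \<bar>V y - V w\<bar> * indicator (cball p r) w * indicator (cball p r) y \<partial>lborel \<partial>lborel)
      \<le> ennreal (unit_ball_vol DIM('a) * r powr DIM('a) * (2 * r) * 2 powr DIM('a)) * ball_mass f p r"
proof -
  let ?d = "real DIM('a)" let ?B = "cball p r"
  define h where "h y = f y * indicator ?B y" for y
  have [measurable]: "h \<in> borel_measurable borel" unfolding h_def by measurable
  let ?m = "\<lambda>y w. w + (1 / 2) *\<^sub>R (y - w)"
  let ?I = "\<integral>\<^sup>+w. \<integral>\<^sup>+y. ennreal \<bar>V y - V (?m y w)\<bar> * indicator ?B w * indicator ?B y \<partial>lborel \<partial>lborel"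
  have half: "?I \<le> ennreal (unit_ball_vol ?d * r powr ?d) * (ennreal r * (ennreal (2 powr ?d) * ball_mass f p r))"
  proof -
    have "?I \<le> (\<integral>\<^sup>+w. \<integral>\<^sup>+y. \<integral>\<^sup>+t. ennreal (2 * r) * h (w + (1 / 2 + t) *\<^sub>R (y - w)) * indicator {0<..1/2} t * indicator ?B w \<partial>lborel \<partial>lborel \<partial>lborel)"
    proof (intro nn_integral_mono)
      fix w y
      show "ennreal \<bar>V y - V (?m y w)\<bar> * indicator ?B w * indicator ?B y
         \<le> (\<integral>\<^sup>+t. ennreal (2 * r) * h (w + (1 / 2 + t) *\<^sub>R (y - w)) * indicator {0<..1/2} t * indicator ?B w \<partial>lborel)"
      proof (cases "w \<in> ?B \<and> y \<in> ?B")
        case True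
        have m: "?m y w + t *\<^sub>R (y - w) = w + (1 / 2 + t) *\<^sub>R (y - w)" for t by (simp add: algebra_simps)
        have inB: "w + (1 / 2 + t) *\<^sub>R (y - w) \<in> ?B" if "0 \<le> t" "t \<le> 1 / 2" for t
        proof -
          have "(1 - (1 / 2 + t)) *\<^sub>R w + (1 / 2 + t) *\<^sub>R y \<in> ?B"
            using True that by (intro convexD_alt[OF convex_cball]) auto
          moreover have "(1 - u) *\<^sub>R w + u *\<^sub>R y = w + u *\<^sub>R (y - w)" for u by (simp add: algebra_simps)
          ultimately show ?thesis by (simp only:)
        qed
        have "dist y w \<le> 2 * r" using True dist_triangle2[of y w p] by (auto simp: dist_commute)
        then have n: "norm (y - w) \<le> 2 * r" by (simp add: dist_norm)
        have "ennreal \<bar>V (?m y w + (1 / 2) *\<^sub>R (y - w)) - V (?m y w)\<bar> \<le> (\<integral>\<^sup>+t\<in>{0<..1/2}. ennreal (2 * r) * h (?m y w + t *\<^sub>R (y - w)) \<partial>lborel)"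
          by (rule diff_le_nn_integral_line[OF V, where x="?m y w"]; (unfold m)?; use inB S f n in \<open>auto simp: h_def\<close>)
        then show ?thesis using True unfolding m by (simp add: algebra_simps)
      qed auto
    qed
    also have "\<dots> = (\<integral>\<^sup>+w. \<integral>\<^sup>+t. \<integral>\<^sup>+y. ennreal (2 * r) * h (w + (1 / 2 + t) *\<^sub>R (y - w)) * indicator {0<..1/2} t * indicator ?B w \<partial>lborel \<partial>lborel \<partial>lborel)"
      by (intro nn_integral_cong lborel_pair.Fubini') measurable
    also have "\<dots> \<le> (\<integral>\<^sup>+w. \<integral>\<^sup>+t. (ennreal (2 * r) * (ennreal (2 powr ?d) * ball_mass f p r) * indicator ?B w) * indicator {0<..1/2::real} t \<partial>lborel \<partial>lborel)"
    proof (intro nn_integral_mono)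
      fix w and t :: real
      show "(\<integral>\<^sup>+y. ennreal (2 * r) * h (w + (1 / 2 + t) *\<^sub>R (y - w)) * indicator {0<..1/2} t * indicator ?B w \<partial>lborel)
        \<le> (ennreal (2 * r) * (ennreal (2 powr ?d) * ball_mass f p r) * indicator ?B w) * indicator {0<..1/2} t"
      proof (cases "w \<in> ?B \<and> 0 < t \<and> t \<le> 1 / 2")
        case True
        have "(\<integral>\<^sup>+y. ennreal (2 * r) * h (w + (1 / 2 + t) *\<^sub>R (y - w)) * indicator {0<..1/2} t * indicator ?B w \<partial>lborel)
          = (\<integral>\<^sup>+y. ennreal (2 * r) * h ((w - (1 / 2 + t) *\<^sub>R w) + (1 / 2 + t) *\<^sub>R y) \<partial>lborel)"
          using True by (intro nn_integral_cong) (auto simp: algebra_simps)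
        also have "\<dots> = ennreal (2 * r) * (ennreal (\<bar>1 / 2 + t\<bar> powr - ?d) * (\<integral>\<^sup>+y. h y \<partial>lborel))"
          using True by (subst nn_integral_cmult) (auto simp: nn_integral_lborel_shift)
        also have "\<dots> \<le> ennreal (2 * r) * (ennreal (2 powr ?d) * (\<integral>\<^sup>+y. h y \<partial>lborel))"
        proof -
          have "\<bar>1 / 2 + t\<bar> powr - ?d \<le> (1 / 2) powr - ?d" using True by (intro powr_mono2') auto
          then have *: "\<bar>1 / 2 + t\<bar> powr - ?d \<le> 2 powr ?d" by (simp add: powr_divide powr_minus_divide)
          show "ennreal (2 * r) * (ennreal (\<bar>1 / 2 + t\<bar> powr - ?d) * (\<integral>\<^sup>+y. h y \<partial>lborel)) \<le> ennreal (2 * r) * (ennreal (2 powr ?d) * (\<integral>\<^sup>+y. h y \<partial>lborel))"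
            by (rule mult_left_mono[OF mult_right_mono[OF ennreal_leI[OF *]]]) auto
        qed
        finally show ?thesis using True by (simp add: h_def ball_mass_def)
      qed (auto simp: indicator_def)
    qed
    also have "\<dots> = (\<integral>\<^sup>+w. (ennreal (2 * r) * ennreal (1 / 2) * (ennreal (2 powr ?d) * ball_mass f p r)) * indicator ?B w \<partial>lborel)"
      by (intro nn_integral_cong, subst nn_integral_cmult_indicator) (auto simp: ac_simps divide_ennreal)
    also have "\<dots> = (ennreal (2 * r) * ennreal (1 / 2) * (ennreal (2 powr ?d) * ball_mass f p r)) * emeasure lborel ?B"
      by (rule nn_integral_cmult_indicator) auto
    also have "ennreal (2 * r) * ennreal (1 / 2) = ennreal r" using r by (subst ennreal_mult[symmetric]) auto
    also have "emeasure lborel ?B = ennreal (unit_ball_vol ?d * r powr ?d)"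
      using r by (simp add: emeasure_cball_ge ennreal_mult)
    finally show ?thesis by (simp only: mult.commute)
  qed
  have sym: "?I = (\<integral>\<^sup>+y. \<integral>\<^sup>+w. ennreal \<bar>V w - V (?m y w)\<bar> * indicator ?B w * indicator ?B y \<partial>lborel \<partial>lborel)"
  proof -
    have msym: "?m y w = ?m w y" for y w :: 'a by (rule euclidean_eqI) (simp add: inner_simps field_simps)
    show ?thesis by (intro nn_integral_cong) (simp only: msym ac_simps)
  qed
  have swap: "?I = (\<integral>\<^sup>+y. \<integral>\<^sup>+w. ennreal \<bar>V y - V (?m y w)\<bar> * indicator ?B w * indicator ?B y \<partial>lborel \<partial>lborel)"
    by (rule lborel_pair.Fubini') measurable
  have "(\<integral>\<^sup>+y. \<integral>\<^sup>+w. ennreal \<bar>V y - V w\<bar> * indicator ?B w * indicator ?B y \<partial>lborel \<partial>lborel)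
     \<le> (\<integral>\<^sup>+y. \<integral>\<^sup>+w. ennreal \<bar>V y - V (?m y w)\<bar> * indicator ?B w * indicator ?B y + ennreal \<bar>V w - V (?m y w)\<bar> * indicator ?B w * indicator ?B y \<partial>lborel \<partial>lborel)"
  proof (intro nn_integral_mono)
    fix y w
    have "ennreal \<bar>V y - V w\<bar> \<le> ennreal (\<bar>V y - V (?m y w)\<bar> + \<bar>V w - V (?m y w)\<bar>)"
      by (intro ennreal_leI) auto
    then show "ennreal \<bar>V y - V w\<bar> * indicator ?B w * indicator ?B y
      \<le> ennreal \<bar>V y - V (?m y w)\<bar> * indicator ?B w * indicator ?B y + ennreal \<bar>V w - V (?m y w)\<bar> * indicator ?B w * indicator ?B y"
      by (auto simp: indicator_def ennreal_plus)
  qed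
  also have "\<dots> = (\<integral>\<^sup>+y. \<integral>\<^sup>+w. ennreal \<bar>V y - V (?m y w)\<bar> * indicator ?B w * indicator ?B y \<partial>lborel \<partial>lborel)
      + (\<integral>\<^sup>+y. \<integral>\<^sup>+w. ennreal \<bar>V w - V (?m y w)\<bar> * indicator ?B w * indicator ?B y \<partial>lborel \<partial>lborel)"
    by (subst nn_integral_add[symmetric]) (auto intro!: nn_integral_cong nn_integral_add)
  also have "\<dots> = ?I + ?I" by (rule arg_cong2[OF swap[symmetric] sym[symmetric], where f="(+)"])
  also have "\<dots> \<le> ennreal (unit_ball_vol ?d * r powr ?d) * (ennreal r * (ennreal (2 powr ?d) * ball_mass f p r))
     + ennreal (unit_ball_vol ?d * r powr ?d) * (ennreal r * (ennreal (2 powr ?d) * ball_mass f p r))"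
    by (intro add_mono half)
  also have "\<dots> = ennreal (unit_ball_vol ?d * r powr ?d * (2 * r) * 2 powr ?d) * ball_mass f p r"
  proof -
    have "ennreal W * (ennreal r * (ennreal E * M)) + ennreal W * (ennreal r * (ennreal E * M)) = ennreal (W * (2 * r) * E) * M"
      if "0 \<le> W" "0 \<le> E" for W E M
    proof -
      have "ennreal (W * (2 * r) * E) = ennreal (W * r * E) + ennreal (W * r * E)"
        using that r by (subst ennreal_plus[symmetric]) (auto simp: algebra_simps)
      then show ?thesis using that r by (simp add: ennreal_mult distrib_right mult.assoc)
    qed
    then show ?thesis by simp
  qed
  finally show ?thesis .
qed


section \<open>Mean oscillation on balls\<close>

definition osc :: "('a::euclidean_space \<Rightarrow> real) \<Rightarrow> real \<Rightarrow> 'a \<Rightarrow> real \<Rightarrow> ennreal" where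
  "osc V a p r = (\<integral>\<^sup>+y\<in>cball p r. ennreal \<bar>V y - a\<bar> \<partial>lborel)"

lemma osc_mono: "cball p r \<subseteq> cball q s \<Longrightarrow> osc V a p r \<le> osc V a q s"
  unfolding osc_def by (intro nn_integral_mono mult_left_mono) (auto simp: indicator_def)

definition avg :: "('a::euclidean_space \<Rightarrow> real) \<Rightarrow> 'a \<Rightarrow> real \<Rightarrow> real" where
  "avg V p r = (LINT y|lborel. indicator (cball p r) y * V y) / measure lborel (cball p r)"

lemma measure_cball_pos: "0 < r \<Longrightarrow> 0 < measure lborel (cball (p::'a::euclidean_space) r)"
  by (simp add: content_cball)

lemma integrable_indicator_cball:
  fixes V :: "'a::euclidean_space \<Rightarrow> real"
  assumes "continuous_on (cball p r) V"
  shows "integrable lborel (\<lambda>y. indicator (cball p r) y * V y)"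
  using borel_integrable_compact[OF compact_cball assms] by simp

lemma avg_diff_le:
  fixes V :: "'a::euclidean_space \<Rightarrow> real"
  assumes V: "continuous_on (cball p r) V" and r: "0 < r"
  shows "ennreal \<bar>avg V p r - a\<bar> \<le> ennreal (1 / measure lborel (cball p r)) * osc V a p r"
proof -
  let ?m = "measure lborel (cball p r)"
  note i = integrable_indicator_cball[OF V]
  have ia: "integrable lborel (\<lambda>y. indicator (cball p r) y * (V y - a))"
    using V by (intro integrable_indicator_cball continuous_intros)
  have m: "0 < ?m" by (rule measure_cball_pos[OF r])
  have "(LINT y|lborel. indicator (cball p r) y * (V y - a)) = (LINT y|lborel. indicator (cball p r) y * V y - indicator (cball p r) y * a)"
    by (simp add: algebra_simps)
  also have "\<dots> = (LINT y|lborel. indicator (cball p r) y * V y) - (LINT y|lborel. indicator (cball p r) y * a)"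
    using emeasure_cball_finite[of p r] by (intro Bochner_Integration.integral_diff i) (auto intro!: integrable_mult_left)
  also have "(LINT y|lborel. indicator (cball p r) y * a) = ?m * a" by simp
  finally have "avg V p r - a = (LINT y|lborel. indicator (cball p r) y * (V y - a)) / ?m"
    using m by (simp add: avg_def field_simps)
  then have "\<bar>avg V p r - a\<bar> \<le> (LINT y|lborel. \<bar>indicator (cball p r) y * (V y - a)\<bar>) / ?m"
    using m integral_abs_bound[of lborel "\<lambda>y. indicator (cball p r) y * (V y - a)"] by (simp add: divide_right_mono)
  then have "ennreal \<bar>avg V p r - a\<bar> \<le> ennreal (1 / ?m) * ennreal (LINT y|lborel. \<bar>indicator (cball p r) y * (V y - a)\<bar>)"
    using m by (subst ennreal_mult[symmetric]) (auto intro!: ennreal_leI)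
  also have "ennreal (LINT y|lborel. \<bar>indicator (cball p r) y * (V y - a)\<bar>) = osc V a p r"
    unfolding osc_def using ia
    by (subst nn_integral_eq_integral[symmetric]) (auto intro!: nn_integral_cong simp: indicator_def)
  finally show ?thesis .
qed

lemma avg_translate:
  fixes V :: "'a::euclidean_space \<Rightarrow> real"
  assumes [measurable]: "V \<in> borel_measurable borel" and r: "0 < r"
  shows "avg (\<lambda>y. V (y + z)) p r = avg V (p + z) r"
proof -
  have "(LINT y|lborel. indicator (cball (p + z) r) y * V y) = (LINT y|distr lborel borel ((+) z). indicator (cball (p + z) r) y * V y)"
    by (simp add: lborel_distr_plus)
  also have "\<dots> = (LINT y|lborel. indicator (cball (p + z) r) (z + y) * V (z + y))"
    by (rule integral_distr) auto
  also have "\<dots> = (LINT y|lborel. indicator (cball p r) y * V (y + z))"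
    by (intro Bochner_Integration.integral_cong) (auto simp: indicator_def dist_norm algebra_simps)
  finally show ?thesis using r by (simp add: avg_def content_cball)
qed

lemma osc_avg_le:
  fixes V :: "'a::euclidean_space \<Rightarrow> real" and f :: "'a \<Rightarrow> ennreal"
  assumes V: "has_grad_on V g S" and [measurable]: "f \<in> borel_measurable borel" "V \<in> borel_measurable borel"
    and r: "0 < r" and S: "cball p r \<subseteq> S"
    and f: "\<And>y. y \<in> cball p r \<Longrightarrow> ennreal (norm (g y)) \<le> f y"
  shows "osc V (avg V p r) p r \<le> ennreal (2 * r * 2 powr DIM('a)) * ball_mass f p r"
proof -
  let ?m = "measure lborel (cball p r)" let ?d = "real DIM('a)"
  have m: "0 < ?m" by (rule measure_cball_pos[OF r])
  have me: "?m = unit_ball_vol ?d * r powr ?d" using r by (simp add: content_cball powr_realpow)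
  have c: "continuous_on (cball p r) V"
    using has_grad_on_continuous[OF V] S continuous_on_subset by blast
  have "osc V (avg V p r) p r \<le> (\<integral>\<^sup>+y. ennreal (1 / ?m) * (\<integral>\<^sup>+w. ennreal \<bar>V y - V w\<bar> * indicator (cball p r) w * indicator (cball p r) y \<partial>lborel) \<partial>lborel)"
    unfolding osc_def
  proof (intro nn_integral_mono)
    fix y
    have "ennreal \<bar>V y - avg V p r\<bar> \<le> ennreal (1 / ?m) * osc V (V y) p r"
      using avg_diff_le[OF c r, of "V y"] by (simp add: abs_minus_commute)
    then show "ennreal \<bar>V y - avg V p r\<bar> * indicator (cball p r) y \<le> ennreal (1 / ?m) * (\<integral>\<^sup>+w. ennreal \<bar>V y - V w\<bar> * indicator (cball p r) w * indicator (cball p r) y \<partial>lborel)"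
      by (auto simp: osc_def indicator_def abs_minus_commute)
  qed
  also have "\<dots> = ennreal (1 / ?m) * (\<integral>\<^sup>+y. \<integral>\<^sup>+w. ennreal \<bar>V y - V w\<bar> * indicator (cball p r) w * indicator (cball p r) y \<partial>lborel \<partial>lborel)"
    by (subst nn_integral_cmult) auto
  also have "\<dots> \<le> ennreal (1 / ?m) * (ennreal (?m * (2 * r) * 2 powr ?d) * ball_mass f p r)"
    unfolding me by (intro mult_left_mono poincare_ball[OF V _ _ r S f]) auto
  also have "\<dots> = ennreal (1 / ?m * (?m * (2 * r) * 2 powr ?d)) * ball_mass f p r"
    using m r by (subst ennreal_mult[of "1 / ?m"]) (auto simp: mult.assoc)
  also have "1 / ?m * (?m * (2 * r) * 2 powr ?d) = 2 * r * 2 powr ?d" using m by simp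
  finally show ?thesis .
qed

text \<open>Insert V(w) between V(y) and a and average over w in the small ball: the first
  difference is a Poincare integral on the large ball, the second is the oscillation already known.
  This propagates a bound along overlapping balls, at the price of the volume ratio (r/s)^d.\<close>

lemma osc_extend:
  fixes V :: "'a::euclidean_space \<Rightarrow> real" and f :: "'a \<Rightarrow> ennreal"
  assumes V: "has_grad_on V g S" and [measurable]: "f \<in> borel_measurable borel" "V \<in> borel_measurable borel"
    and r: "0 < s" "s \<le> r" and S: "cball p r \<subseteq> S"
    and f: "\<And>y. y \<in> cball p r \<Longrightarrow> ennreal (norm (g y)) \<le> f y"
  shows "osc V a p r \<le> ennreal ((r / s) powr DIM('a)) * (ennreal (2 * r * 2 powr DIM('a)) * ball_mass f p r + osc V a p s)"
proof -
  let ?d = "real DIM('a)" let ?w = "unit_ball_vol ?d"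
  have ms: "emeasure lborel (cball p s) = ennreal (?w * s powr ?d)" using r by (simp add: emeasure_cball_ge ennreal_mult)
  have mr: "emeasure lborel (cball p r) = ennreal (?w * r powr ?d)" using r by (simp add: emeasure_cball_ge ennreal_mult)
  have w: "0 < ?w" by simp
  have "ennreal (?w * s powr ?d) * osc V a p r = (\<integral>\<^sup>+y. \<integral>\<^sup>+w. (ennreal \<bar>V y - a\<bar> * indicator (cball p r) y) * indicator (cball p s) w \<partial>lborel \<partial>lborel)"
    unfolding osc_def ms[symmetric]
    by (simp add: nn_integral_cmult_indicator nn_integral_multc) (simp add: mult.commute)
  also have "\<dots> \<le> (\<integral>\<^sup>+y. \<integral>\<^sup>+w. ennreal \<bar>V y - V w\<bar> * indicator (cball p r) w * indicator (cball p r) y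
      + indicator (cball p r) y * (ennreal \<bar>V w - a\<bar> * indicator (cball p s) w) \<partial>lborel \<partial>lborel)"
  proof (intro nn_integral_mono)
    fix y w
    have "ennreal \<bar>V y - a\<bar> \<le> ennreal (\<bar>V y - V w\<bar> + \<bar>V w - a\<bar>)" by (intro ennreal_leI) auto
    then show "(ennreal \<bar>V y - a\<bar> * indicator (cball p r) y) * indicator (cball p s) w
       \<le> ennreal \<bar>V y - V w\<bar> * indicator (cball p r) w * indicator (cball p r) y
      + indicator (cball p r) y * (ennreal \<bar>V w - a\<bar> * indicator (cball p s) w)"
      using r by (auto simp: indicator_def ennreal_plus)
  qed
  also have "\<dots> = (\<integral>\<^sup>+y. \<integral>\<^sup>+w. ennreal \<bar>V y - V w\<bar> * indicator (cball p r) w * indicator (cball p r) y \<partial>lborel \<partial>lborel)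
      + (\<integral>\<^sup>+y. indicator (cball p r) y * osc V a p s \<partial>lborel)"
    unfolding osc_def by (subst nn_integral_add[symmetric]) (auto simp: nn_integral_add nn_integral_cmult)
  also have "(\<integral>\<^sup>+y. indicator (cball p r) y * osc V a p s \<partial>lborel) = ennreal (?w * r powr ?d) * osc V a p s"
    unfolding mr[symmetric] by (simp add: nn_integral_multc)
  also have "(\<integral>\<^sup>+y. \<integral>\<^sup>+w. ennreal \<bar>V y - V w\<bar> * indicator (cball p r) w * indicator (cball p r) y \<partial>lborel \<partial>lborel) + ennreal (?w * r powr ?d) * osc V a p s
     \<le> ennreal (?w * r powr ?d * (2 * r) * 2 powr ?d) * ball_mass f p r + ennreal (?w * r powr ?d) * osc V a p s"
    using r by (intro add_right_mono poincare_ball[OF V _ _ _ S f]) auto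
  also have "\<dots> = ennreal (?w * s powr ?d) * (ennreal ((r / s) powr ?d) * (ennreal (2 * r * 2 powr ?d) * ball_mass f p r + osc V a p s))"
  proof -
    have w': "?w \<noteq> 0" using w by (metis less_irrefl)
    have e: "(?w * s powr ?d) * (r / s) powr ?d = ?w * r powr ?d" using r by (simp add: powr_divide)
    have "ennreal (?w * s powr ?d) * ennreal ((r / s) powr ?d) = ennreal (?w * r powr ?d)"
      using w by (subst ennreal_mult[symmetric]) (auto simp: e)
    moreover have "ennreal (?w * r powr ?d * (2 * r) * 2 powr ?d) = ennreal (?w * r powr ?d) * ennreal (2 * r * 2 powr ?d)"
      using w r by (subst ennreal_mult[symmetric]) (auto simp: mult.assoc)
    ultimately show ?thesis by (simp only: mult.assoc[symmetric] distrib_left)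
  qed
  finally have "ennreal (1 / (?w * s powr ?d)) * (ennreal (?w * s powr ?d) * osc V a p r)
      \<le> ennreal (1 / (?w * s powr ?d)) * (ennreal (?w * s powr ?d) * (ennreal ((r / s) powr ?d) * (ennreal (2 * r * 2 powr ?d) * ball_mass f p r + osc V a p s)))"
    by (rule mult_left_mono) simp
  moreover have "1 / (?w * s powr ?d) * (?w * s powr ?d) = 1"
    using less_imp_neq[OF w] r by (intro nonzero_eq_divide_eq[THEN iffD1]) auto
  then have "ennreal (1 / (?w * s powr ?d)) * ennreal (?w * s powr ?d) = 1"
    using w r by (metis ennreal_1 ennreal_mult' ennreal_mult'' less_imp_le mult_nonneg_nonneg powr_ge_zero)
  ultimately show ?thesis by (simp only: mult.assoc[symmetric] mult_1_left)
qed

section \<open>Periodic domains with a cone property\<close>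

lemma lattice_uminus: "z \<in> lattice \<Longrightarrow> - z \<in> lattice"
  and lattice_add: "z \<in> lattice \<Longrightarrow> w \<in> lattice \<Longrightarrow> z + w \<in> lattice"
  and lattice_0: "0 \<in> lattice"
  by (auto simp: lattice_def inner_add_left)

lemma lattice_diff: "z \<in> lattice \<Longrightarrow> w \<in> lattice \<Longrightarrow> z - w \<in> lattice"
  using lattice_add[of z "- w"] lattice_uminus[of w] by simp

lemma finite_lattice_ball: "finite {z \<in> lattice. norm (z::'a::euclidean_space) \<le> N}"
proof -
  let ?I = "{k::int. \<bar>real_of_int k\<bar> \<le> N}"
  have "?I \<subseteq> {- \<lceil>N\<rceil>..\<lceil>N\<rceil>}" by (auto simp: abs_le_iff) linarith+
  then have "finite ?I" using finite_subset by blast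
  then have f: "finite (Basis \<rightarrow>\<^sub>E ?I)" for B :: "'a set" by (intro finite_PiE) auto
  have "{z \<in> lattice. norm (z::'a) \<le> N} \<subseteq> (\<lambda>k. \<Sum>b\<in>Basis. of_int (k b) *\<^sub>R b) ` (Basis \<rightarrow>\<^sub>E ?I)"
  proof
    fix z :: 'a assume z: "z \<in> {z \<in> lattice. norm z \<le> N}"
    define k where "k = restrict (\<lambda>b. \<lfloor>z \<bullet> b\<rfloor>) Basis"
    have k: "of_int (k b) = z \<bullet> b" if "b \<in> Basis" for b
      using z that by (auto simp: k_def lattice_def elim!: Ints_cases)
    have "k \<in> Basis \<rightarrow>\<^sub>E ?I"
      using z by (auto simp: k intro: order_trans[OF Basis_le_norm]) (simp add: k_def)
    moreover have "z = (\<Sum>b\<in>Basis. of_int (k b) *\<^sub>R b)"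
      using k by (simp add: euclidean_representation)
    ultimately show "z \<in> (\<lambda>k. \<Sum>b\<in>Basis. of_int (k b) *\<^sub>R b) ` (Basis \<rightarrow>\<^sub>E ?I)" by blast
  qed
  then show ?thesis using f finite_subset by blast
qed

definition lattice_floor :: "'a::euclidean_space \<Rightarrow> 'a" where
  "lattice_floor y = (\<Sum>b\<in>Basis. of_int \<lfloor>y \<bullet> b\<rfloor> *\<^sub>R b)"

lemma lattice_floor_inner: "b \<in> Basis \<Longrightarrow> lattice_floor y \<bullet> b = of_int \<lfloor>y \<bullet> b\<rfloor>"
  by (simp add: lattice_floor_def)

lemma lattice_floor_lattice: "lattice_floor y \<in> lattice"
  by (simp add: lattice_def lattice_floor_inner)

lemma diff_lattice_floor_cbox: "y - lattice_floor y \<in> cbox 0 One"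
  by (auto simp: mem_box inner_diff_left lattice_floor_inner) linarith

lemma norm_diff_lattice_floor: "norm (y - lattice_floor (y::'a::euclidean_space)) \<le> DIM('a)"
proof -
  have "norm (y - lattice_floor y) \<le> (\<Sum>b\<in>Basis. \<bar>(y - lattice_floor y) \<bullet> b\<bar>)" by (rule norm_le_l1)
  also have "\<dots> \<le> (\<Sum>b\<in>(Basis::'a set). 1)"
    using diff_lattice_floor_cbox[of y] by (intro sum_mono) (auto simp: mem_box)
  finally show ?thesis by simp
qed

lemma lattice_floor_measurable [measurable]: "lattice_floor \<in> borel_measurable borel"
  unfolding lattice_floor_def by measurable

lemma riesz_translate:
  assumes "f \<in> borel_measurable borel"
  shows "riesz (\<lambda>y. f (y + z)) x = riesz f (x + z)"
  using riesz_affine[OF assms, of 1 z x] by (simp add: add.commute)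

lemma ball_mass_translate:
  assumes "f \<in> borel_measurable borel"
  shows "ball_mass (\<lambda>y. f (y + z)) x t = ball_mass f (x + z) t"
  using ball_mass_affine[OF assms, of 1 z x t] by (simp add: add.commute)

lemma ennreal_mult_divide_cancel:
  assumes "0 < w"
  shows "ennreal (1 / w) * (a * ennreal w) = a"
proof -
  have "ennreal (1 / w) * ennreal w = 1" using assms by (subst ennreal_mult[symmetric]) auto
  then show ?thesis by (metis mult.commute mult.left_commute mult.right_neutral)
qed

text \<open>One direction n serves a whole neighbourhood of x0, also when x0 lies on T, so that
  estimates are uniform up to the holes. In the interior of T the cone condition is vacuous, and
  away from T the choice n = 0 is permitted.\<close>

locale periodic_cone_domain =
  fixes T :: "'a::euclidean_space set"
  assumes dim: "2 \<le> DIM('a)" and closed: "closed T" and nonempty: "T \<noteq> {}" "- T \<noteq> {}"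
    and connected: "connected (- T)"
    and periodic: "\<And>x z. z \<in> lattice \<Longrightarrow> x \<in> T \<Longrightarrow> x + z \<in> T"
    and cone: "\<And>x0. \<exists>n r c t0. norm n \<le> 1 \<and> 0 < r \<and> 0 < c \<and> 0 < t0 \<and>
       (\<forall>x\<in>ball x0 r - T. \<forall>t\<in>{0..t0}. c * t \<le> infdist (x + t *\<^sub>R n) T)"
begin

abbreviation dT :: "'a \<Rightarrow> real" where "dT x \<equiv> infdist x T"

lemma dT_le: "dT x \<le> dT y + dist x y"
  by (rule infdist_triangle)

lemma dT_pos_iff: "0 < dT x \<longleftrightarrow> x \<notin> T"
  using in_closed_iff_infdist_zero[OF closed nonempty(1), of x] infdist_nonneg[of x T] by linarith

lemma dT_translate:
  assumes "z \<in> lattice"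
  shows "dT (x + z) = dT x"
proof -
  have *: "dT (x + z) \<le> dT x" if z: "z \<in> lattice" for x z
  proof -
    obtain a where "a \<in> T" "dT x = dist x a" using infdist_attains_inf[OF closed nonempty(1)] by blast
    then show ?thesis using infdist_le[of "a + z" T "x + z"] periodic[OF z] by simp
  qed
  show ?thesis using *[OF assms, of x] *[OF lattice_uminus[OF assms], of "x + z"] by simp
qed

text \<open>Cutting off at distance k from T records that an estimate was obtained along paths that
  stay this far from the holes.\<close>

definition fcut :: "('a \<Rightarrow> 'a) \<Rightarrow> real \<Rightarrow> 'a \<Rightarrow> ennreal" where
  "fcut g k y = ennreal (norm (g y)) * indicator {y. k \<le> dT y} y"

text \<open>The margin h admits mollified functions, which are differentiable only at some distance
  from T. Measurability is global because the integrals run over the whole space.\<close>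

definition reg :: "real \<Rightarrow> ('a \<Rightarrow> real) \<Rightarrow> ('a \<Rightarrow> 'a) \<Rightarrow> bool" where
  "reg h V g \<longleftrightarrow> has_grad_on V g {y. h < dT y} \<and> V \<in> borel_measurable borel \<and> g \<in> borel_measurable borel"

lemma dT_measurable [measurable]: "dT \<in> borel_measurable borel"
  by (intro borel_measurable_continuous_onI continuous_intros)

lemma fcut_measurable: "reg h V g \<Longrightarrow> fcut g k \<in> borel_measurable borel"
  unfolding fcut_def reg_def by measurable auto

lemma fcut_mono: "k' \<le> k \<Longrightarrow> fcut g k y \<le> fcut g k' y"
  by (auto simp: fcut_def indicator_def)

lemma fcut_ge: "k \<le> dT y \<Longrightarrow> ennreal (norm (g y)) \<le> fcut g k y"
  by (simp add: fcut_def)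

lemma reg_translate:
  assumes "reg h V g" "z \<in> lattice"
  shows "reg h (\<lambda>y. V (y + z)) (\<lambda>y. g (y + z))"
proof -
  have [measurable]: "V \<in> borel_measurable borel" "g \<in> borel_measurable borel" using assms by (auto simp: reg_def)
  have "((\<lambda>y. V (y + z)) has_derivative (\<lambda>h. g (x + z) \<bullet> h)) (at x)" if "h < dT x" for x
  proof -
    have "(V has_derivative (\<lambda>h. g (x + z) \<bullet> h)) (at (x + z))"
      using assms that by (auto simp: reg_def has_grad_on_def dT_translate)
    moreover have "((\<lambda>y. y + z) has_derivative (\<lambda>h. h)) (at x)" by (auto intro!: derivative_eq_intros)
    ultimately show ?thesis using has_derivative_compose[of "\<lambda>y. y + z" "\<lambda>h. h" x UNIV V] by simp
  qed
  moreover have "continuous_on {y. h < dT y} (\<lambda>y. g (y + z))"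
    by (rule continuous_on_compose2[of "{y. h < dT y}" g])
       (use assms in \<open>auto simp: reg_def has_grad_on_def dT_translate intro!: continuous_intros\<close>)
  ultimately show ?thesis unfolding reg_def has_grad_on_def by auto
qed

lemma fcut_translate: "z \<in> lattice \<Longrightarrow> fcut (\<lambda>y. g (y + z)) k = (\<lambda>y. fcut g k (y + z))"
  by (auto simp: fcut_def dT_translate indicator_def)

text \<open>One number C is at once factor, inverse cut-off level and radius. Enlarging it weakens
  the claim in all three places, so constants from several steps are easy to merge.\<close>

definition chain_bound :: "'a \<Rightarrow> 'a \<Rightarrow> real \<Rightarrow> bool" where
  "chain_bound e p C \<longleftrightarrow> (\<forall>h V g. h < 1 / C \<longrightarrow> reg h V g \<longrightarrow>
     osc V (avg V e (dT e / 2)) p (dT p / 2) \<le> ennreal C * ball_mass (fcut g (1 / C)) e C)"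

lemma chain_boundD:
  "chain_bound e p C \<Longrightarrow> h < 1 / C \<Longrightarrow> reg h V g \<Longrightarrow>
     osc V (avg V e (dT e / 2)) p (dT p / 2) \<le> ennreal C * ball_mass (fcut g (1 / C)) e C"
  unfolding chain_bound_def by blast

text \<open>Connectedness replaces an explicit chain of balls: the property of having some constant
  spreads between any two points of a small ball, so neither the chain nor its length has to be
  named.\<close>

lemma osc_chain:
  assumes e: "e \<notin> T" and p: "p \<notin> T"
  shows "\<exists>C>0. chain_bound e p C"
proof (rule connected_induction_simple[OF connected, of e p "\<lambda>p. \<exists>C>0. chain_bound e p C"])
  let ?d = "real DIM('a)"
  show "e \<in> - T" "p \<in> - T" using e p by auto
  show "\<exists>C>0. chain_bound e e C"
  proof -
    define r where "r = dT e / 2"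
    have r: "0 < r" using dT_pos_iff e by (simp add: r_def)
    define C where "C = max (1 / r) (max r (2 * r * 2 powr ?d))"
    have C: "1 / r \<le> C" "r \<le> C" "2 * r * 2 powr ?d \<le> C" by (simp_all add: C_def)
    have C0: "0 < C" using C(2) r by linarith
    have C1: "1 / C \<le> r" using C(1) C0 r by (simp add: field_simps)
    have far: "r \<le> dT y" if "y \<in> cball e r" for y
      using dT_le[of e y] that by (simp add: r_def)
    have "chain_bound e e C" unfolding chain_bound_def
    proof (intro allI impI)
      fix h V g assume h: "h < 1 / C" and reg: "reg h V g"
      have "osc V (avg V e r) e r \<le> ennreal (2 * r * 2 powr ?d) * ball_mass (fcut g (1 / C)) e r"
      proof (rule osc_avg_le[OF _ fcut_measurable[OF reg]])
        show "has_grad_on V g {y. h < dT y}" "V \<in> borel_measurable borel" using reg by (auto simp: reg_def)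
        show "cball e r \<subseteq> {y. h < dT y}" using far h C1 by fastforce
        show "ennreal (norm (g y)) \<le> fcut g (1 / C) y" if "y \<in> cball e r" for y
          using far[OF that] C1 by (intro fcut_ge) linarith
      qed (rule r)
      also have "\<dots> \<le> ennreal C * ball_mass (fcut g (1 / C)) e C"
        using C by (intro mult_mono ennreal_leI ball_mass_mono) auto
      finally show "osc V (avg V e (dT e / 2)) e (dT e / 2) \<le> ennreal C * ball_mass (fcut g (1 / C)) e C"
        by (simp add: r_def)
    qed
    then show ?thesis using C0 by blast
  qed
  fix a assume "a \<in> - T"
  then have a: "0 < dT a" by (simp add: dT_pos_iff)
  \<comment> \<open>Within this radius the distance to T is nearly constant, so for x and y in U the
    ball of radius \<open>dT a / 4\<close> about y lies in the half-distance ball about x: 1/8 + 1/4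
    < 15/32.\<close>
  define U where "U = ball a (dT a / 16)"
  have U: "\<bar>dT x - dT a\<bar> < dT a / 16" if "x \<in> U" for x
  proof -
    have "dist a x < dT a / 16" using that by (simp add: U_def)
    then show ?thesis using dT_le[of a x] dT_le[of x a] dist_commute[of a x]
      by (intro abs_less_iff[THEN iffD2] conjI) linarith+
  qed
  have sub: "U \<subseteq> - T"
  proof
    fix x assume "x \<in> U"
    then have "0 < dT x" using U[of x] a by linarith
    then show "x \<in> - T" by (simp add: dT_pos_iff)
  qed
  have step: "\<exists>C>0. chain_bound e y C" if x: "x \<in> U" and y: "y \<in> U" and C: "\<exists>C>0. chain_bound e x C" for x y
  proof -
    obtain C1 where C1: "0 < C1" "chain_bound e x C1" using C by blast
    define r where "r = dT y / 2"
    define s where "s = dT a / 4"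
    have "- (dT y - dT a) < dT a / 16" using U[OF y] by linarith
    then have s: "0 < s" "s \<le> r" using a by (simp_all add: r_def s_def)
    have "dist x y \<le> dist a x + dist a y" by (rule dist_triangle3)
    then have xy: "dist x y \<le> dT a / 8" using x y by (auto simp: U_def)
    have sub: "cball y s \<subseteq> cball x (dT x / 2)"
    proof -
      have "- (dT x - dT a) < dT a / 16" using U[OF x] by linarith
      then have "dist y x + s \<le> dT x / 2" using xy a dist_commute[of x y] unfolding s_def by linarith
      then show ?thesis by (intro cball_subset_cball_iff[THEN iffD2] disjI1)
    qed
    define k where "k = (r / s) powr ?d * (2 * r * 2 powr ?d + C1)"
    \<comment> \<open>One summand for each demand: the old constant, the inverse distance of the new
      ball from T, a radius about e that covers this ball, and the new factor.\<close>
    define C where "C = C1 + 1 / r + (dist e y + r) + k"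
    have k: "0 \<le> k" using s C1 by (simp add: k_def)
    have C: "C1 \<le> C" "1 / r \<le> C" "dist e y + r \<le> C" "k \<le> C"
      using s C1 k by (auto simp: C_def)
    have C0: "0 < C" using C(1) C1 by linarith
    have Cr: "1 / C \<le> r" using C(2) C0 s by (simp add: field_simps)
    have CC1: "1 / C \<le> 1 / C1" using C(1) C1 by (simp add: frac_le)
    have far: "r \<le> dT z" if "z \<in> cball y r" for z
      using dT_le[of y z] that by (simp add: r_def)
    have "chain_bound e y C" unfolding chain_bound_def
    proof (intro allI impI)
      fix h V g assume h: "h < 1 / C" and reg: "reg h V g"
      let ?a = "avg V e (dT e / 2)" and ?f = "fcut g (1 / C)"
      have "osc V ?a y r \<le> ennreal ((r / s) powr ?d) * (ennreal (2 * r * 2 powr ?d) * ball_mass ?f y r + osc V ?a y s)"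
      proof (rule osc_extend[OF _ fcut_measurable[OF reg]])
        show "has_grad_on V g {y. h < dT y}" "V \<in> borel_measurable borel" using reg by (auto simp: reg_def)
        show "cball y r \<subseteq> {y. h < dT y}" using far h Cr by fastforce
        show "ennreal (norm (g z)) \<le> fcut g (1 / C) z" if "z \<in> cball y r" for z
          using far[OF that] Cr by (intro fcut_ge) linarith
      qed (use s in auto)
      also have "\<dots> \<le> ennreal ((r / s) powr ?d) * (ennreal (2 * r * 2 powr ?d) * ball_mass ?f e C + ennreal C1 * ball_mass ?f e C)"
      proof (intro mult_left_mono add_mono)
        show "ball_mass ?f y r \<le> ball_mass ?f e C" using C by (intro ball_mass_subset) auto
        have "osc V ?a y s \<le> osc V ?a x (dT x / 2)" by (rule osc_mono[OF sub])
        also have "\<dots> \<le> ennreal C1 * ball_mass (fcut g (1 / C1)) e C1"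
          using h CC1 by (intro chain_boundD[OF C1(2) _ reg]) linarith
        also have "\<dots> \<le> ennreal C1 * ball_mass ?f e C"
          using C CC1 by (intro mult_left_mono ball_mass_mono fcut_mono) auto
        finally show "osc V ?a y s \<le> ennreal C1 * ball_mass ?f e C" .
      qed auto
      also have "\<dots> = ennreal k * ball_mass ?f e C"
        using s C1 unfolding k_def by (simp add: ennreal_mult ennreal_plus distrib_right mult.assoc)
      also have "\<dots> \<le> ennreal C * ball_mass ?f e C" using C by (intro mult_right_mono ennreal_leI) auto
      finally show "osc V ?a y (dT y / 2) \<le> ennreal C * ball_mass ?f e C" by (simp add: r_def)
    qed
    then show ?thesis using C0 by blast
  qed
  have U': "open U" "a \<in> U" using a by (auto simp: U_def)
  show "\<exists>U. openin (top_of_set (- T)) U \<and> a \<in> U \<and> (\<forall>x\<in>U. \<forall>y\<in>U. (\<exists>C>0. chain_bound e x C) \<longrightarrow> (\<exists>C>0. chain_bound e y C))"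
  proof (intro exI[of _ U] conjI ballI impI open_subset[OF sub] U')
    show "\<exists>C>0. chain_bound e y C" if "x \<in> U" "y \<in> U" "\<exists>C>0. chain_bound e x C" for x y
      by (rule step[OF that])
  qed
qed

text \<open>The cut-off level is proportional to the distance of x itself; this is what later makes
  the weight at x comparable with the weight under the potential.\<close>

definition local_bound :: "'a \<Rightarrow> 'a \<Rightarrow> real \<Rightarrow> bool" where
  "local_bound e x C \<longleftrightarrow> (\<forall>h V g. h < dT x / C \<longrightarrow> reg h V g \<longrightarrow>
     ennreal \<bar>V x - avg V e (dT e / 2)\<bar> \<le> ennreal C * riesz (fcut g (dT x / C)) x)"

lemma local_boundD:
  "local_bound e x C \<Longrightarrow> h < dT x / C \<Longrightarrow> reg h V g \<Longrightarrow>
     ennreal \<bar>V x - avg V e (dT e / 2)\<bar> \<le> ennreal C * riesz (fcut g (dT x / C)) x"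
  unfolding local_bound_def by blast

lemma local_bound_mono:
  assumes "local_bound e x C" "0 < C" "C \<le> C'"
  shows "local_bound e x C'"
  unfolding local_bound_def
proof (intro allI impI)
  fix h V g assume h: "h < dT x / C'" and reg: "reg h V g"
  have le: "dT x / C' \<le> dT x / C" using assms by (intro divide_left_mono) (auto simp: infdist_nonneg)
  have "ennreal \<bar>V x - avg V e (dT e / 2)\<bar> \<le> ennreal C * riesz (fcut g (dT x / C)) x"
    using h le by (intro local_boundD[OF assms(1) _ reg]) linarith
  also have "\<dots> \<le> ennreal C' * riesz (fcut g (dT x / C')) x"
    using assms le by (intro mult_mono ennreal_leI riesz_mono fcut_mono) auto
  finally show "ennreal \<bar>V x - avg V e (dT e / 2)\<bar> \<le> ennreal C' * riesz (fcut g (dT x / C')) x" .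
qed

text \<open>From every x near x0 the cone ends in a small ball about
  \<open>x + t0 *\<^sub>R n\<close>, and for all these x that ball lies in the half-distance ball of
  one fixed point p. \<open>cone_estimate\<close> controls V along the cone, and
  \<open>osc_chain\<close> controls V near p.\<close>

lemma local_estimate:
  assumes e: "e \<notin> T"
  shows "\<exists>r>0. \<exists>C>0. \<forall>x\<in>ball x0 r - T. local_bound e x C"
proof -
  let ?d = "real DIM('a)" let ?w = "unit_ball_vol ?d"
  obtain n r c t0 where n: "norm n \<le> 1" and r: "0 < r" and c: "0 < c" and t0: "0 < t0"
    and cone0: "\<And>x t. x \<in> ball x0 r \<Longrightarrow> x \<notin> T \<Longrightarrow> 0 \<le> t \<Longrightarrow> t \<le> t0 \<Longrightarrow> c * t \<le> dT (x + t *\<^sub>R n)"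
    using cone[of x0] by (auto simp: Ball_def)
  define c1 where "c1 = min c 1"
  have c1: "0 < c1" "c1 \<le> 1" "c1 \<le> c" using c by (auto simp: c1_def)
  have cone1: "c1 * t \<le> dT (x + t *\<^sub>R n)" if "x \<in> ball x0 r" "x \<notin> T" "0 \<le> t" "t \<le> t0" for x t
    using cone0[OF that] mult_right_mono[OF c1(3) that(3)] by linarith
  \<comment> \<open>Small against the distance \<open>c1 * t0\<close> from T that the cones reach,
    so that all of them end in the half-distance ball of p.\<close>
  define r' where "r' = min r (c1 * t0 / 16)"
  have r': "0 < r'" "r' \<le> r" "r' \<le> c1 * t0 / 16" using r c1 t0 by (auto simp: r'_def)
  show ?thesis
  proof (cases "ball x0 r' \<subseteq> T")
    case True
    then show ?thesis using r' by (intro exI[of _ r'] conjI exI[of _ 1]) auto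
  next
    case False
    then obtain x1 where x1: "x1 \<in> ball x0 r'" "x1 \<notin> T" by blast
    define p where "p = x1 + t0 *\<^sub>R n"
    have dp: "c1 * t0 \<le> dT p" using cone1[of x1 t0] x1 r' t0 by (auto simp: p_def)
    then have "p \<notin> T" using c1 t0 by (metis dT_pos_iff mult_pos_pos order_less_le_trans)
    then obtain C1 where C1: "0 < C1" "chain_bound e p C1" using osc_chain[OF e] by blast
    \<comment> \<open>Opening the cone by a quarter of the growth rate leaves three quarters of the
      linear growth of the distance on the whole cone.\<close>
    define c2 where "c2 = c1 / 4"
    have c2: "0 < c2" "c2 \<le> 1" using c1 by (auto simp: c2_def)
    \<comment> \<open>Chosen so that \<open>cball e C1\<close> lies in \<open>cball x R\<close>; the
      mass near e is then bounded by the potential at x.\<close>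
    define R where "R = C1 + dist e x0 + r'"
    have R: "0 < R" using C1 r' zero_le_dist[of e x0] unfolding R_def by linarith
    define K1 where "K1 = c2 powr - ?d * 2 powr ?d"
    define K2 where "K2 = (?d - 1) * R powr (?d - 1)"
    define K3 where "K3 = (t0 * c2) powr - ?d * (C1 * K2)"
    have K: "0 \<le> K1" "0 \<le> K2" "0 \<le> K3" using dim C1 by (auto simp: K1_def K2_def K3_def)
    \<comment> \<open>The first summand keeps the cut-off level below the distance to T along the
      cone, the second keeps it below 1/C1, and the third is the factor of the estimate after
      division by the volume of the unit ball.\<close>
    define C where "C = 8 / c1 + C1 * (dT x0 + r') + (K1 + K3) / ?w"
    have w: "0 < ?w" by simp
    have nn: "0 \<le> C1 * (dT x0 + r')" "0 \<le> (K1 + K3) / ?w" "0 < 8 / c1"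
      using C1 r' K c1 w by (auto simp: infdist_nonneg)
    have C: "8 / c1 \<le> C" "C1 * (dT x0 + r') \<le> C" "(K1 + K3) / ?w \<le> C"
      using nn unfolding C_def by linarith+
    have C0: "0 < C" using C(1) nn by linarith
    have "local_bound e x C" if "x \<in> ball x0 r' - T" for x
      unfolding local_bound_def
    proof (intro allI impI)
      fix h V g assume h: "h < dT x / C" and reg: "reg h V g"
      note [measurable] = fcut_measurable[OF reg]
      have V: "has_grad_on V g {y. h < dT y}" and [measurable]: "V \<in> borel_measurable borel" using reg by (auto simp: reg_def)
      let ?a = "avg V e (dT e / 2)" and ?f = "fcut g (dT x / C)"
      have x: "x \<in> ball x0 r" "x \<notin> T" "dist x x0 < r'" using that r' by (auto simp: dist_commute)
      have dx: "0 < dT x" using x dT_pos_iff by blast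
      have far: "dT x / C \<le> dT (x + t *\<^sub>R (n + c2 *\<^sub>R s))" if t: "0 \<le> t" "t \<le> t0" and s: "norm s \<le> 1" for t s
      proof -
        let ?y = "x + t *\<^sub>R (n + c2 *\<^sub>R s)"
        have "norm (n + c2 *\<^sub>R s) \<le> 1 + 1" using n c2 s by (intro norm_triangle_mono) (auto intro: mult_le_one)
        then have "dist x ?y \<le> 2 * t" using t mult_left_mono[of "norm (n + c2 *\<^sub>R s)" 2 t] by (simp add: dist_norm)
        then have 1: "dT x - 2 * t \<le> dT ?y" using dT_le[of x ?y] by linarith
        have "dist (x + t *\<^sub>R n) ?y = t * c2 * norm s" using t c2 by (simp add: dist_norm algebra_simps)
        also have "\<dots> \<le> t * c2 * 1" using t c2 s by (intro mult_left_mono) auto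
        finally have 2: "c1 * t - t * c2 \<le> dT ?y" using dT_le[of "x + t *\<^sub>R n" ?y] cone1[OF x(1,2) t] by linarith
        have 3: "dT x / C \<le> c1 * dT x / 8"
          using C(1) C0 c1 dx by (simp add: field_simps)
        \<comment> \<open>Near the vertex the distance has lost at most half of its value; beyond t
          = \<open>dT x / 4\<close> the linear growth along the cone takes over.\<close>
        have "c1 * dT x / 8 \<le> dT ?y"
        proof (cases "t \<le> dT x / 4")
          case True
          have "c1 * dT x \<le> 1 * dT x" using c1 dx by (intro mult_right_mono) auto
          then show ?thesis using 1 True dx by linarith
        next
          case False
          have "c1 * (dT x / 4) \<le> c1 * t" using False c1 by (intro mult_left_mono) auto
          moreover have "t * c2 = c1 * t / 4" by (simp add: c2_def)
          moreover have "0 \<le> c1 * t" using c1 t by simp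
          ultimately show ?thesis using 2 by linarith
        qed
        then show ?thesis using 3 by linarith
      qed
      have I1: "(\<integral>\<^sup>+s\<in>cball 0 1. ennreal \<bar>V (x + t0 *\<^sub>R (n + c2 *\<^sub>R s)) - V x\<bar> \<partial>lborel) \<le> ennreal K1 * riesz ?f x"
        unfolding K1_def
      proof (rule cone_estimate[OF V])
        show "x + t *\<^sub>R (n + c2 *\<^sub>R s) \<in> {y. h < dT y}" if "0 \<le> t" "t \<le> t0" "norm s \<le> 1" for t s
          using far[OF that] h by simp
        show "ennreal (norm (g (x + t *\<^sub>R (n + c2 *\<^sub>R s)))) \<le> ?f (x + t *\<^sub>R (n + c2 *\<^sub>R s))" if "0 \<le> t" "t \<le> t0" "norm s \<le> 1" for t s
          using far[OF that] by (rule fcut_ge)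
      qed (use n c2 t0 in auto)
      have I2: "(\<integral>\<^sup>+s\<in>cball 0 1. ennreal \<bar>V (x + t0 *\<^sub>R (n + c2 *\<^sub>R s)) - ?a\<bar> \<partial>lborel) \<le> ennreal K3 * riesz ?f x"
      proof -
        have "(\<integral>\<^sup>+s\<in>cball 0 1. ennreal \<bar>V (x + t0 *\<^sub>R (n + c2 *\<^sub>R s)) - ?a\<bar> \<partial>lborel)
           = ball_mass (\<lambda>s. ennreal \<bar>V ((x + t0 *\<^sub>R n) + (t0 * c2) *\<^sub>R s) - ?a\<bar>) 0 1"
          unfolding ball_mass_def by (simp add: algebra_simps)
        also have "\<dots> = ennreal ((t0 * c2) powr - ?d) * osc V ?a (x + t0 *\<^sub>R n) (t0 * c2)"
          using t0 c2 by (subst ball_mass_affine[where f="\<lambda>y. ennreal \<bar>V y - ?a\<bar>"]) (auto simp: osc_def ball_mass_def)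
        also have "\<dots> \<le> ennreal ((t0 * c2) powr - ?d) * (ennreal C1 * (ennreal K2 * riesz ?f x))"
        proof (intro mult_left_mono)
          have "dist x x1 \<le> dist x x0 + dist x0 x1" by (rule dist_triangle)
          then have "dist x x1 \<le> c1 * t0 / 8" using x(3) x1(1) r'(3) by auto
          moreover have "dist (x + t0 *\<^sub>R n) p = dist x x1" by (simp add: p_def dist_norm)
          moreover have "t0 * c2 = c1 * t0 / 4" by (simp add: c2_def)
          moreover have "0 \<le> c1 * t0" using c1 t0 by simp
          ultimately have "dist (x + t0 *\<^sub>R n) p + t0 * c2 \<le> dT p / 2" using dp by linarith
          then have "osc V ?a (x + t0 *\<^sub>R n) (t0 * c2) \<le> osc V ?a p (dT p / 2)"
            by (intro osc_mono cball_subset_cball_iff[THEN iffD2] disjI1)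
          also have "\<dots> \<le> ennreal C1 * ball_mass (fcut g (1 / C1)) e C1"
          proof -
            have "dT x \<le> dT x0 + r'" using dT_le[of x x0] x by linarith
            then have "C1 * dT x \<le> C" using C(2) C1 mult_left_mono[of "dT x" "dT x0 + r'" C1] by linarith
            then have le: "dT x / C \<le> 1 / C1" using C0 C1 by (simp add: field_simps)
            then have "osc V ?a p (dT p / 2) \<le> ennreal C1 * ball_mass (fcut g (1 / C1)) e C1"
              using h by (intro chain_boundD[OF C1(2) _ reg]) linarith
            then show ?thesis .
          qed
          also have "\<dots> \<le> ennreal C1 * ball_mass ?f x R"
          proof (intro mult_left_mono)
            have "dT x \<le> dT x0 + r'" using dT_le[of x x0] x by linarith
            then have "C1 * dT x \<le> C" using C(2) C1 mult_left_mono[of "dT x" "dT x0 + r'" C1] by linarith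
            then have le: "dT x / C \<le> 1 / C1" using C0 C1 by (simp add: field_simps)
            have "ball_mass (fcut g (1 / C1)) e C1 \<le> ball_mass ?f e C1" using le by (intro ball_mass_mono fcut_mono) auto
            also have "\<dots> \<le> ball_mass ?f x R"
              using dist_triangle[of x e x0] x by (intro ball_mass_subset) (auto simp: R_def dist_commute)
            finally show "ball_mass (fcut g (1 / C1)) e C1 \<le> ball_mass ?f x R" .
          qed auto
          also have "\<dots> \<le> ennreal C1 * (ennreal K2 * riesz ?f x)"
            unfolding K2_def by (intro mult_left_mono riesz_ge_ball_mass dim R) auto
          finally show "osc V ?a (x + t0 *\<^sub>R n) (t0 * c2) \<le> ennreal C1 * (ennreal K2 * riesz ?f x)" .
        qed auto
        also have "\<dots> = ennreal K3 * riesz ?f x"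
          using C1 K by (simp add: K3_def ennreal_mult mult.assoc)
        finally show ?thesis .
      qed
      have "ennreal \<bar>V x - ?a\<bar> * ennreal ?w = (\<integral>\<^sup>+s\<in>cball (0::'a) 1. ennreal \<bar>V x - ?a\<bar> \<partial>lborel)"
        by (simp add: nn_integral_cmult_indicator emeasure_cball)
      also have "\<dots> \<le> (\<integral>\<^sup>+s. ennreal \<bar>V (x + t0 *\<^sub>R (n + c2 *\<^sub>R s)) - V x\<bar> * indicator (cball 0 1) s
         + ennreal \<bar>V (x + t0 *\<^sub>R (n + c2 *\<^sub>R s)) - ?a\<bar> * indicator (cball 0 1) s \<partial>lborel)"
      proof (intro nn_integral_mono)
        fix s
        let ?v = "V (x + t0 *\<^sub>R (n + c2 *\<^sub>R s))"
        have "ennreal \<bar>V x - ?a\<bar> \<le> ennreal (\<bar>?v - V x\<bar> + \<bar>?v - ?a\<bar>)" by (intro ennreal_leI) auto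
        then show "ennreal \<bar>V x - ?a\<bar> * indicator (cball 0 1) s
          \<le> ennreal \<bar>?v - V x\<bar> * indicator (cball 0 1) s + ennreal \<bar>?v - ?a\<bar> * indicator (cball 0 1) s"
          by (auto simp: indicator_def ennreal_plus)
      qed
      also have "\<dots> = (\<integral>\<^sup>+s\<in>cball 0 1. ennreal \<bar>V (x + t0 *\<^sub>R (n + c2 *\<^sub>R s)) - V x\<bar> \<partial>lborel)
         + (\<integral>\<^sup>+s\<in>cball 0 1. ennreal \<bar>V (x + t0 *\<^sub>R (n + c2 *\<^sub>R s)) - ?a\<bar> \<partial>lborel)"
        by (intro nn_integral_add) measurable
      also have "\<dots> \<le> ennreal K1 * riesz ?f x + ennreal K3 * riesz ?f x" by (intro add_mono I1 I2)
      also have "\<dots> = ennreal (K1 + K3) * riesz ?f x" using K by (simp add: ennreal_plus distrib_right)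
      finally have "ennreal (1 / ?w) * (ennreal \<bar>V x - ?a\<bar> * ennreal ?w) \<le> ennreal (1 / ?w) * (ennreal (K1 + K3) * riesz ?f x)"
        by (rule mult_left_mono) auto
      also have "\<dots> = ennreal ((K1 + K3) / ?w) * riesz ?f x"
        using K w by (simp add: mult.assoc[symmetric] ennreal_mult[symmetric] del: ennreal_plus)
      also have "\<dots> \<le> ennreal C * riesz ?f x" using C by (intro mult_right_mono ennreal_leI) auto
      also have "ennreal (1 / ?w) * (ennreal \<bar>V x - ?a\<bar> * ennreal ?w) = ennreal \<bar>V x - ?a\<bar>"
        by (rule ennreal_mult_divide_cancel[OF w])
      finally show "ennreal \<bar>V x - ?a\<bar> \<le> ennreal C * riesz ?f x" .
    qed
    then show ?thesis using r' C0 by blast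
  qed
qed

lemma local_estimate_uniform:
  assumes e: "e \<notin> T" and K: "compact K"
  shows "\<exists>C>0. \<forall>x\<in>K - T. local_bound e x C"
proof -
  obtain r C where rC: "\<And>x0. 0 < r x0" "\<And>x0. 0 < C x0" "\<And>x0 x. x \<in> ball x0 (r x0) - T \<Longrightarrow> local_bound e x (C x0)"
    using local_estimate[OF e] by metis
  have "K \<subseteq> (\<Union>x0\<in>K. ball x0 (r x0))" using rC(1) by force
  then obtain D where D: "D \<subseteq> K" "finite D" "K \<subseteq> (\<Union>x0\<in>D. ball x0 (r x0))"
    using compactE_image[OF K, of K "\<lambda>x0. ball x0 (r x0)"] by auto
  \<comment> \<open>A sum serves as an upper bound for the finitely many constants; the added 1
    keeps it positive when the cover is empty.\<close>
  define M where "M = (\<Sum>x0\<in>D. C x0) + 1"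
  have "0 < M" using rC(2) unfolding M_def by (intro add_nonneg_pos sum_nonneg) (auto intro: less_imp_le)
  moreover have "local_bound e x M" if x: "x \<in> K - T" for x
  proof -
    obtain x0 where x0: "x0 \<in> D" "x \<in> ball x0 (r x0)" using D x by blast
    have "C x0 \<le> (\<Sum>x0\<in>D. C x0)" using D x0 rC(2) by (intro member_le_sum) (auto intro: less_imp_le)
    then have "C x0 \<le> M" by (simp add: M_def)
    then show ?thesis using rC(2,3) x0 x local_bound_mono by blast
  qed
  ultimately show ?thesis by blast
qed

text \<open>Periodicity carries the constant from the compact unit cell to every x; the reference
  ball moves along with the cell of x.\<close>

lemma local_estimate_cell:
  assumes e: "e \<notin> T"
  shows "\<exists>C>0. \<forall>x h V g. x \<notin> T \<longrightarrow> h < dT x / C \<longrightarrow> reg h V g \<longrightarrow>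
     ennreal \<bar>V x - avg V (e + lattice_floor x) (dT e / 2)\<bar> \<le> ennreal C * riesz (fcut g (dT x / C)) x"
proof -
  obtain C where C: "0 < C" "\<And>x. x \<in> cbox 0 One - T \<Longrightarrow> local_bound e x C"
    using local_estimate_uniform[OF e compact_cbox] by blast
  have r: "0 < dT e / 2" using e dT_pos_iff by simp
  show ?thesis
  proof (intro exI[of _ C] conjI C(1) allI impI)
    fix x h V g assume x: "x \<notin> T" and h: "h < dT x / C" and reg: "reg h V g"
    let ?z = "lattice_floor x"
    have z: "?z \<in> lattice" by (rule lattice_floor_lattice)
    have d: "dT (x - ?z) = dT x" using dT_translate[OF z, of "x - ?z"] by simp
    then have "x - ?z \<in> cbox 0 One - T" using x diff_lattice_floor_cbox[of x] by (metis DiffI dT_pos_iff)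
    then have "ennreal \<bar>V (x - ?z + ?z) - avg (\<lambda>y. V (y + ?z)) e (dT e / 2)\<bar> \<le> ennreal C * riesz (fcut (\<lambda>y. g (y + ?z)) (dT (x - ?z) / C)) (x - ?z)"
      using local_boundD[OF C(2) _ reg_translate[OF reg z], of "x - ?z"] h d by simp
    moreover have "avg (\<lambda>y. V (y + ?z)) e (dT e / 2) = avg V (e + ?z) (dT e / 2)"
      using reg r by (intro avg_translate) (auto simp: reg_def)
    moreover have "riesz (fcut (\<lambda>y. g (y + ?z)) (dT x / C)) (x - ?z) = riesz (fcut g (dT x / C)) x"
      using riesz_translate[OF fcut_measurable[OF reg], of "dT x / C" ?z "x - ?z"] by (simp add: fcut_translate[OF z])
    ultimately show "ennreal \<bar>V x - avg V (e + ?z) (dT e / 2)\<bar> \<le> ennreal C * riesz (fcut g (dT x / C)) x"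
      by (simp add: d)
  qed
qed

end

section \<open>The pointwise bound for smooth functions\<close>

lemma unit_ball_vol_neq_0 [simp]: "unit_ball_vol (real n) \<noteq> 0"
  using unit_ball_vol_pos[of "real n"] by linarith

section \<open>The mollifier and its mass\<close>

lemma bump_measurable [measurable]: "bump r \<in> borel_measurable (borel :: 'a::euclidean_space measure)"
proof -
  have "continuous_on UNIV (bump r :: 'a \<Rightarrow> real)"
    using smooth_gen_Ck[OF smooth_gen_bump, of 0 r "0::'a"] by simp
  then show ?thesis by (rule borel_measurable_continuous_onI)
qed

lemma bump_integrable:
  assumes r: "0 < r"
  shows "integrable lborel (bump r :: 'a::euclidean_space \<Rightarrow> real)"
proof (rule Bochner_Integration.integrable_bound)
  show "integrable lborel (indicator (cball 0 r) :: 'a \<Rightarrow> real)"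
    using emeasure_cball_finite[of "0::'a" r] by (auto simp: integrable_indicator_iff)
  show "AE (y::'a) in lborel. norm (bump r y) \<le> norm (indicator (cball 0 r) y :: real)"
  proof (intro AE_I2)
    fix y :: 'a
    have "\<bar>bump r y\<bar> \<le> 1" using bump_nonneg[of r y] bump_le_1[of r y] by simp
    moreover have "bump r y = 0" if "\<not> norm y \<le> r" using bump_eq_0[OF r, of y] that by simp
    ultimately show "norm (bump r y) \<le> norm (indicator (cball 0 r) y :: real)"
      by (auto simp: indicator_def)
  qed
qed measurable

definition bump_mass :: "'a::euclidean_space itself \<Rightarrow> real \<Rightarrow> real" where
  "bump_mass _ r = (LINT y|lborel. bump r (y::'a))"

lemma nn_integral_bump:
  fixes x :: "'a::euclidean_space"
  assumes "0 < r"
  shows "(\<integral>\<^sup>+y. ennreal (bump r (y - x)) \<partial>lborel) = ennreal (bump_mass TYPE('a) r)"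
proof -
  have "(\<integral>\<^sup>+y. ennreal (bump r (y - x)) \<partial>lborel) = (\<integral>\<^sup>+y. ennreal (bump r (- x + 1 *\<^sub>R y)) \<partial>lborel)" by simp
  also have "\<dots> = (\<integral>\<^sup>+y. ennreal (bump r (y::'a)) \<partial>lborel)"
    by (subst nn_integral_lborel_shift[where f="\<lambda>y. ennreal (bump r y)"]) auto
  also have "\<dots> = ennreal (bump_mass TYPE('a) r)"
    unfolding bump_mass_def using bump_integrable[OF assms] bump_nonneg
    by (intro nn_integral_eq_integral) auto
  finally show ?thesis .
qed

lemma bump_mass_scale:
  assumes r: "0 < r"
  shows "bump_mass TYPE('a::euclidean_space) r = r powr DIM('a) * bump_mass TYPE('a) 1"
proof -
  have "ennreal (bump_mass TYPE('a) 1) = (\<integral>\<^sup>+y. ennreal (bump r (0 + r *\<^sub>R (y::'a))) \<partial>lborel)"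
    using nn_integral_bump[of 1 "0::'a"] r by (simp add: bump_scale)
  also have "\<dots> = ennreal (r powr - DIM('a)) * ennreal (bump_mass TYPE('a) r)"
    using r nn_integral_bump[OF r, of "0::'a"]
    by (subst nn_integral_lborel_shift[where f="\<lambda>y. ennreal (bump r y)"]) auto
  finally have "ennreal (bump_mass TYPE('a) 1) = ennreal (r powr - DIM('a) * bump_mass TYPE('a) r)"
    by (simp add: ennreal_mult')
  moreover have nn: "0 \<le> bump_mass TYPE('a) s" for s
    unfolding bump_mass_def by (intro integral_nonneg_AE) (simp add: bump_nonneg)
  ultimately have "bump_mass TYPE('a) 1 = r powr - DIM('a) * bump_mass TYPE('a) r"
    by (subst (asm) ennreal_inj) auto
  then show ?thesis using r by (simp add: powr_minus field_simps)
qed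

lemma bump_mass_pos:
  assumes r: "0 < r"
  shows "0 < bump_mass TYPE('a::euclidean_space) r"
proof (rule ccontr)
  assume "\<not> 0 < bump_mass TYPE('a) r"
  then have "(\<integral>\<^sup>+y. ennreal (bump r (y::'a)) \<partial>lborel) = 0"
    using nn_integral_bump[OF r, of "0::'a"] by (simp add: ennreal_neg)
  then have "AE y in lborel. bump r (y::'a) = 0"
    by (subst (asm) nn_integral_0_iff_AE) (auto simp: bump_nonneg ennreal_eq_0_iff antisym)
  then have "AE y in lborel. (y::'a) \<notin> ball 0 r"
    by (rule eventually_mono) (use bump_pos_iff[OF r] in force)
  then have "emeasure lborel (ball (0::'a) r) = 0"
    by (subst (asm) AE_iff_measurable[OF _ refl]) (auto simp: ball_def)
  then show False using r by (simp add: emeasure_ball)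
qed

lemma bump_gradient:
  assumes r: "0 < r"
  obtains \<gamma> :: "'a::euclidean_space \<Rightarrow> 'a" and L M where
    "\<And>y. (bump r has_derivative (\<lambda>h. \<gamma> y \<bullet> h)) (at y)" "\<And>y z. norm (\<gamma> y - \<gamma> z) \<le> L * norm (y - z)"
    "\<And>y. norm (\<gamma> y) \<le> M" "\<And>y. r < norm y \<Longrightarrow> \<gamma> y = 0"
proof -
  have "smooth_gen (1 / r\<^sup>2) (0::'a) (bump r)" using smooth_gen_bump[of r "0::'a"] by simp
  moreover have "bump r y = 0" if "y \<notin> cball 0 r" for y :: 'a using bump_eq_0[OF r, of y] that by simp
  ultimately have "\<exists>\<gamma> L M. (\<forall>y::'a. (bump r has_derivative (\<lambda>h. \<gamma> y \<bullet> h)) (at y)) \<and> (\<forall>y z. norm (\<gamma> y - \<gamma> z) \<le> L * norm (y - z))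
     \<and> (\<forall>y. norm (\<gamma> y) \<le> M) \<and> (\<forall>y. y \<notin> cball 0 r \<longrightarrow> \<gamma> y = 0)"
    by (rule smooth_gen_gradient)
  then show thesis using that by (auto simp: not_le)
qed

text \<open>For compactly supported functions the cone in the cone estimate may be a full ball of
  arbitrarily large radius.\<close>
lemma riesz_bound_compact_support:
  fixes w :: "'a::euclidean_space \<Rightarrow> real" and f :: "'a \<Rightarrow> ennreal"
  assumes w: "has_grad_on w g UNIV" and [measurable]: "f \<in> borel_measurable borel" "w \<in> borel_measurable borel"
    and f: "\<And>y. ennreal (norm (g y)) \<le> f y"
    and supp: "\<And>y. R < norm y \<Longrightarrow> w y = 0"
  shows "ennreal \<bar>w x\<bar> \<le> ennreal (2 * 2 powr DIM('a) / unit_ball_vol DIM('a)) * riesz f x"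
proof -
  let ?d = "real DIM('a)" let ?w = "unit_ball_vol ?d"
  \<comment> \<open>In the variable s the support of \<open>w (x + t *\<^sub>R s)\<close> lies in a
    ball of radius 1/2, whose volume is at most half that of the unit ball because 2^(-d) \<le> 1/2.
    Outside that ball the difference from w(x) is |w(x)| itself.\<close>
  define t where "t = 2 * max R 1"
  have t: "2 \<le> t" "R \<le> t / 2" by (auto simp: t_def)
  have I: "(\<integral>\<^sup>+s\<in>cball 0 1. ennreal \<bar>w (x + t *\<^sub>R (0 + 1 *\<^sub>R s)) - w x\<bar> \<partial>lborel) \<le> ennreal (1 powr - ?d * 2 powr ?d) * riesz f x"
    by (rule cone_estimate[OF w]) (use t f in auto)
  let ?c = "- (1 / t) *\<^sub>R x"
  have "ennreal \<bar>w x\<bar> * ennreal ?w = (\<integral>\<^sup>+s\<in>cball (0::'a) 1. ennreal \<bar>w x\<bar> \<partial>lborel)"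
    by (simp add: nn_integral_cmult_indicator emeasure_cball)
  also have "\<dots> \<le> (\<integral>\<^sup>+s. ennreal \<bar>w (x + t *\<^sub>R (0 + 1 *\<^sub>R s)) - w x\<bar> * indicator (cball 0 1) s + ennreal \<bar>w x\<bar> * indicator (cball ?c (1 / 2)) s \<partial>lborel)"
  proof (intro nn_integral_mono)
    fix s :: 'a
    show "ennreal \<bar>w x\<bar> * indicator (cball 0 1) s \<le> ennreal \<bar>w (x + t *\<^sub>R (0 + 1 *\<^sub>R s)) - w x\<bar> * indicator (cball 0 1) s + ennreal \<bar>w x\<bar> * indicator (cball ?c (1 / 2)) s"
    proof (cases "s \<in> cball ?c (1 / 2)")
      case False
      have "t *\<^sub>R (s - ?c) = x + t *\<^sub>R s" using t by (simp add: algebra_simps)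
      then have "norm (x + t *\<^sub>R s) = t * dist ?c s" using t by (metis abs_of_nonneg dist_commute dist_norm norm_scaleR order_trans zero_le_numeral)
      moreover have "t * (1 / 2) < t * dist ?c s" using False t by (intro mult_strict_left_mono) auto
      ultimately have "w (x + t *\<^sub>R s) = 0" using t by (intro supp) linarith
      then show ?thesis by simp
    qed (auto simp: indicator_def add_increasing)
  qed
  also have "\<dots> = (\<integral>\<^sup>+s\<in>cball 0 1. ennreal \<bar>w (x + t *\<^sub>R (0 + 1 *\<^sub>R s)) - w x\<bar> \<partial>lborel) + ennreal \<bar>w x\<bar> * emeasure lborel (cball ?c (1 / 2))"
    by (subst nn_integral_add) (auto simp: nn_integral_cmult_indicator)
  also have "\<dots> \<le> ennreal (2 powr ?d) * riesz f x + ennreal \<bar>w x\<bar> * ennreal (?w / 2)"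
  proof (intro add_mono mult_left_mono)
    have "(1 / 2 :: real) ^ DIM('a) \<le> (1 / 2) ^ 1" by (intro power_decreasing) (auto simp: Suc_leI)
    then show "emeasure lborel (cball ?c (1 / 2)) \<le> ennreal (?w / 2)"
      using mult_left_mono[of "(1 / 2 :: real) ^ DIM('a)" "1 / 2" ?w]
      by (subst emeasure_cball) (auto intro!: ennreal_leI)
  qed (use I in auto)
  finally have "ennreal \<bar>w x\<bar> * ennreal ?w \<le> ennreal (2 powr ?d) * riesz f x + ennreal \<bar>w x\<bar> * ennreal (?w / 2)" .
  then have "ennreal (\<bar>w x\<bar> * ?w) \<le> ennreal (2 powr ?d) * riesz f x + ennreal (\<bar>w x\<bar> * (?w / 2))"
    by (subst (1 2) ennreal_mult) auto
  \<comment> \<open>The left side is split so that the finite half can be cancelled.\<close>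
  moreover have "ennreal (\<bar>w x\<bar> * ?w) = ennreal (\<bar>w x\<bar> * (?w / 2)) + ennreal (\<bar>w x\<bar> * (?w / 2))"
    by (subst ennreal_plus[symmetric]) (auto simp: field_simps)
  ultimately have "ennreal (\<bar>w x\<bar> * (?w / 2)) \<le> ennreal (2 powr ?d) * riesz f x"
    by (simp add: add.commute)
  then have "ennreal (2 / ?w) * ennreal (\<bar>w x\<bar> * (?w / 2)) \<le> ennreal (2 / ?w) * (ennreal (2 powr ?d) * riesz f x)"
    by (intro mult_left_mono) auto
  moreover have "ennreal (2 / ?w) * ennreal (\<bar>w x\<bar> * (?w / 2)) = ennreal \<bar>w x\<bar>"
    by (subst ennreal_mult[symmetric]) auto
  moreover have "ennreal (2 / ?w) * ennreal (2 powr ?d) = ennreal (2 * 2 powr ?d / ?w)"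
    by (subst ennreal_mult[symmetric]) auto
  ultimately show ?thesis by (simp only: mult.assoc[symmetric])
qed

section \<open>Cell averages on the lattice\<close>

context periodic_cone_domain
begin

text \<open>\<open>osc_chain\<close> with target \<open>e + z\<close>: by periodicity this point has
  the same distance to T as e, so the two averages are over congruent balls.\<close>

lemma avg_shift_bound:
  assumes e: "e \<notin> T" and z: "z \<in> lattice"
  shows "\<exists>C>0. \<forall>h V g. h < 1 / C \<longrightarrow> reg h V g \<longrightarrow>
     ennreal \<bar>avg V (e + z) (dT e / 2) - avg V e (dT e / 2)\<bar> \<le> ennreal C * ball_mass (fcut g (1 / C)) e C"
proof -
  have d: "dT (e + z) = dT e" using z by (rule dT_translate)
  have e0: "0 < dT e" using e dT_pos_iff by simp
  then have "e + z \<notin> T" using d dT_pos_iff by metis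
  then obtain C1 where C1: "0 < C1" "chain_bound e (e + z) C1" using osc_chain[OF e] by blast
  let ?r = "dT e / 2" let ?m = "measure lborel (cball (e + z) ?r)"
  have m: "0 < ?m" using e0 by (intro measure_cball_pos) simp
  define C where "C = C1 + 1 / ?r + 1 / ?m * C1"
  have nn: "0 < 1 / ?r" "0 < 1 / ?m * C1" using e0 m C1 by auto
  have C: "C1 \<le> C" "1 / ?r \<le> C" "1 / ?m * C1 \<le> C" using nn C1 unfolding C_def by linarith+
  have C0: "0 < C" using C C1 by linarith
  have Cr: "1 / C \<le> ?r" using C(2) C0 e0 by (simp add: field_simps)
  have CC1: "1 / C \<le> 1 / C1" using C(1) C1 by (simp add: frac_le)
  show ?thesis
  proof (intro exI[of _ C] conjI C0 allI impI)
    fix h V g assume h: "h < 1 / C" and reg: "reg h V g"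
    have "cball (e + z) ?r \<subseteq> {y. h < dT y}"
    proof
      fix y assume "y \<in> cball (e + z) ?r"
      then have "?r \<le> dT y" using dT_le[of "e + z" y] d by simp
      then show "y \<in> {y. h < dT y}" using h Cr by simp
    qed
    moreover have "has_grad_on V g {y. h < dT y}" using reg by (simp add: reg_def)
    ultimately have "continuous_on (cball (e + z) ?r) V"
      using has_grad_on_continuous continuous_on_subset by blast
    then have "ennreal \<bar>avg V (e + z) ?r - avg V e ?r\<bar> \<le> ennreal (1 / ?m) * osc V (avg V e ?r) (e + z) ?r"
      using e0 by (intro avg_diff_le) auto
    also have "\<dots> \<le> ennreal (1 / ?m) * (ennreal C1 * ball_mass (fcut g (1 / C1)) e C1)"
    proof (intro mult_left_mono)
      have "osc V (avg V e ?r) (e + z) (dT (e + z) / 2) \<le> ennreal C1 * ball_mass (fcut g (1 / C1)) e C1"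
        using h CC1 by (intro chain_boundD[OF C1(2) _ reg]) linarith
      then show "osc V (avg V e ?r) (e + z) ?r \<le> ennreal C1 * ball_mass (fcut g (1 / C1)) e C1" by (simp add: d)
    qed auto
    also have "\<dots> = ennreal (1 / ?m * C1) * ball_mass (fcut g (1 / C1)) e C1"
      using m C1 by (subst ennreal_mult) (auto simp: mult.assoc)
    also have "\<dots> \<le> ennreal C * ball_mass (fcut g (1 / C)) e C"
      using C CC1 by (intro mult_mono ennreal_leI ball_mass_mono fcut_mono) auto
    finally show "ennreal \<bar>avg V (e + z) ?r - avg V e ?r\<bar> \<le> ennreal C * ball_mass (fcut g (1 / C)) e C" .
  qed
qed

text \<open>The cells of points at distance at most 1 differ by one of finitely many lattice
  vectors, so the sum of the constants of \<open>avg_shift_bound\<close> covers all of them.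
  Periodicity moves the base cell to the cell of x.\<close>

lemma avg_lattice_floor_bound:
  assumes e: "e \<notin> T"
  shows "\<exists>C>0. \<forall>h V g x y. h < 1 / C \<longrightarrow> reg h V g \<longrightarrow> dist x y \<le> 1 \<longrightarrow>
     ennreal \<bar>avg V (e + lattice_floor y) (dT e / 2) - avg V (e + lattice_floor x) (dT e / 2)\<bar> \<le> ennreal C * ball_mass (fcut g (1 / C)) x C"
proof -
  let ?r = "dT e / 2" let ?d = "real DIM('a)"
  \<comment> \<open>The bound is 1 for the distance of the points plus d for each of their two
    offsets inside a cell.\<close>
  let ?Z = "{z \<in> lattice. norm (z::'a) \<le> 1 + 2 * ?d}"
  have r: "0 < ?r" using e dT_pos_iff by simp
  have "\<forall>z\<in>?Z. \<exists>C>0. \<forall>h V g. h < 1 / C \<longrightarrow> reg h V g \<longrightarrow>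
     ennreal \<bar>avg V (e + z) ?r - avg V e ?r\<bar> \<le> ennreal C * ball_mass (fcut g (1 / C)) e C"
    using avg_shift_bound[OF e] by blast
  then obtain c where c: "\<And>z. z \<in> ?Z \<Longrightarrow> 0 < c z"
    "\<And>z h V g. z \<in> ?Z \<Longrightarrow> h < 1 / c z \<Longrightarrow> reg h V g \<Longrightarrow>
     ennreal \<bar>avg V (e + z) ?r - avg V e ?r\<bar> \<le> ennreal (c z) * ball_mass (fcut g (1 / c z)) e (c z)"
    by (subst (asm) bchoice_iff) blast
  define C where "C = (\<Sum>z\<in>?Z. c z) + 1 + norm e + ?d"
  have cC: "c z + norm e + ?d \<le> C" if "z \<in> ?Z" for z
  proof -
    have "c z \<le> (\<Sum>z\<in>?Z. c z)"
      by (rule member_le_sum[OF that _ finite_lattice_ball]) (use c(1) in \<open>blast intro: less_imp_le\<close>)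
    then show ?thesis by (simp add: C_def)
  qed
  have "0 \<le> (\<Sum>z\<in>?Z. c z)" using c(1) by (intro sum_nonneg) (auto intro: less_imp_le)
  then have C0: "0 < C" unfolding C_def by (simp add: add_nonneg_pos add_pos_nonneg)
  show ?thesis
  proof (intro exI[of _ C] conjI C0 allI impI)
    fix h V g x y assume h: "h < 1 / C" and reg: "reg h V g" and xy: "dist x (y::'a) \<le> 1"
    let ?x = "lattice_floor x" and ?y = "lattice_floor y"
    note lx = lattice_floor_lattice[of x] and ly = lattice_floor_lattice[of y]
    define z where "z = ?y - ?x"
    have "z = ((y - x) + (x - ?x)) - (y - ?y)" by (simp add: z_def)
    then have "norm z \<le> norm ((y - x) + (x - ?x)) + norm (y - ?y)" by (simp only: norm_triangle_ineq4)
    then have "norm z \<le> norm (y - x) + norm (x - ?x) + norm (y - ?y)"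
      using norm_triangle_ineq[of "y - x" "x - ?x"] by linarith
    then have z: "z \<in> ?Z"
      using xy norm_diff_lattice_floor[of x] norm_diff_lattice_floor[of y] lattice_diff[OF ly lx]
      by (simp add: z_def dist_norm norm_minus_commute)
    have c0: "0 < c z" by (rule c(1)[OF z])
    have cz: "c z \<le> C" using cC[OF z] norm_ge_zero[of e] of_nat_0_le_iff[of "DIM('a)", where 'a=real] by linarith
    have CC: "1 / C \<le> 1 / c z" using cz c0 by (simp add: frac_le)
    have t: "avg (\<lambda>y. V (y + ?x)) p ?r = avg V (p + ?x) ?r" for p
      using reg r by (intro avg_translate) (auto simp: reg_def)
    have "ennreal \<bar>avg (\<lambda>y. V (y + ?x)) (e + z) ?r - avg (\<lambda>y. V (y + ?x)) e ?r\<bar>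
       \<le> ennreal (c z) * ball_mass (fcut (\<lambda>y. g (y + ?x)) (1 / c z)) e (c z)"
      using h CC by (intro c(2)[OF z _ reg_translate[OF reg lx]]) linarith
    then have "ennreal \<bar>avg V (e + ?y) ?r - avg V (e + ?x) ?r\<bar> \<le> ennreal (c z) * ball_mass (\<lambda>y. fcut g (1 / c z) (y + ?x)) e (c z)"
      unfolding t by (simp add: z_def fcut_translate[OF lx] add.assoc)
    also have "\<dots> = ennreal (c z) * ball_mass (fcut g (1 / c z)) (e + ?x) (c z)"
      by (subst ball_mass_translate[OF fcut_measurable[OF reg]]) simp
    also have "\<dots> \<le> ennreal C * ball_mass (fcut g (1 / C)) x C"
    proof (intro mult_mono ennreal_leI cz)
      have "dist x (e + ?x) \<le> norm (x - ?x) + norm e"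
        using norm_triangle_ineq4[of "x - ?x" e] by (simp add: dist_norm algebra_simps)
      then have "dist x (e + ?x) + c z \<le> C" using norm_diff_lattice_floor[of x] cC[OF z] by linarith
      then have "ball_mass (fcut g (1 / c z)) (e + ?x) (c z) \<le> ball_mass (fcut g (1 / c z)) x C" by (rule ball_mass_subset)
      also have "\<dots> \<le> ball_mass (fcut g (1 / C)) x C" using CC by (intro ball_mass_mono fcut_mono) auto
      finally show "ball_mass (fcut g (1 / c z)) (e + ?x) (c z) \<le> ball_mass (fcut g (1 / C)) x C" .
    qed auto
    finally show "ennreal \<bar>avg V (e + ?y) ?r - avg V (e + ?x) ?r\<bar> \<le> ennreal C * ball_mass (fcut g (1 / C)) x C" .
  qed
qed


text \<open>The piecewise constant function of cell averages is smoothed at unit scale; the resulting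
  function lives on all of space, so no holes obstruct the passage to infinity.\<close>
lemma avg_riesz_bound:
  assumes e: "e \<notin> T"
  shows "\<exists>C>0. \<forall>h V g x R. h < 1 / C \<longrightarrow> reg h V g \<longrightarrow> (\<forall>y. R < norm y \<longrightarrow> V y = 0) \<longrightarrow>
     ennreal \<bar>avg V (e + lattice_floor x) (dT e / 2)\<bar> \<le> ennreal C * riesz (fcut g (1 / C)) x"
proof -
  let ?d = "real DIM('a)" let ?r = "dT e / 2"
  have r: "0 < ?r" using e dT_pos_iff by simp
  obtain C1 where C1: "0 < C1" "\<And>h V g x y. h < 1 / C1 \<Longrightarrow> reg h V g \<Longrightarrow> dist x y \<le> 1 \<Longrightarrow>
     ennreal \<bar>avg V (e + lattice_floor y) ?r - avg V (e + lattice_floor x) ?r\<bar> \<le> ennreal C1 * ball_mass (fcut g (1 / C1)) x C1"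
    using avg_lattice_floor_bound[OF e] by blast
  obtain \<gamma> :: "'a \<Rightarrow> 'a" and L M where \<gamma>: "\<And>y. (bump 1 has_derivative (\<lambda>h. \<gamma> y \<bullet> h)) (at y)"
    "\<And>y z. norm (\<gamma> y - \<gamma> z) \<le> L * norm (y - z)" "\<And>y. norm (\<gamma> y) \<le> M" "\<And>y. 1 < norm y \<Longrightarrow> \<gamma> y = 0"
    using bump_gradient[of 1] by auto
  have M: "0 \<le> M" using \<gamma>(3)[of 0] norm_ge_zero order_trans by blast
  let ?N = "bump_mass TYPE('a) 1"
  have N: "0 < ?N" by (rule bump_mass_pos) simp
  have b1: "\<bar>bump 1 y\<bar> \<le> 1" for y :: 'a using bump_nonneg[of 1 y] bump_le_1[of 1 y] by simp
  let ?w = "unit_ball_vol ?d"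
  have cont: "continuous_on UNIV \<gamma>"
  proof -
    have "0 \<le> L"
    proof -
      obtain b :: 'a where "b \<in> Basis" using nonempty_Basis by blast
      then show ?thesis using order_trans[OF norm_ge_zero \<gamma>(2)[of b 0]] by simp
    qed
    then show ?thesis by (intro lipschitz_on_continuous_on[of L]) (auto simp: lipschitz_on_def dist_norm \<gamma>)
  qed
  have [measurable]: "\<gamma> \<in> borel_measurable borel" using cont by (rule borel_measurable_continuous_onI)
  \<comment> \<open>The entry with M is the bound for the mollified gradient; the maximum with 1
    keeps K positive.\<close>
  define K where "K = max 1 (M * ?w / ?N) * C1"
  have K: "C1 \<le> K" "M * ?w / ?N * C1 \<le> K" "0 < K"
  proof -
    have "1 * C1 \<le> K" "M * ?w / ?N * C1 \<le> K" using C1(1) unfolding K_def by (intro mult_right_mono; simp)+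
    then show "C1 \<le> K" "M * ?w / ?N * C1 \<le> K" "0 < K" using C1(1) by auto
  qed
  define K2 where "K2 = 2 * 2 powr ?d / ?w"
  define K3 where "K3 = ?w * (C1 * (?d - 1) * (2 * C1) powr (?d - 1) + 2 powr (?d - 1) * C1 powr ?d)"
  define K4 where "K4 = (?d - 1) * C1 powr (?d - 1)"
  have Kn: "0 \<le> K2" "0 \<le> K3" "0 \<le> K4" using dim C1(1) by (auto simp: K2_def K3_def K4_def)
  define C where "C = C1 + C1 * K4 + K2 * (K * K3)"
  have C: "C1 \<le> C" "C1 * K4 + K2 * (K * K3) \<le> C" using Kn K C1 by (auto simp: C_def)
  have C0: "0 < C" using C C1 by linarith
  show ?thesis
  proof (intro exI[of _ C] conjI C0 allI impI)
    fix h V g R and x :: 'a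
    assume h: "h < 1 / C" and reg: "reg h V g" and supp: "\<forall>y. R < norm y \<longrightarrow> V y = 0"
    note fm [measurable] = fcut_measurable[OF reg]
    have Vm [measurable]: "V \<in> borel_measurable borel" using reg by (simp add: reg_def)
    have CC: "1 / C \<le> 1 / C1" using C C1 by (simp add: frac_le)
    have h1: "h < 1 / C1" using h CC by linarith
    define u where "u s = avg V (e + lattice_floor s) ?r" for s
    define f where "f = fcut g (1 / C1)"
    have [measurable]: "f \<in> borel_measurable borel" unfolding f_def by (rule fm)
    let ?G = "\<lambda>y. ball_mass f y C1"
    have uG: "ennreal \<bar>u s - u y\<bar> \<le> ennreal C1 * ?G y" if "dist y s \<le> 1" for y s
      unfolding u_def f_def by (rule C1(2)[OF h1 reg that])
    \<comment> \<open>The radius of the support of V, plus the averaging radius, the centre e and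
      the offset inside a cell: beyond it every averaging ball misses the support.\<close>
    define R2 where "R2 = \<bar>R\<bar> + ?r + norm e + ?d + 1"
    have u0: "u s = 0" if "R2 < norm s" for s
    proof -
      have "indicator (cball (e + lattice_floor s) ?r) y * V y = 0" for y
      proof (cases "y \<in> cball (e + lattice_floor s) ?r")
        case True
        have "norm s \<le> norm (s - lattice_floor s) + norm (lattice_floor s)"
          using norm_triangle_ineq[of "s - lattice_floor s" "lattice_floor s"] by simp
        moreover have "norm (lattice_floor s) \<le> norm (e + lattice_floor s - y) + norm y + norm e"
          using norm_triangle_ineq[of "e + lattice_floor s - y" y] norm_triangle_ineq4[of "e + lattice_floor s" e] by simp
        moreover have "norm (e + lattice_floor s - y) \<le> ?r" using True by (simp add: dist_norm)
        ultimately have "R < norm y" using that norm_diff_lattice_floor[of s] unfolding R2_def by linarith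
        then show ?thesis using supp by simp
      qed simp
      then have "(\<lambda>y. indicator (cball (e + lattice_floor s) ?r) y * V y) = (\<lambda>_. 0)" by (intro ext)
      then show ?thesis unfolding u_def avg_def by (simp only:) simp
    qed
    have um [measurable]: "u \<in> borel_measurable borel"
    proof -
      have "(\<lambda>s. LINT y|lborel. (if dist (e + lattice_floor s) y \<le> ?r then V y else 0)) \<in> borel_measurable borel"
        by measurable
      moreover have "u = (\<lambda>s. (LINT y|lborel. (if dist (e + lattice_floor s) y \<le> ?r then V y else 0)) / (?w * ?r ^ DIM('a)))"
        using r unfolding u_def avg_def
        by (intro ext arg_cong2[where f="(/)"] Bochner_Integration.integral_cong) (auto simp: indicator_def content_cball)
      ultimately show ?thesis by simp
    qed
    \<comment> \<open>Inside the radius only finitely many cells occur, hence only finitely many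
      values of u.\<close>
    obtain B where B: "\<And>s. \<bar>u s\<bar> \<le> B"
    proof -
      let ?Z = "{z \<in> lattice. norm (z::'a) \<le> R2 + ?d}"
      have "\<bar>u s\<bar> \<le> (\<Sum>z\<in>?Z. \<bar>avg V (e + z) ?r\<bar>)" for s
      proof (cases "R2 < norm s")
        case False
        have "norm (lattice_floor s) \<le> norm s + norm (s - lattice_floor s)"
          using norm_triangle_ineq4[of s "s - lattice_floor s"] by simp
        then have "lattice_floor s \<in> ?Z" using False norm_diff_lattice_floor[of s] lattice_floor_lattice[of s] by simp
        then show ?thesis unfolding u_def
          by (intro member_le_sum[of "lattice_floor s" ?Z "\<lambda>z. \<bar>avg V (e + z) ?r\<bar>"] finite_lattice_ball) auto
      qed (auto simp: u0 intro: sum_nonneg)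
      then show thesis by (rule that)
    qed
    have ui: "integrable lborel u"
    proof (rule Bochner_Integration.integrable_bound)
      show "integrable lborel (\<lambda>s. B * indicator (cball (0::'a) R2) s)"
        using emeasure_cball_finite[of "0::'a" R2] by (auto simp: integrable_indicator_iff)
      show "AE s in lborel. norm (u s) \<le> norm (B * indicator (cball (0::'a) R2) s)"
      proof (intro AE_I2)
        fix s :: 'a
        show "norm (u s) \<le> norm (B * indicator (cball (0::'a) R2) s)"
          using B[of s] u0[of s] by (auto simp: indicator_def not_le)
      qed
    qed measurable
    note conv = has_derivative_convolution[OF _ \<gamma>(1) b1 \<gamma>(2,3)]
    define w where "w y = (LINT s|lborel. u s * bump 1 (s - y)) / ?N" for y
    define gw where "gw y = (1 / ?N) *\<^sub>R (LINT s|lborel. u s *\<^sub>R (- \<gamma> (s - y)))" for y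
    have wd: "has_grad_on w gw UNIV"
    proof -
      have "(w has_derivative (\<lambda>h. gw y \<bullet> h)) (at y)" for y
        unfolding w_def gw_def
        using has_derivative_mult_right[OF conv(1)[OF ui, of y], of "1 / ?N"] by (simp add: inner_scaleR_left)
      moreover have "continuous_on UNIV gw" unfolding gw_def by (intro continuous_intros conv(2)[OF ui])
      ultimately show ?thesis by (simp add: has_grad_on_def)
    qed
    have wm [measurable]: "w \<in> borel_measurable borel"
      using has_grad_on_continuous[OF wd] by (rule borel_measurable_continuous_onI)
    have bump_far: "bump 1 (s - y) = 0" if "\<not> dist y s \<le> 1" for s y :: 'a
      using that by (intro bump_eq_0) (auto simp: dist_norm norm_minus_commute)
    have \<gamma>_far: "\<gamma> (s - y) = 0" if "\<not> dist y s \<le> 1" for s y :: 'a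
      using that by (intro \<gamma>(4)) (auto simp: dist_norm norm_minus_commute)
    text \<open>Subtracting the constant \<open>u y\<close> near \<open>y\<close> does not change the gradient at \<open>y\<close>.\<close>
    have local: "w y - u y = (LINT s|lborel. (u s - u y) * indicator (cball y 3) s * bump 1 (s - y)) / ?N \<and>
       gw y = (1 / ?N) *\<^sub>R (LINT s|lborel. ((u s - u y) * indicator (cball y 3) s) *\<^sub>R (- \<gamma> (s - y)))" for y
    proof -
      \<comment> \<open>The subtracted constant is cut off to stay integrable. Bumps centred within
        1 of y see only \<open>cball y 2\<close>, so the cut-off at radius 3 is invisible to
        them.\<close>
      define u' where "u' s = (u s - u y) * indicator (cball y 3) s" for s
      have i3: "integrable lborel (indicator (cball y 3) :: 'a \<Rightarrow> real)"
        using emeasure_cball_finite[of y 3] by (auto simp: integrable_indicator_iff)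
      have u'i: "integrable lborel u'"
        unfolding u'_def left_diff_distrib
        using ui i3 by (intro Bochner_Integration.integrable_diff integrable_mult_right integrable_real_mult_indicator) auto
      have eq: "(LINT s|lborel. u' s * bump 1 (s - z)) = (LINT s|lborel. u s * bump 1 (s - z)) - u y * ?N" if z: "dist y z \<le> 1" for z
      proof -
        have bi: "integrable lborel (\<lambda>s. bump 1 (s - z))" 
          and bN: "(LINT s|lborel. bump 1 (s - z)) = ?N"
        proof -
          have "(\<integral>\<^sup>+s. ennreal (bump 1 (s - z)) \<partial>lborel) = ennreal ?N" by (rule nn_integral_bump) simp
          then have "has_bochner_integral lborel (\<lambda>s. bump 1 (s - z)) ?N"
            using N by (intro has_bochner_integral_nn_integral) (auto simp: bump_nonneg)
          then show "integrable lborel (\<lambda>s. bump 1 (s - z))" "(LINT s|lborel. bump 1 (s - z)) = ?N"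
            by (auto simp: has_bochner_integral_iff)
        qed
        have "u' s * bump 1 (s - z) = u s * bump 1 (s - z) - u y * bump 1 (s - z)" for s
        proof (cases "dist z s \<le> 1")
          case True
          then have "s \<in> cball y 3" using dist_triangle[of y s z] z by simp
          then show ?thesis by (simp add: u'_def left_diff_distrib)
        qed (simp add: bump_far)
        then have "(LINT s|lborel. u' s * bump 1 (s - z)) = (LINT s|lborel. u s * bump 1 (s - z) - u y * bump 1 (s - z))" by simp
        also have "\<dots> = (LINT s|lborel. u s * bump 1 (s - z)) - (LINT s|lborel. u y * bump 1 (s - z))"
          using conv(3)[OF ui] bi by (intro Bochner_Integration.integral_diff) auto
        finally show ?thesis by (simp add: bN)
      qed
      have 1: "w y - u y = (LINT s|lborel. u' s * bump 1 (s - y)) / ?N"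
        using N by (simp add: eq w_def diff_divide_distrib)
      let ?W' = "\<lambda>z. LINT s|lborel. u' s * bump 1 (s - z)" and ?W = "\<lambda>z. LINT s|lborel. u s * bump 1 (s - z)"
      have "((\<lambda>z. ?W z - u y * ?N) has_derivative (\<lambda>h. (LINT s|lborel. u s *\<^sub>R (- \<gamma> (s - y))) \<bullet> h - 0)) (at y)"
        by (intro has_derivative_diff conv(1)[OF ui]) simp
      then have "(?W' has_derivative (\<lambda>h. (LINT s|lborel. u s *\<^sub>R (- \<gamma> (s - y))) \<bullet> h - 0)) (at y)"
        by (rule has_derivative_transform_within_open[where s="ball y 1"]) (auto simp: eq)
      moreover have "(?W' has_derivative (\<lambda>h. (LINT s|lborel. u' s *\<^sub>R (- \<gamma> (s - y))) \<bullet> h)) (at y)"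
        by (rule conv(1)[OF u'i])
      ultimately have "(\<lambda>h. (LINT s|lborel. u s *\<^sub>R (- \<gamma> (s - y))) \<bullet> h - 0) = (\<lambda>h. (LINT s|lborel. u' s *\<^sub>R (- \<gamma> (s - y))) \<bullet> h)"
        by (rule has_derivative_unique)
      then have E: "(LINT s|lborel. u s *\<^sub>R (- \<gamma> (s - y))) \<bullet> b = (LINT s|lborel. u' s *\<^sub>R (- \<gamma> (s - y))) \<bullet> b" for b
        by (metis diff_zero)
      have "gw y = (1 / ?N) *\<^sub>R (LINT s|lborel. u' s *\<^sub>R (- \<gamma> (s - y)))"
        unfolding gw_def by (rule arg_cong[OF euclidean_eqI]) (rule E)
      then show ?thesis using 1 unfolding u'_def by (rule conjI[rotated])
    qed
    \<comment> \<open>On \<open>cball y 1\<close> the values of u differ from u(y) by at most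
      \<open>C1 * ?G y\<close>, and the integrals against the bump or its gradient inherit this up
      to constants. An infinite right side makes both bounds trivial.\<close>
    have bounds: "ennreal \<bar>w y - u y\<bar> \<le> ennreal C1 * ?G y \<and> ennreal (norm (gw y)) \<le> ennreal K * ?G y" for y
    proof (cases "ennreal C1 * ?G y = \<infinity>")
      case True
      then have "?G y = \<infinity>" by (auto simp: ennreal_mult_eq_top_iff)
      then show ?thesis using True K by (simp add: ennreal_mult_top)
    next
      case False
      then obtain G where G: "0 \<le> G" "ennreal C1 * ?G y = ennreal G" by (cases "ennreal C1 * ?G y") auto
      have le: "\<bar>u s - u y\<bar> \<le> G" if "dist y s \<le> 1" for s
        using uG[OF that] G by simp
      have "\<bar>LINT s|lborel. (u s - u y) * indicator (cball y 3) s * bump 1 (s - y)\<bar> \<le> (LINT s|lborel. G * bump 1 (s - y))"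
      proof (rule integral_abs_bound_integral)
        have bi: "integrable lborel (\<lambda>s. bump 1 (s - y))" and bN: "(LINT s|lborel. bump 1 (s - y)) = ?N"
        proof -
          have "(\<integral>\<^sup>+s. ennreal (bump 1 (s - y)) \<partial>lborel) = ennreal ?N" by (rule nn_integral_bump) simp
          then have "has_bochner_integral lborel (\<lambda>s. bump 1 (s - y)) ?N"
            using N by (intro has_bochner_integral_nn_integral) (auto simp: bump_nonneg)
          then show "integrable lborel (\<lambda>s. bump 1 (s - y))" "(LINT s|lborel. bump 1 (s - y)) = ?N"
            by (auto simp: has_bochner_integral_iff)
        qed
        then show "integrable lborel (\<lambda>s. G * bump 1 (s - y))" by simp
        have *: "\<bar>(u s - u y) * indicator (cball y 3) s * bump 1 (s - y)\<bar> \<le> G * bump 1 (s - y)" for s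
        proof (cases "dist y s \<le> 1")
          case True
          then show ?thesis using le[OF True] bump_nonneg[of 1 "s - y"] by (simp add: abs_mult mult_right_mono)
        qed (simp add: bump_far)
        show "integrable lborel (\<lambda>s. (u s - u y) * indicator (cball y 3) s * bump 1 (s - y))"
          by (rule Bochner_Integration.integrable_bound[OF \<open>integrable lborel (\<lambda>s. G * bump 1 (s - y))\<close>])
             (use * in \<open>auto intro!: AE_I2 order_trans[OF _ abs_ge_self]\<close>)
        show "\<bar>(u s - u y) * indicator (cball y 3) s * bump 1 (s - y)\<bar> \<le> G * bump 1 (s - y)" for s by (rule *)
      qed
      also have "\<dots> = G * ?N"
      proof -
        have "(\<integral>\<^sup>+s. ennreal (bump 1 (s - y)) \<partial>lborel) = ennreal ?N" by (rule nn_integral_bump) simp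
        then have "(LINT s|lborel. bump 1 (s - y)) = ?N"
          using N by (subst integral_eq_nn_integral) (auto simp: bump_nonneg)
        then show ?thesis by simp
      qed
      finally have I1: "\<bar>LINT s|lborel. (u s - u y) * indicator (cball y 3) s * bump 1 (s - y)\<bar> \<le> G * ?N" .
      have "\<bar>w y - u y\<bar> \<le> G"
        unfolding conjunct1[OF local] abs_divide using I1 N by (simp only: abs_of_pos pos_divide_le_eq)
      then have 1: "ennreal \<bar>w y - u y\<bar> \<le> ennreal C1 * ?G y" unfolding G(2) by (rule ennreal_leI)
      have "norm (LINT s|lborel. ((u s - u y) * indicator (cball y 3) s) *\<^sub>R (- \<gamma> (s - y))) \<le> (LINT s|lborel. G * M * indicator (cball y 1) s)"
      proof (rule order_trans[OF integral_norm_bound], rule integral_mono')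
        show "0 \<le> G * M * indicator (cball y 1) s" for s using G M by simp
        show "integrable lborel (\<lambda>s. G * M * indicator (cball y 1) s)"
          using emeasure_cball_finite[of y 1] by (auto simp: integrable_indicator_iff)
        show "norm (((u s - u y) * indicator (cball y 3) s) *\<^sub>R (- \<gamma> (s - y))) \<le> G * M * indicator (cball y 1) s" for s
        proof (cases "dist y s \<le> 1")
          case True
          then show ?thesis using le[OF True] \<gamma>(3)[of "s - y"] G M by (simp add: mult_mono)
        qed (simp add: \<gamma>_far)
      qed
      also have "\<dots> = G * (M * ?w)" by (simp add: content_cball)
      finally have I2: "norm (LINT s|lborel. ((u s - u y) * indicator (cball y 3) s) *\<^sub>R (- \<gamma> (s - y))) \<le> G * (M * ?w)" .
      have "norm (gw y) \<le> \<bar>1 / ?N\<bar> * (G * (M * ?w))"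
        unfolding conjunct2[OF local] norm_scaleR using I2 by (intro mult_left_mono) auto
      then have "norm (gw y) \<le> (M * ?w / ?N) * G" using N by (simp add: mult_ac)
      then have "ennreal (norm (gw y)) \<le> ennreal (M * ?w / ?N) * ennreal G"
        using M N by (subst ennreal_mult[symmetric]) (auto intro!: ennreal_leI simp: G)
      also have "\<dots> = ennreal (M * ?w / ?N * C1) * ?G y"
      proof -
        have "ennreal (M * ?w / ?N * C1) = ennreal (M * ?w / ?N) * ennreal C1"
          using M N C1(1) by (intro ennreal_mult) auto
        then show ?thesis unfolding G(2)[symmetric] by (simp only: mult.assoc)
      qed
      also have "\<dots> \<le> ennreal K * ?G y" using K by (intro mult_right_mono ennreal_leI) auto
      finally show ?thesis using 1 by blast
    qed
    have w0: "w y = 0" if "R2 + 1 < norm y" for y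
    proof -
      have "u s * bump 1 (s - y) = 0" for s
      proof (cases "dist y s \<le> 1")
        case True
        then have "R2 < norm s" using that norm_triangle_ineq2[of y s] by (simp add: dist_norm)
        then show ?thesis by (simp add: u0)
      qed (simp add: bump_far)
      then have "(\<lambda>s. u s * bump 1 (s - y)) = (\<lambda>_. 0)" by (intro ext)
      then show ?thesis unfolding w_def by (simp only:) simp
    qed
    have "ennreal \<bar>w x\<bar> \<le> ennreal K2 * riesz (\<lambda>y. ennreal K * ?G y) x"
      unfolding K2_def by (rule riesz_bound_compact_support[OF wd _ _ _ w0]) (use bounds in auto)
    also have "\<dots> = ennreal K2 * (ennreal K * riesz ?G x)" by (subst riesz_cmult) auto
    also have "\<dots> \<le> ennreal K2 * (ennreal K * (ennreal K3 * riesz f x))"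
      unfolding K3_def using C1(1) dim by (intro mult_left_mono riesz_ball_mass) auto
    also have "\<dots> = ennreal (K2 * (K * K3)) * riesz f x"
      using K Kn by (simp add: ennreal_mult mult.assoc)
    finally have wx: "ennreal \<bar>w x\<bar> \<le> ennreal (K2 * (K * K3)) * riesz f x" .
    have "ennreal \<bar>w x - u x\<bar> \<le> ennreal C1 * (ennreal K4 * riesz f x)"
      unfolding K4_def using C1(1) dim
      by (intro order_trans[OF conjunct1[OF bounds]] mult_left_mono riesz_ge_ball_mass) auto
    also have "\<dots> = ennreal (C1 * K4) * riesz f x" using Kn C1 by (simp add: ennreal_mult mult.assoc)
    finally have wux: "ennreal \<bar>w x - u x\<bar> \<le> ennreal (C1 * K4) * riesz f x" .
    have "ennreal \<bar>u x\<bar> \<le> ennreal (\<bar>w x - u x\<bar> + \<bar>w x\<bar>)" by (intro ennreal_leI) auto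
    also have "\<dots> \<le> ennreal (C1 * K4) * riesz f x + ennreal (K2 * (K * K3)) * riesz f x"
      using add_mono[OF wux wx] by (simp add: ennreal_plus)
    also have "\<dots> = ennreal (C1 * K4 + K2 * (K * K3)) * riesz f x"
      using Kn K C1 by (simp add: ennreal_plus distrib_right)
    also have "\<dots> \<le> ennreal C * riesz (fcut g (1 / C)) x"
      unfolding f_def using C CC by (intro mult_mono ennreal_leI riesz_mono fcut_mono) auto
    finally show "ennreal \<bar>avg V (e + lattice_floor x) ?r\<bar> \<le> ennreal C * riesz (fcut g (1 / C)) x"
      by (simp add: u_def)
  qed
qed

text \<open>With a cut-off level k that is a fixed fraction of dist(x, T), one has k |g(y)| \<le>
  dist(y, T) |g(y)| on the cut-off set. Hence dist(x, T) = \<open>C0\<close> k passes under the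
  potential.\<close>

lemma weighted_riesz_bound:
  shows "\<exists>C>0. \<forall>h V g x R. x \<notin> T \<longrightarrow> h < dT x / C \<longrightarrow> reg h V g \<longrightarrow> (\<forall>y. R < norm y \<longrightarrow> V y = 0) \<longrightarrow>
     ennreal (dT x * \<bar>V x\<bar>) \<le> ennreal C * riesz (\<lambda>y. ennreal (dT y * norm (g y)) * indicator {y. h < dT y} y) x"
proof -
  obtain e where e: "e \<notin> T" using nonempty(2) by blast
  obtain C1 where C1: "0 < C1" "\<And>x h V g. x \<notin> T \<Longrightarrow> h < dT x / C1 \<Longrightarrow> reg h V g \<Longrightarrow>
     ennreal \<bar>V x - avg V (e + lattice_floor x) (dT e / 2)\<bar> \<le> ennreal C1 * riesz (fcut g (dT x / C1)) x"
    using local_estimate_cell[OF e] by blast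
  obtain C2 where C2: "0 < C2" "\<And>h V g x R. h < 1 / C2 \<Longrightarrow> reg h V g \<Longrightarrow> (\<forall>y. R < norm y \<longrightarrow> V y = 0) \<Longrightarrow>
     ennreal \<bar>avg V (e + lattice_floor x) (dT e / 2)\<bar> \<le> ennreal C2 * riesz (fcut g (1 / C2)) x"
    using avg_riesz_bound[OF e] by blast
  obtain a where a: "a \<in> T" using nonempty(1) by blast
  \<comment> \<open>By periodicity an upper bound for the distance to T everywhere, from one point
    of T and the size of a cell. It compares \<open>dT x\<close> with the fixed level 1/C2.\<close>
  define D where "D = norm a + DIM('a) + 1"
  have D: "0 < D" by (simp add: D_def add_nonneg_pos)
  have dD: "dT x \<le> D" for x
  proof -
    have "dT x = dT (x - lattice_floor x)"
      using dT_translate[OF lattice_floor_lattice, of "x - lattice_floor x" x] by simp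
    also have "\<dots> \<le> dist (x - lattice_floor x) a" by (rule infdist_le[OF a])
    also have "\<dots> \<le> norm (x - lattice_floor x) + norm a" unfolding dist_norm by (rule norm_triangle_ineq4)
    finally show ?thesis using norm_diff_lattice_floor[of x] by (simp add: D_def)
  qed
  \<comment> \<open>Puts \<open>dT x / C0\<close> below both cut-off levels:
    \<open>dT x / C1\<close> from the local estimate and 1/C2 from the averages.\<close>
  define C0 where "C0 = C1 + D * C2"
  have C0: "C1 \<le> C0" "D * C2 \<le> C0" "0 < C0" using C1 C2 D by (auto simp: C0_def add_pos_pos)
  define C where "C = max C0 (C0 * (C1 + C2))"
  have C: "C0 \<le> C" "C0 * (C1 + C2) \<le> C" "0 < C" using C0 by (auto simp: C_def less_max_iff_disj)
  show ?thesis
  proof (intro exI[of _ C] conjI C(3) allI impI)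
    fix h V g x R assume x: "x \<notin> T" and h: "h < dT x / C" and reg: "reg h V g" and supp: "\<forall>y::'a. R < norm y \<longrightarrow> V y = 0"
    have dx: "0 < dT x" using x dT_pos_iff by simp
    let ?k = "dT x / C0"
    have k: "0 < ?k" using dx C0 by simp
    have hk: "h < ?k" using h C C0 dx divide_left_mono[of C0 C "dT x"] by simp
    have k1: "?k \<le> dT x / C1" using C0 C1 dx by (intro divide_left_mono) auto
    have k2: "?k \<le> 1 / C2"
    proof -
      have "dT x * C2 \<le> D * C2" using dD[of x] C2 by (intro mult_right_mono) auto
      then have "dT x * C2 \<le> C0" using C0 by linarith
      then show ?thesis using C0 C2 by (simp add: field_simps)
    qed
    let ?A = "avg V (e + lattice_floor x) (dT e / 2)" let ?f = "fcut g ?k"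
    have [measurable]: "?f \<in> borel_measurable borel" by (rule fcut_measurable[OF reg])
    have "ennreal \<bar>V x\<bar> \<le> ennreal (\<bar>V x - ?A\<bar> + \<bar>?A\<bar>)" by (intro ennreal_leI) auto
    also have "\<dots> = ennreal \<bar>V x - ?A\<bar> + ennreal \<bar>?A\<bar>" by (simp add: ennreal_plus)
    also have "\<dots> \<le> ennreal C1 * riesz ?f x + ennreal C2 * riesz ?f x"
    proof (intro add_mono)
      have "ennreal \<bar>V x - ?A\<bar> \<le> ennreal C1 * riesz (fcut g (dT x / C1)) x"
        using hk k1 by (intro C1(2)[OF x _ reg]) linarith
      also have "\<dots> \<le> ennreal C1 * riesz ?f x" using k1 by (intro mult_left_mono riesz_mono fcut_mono) auto
      finally show "ennreal \<bar>V x - ?A\<bar> \<le> ennreal C1 * riesz ?f x" .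
      have "ennreal \<bar>?A\<bar> \<le> ennreal C2 * riesz (fcut g (1 / C2)) x"
        using hk k2 by (intro C2(2)[OF _ reg supp]) linarith
      also have "\<dots> \<le> ennreal C2 * riesz ?f x" using k2 by (intro mult_left_mono riesz_mono fcut_mono) auto
      finally show "ennreal \<bar>?A\<bar> \<le> ennreal C2 * riesz ?f x" .
    qed
    also have "\<dots> = ennreal (C1 + C2) * riesz ?f x" using C1 C2 by (simp add: ennreal_plus distrib_right)
    finally have V: "ennreal \<bar>V x\<bar> \<le> ennreal (C1 + C2) * riesz ?f x" .
    have "ennreal (dT x * \<bar>V x\<bar>) = ennreal (dT x) * ennreal \<bar>V x\<bar>" using dx by (simp add: ennreal_mult)
    also have "\<dots> \<le> ennreal (dT x) * (ennreal (C1 + C2) * riesz ?f x)" by (intro mult_left_mono V) auto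
    also have "\<dots> = ennreal (C0 * (C1 + C2)) * (ennreal ?k * riesz ?f x)"
    proof -
      have "dT x * (C1 + C2) = C0 * (C1 + C2) * ?k" using C0 by simp
      then have "ennreal (dT x) * ennreal (C1 + C2) = ennreal (C0 * (C1 + C2)) * ennreal ?k"
        using dx C1 C2 C0 k by (subst (1 2) ennreal_mult[symmetric]) auto
      then show ?thesis by (simp only: mult.assoc[symmetric])
    qed
    also have "ennreal ?k * riesz ?f x = riesz (\<lambda>y. ennreal ?k * ?f y) x" by (rule riesz_cmult[symmetric]) measurable
    also have "ennreal (C0 * (C1 + C2)) * riesz (\<lambda>y. ennreal ?k * ?f y) x
       \<le> ennreal C * riesz (\<lambda>y. ennreal (dT y * norm (g y)) * indicator {y. h < dT y} y) x"
    proof (rule mult_mono[OF ennreal_leI[OF C(2)] riesz_mono])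
      fix y
      show "ennreal ?k * ?f y \<le> ennreal (dT y * norm (g y)) * indicator {y. h < dT y} y"
      proof (cases "?k \<le> dT y")
        case True
        then show ?thesis using hk k
          by (simp add: fcut_def ennreal_mult) (intro mult_right_mono ennreal_leI, auto)
      qed (simp add: fcut_def)
    qed auto
    finally show "ennreal (dT x * \<bar>V x\<bar>) \<le> ennreal C * riesz (\<lambda>y. ennreal (dT y * norm (g y)) * indicator {y. h < dT y} y) x" .
  qed
qed

end

section \<open>Mollified functions converge almost everywhere\<close>

lemma ennreal_tendsto_0I:
  fixes X :: "'b \<Rightarrow> ennreal"
  assumes "\<And>e. 0 < e \<Longrightarrow> eventually (\<lambda>n. X n \<le> ennreal e) F"
  shows "(X \<longlongrightarrow> 0) F"
proof (rule order_tendstoI)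
  fix a :: ennreal assume a: "0 < a"
  obtain e where e: "0 < e" "ennreal e < a"
  proof (cases a)
    case (real r)
    then show ?thesis using a that[of "r / 2"] by (auto simp: ennreal_less_iff)
  next
    case top
    then show ?thesis using that[of 1] by simp
  qed
  show "eventually (\<lambda>n. X n < a) F"
    using assms[OF e(1)] by (rule eventually_mono) (use e in auto)
qed simp

lemma ennreal_tendsto_0D:
  fixes X :: "'b \<Rightarrow> ennreal"
  assumes "(X \<longlongrightarrow> 0) F" "0 < e"
  shows "eventually (\<lambda>n. X n \<le> ennreal e) F"
  using order_tendstoD(2)[OF assms(1), of "ennreal e"] assms(2) by (auto elim: eventually_mono)

lemma nn_integral_lborel_translate:
  fixes f :: "'a::euclidean_space \<Rightarrow> ennreal"
  assumes "f \<in> borel_measurable borel"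
  shows "(\<integral>\<^sup>+x. f (x + t) \<partial>lborel) = (\<integral>\<^sup>+x. f x \<partial>lborel)"
  using nn_integral_lborel_shift[OF assms, of 1 t] by (simp add: add.commute)

text \<open>Points of A stay in an open neighbourhood U of A after a small shift, by dominated
  convergence. The points that are shifted into U - A have measure at most e/2, by outer regularity
  and translation invariance.\<close>

lemma indicator_translation_tendsto:
  fixes A :: "'a::euclidean_space set"
  assumes A[measurable]: "A \<in> sets borel" and fin: "emeasure lborel A < \<infinity>" and h: "h \<longlonglongrightarrow> 0"
  shows "(\<lambda>n. \<integral>\<^sup>+x. indicator A x * indicator (- A) (x + h n) \<partial>lborel) \<longlonglongrightarrow> 0"
proof (rule ennreal_tendsto_0I)
  fix e :: real assume e: "0 < e"
  obtain U where U: "open U" "A \<subseteq> U" "emeasure lborel (U - A) \<le> ennreal (e / 2)"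
    using outer_regular_lborel_le[of A "e / 2"] A e by auto
  have [measurable]: "U \<in> sets borel" using U by auto
  have "(\<lambda>n. \<integral>\<^sup>+x. indicator A x * indicator (- U) (x + h n) \<partial>lborel) \<longlonglongrightarrow> (\<integral>\<^sup>+x. 0 \<partial>(lborel :: 'a measure))"
  proof (rule nn_integral_dominated_convergence[where w="indicator A"])
    show "AE x in lborel. (\<lambda>n. indicator A x * indicator (- U) (x + h n)) \<longlonglongrightarrow> (0 :: ennreal)"
    proof (intro AE_I2)
      fix x :: 'a
      show "(\<lambda>n. indicator A x * indicator (- U) (x + h n)) \<longlonglongrightarrow> (0 :: ennreal)"
      proof (cases "x \<in> A")
        case True
        have "(\<lambda>n. x + h n) \<longlonglongrightarrow> x + 0" by (intro tendsto_intros h)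
        then have "eventually (\<lambda>n. x + h n \<in> U) sequentially"
          using U True by (intro topological_tendstoD) auto
        then show ?thesis by (intro tendsto_eventually) (auto elim!: eventually_mono simp: indicator_def)
      qed simp
    qed
    show "(\<integral>\<^sup>+x. indicator A x \<partial>lborel) < \<infinity>" using fin by simp
  qed (auto simp: indicator_def)
  then have "eventually (\<lambda>n. (\<integral>\<^sup>+x. indicator A x * indicator (- U) (x + h n) \<partial>lborel) \<le> ennreal (e / 2)) sequentially"
    using e by (intro ennreal_tendsto_0D) auto
  then show "eventually (\<lambda>n. (\<integral>\<^sup>+x. indicator A x * indicator (- A) (x + h n) \<partial>lborel) \<le> ennreal e) sequentially"
  proof eventually_elim
    case (elim n)
    have "(\<integral>\<^sup>+x. indicator A x * indicator (- A) (x + h n) \<partial>lborel)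
       \<le> (\<integral>\<^sup>+x. indicator A x * indicator (- U) (x + h n) + indicator (U - A) (x + h n) \<partial>lborel)"
      by (intro nn_integral_mono) (auto simp: indicator_def)
    also have "\<dots> = (\<integral>\<^sup>+x. indicator A x * indicator (- U) (x + h n) \<partial>lborel) + (\<integral>\<^sup>+x. indicator (U - A) (x + h n) \<partial>lborel)"
      by (rule nn_integral_add) measurable
    also have "(\<integral>\<^sup>+x. indicator (U - A) (x + h n) \<partial>lborel) = (\<integral>\<^sup>+x. indicator (U - A) x \<partial>lborel)"
      by (rule nn_integral_lborel_translate) measurable
    also have "\<dots> = emeasure lborel (U - A)" by simp
    also have "(\<integral>\<^sup>+x. indicator A x * indicator (- U) (x + h n) \<partial>lborel) + emeasure lborel (U - A) \<le> ennreal (e / 2) + ennreal (e / 2)"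
      by (intro add_mono elim U)
    also have "\<dots> = ennreal e" using e by (subst ennreal_plus[symmetric]) auto
    finally show ?case .
  qed
qed

text \<open>Induction over integrable functions: indicators by the preceding lemma, sums by the
  triangle inequality, limits by splitting the error into three parts, two of which agree by
  translation invariance.\<close>

lemma L1_translation_continuous:
  fixes u :: "'a::euclidean_space \<Rightarrow> real"
  assumes "integrable lborel u" "h \<longlonglongrightarrow> 0"
  shows "(\<lambda>n. \<integral>\<^sup>+x. ennreal (norm (u (x + h n) - u x)) \<partial>lborel) \<longlonglongrightarrow> 0"
  using assms(1)
proof (induction rule: integrable_induct)
  case (base A c)
  then have [measurable]: "A \<in> sets borel" by simp
  have "(\<lambda>n. \<integral>\<^sup>+x. ennreal (norm (indicator A (x + h n) *\<^sub>R c - indicator A x *\<^sub>R c)) \<partial>lborel)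
    = (\<lambda>n. ennreal \<bar>c\<bar> * ((\<integral>\<^sup>+x. indicator A x * indicator (- A) (x + h n) \<partial>lborel) + (\<integral>\<^sup>+x. indicator A x * indicator (- A) (x + (- h n)) \<partial>lborel)))"
  proof
    fix n
    have "(\<integral>\<^sup>+x. ennreal (norm (indicator A (x + h n) *\<^sub>R c - indicator A x *\<^sub>R c)) \<partial>lborel)
       = (\<integral>\<^sup>+x. ennreal \<bar>c\<bar> * (indicator A x * indicator (- A) (x + h n) + indicator A (x + h n) * indicator (- A) x) \<partial>lborel)"
      by (intro nn_integral_cong) (auto simp: indicator_def)
    also have "\<dots> = ennreal \<bar>c\<bar> * ((\<integral>\<^sup>+x. indicator A x * indicator (- A) (x + h n) \<partial>lborel) + (\<integral>\<^sup>+x. indicator A (x + h n) * indicator (- A) x \<partial>lborel))"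
      by (subst nn_integral_cmult, measurable) (subst nn_integral_add, auto)
    also have "(\<integral>\<^sup>+x. indicator A (x + h n) * indicator (- A) x \<partial>lborel) = (\<integral>\<^sup>+x. indicator A x * indicator (- A) (x + (- h n)) \<partial>lborel)"
      using nn_integral_lborel_translate[of "\<lambda>x. indicator A (x + h n) * indicator (- A) x" "- h n"] by simp
    finally show "(\<integral>\<^sup>+x. ennreal (norm (indicator A (x + h n) *\<^sub>R c - indicator A x *\<^sub>R c)) \<partial>lborel)
       = ennreal \<bar>c\<bar> * ((\<integral>\<^sup>+x. indicator A x * indicator (- A) (x + h n) \<partial>lborel) + (\<integral>\<^sup>+x. indicator A x * indicator (- A) (x + (- h n)) \<partial>lborel))" .
  qed
  moreover have "(\<lambda>n. ennreal \<bar>c\<bar> * ((\<integral>\<^sup>+x. indicator A x * indicator (- A) (x + h n) \<partial>lborel) + (\<integral>\<^sup>+x. indicator A x * indicator (- A) (x + (- h n)) \<partial>lborel)))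
     \<longlonglongrightarrow> ennreal \<bar>c\<bar> * (0 + 0)"
    using base assms(2) tendsto_minus[OF assms(2)]
    by (intro ennreal_tendsto_cmult tendsto_add indicator_translation_tendsto) auto
  ultimately show ?case by simp
next
  case (add f g)
  then have [measurable]: "f \<in> borel_measurable borel" "g \<in> borel_measurable borel" by auto
  have "(\<lambda>n. (\<integral>\<^sup>+x. ennreal (norm (f (x + h n) - f x)) \<partial>lborel) + (\<integral>\<^sup>+x. ennreal (norm (g (x + h n) - g x)) \<partial>lborel)) \<longlonglongrightarrow> 0 + 0"
    by (intro tendsto_add add.IH)
  then have H: "(\<lambda>n. (\<integral>\<^sup>+x. ennreal (norm (f (x + h n) - f x)) \<partial>lborel) + (\<integral>\<^sup>+x. ennreal (norm (g (x + h n) - g x)) \<partial>lborel)) \<longlonglongrightarrow> 0"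
    by simp
  have le: "(\<integral>\<^sup>+x. ennreal (norm (f (x + h n) + g (x + h n) - (f x + g x))) \<partial>lborel)
     \<le> (\<integral>\<^sup>+x. ennreal (norm (f (x + h n) - f x)) \<partial>lborel) + (\<integral>\<^sup>+x. ennreal (norm (g (x + h n) - g x)) \<partial>lborel)" for n
    by (subst nn_integral_add[symmetric])
       (auto simp del: ennreal_plus simp add: ennreal_plus[symmetric] intro!: nn_integral_mono ennreal_leI)
  show ?case
    by (rule tendsto_sandwich[OF _ _ tendsto_const H]) (intro always_eventually allI zero_le le)+
next
  case (lim f s)
  have [measurable]: "f \<in> borel_measurable borel" "\<And>i. s i \<in> borel_measurable borel" using lim by auto
  show ?case
  proof (rule ennreal_tendsto_0I)
    fix e :: real assume e: "0 < e"
    have "(\<lambda>i. \<integral>\<^sup>+x. ennreal (norm (f x - s i x)) \<partial>lborel) \<longlonglongrightarrow> 0"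
    proof (rule nn_integral_dominated_convergence_norm[where w="\<lambda>x. 2 * norm (f x)"])
      show "(\<integral>\<^sup>+x. ennreal (2 * norm (f x)) \<partial>lborel) < \<infinity>"
      proof -
        have "integrable lborel f" by fact
        then have "integrable lborel (\<lambda>x. 2 * norm (f x))" by simp
        then have "(\<integral>\<^sup>+x. ennreal (norm (2 * norm (f x))) \<partial>lborel) < \<infinity>" by (simp only: integrable_iff_bounded)
        then show ?thesis by (simp add: abs_mult)
      qed
    qed (use lim in auto)
    from ennreal_tendsto_0D[OF this, of "e / 3"] obtain i where i: "(\<integral>\<^sup>+x. ennreal (norm (f x - s i x)) \<partial>lborel) \<le> ennreal (e / 3)"
      using e by (auto simp: eventually_sequentially)
    have "eventually (\<lambda>n. (\<integral>\<^sup>+x. ennreal (norm (s i (x + h n) - s i x)) \<partial>lborel) \<le> ennreal (e / 3)) sequentially"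
      using e by (intro ennreal_tendsto_0D lim) auto
    then show "eventually (\<lambda>n. (\<integral>\<^sup>+x. ennreal (norm (f (x + h n) - f x)) \<partial>lborel) \<le> ennreal e) sequentially"
    proof eventually_elim
      case (elim n)
      have "(\<integral>\<^sup>+x. ennreal (norm (f (x + h n) - f x)) \<partial>lborel)
         \<le> (\<integral>\<^sup>+x. ennreal (norm (f (x + h n) - s i (x + h n))) + (ennreal (norm (s i (x + h n) - s i x)) + ennreal (norm (f x - s i x))) \<partial>lborel)"
        by (auto simp del: ennreal_plus simp add: ennreal_plus[symmetric] intro!: nn_integral_mono ennreal_leI)
      also have "\<dots> = (\<integral>\<^sup>+x. ennreal (norm (f (x + h n) - s i (x + h n))) \<partial>lborel) + ((\<integral>\<^sup>+x. ennreal (norm (s i (x + h n) - s i x)) \<partial>lborel) + (\<integral>\<^sup>+x. ennreal (norm (f x - s i x)) \<partial>lborel))"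
        by (subst nn_integral_add, measurable) (subst nn_integral_add, auto)
      also have "(\<integral>\<^sup>+x. ennreal (norm (f (x + h n) - s i (x + h n))) \<partial>lborel) = (\<integral>\<^sup>+x. ennreal (norm (f x - s i x)) \<partial>lborel)"
        by (rule nn_integral_lborel_translate[where f="\<lambda>x. ennreal (norm (f x - s i x))"]) measurable
      also have "(\<integral>\<^sup>+x. ennreal (norm (f x - s i x)) \<partial>lborel) + ((\<integral>\<^sup>+x. ennreal (norm (s i (x + h n) - s i x)) \<partial>lborel) + (\<integral>\<^sup>+x. ennreal (norm (f x - s i x)) \<partial>lborel))
         \<le> ennreal (e / 3) + (ennreal (e / 3) + ennreal (e / 3))"
        by (intro add_mono elim i)
      also have "\<dots> = ennreal e" using e by (simp del: ennreal_plus add: ennreal_plus[symmetric])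
      finally show ?case .
    qed
  qed
qed

definition mollify :: "real \<Rightarrow> ('a::euclidean_space \<Rightarrow> real) \<Rightarrow> 'a \<Rightarrow> real" where
  "mollify r u x = (LINT y|lborel. u y * bump r (y - x)) / bump_mass TYPE('a) r"

lemma continuous_on_mollify:
  fixes u :: "'a::euclidean_space \<Rightarrow> real"
  assumes u: "integrable lborel u" and r: "0 < r"
  shows "continuous_on UNIV (mollify r u)" "integrable lborel (\<lambda>y. u y * bump r (y - x))"
proof -
  obtain \<gamma> :: "'a \<Rightarrow> 'a" and L M where \<gamma>: "\<And>y. (bump r has_derivative (\<lambda>h. \<gamma> y \<bullet> h)) (at y)"
    "\<And>y z. norm (\<gamma> y - \<gamma> z) \<le> L * norm (y - z)" "\<And>y. norm (\<gamma> y) \<le> M"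
    using bump_gradient[OF r] by metis
  have b1: "\<bar>bump r y\<bar> \<le> 1" for y :: 'a using bump_nonneg[of r y] bump_le_1[of r y] by simp
  note conv = has_derivative_convolution[OF u \<gamma>(1) b1 \<gamma>(2,3)]
  have "continuous_on UNIV (\<lambda>x. LINT y|lborel. u y * bump r (y - x))"
    using conv(1) has_derivative_continuous by (intro continuous_at_imp_continuous_on) blast
  then show "continuous_on UNIV (mollify r u)" unfolding mollify_def[abs_def]
    using bump_mass_pos[OF r, where 'a='a] by (intro continuous_intros) auto
  show "integrable lborel (\<lambda>y. u y * bump r (y - x))" by (rule conv(3))
qed

text \<open>A mollification is an average of translates by vectors of length at most r, so Fubini
  bounds its L^1 error by the largest translation error.\<close>

lemma mollify_diff_nn_integral_le:
  fixes u :: "'a::euclidean_space \<Rightarrow> real"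
  assumes u: "integrable lborel u" and r: "0 < r"
    and e: "\<And>h. norm h \<le> r \<Longrightarrow> (\<integral>\<^sup>+x. ennreal (norm (u (x + h) - u x)) \<partial>lborel) \<le> ennreal e"
  shows "(\<integral>\<^sup>+x. ennreal (norm (mollify r u x - u x)) \<partial>lborel) \<le> ennreal e"
proof -
  let ?N = "bump_mass TYPE('a) r"
  have N: "0 < ?N" by (rule bump_mass_pos[OF r])
  have [measurable]: "u \<in> borel_measurable borel" using u by auto
  have bb: "has_bochner_integral lborel (\<lambda>s. bump r (s - x)) ?N" for x :: 'a
    using N nn_integral_bump[OF r, of x] by (intro has_bochner_integral_nn_integral) (auto simp: bump_nonneg)
  have "ennreal (norm (mollify r u x - u x)) \<le> ennreal (1 / ?N) * (\<integral>\<^sup>+h. ennreal (norm (u (x + h) - u x)) * ennreal (bump r h) \<partial>lborel)" for x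
  proof -
    have i: "integrable lborel (\<lambda>y. u y * bump r (y - x) - u x * bump r (y - x))"
      using continuous_on_mollify(2)[OF u r] bb[of x] by (auto simp: has_bochner_integral_iff)
    have "mollify r u x - u x = (LINT y|lborel. u y * bump r (y - x) - u x * bump r (y - x)) / ?N"
      using N continuous_on_mollify(2)[OF u r, of x] bb[of x] by (simp add: mollify_def has_bochner_integral_iff diff_divide_distrib)
    then have "ennreal (norm (mollify r u x - u x)) = ennreal (1 / ?N) * ennreal (norm (LINT y|lborel. u y * bump r (y - x) - u x * bump r (y - x)))"
      using N by (subst ennreal_mult[symmetric]) auto
    also have "\<dots> \<le> ennreal (1 / ?N) * (\<integral>\<^sup>+y. ennreal (norm (u y * bump r (y - x) - u x * bump r (y - x))) \<partial>lborel)"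
      by (intro mult_left_mono integral_norm_bound_ennreal i) auto
    also have "(\<integral>\<^sup>+y. ennreal (norm (u y * bump r (y - x) - u x * bump r (y - x))) \<partial>lborel)
       = (\<integral>\<^sup>+h. ennreal (norm (u (h + x) * bump r (h + x - x) - u x * bump r (h + x - x))) \<partial>lborel)"
      by (rule nn_integral_lborel_translate[symmetric]) measurable
    also have "\<dots> = (\<integral>\<^sup>+h. ennreal (norm (u (x + h) - u x)) * ennreal (bump r h) \<partial>lborel)"
      by (intro nn_integral_cong)
         (simp add: left_diff_distrib[symmetric] abs_mult bump_nonneg ennreal_mult add.commute)
    finally show ?thesis .
  qed
  then have "(\<integral>\<^sup>+x. ennreal (norm (mollify r u x - u x)) \<partial>lborel)
     \<le> (\<integral>\<^sup>+x. ennreal (1 / ?N) * (\<integral>\<^sup>+h. ennreal (norm (u (x + h) - u x)) * ennreal (bump r h) \<partial>lborel) \<partial>lborel)"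
    by (intro nn_integral_mono)
  also have "\<dots> = ennreal (1 / ?N) * (\<integral>\<^sup>+x. \<integral>\<^sup>+h. ennreal (norm (u (x + h) - u x)) * ennreal (bump r h) \<partial>lborel \<partial>lborel)"
    by (rule nn_integral_cmult) measurable
  also have "\<dots> \<le> ennreal (1 / ?N) * (ennreal e * ennreal ?N)"
  proof (rule mult_left_mono)
  have "(\<integral>\<^sup>+x. \<integral>\<^sup>+h. ennreal (norm (u (x + h) - u x)) * ennreal (bump r h) \<partial>lborel \<partial>lborel)
     = (\<integral>\<^sup>+h. \<integral>\<^sup>+x. ennreal (norm (u (x + h) - u x)) * ennreal (bump r h) \<partial>lborel \<partial>lborel)"
    by (rule lborel_pair.Fubini') measurable
  also have "\<dots> \<le> (\<integral>\<^sup>+h. ennreal e * ennreal (bump r (h - (0::'a))) \<partial>lborel)"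
  proof (intro nn_integral_mono)
    fix h :: 'a
    have "(\<integral>\<^sup>+x. ennreal (norm (u (x + h) - u x)) * ennreal (bump r h) \<partial>lborel) = (\<integral>\<^sup>+x. ennreal (norm (u (x + h) - u x)) \<partial>lborel) * ennreal (bump r h)"
      by (rule nn_integral_multc) measurable
    also have "\<dots> \<le> ennreal e * ennreal (bump r (h - (0::'a)))"
    proof (cases "norm h \<le> r")
      case True
      then show ?thesis using e[OF True] by (simp add: mult_right_mono)
    next
      case False
      then show ?thesis using bump_eq_0[OF r, of h] by simp
    qed
    finally show "(\<integral>\<^sup>+x. ennreal (norm (u (x + h) - u x)) * ennreal (bump r h) \<partial>lborel) \<le> ennreal e * ennreal (bump r (h - (0::'a)))" .
  qed
  also have "\<dots> = ennreal e * ennreal ?N" by (subst nn_integral_cmult) (auto simp: nn_integral_bump[OF r, of 0, simplified])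
  finally show "(\<integral>\<^sup>+x. \<integral>\<^sup>+h. ennreal (norm (u (x + h) - u x)) * ennreal (bump r h) \<partial>lborel \<partial>lborel) \<le> ennreal e * ennreal ?N" .
  qed simp
  also have "\<dots> = ennreal e" by (rule ennreal_mult_divide_cancel[OF N])
  finally show ?thesis .
qed

text \<open>L^1 convergence yields almost everywhere convergence along a subsequence; hence radii
  that depend on u.\<close>

lemma mollify_AE:
  fixes u :: "'a::euclidean_space \<Rightarrow> real"
  assumes u: "integrable lborel u"
  shows "\<exists>r. (\<forall>n::nat. 0 < r n) \<and> r \<longlonglongrightarrow> 0 \<and> (AE x in lborel. (\<lambda>n. mollify (r n) u x) \<longlonglongrightarrow> u x)"
proof -
  define \<rho> :: "nat \<Rightarrow> real" where "\<rho> n = 1 / Suc n" for n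
  have \<rho>: "0 < \<rho> n" for n by (simp add: \<rho>_def)
  have \<rho>0: "\<rho> \<longlonglongrightarrow> 0" unfolding \<rho>_def by (rule LIMSEQ_Suc[OF lim_1_over_n])
  \<comment> \<open>Translation continuity is available along sequences; by contradiction it becomes
    uniform over all small shifts.\<close>
  have ed: "\<exists>d>0. \<forall>h. norm h \<le> d \<longrightarrow> (\<integral>\<^sup>+x. ennreal (norm (u (x + h) - u x)) \<partial>lborel) \<le> ennreal e" if e: "0 < e" for e
  proof (rule ccontr)
    assume "\<not> ?thesis"
    then have "\<exists>h. norm h \<le> \<rho> n \<and> \<not> (\<integral>\<^sup>+x. ennreal (norm (u (x + h) - u x)) \<partial>lborel) \<le> ennreal e" for n
      using \<rho> by blast
    then obtain h where h: "\<And>n. norm (h n) \<le> \<rho> n" "\<And>n. \<not> (\<integral>\<^sup>+x. ennreal (norm (u (x + h n) - u x)) \<partial>lborel) \<le> ennreal e" by metis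
    have "h \<longlonglongrightarrow> 0" by (rule Lim_null_comparison[OF _ \<rho>0]) (simp add: h)
    from ennreal_tendsto_0D[OF L1_translation_continuous[OF u this] e] h(2) show False
      by (auto simp: eventually_sequentially)
  qed
  have c: "(\<lambda>n. \<integral>\<^sup>+x. ennreal (norm (mollify (\<rho> n) u x - u x)) \<partial>lborel) \<longlonglongrightarrow> 0"
  proof (rule ennreal_tendsto_0I)
    fix e :: real assume "0 < e"
    then obtain d where d: "0 < d" "\<And>h. norm h \<le> d \<Longrightarrow> (\<integral>\<^sup>+x. ennreal (norm (u (x + h) - u x)) \<partial>lborel) \<le> ennreal e"
      using ed by blast
    have "eventually (\<lambda>n. \<rho> n < d) sequentially" using order_tendstoD(2)[OF \<rho>0 d(1)] .
    then show "eventually (\<lambda>n. (\<integral>\<^sup>+x. ennreal (norm (mollify (\<rho> n) u x - u x)) \<partial>lborel) \<le> ennreal e) sequentially"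
    proof eventually_elim
      case (elim n)
      show ?case
        by (rule mollify_diff_nn_integral_le(1)[OF u \<rho>], rule d(2)) (use elim in linarith)
    qed
  qed
  \<comment> \<open>From \<open>n0\<close> on the L^1 bound itself shows that the differences are
    integrable, as the passage to a subsequence requires.\<close>
  then obtain n0 where n0: "\<And>n. n0 \<le> n \<Longrightarrow> (\<integral>\<^sup>+x. ennreal (norm (mollify (\<rho> n) u x - u x)) \<partial>lborel) \<le> ennreal 1"
    using ennreal_tendsto_0D[OF c, of 1] by (auto simp: eventually_sequentially)
  have [measurable]: "u \<in> borel_measurable borel" using u by auto
  have [measurable]: "mollify (\<rho> n) u \<in> borel_measurable borel" for n
    using continuous_on_mollify(1)[OF u \<rho>] by (rule borel_measurable_continuous_onI)
  have i: "integrable lborel (\<lambda>x. mollify (\<rho> (n + n0)) u x - u x)" for n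
    using n0[of "n + n0"] by (intro integrableI_bounded) (auto intro: order_le_less_trans)
  have "(\<lambda>n. LINT x|lborel. norm (mollify (\<rho> (n + n0)) u x - u x)) \<longlonglongrightarrow> 0"
  proof -
    have "(\<lambda>n. \<integral>\<^sup>+x. ennreal (norm (mollify (\<rho> (n + n0)) u x - u x)) \<partial>lborel) \<longlonglongrightarrow> 0"
      by (rule LIMSEQ_ignore_initial_segment[OF c])
    moreover have "(\<integral>\<^sup>+x. ennreal (norm (mollify (\<rho> (n + n0)) u x - u x)) \<partial>lborel) = ennreal (LINT x|lborel. norm (mollify (\<rho> (n + n0)) u x - u x))" for n
      using i[of n] by (intro nn_integral_eq_integral) auto
    ultimately show ?thesis by (simp add: tendsto_ennreal_iff[of _ _ 0, simplified])
  qed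
  from tendsto_L1_AE_subseq[OF i this] obtain s :: "nat \<Rightarrow> nat" where s: "strict_mono s"
    "AE x in lborel. (\<lambda>n. mollify (\<rho> (s n + n0)) u x - u x) \<longlonglongrightarrow> 0" by auto
  show ?thesis
  proof (intro exI[of _ "\<lambda>n. \<rho> (s n + n0)"] conjI allI \<rho>)
    have "(\<lambda>n. \<rho> (n + n0)) \<longlonglongrightarrow> 0" by (rule LIMSEQ_ignore_initial_segment[OF \<rho>0])
    from LIMSEQ_subseq_LIMSEQ[OF this s(1)] show "(\<lambda>n. \<rho> (s n + n0)) \<longlonglongrightarrow> 0" by (simp add: o_def)
    show "AE x in lborel. (\<lambda>n. mollify (\<rho> (s n + n0)) u x) \<longlonglongrightarrow> u x"
      using s(2) by eventually_elim (simp add: LIM_zero_iff)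
  qed
qed

section \<open>The pointwise bound for weakly differentiable functions\<close>

definition mollify_grad :: "real \<Rightarrow> ('a::euclidean_space \<Rightarrow> 'a) \<Rightarrow> 'a \<Rightarrow> 'a" where
  "mollify_grad r G x = (1 / bump_mass TYPE('a) r) *\<^sub>R (LINT y|lborel. bump r (y - x) *\<^sub>R G y)"

lemma weak_gradient_integrable:
  fixes u :: "'a::euclidean_space \<Rightarrow> real" and G :: "'a \<Rightarrow> 'a"
  assumes wg: "weak_gradient S u G" and [measurable]: "u \<in> borel_measurable borel" "G \<in> borel_measurable borel"
    and K: "compact K" "K \<subseteq> S"
  shows "integrable lborel (\<lambda>y. indicator K y * u y)" "integrable lborel (\<lambda>y. indicator K y *\<^sub>R G y)"
proof -
  have [measurable]: "K \<in> sets borel" using K by (simp add: borel_compact)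
  have "integrable lebesgue (\<lambda>y. indicator K y *\<^sub>R u y)" "\<And>b. b \<in> Basis \<Longrightarrow> integrable lebesgue (\<lambda>y. indicator K y *\<^sub>R (G y \<bullet> b))"
    using wg K unfolding weak_gradient_def set_integrable_def by blast+
  then have 1: "integrable lborel (\<lambda>y. indicator K y *\<^sub>R u y)" and 2: "\<And>b. b \<in> Basis \<Longrightarrow> integrable lborel (\<lambda>y. indicator K y *\<^sub>R (G y \<bullet> b))"
    by (simp_all add: integrable_completion)
  show "integrable lborel (\<lambda>y. indicator K y * u y)" using 1 by simp
  have "integrable lborel (\<lambda>y. \<Sum>b\<in>Basis. (indicator K y *\<^sub>R (G y \<bullet> b)) *\<^sub>R b)"
    using 2 by (intro Bochner_Integration.integrable_sum integrable_scaleR_left) auto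
  moreover have "(\<Sum>b\<in>Basis. (indicator K y *\<^sub>R (G y \<bullet> b)) *\<^sub>R b) = indicator K y *\<^sub>R G y" for y
    by (simp only: scaleR_scaleR[symmetric] real_scaleR_def scaleR_sum_right[symmetric] euclidean_representation)
  ultimately show "integrable lborel (\<lambda>y. indicator K y *\<^sub>R G y)" by simp
qed

text \<open>Testing the weak gradient with the bump centred at x shows that the gradient of the
  mollified function is the mollified G. The room 2 r lets the centre move by r: bumps centred in
  \<open>ball x0 r\<close> live on \<open>cball x0 (2 * r)\<close>, and there u and G can be
  replaced by integrable cut-offs.\<close>

lemma mollify_weak_gradient:
  fixes u :: "'a::euclidean_space \<Rightarrow> real" and G :: "'a \<Rightarrow> 'a"
  assumes wg: "weak_gradient S u G" and [measurable]: "u \<in> borel_measurable borel" "G \<in> borel_measurable borel"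
    and S: "open S" and r: "0 < r" and E: "\<And>x. x \<in> E \<Longrightarrow> cball x (2 * r) \<subseteq> S"
  shows "has_grad_on (mollify r u) (mollify_grad r G) E"
    and "\<And>x. x \<in> E \<Longrightarrow> ennreal (norm (mollify_grad r G x)) \<le> ennreal (1 / bump_mass TYPE('a) r) * ball_mass (\<lambda>y. ennreal (norm (G y))) x r"
proof -
  let ?N = "bump_mass TYPE('a) r"
  have N: "0 < ?N" by (rule bump_mass_pos[OF r])
  have [measurable]: "S \<in> sets borel" using S by auto
  obtain \<gamma> :: "'a \<Rightarrow> 'a" and L M where \<gamma>: "\<And>y. (bump r has_derivative (\<lambda>h. \<gamma> y \<bullet> h)) (at y)"
    "\<And>y z. norm (\<gamma> y - \<gamma> z) \<le> L * norm (y - z)" "\<And>y. norm (\<gamma> y) \<le> M" "\<And>y. r < norm y \<Longrightarrow> \<gamma> y = 0"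
    using bump_gradient[OF r] by metis
  have b1: "\<bar>bump r y\<bar> \<le> 1" for y :: 'a using bump_nonneg[of r y] bump_le_1[of r y] by simp
  have far: "bump r (y - x) = 0" if "\<not> dist x y \<le> r" for x y :: 'a
    using that by (intro bump_eq_0[OF r]) (auto simp: dist_norm norm_minus_commute)
  have \<gamma>far: "\<gamma> (y - x) = 0" if "\<not> dist x y \<le> r" for x y :: 'a
    using that by (intro \<gamma>(4)) (auto simp: dist_norm norm_minus_commute)
  have cont_\<gamma>: "continuous_on UNIV \<gamma>"
  proof -
    have "0 \<le> L"
    proof -
      obtain b :: 'a where "b \<in> Basis" using nonempty_Basis by blast
      then show ?thesis using order_trans[OF norm_ge_zero \<gamma>(2)[of b 0]] by simp
    qed
    then show ?thesis by (intro lipschitz_on_continuous_on[of L]) (auto simp: lipschitz_on_def dist_norm \<gamma>)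
  qed
  have [measurable]: "\<gamma> \<in> borel_measurable borel" using cont_\<gamma> by (rule borel_measurable_continuous_onI)
  have main: "(mollify r u has_derivative (\<lambda>h. mollify_grad r G x0 \<bullet> h)) (at x0) \<and> isCont (mollify_grad r G) x0 \<and>
      integrable lborel (\<lambda>y. bump r (y - x0) *\<^sub>R G y)" if x0: "x0 \<in> E" for x0
  proof -
    let ?K = "cball x0 (2 * r)"
    define uK where "uK y = indicator ?K y * u y" for y
    define GK where "GK y = indicator ?K y *\<^sub>R G y" for y
    have i: "integrable lborel uK" "integrable lborel GK"
      unfolding uK_def GK_def using weak_gradient_integrable[OF wg _ _ compact_cball E[OF x0]] by auto
    note conv = has_derivative_convolution[OF i(1) \<gamma>(1) b1 \<gamma>(2,3)]
    have inK: "y \<in> ?K" if "x \<in> ball x0 r" "dist x y \<le> r" for x y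
      using that dist_triangle[of x0 y x] by simp
    have mu: "mollify r u x = mollify r uK x" if "x \<in> ball x0 r" for x
    proof -
      have "u y * bump r (y - x) = uK y * bump r (y - x)" for y
        using inK[OF that, of y] far[of x y] by (cases "dist x y \<le> r") (auto simp: uK_def)
      then have "(\<lambda>y. u y * bump r (y - x)) = (\<lambda>y. uK y * bump r (y - x))" by (intro ext)
      then show ?thesis unfolding mollify_def by (simp only:)
    qed
    have GKe: "bump r (y - x) *\<^sub>R G y = bump r (y - x) *\<^sub>R GK y" if "x \<in> ball x0 r" for x y
      using inK[OF that, of y] far[of x y] by (cases "dist x y \<le> r") (auto simp: GK_def)
    have bi: "integrable lborel (\<lambda>y. bump r (y - x) *\<^sub>R GK y)" for x
    proof (rule Bochner_Integration.integrable_bound[OF integrable_norm[OF i(2)]])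
      have [measurable]: "GK \<in> borel_measurable borel" using i(2) by auto
      show "(\<lambda>y. bump r (y - x) *\<^sub>R GK y) \<in> borel_measurable lborel" by measurable
      show "AE y in lborel. norm (bump r (y - x) *\<^sub>R GK y) \<le> norm (norm (GK y))"
        using b1 by (intro AE_I2) (auto intro: mult_left_le_one_le)
    qed
    have x0r: "x0 \<in> ball x0 r" using r by simp
    have weak: "(LINT y|lborel. uK y *\<^sub>R (- \<gamma> (y - x0))) = (LINT y|lborel. bump r (y - x0) *\<^sub>R GK y)"
    proof (rule euclidean_eqI)
      fix b :: 'a assume b: "b \<in> Basis"
      have t: "test_function S (\<lambda>y. bump r (y - x0))"
        using r E[OF x0] by (intro test_function_bump) (auto intro: order_trans[OF _ E[OF x0]])
      have fd: "frechet_derivative (\<lambda>y. bump r (y - x0)) (at y) b = \<gamma> (y - x0) \<bullet> b" for y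
      proof -
        have "((\<lambda>y. bump r (y - x0)) has_derivative (\<lambda>h. \<gamma> (y - x0) \<bullet> h)) (at y)"
        proof -
          have "((\<lambda>y. y - x0) has_derivative (\<lambda>h. h)) (at y)" by (auto intro!: derivative_eq_intros)
          from has_derivative_compose[OF this \<gamma>(1)] show ?thesis by simp
        qed
        then show ?thesis by (metis frechet_derivative_at)
      qed
      have SK: "indicator S y *\<^sub>R (u y * (\<gamma> (y - x0) \<bullet> b)) = uK y * (\<gamma> (y - x0) \<bullet> b)"
        "indicator S y *\<^sub>R (G y \<bullet> b * bump r (y - x0)) = (bump r (y - x0) *\<^sub>R GK y) \<bullet> b" for y
        using inK[OF x0r, of y] E[OF x0] far[of x0 y] \<gamma>far[of x0 y]
        by (cases "dist x0 y \<le> r"; auto simp: uK_def GK_def indicator_def)+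
      have "(LINT y:S|lebesgue. u y * frechet_derivative (\<lambda>y. bump r (y - x0)) (at y) b) = - (LINT y:S|lebesgue. (G y \<bullet> b) * bump r (y - x0))"
        using wg t b unfolding weak_gradient_def by blast
      then have "(LINT y|lebesgue. uK y * (\<gamma> (y - x0) \<bullet> b)) = - (LINT y|lebesgue. (bump r (y - x0) *\<^sub>R GK y) \<bullet> b)"
        unfolding set_lebesgue_integral_def fd SK .
      then have W: "(LINT y|lborel. uK y * (\<gamma> (y - x0) \<bullet> b)) = - (LINT y|lborel. (bump r (y - x0) *\<^sub>R GK y) \<bullet> b)"
        unfolding uK_def GK_def by (subst (asm) (1 2) integral_completion) auto
      have "(LINT y|lborel. uK y *\<^sub>R (- \<gamma> (y - x0))) \<bullet> b = (LINT y|lborel. (uK y *\<^sub>R (- \<gamma> (y - x0))) \<bullet> b)"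
        by (rule integral_inner_left[symmetric]) (rule conv(4))
      also have "\<dots> = - (LINT y|lborel. uK y * (\<gamma> (y - x0) \<bullet> b))" by simp
      also have "\<dots> = (LINT y|lborel. (bump r (y - x0) *\<^sub>R GK y) \<bullet> b)" unfolding W by simp
      also have "\<dots> = (LINT y|lborel. bump r (y - x0) *\<^sub>R GK y) \<bullet> b" by (rule integral_inner_left) (rule bi)
      finally show "(LINT y|lborel. uK y *\<^sub>R (- \<gamma> (y - x0))) \<bullet> b = (LINT y|lborel. bump r (y - x0) *\<^sub>R GK y) \<bullet> b" .
    qed
    have mg: "mollify_grad r G x = (1 / ?N) *\<^sub>R (LINT y|lborel. bump r (y - x) *\<^sub>R GK y)" if "x \<in> ball x0 r" for x
      unfolding mollify_grad_def by (simp only: GKe[OF that])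
    have "(mollify r uK has_derivative (\<lambda>h. (1 / ?N) * ((LINT y|lborel. uK y *\<^sub>R (- \<gamma> (y - x0))) \<bullet> h))) (at x0)"
      unfolding mollify_def[abs_def] using has_derivative_mult_right[OF conv(1)[of x0], of "1 / ?N"] by simp
    then have "(mollify r uK has_derivative (\<lambda>h. mollify_grad r G x0 \<bullet> h)) (at x0)"
      unfolding mg[OF x0r] weak inner_scaleR_left .
    then have 1: "(mollify r u has_derivative (\<lambda>h. mollify_grad r G x0 \<bullet> h)) (at x0)"
      by (rule has_derivative_transform_within_open[where s="ball x0 r"]) (use r mu in auto)
    \<comment> \<open>Each component of the mollified field is a scalar mollification, whose
      continuity is known.\<close>
    have mg2: "mollify_grad r G x = (\<Sum>b\<in>Basis. mollify r (\<lambda>y. GK y \<bullet> b) x *\<^sub>R b)" if "x \<in> ball x0 r" for x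
    proof (rule euclidean_eqI)
      fix b :: 'a assume b: "b \<in> Basis"
      have "mollify_grad r G x \<bullet> b = (1 / ?N) * (LINT y|lborel. (bump r (y - x) *\<^sub>R GK y) \<bullet> b)"
        by (simp only: mg[OF that] inner_scaleR_left[of "1 / ?N"] integral_inner_left[OF bi])
      also have "\<dots> = mollify r (\<lambda>y. GK y \<bullet> b) x" by (simp add: mollify_def mult.commute)
      finally show "mollify_grad r G x \<bullet> b = (\<Sum>b\<in>Basis. mollify r (\<lambda>y. GK y \<bullet> b) x *\<^sub>R b) \<bullet> b"
        using b by simp
    qed
    have "continuous_on (ball x0 r) (\<lambda>x. \<Sum>b\<in>Basis. mollify r (\<lambda>y. GK y \<bullet> b) x *\<^sub>R b)"
      using continuous_on_mollify(1)[OF integrable_inner_left[OF i(2)] r]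
      by (intro continuous_intros) (auto intro: continuous_on_subset)
    then have "continuous_on (ball x0 r) (mollify_grad r G)"
      by (rule continuous_on_eq) (simp add: mg2)
    then have 2: "isCont (mollify_grad r G) x0" using x0r continuous_on_interior[of "ball x0 r" "mollify_grad r G" x0] by simp
    have "(\<lambda>y. bump r (y - x0) *\<^sub>R G y) = (\<lambda>y. bump r (y - x0) *\<^sub>R GK y)" using GKe[OF x0r] by (intro ext)
    then have 3: "integrable lborel (\<lambda>y. bump r (y - x0) *\<^sub>R G y)" using bi[of x0] by simp
    show ?thesis using 1 2 3 by blast
  qed
  show "has_grad_on (mollify r u) (mollify_grad r G) E"
    using main unfolding has_grad_on_def by (auto intro: continuous_at_imp_continuous_on)
  fix x assume x: "x \<in> E"
  have "ennreal (norm (mollify_grad r G x)) = ennreal (1 / ?N) * ennreal (norm (LINT y|lborel. bump r (y - x) *\<^sub>R G y))"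
    unfolding mollify_grad_def using N by (subst ennreal_mult[symmetric]) auto
  also have "\<dots> \<le> ennreal (1 / ?N) * (\<integral>\<^sup>+y. ennreal (norm (bump r (y - x) *\<^sub>R G y)) \<partial>lborel)"
    using main[OF x] by (intro mult_left_mono integral_norm_bound_ennreal) auto
  also have "\<dots> \<le> ennreal (1 / ?N) * ball_mass (\<lambda>y. ennreal (norm (G y))) x r"
    unfolding ball_mass_def
  proof (intro mult_left_mono nn_integral_mono)
    fix y
    show "ennreal (norm (bump r (y - x) *\<^sub>R G y)) \<le> ennreal (norm (G y)) * indicator (cball x r) y"
      using far[of x y] b1[of "y - x"] by (cases "dist x y \<le> r") (auto intro!: ennreal_leI mult_left_le_one_le)
  qed auto
  finally show "ennreal (norm (mollify_grad r G x)) \<le> ennreal (1 / ?N) * ball_mass (\<lambda>y. ennreal (norm (G y))) x r" .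
qed

context periodic_cone_domain
begin

text \<open>Rescaled to the unit cell, the mollified function satisfies \<open>reg\<close> with
  margin 2 r/\<epsilon>, so \<open>weighted_riesz_bound\<close> applies. Its gradient is dominated
  by a mean of |G| over balls of radius r, on which the weight changes by at most a factor 2, and
  such a mean costs the potential only a constant.\<close>

lemma mollified_pointwise_bound:
  "\<exists>C>0. \<forall>\<epsilon> u G R r x. 0 < \<epsilon> \<longrightarrow> 0 < r \<longrightarrow> u \<in> borel_measurable borel \<longrightarrow> G \<in> borel_measurable borel \<longrightarrow>
     weak_gradient (- (*\<^sub>R) \<epsilon> ` T) u G \<longrightarrow> (\<forall>y. R < norm y \<longrightarrow> u y = 0) \<longrightarrow>
     C * r < \<epsilon> * dT ((1 / \<epsilon>) *\<^sub>R x) \<longrightarrow>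
     ennreal (dT ((1 / \<epsilon>) *\<^sub>R x) * \<bar>mollify r u x\<bar>) \<le> ennreal C * riesz (\<lambda>y. ennreal (dT ((1 / \<epsilon>) *\<^sub>R y) * norm (G y))) x"
proof -
  let ?d = "real DIM('a)" let ?w = "unit_ball_vol ?d" let ?N1 = "bump_mass TYPE('a) 1"
  obtain C1 where C1: "0 < C1" "\<And>h V g x R. x \<notin> T \<Longrightarrow> h < dT x / C1 \<Longrightarrow> reg h V g \<Longrightarrow> (\<forall>y. R < norm y \<longrightarrow> V y = 0) \<Longrightarrow>
     ennreal (dT x * \<bar>V x\<bar>) \<le> ennreal C1 * riesz (\<lambda>y. ennreal (dT y * norm (g y)) * indicator {y. h < dT y} y) x"
    using weighted_riesz_bound by blast
  have N1: "0 < ?N1" by (rule bump_mass_pos) simp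
  \<comment> \<open>The constant of \<open>riesz_ball_mass\<close> at radius r is c r^d.\<close>
  define c where "c = ?w * ((?d - 1) * 2 powr (?d - 1) + 2 powr (?d - 1))"
  have c: "0 \<le> c" using dim by (simp add: c_def)
  define C where "C = max (max 2 (2 * C1)) (C1 * (2 / ?N1 * c))"
  have C: "2 \<le> C" "2 * C1 \<le> C" "C1 * (2 / ?N1 * c) \<le> C" by (simp_all add: C_def)
  show ?thesis
  proof (intro exI[of _ C] conjI allI impI)
    show "0 < C" using C by linarith
    fix \<epsilon> u G R r x
    assume e: "(0::real) < \<epsilon>" and r: "0 < r" and um: "u \<in> borel_measurable borel" and Gm: "G \<in> borel_measurable borel"
      and wg: "weak_gradient (- (*\<^sub>R) \<epsilon> ` T) u G" and supp: "\<forall>y. R < norm y \<longrightarrow> u y = 0"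
      and x: "C * r < \<epsilon> * dT ((1 / \<epsilon>) *\<^sub>R x)"
    note [measurable] = um Gm
    let ?N = "bump_mass TYPE('a) r"
    have N: "0 < ?N" by (rule bump_mass_pos[OF r])
    let ?S = "- (*\<^sub>R) \<epsilon> ` T"
    have S: "open ?S" using closed_scaling[OF closed] by auto
    define h where "h = 2 * r / \<epsilon>"
    have inS: "cball (\<epsilon> *\<^sub>R y) (2 * r) \<subseteq> ?S" if "h < dT y" for y
    proof
      fix z assume z: "z \<in> cball (\<epsilon> *\<^sub>R y) (2 * r)"
      show "z \<in> ?S"
      proof
        assume "z \<in> (*\<^sub>R) \<epsilon> ` T"
        then obtain t where t: "t \<in> T" "z = \<epsilon> *\<^sub>R t" by blast
        have "dist (\<epsilon> *\<^sub>R y) z = \<epsilon> * dist y t" using e t by (simp add: dist_norm scaleR_diff_right[symmetric])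
        then have "\<epsilon> * dist y t \<le> 2 * r" using z by simp
        then have "dist y t \<le> h" using e by (simp add: h_def field_simps)
        then show False using infdist_le[OF t(1), of y] that by simp
      qed
    qed
    define E where "E = {z. h < dT ((1 / \<epsilon>) *\<^sub>R z)}"
    have E: "cball z (2 * r) \<subseteq> ?S" if "z \<in> E" for z
      using inS[of "(1 / \<epsilon>) *\<^sub>R z"] that e by (simp add: E_def)
    have mw: "has_grad_on (mollify r u) (mollify_grad r G) E"
      "\<And>x. x \<in> E \<Longrightarrow> ennreal (norm (mollify_grad r G x)) \<le> ennreal (1 / ?N) * ball_mass (\<lambda>y. ennreal (norm (G y))) x r"
      using mollify_weak_gradient[OF wg um Gm S r, of E] E by blast+
    define U where "U = {y. h < dT y}"
    have Uo: "open U" unfolding U_def by (intro open_Collect_less continuous_intros)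
    then have [measurable]: "U \<in> sets borel" by auto
    have UE: "y \<in> U \<Longrightarrow> \<epsilon> *\<^sub>R y \<in> E" for y using e by (simp add: U_def E_def)
    \<comment> \<open>Only on the open set U is the mollification known to be differentiable; the
      extension by 0 is Borel and keeps a bounded support.\<close>
    define V where "V y = (if y \<in> U then mollify r u (\<epsilon> *\<^sub>R y) else 0)" for y
    define g where "g y = (if y \<in> U then \<epsilon> *\<^sub>R mollify_grad r G (\<epsilon> *\<^sub>R y) else 0)" for y
    have der: "((\<lambda>y. mollify r u (\<epsilon> *\<^sub>R y)) has_derivative (\<lambda>k. g y \<bullet> k)) (at y)" if "y \<in> U" for y
    proof -
      have "((\<lambda>y. \<epsilon> *\<^sub>R y) has_derivative (\<lambda>k. \<epsilon> *\<^sub>R k)) (at y)" by (auto intro!: derivative_eq_intros)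
      moreover have "(mollify r u has_derivative (\<lambda>k. mollify_grad r G (\<epsilon> *\<^sub>R y) \<bullet> k)) (at (\<epsilon> *\<^sub>R y))"
        using mw(1) UE[OF that] by (simp add: has_grad_on_def)
      ultimately have "((\<lambda>y. mollify r u (\<epsilon> *\<^sub>R y)) has_derivative (\<lambda>k. mollify_grad r G (\<epsilon> *\<^sub>R y) \<bullet> (\<epsilon> *\<^sub>R k))) (at y)"
        using has_derivative_compose by blast
      then show ?thesis using that by (simp add: g_def)
    qed
    have derV: "(V has_derivative (\<lambda>k. g y \<bullet> k)) (at y)" if "y \<in> U" for y
      using der[OF that] Uo that by (rule has_derivative_transform_within_open) (simp add: V_def)
    have cg: "continuous_on U (\<lambda>y. \<epsilon> *\<^sub>R mollify_grad r G (\<epsilon> *\<^sub>R y))"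
    proof (rule continuous_on_scaleR[OF continuous_on_const])
      have "continuous_on E (mollify_grad r G)" using mw(1) by (simp add: has_grad_on_def)
      then show "continuous_on U (\<lambda>y. mollify_grad r G (\<epsilon> *\<^sub>R y))"
        by (rule continuous_on_compose2) (use UE in \<open>auto intro!: continuous_intros\<close>)
    qed
    have "continuous_on U (\<lambda>y. mollify r u (\<epsilon> *\<^sub>R y))"
      using der has_derivative_continuous by (intro continuous_at_imp_continuous_on) blast
    then have "(\<lambda>y. indicator U y *\<^sub>R mollify r u (\<epsilon> *\<^sub>R y)) \<in> borel_measurable borel"
      by (intro borel_measurable_continuous_on_indicator) auto
    moreover have "V = (\<lambda>y. indicator U y *\<^sub>R mollify r u (\<epsilon> *\<^sub>R y))" by (auto simp: V_def indicator_def)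
    ultimately have Vm: "V \<in> borel_measurable borel" by simp
    have "(\<lambda>y. indicator U y *\<^sub>R (\<epsilon> *\<^sub>R mollify_grad r G (\<epsilon> *\<^sub>R y))) \<in> borel_measurable borel"
      using cg by (intro borel_measurable_continuous_on_indicator) auto
    moreover have "g = (\<lambda>y. indicator U y *\<^sub>R (\<epsilon> *\<^sub>R mollify_grad r G (\<epsilon> *\<^sub>R y)))" by (auto simp: g_def indicator_def)
    ultimately have gm: "g \<in> borel_measurable borel" by simp
    have "continuous_on U g" by (rule continuous_on_eq[OF cg]) (simp add: g_def)
    then have reg: "reg h V g" using derV Vm gm by (simp add: reg_def has_grad_on_def U_def)
    have suppV: "\<forall>y. (R + r) / \<epsilon> < norm y \<longrightarrow> V y = 0"
    proof (intro allI impI)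
      fix y :: 'a assume "(R + r) / \<epsilon> < norm y"
      then have y: "R + r < norm (\<epsilon> *\<^sub>R y)" using e by (simp add: field_simps)
      have "u z * bump r (z - \<epsilon> *\<^sub>R y) = 0" for z
      proof (cases "norm (z - \<epsilon> *\<^sub>R y) < r")
        case True
        then have "R < norm z" using y norm_triangle_ineq2[of "\<epsilon> *\<^sub>R y" z] by (simp add: norm_minus_commute)
        then show ?thesis using supp by simp
      qed (use bump_eq_0[OF r, of "z - \<epsilon> *\<^sub>R y"] in simp)
      then have "(\<lambda>z. u z * bump r (z - \<epsilon> *\<^sub>R y)) = (\<lambda>_. 0)" by (intro ext)
      then have "mollify r u (\<epsilon> *\<^sub>R y) = 0" unfolding mollify_def by (simp only:) simp
      then show "V y = 0" by (simp add: V_def)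
    qed
    let ?x = "(1 / \<epsilon>) *\<^sub>R x"
    have dx: "C * r / \<epsilon> < dT ?x" using x e by (simp add: field_simps)
    have hC: "h \<le> C * r / \<epsilon>" unfolding h_def using C r e by (intro divide_right_mono mult_right_mono) auto
    have "0 < h" using r e by (simp add: h_def)
    then have dx0: "0 < dT ?x" using dx hC by linarith
    then have xT: "?x \<notin> T" using dT_pos_iff by blast
    have xU: "?x \<in> U" using dx hC by (simp add: U_def)
    have hx: "h < dT ?x / C1"
    proof -
      have "C1 * h = 2 * C1 * r / \<epsilon>" by (simp add: h_def)
      also have "\<dots> \<le> C * r / \<epsilon>" using C r e by (intro divide_right_mono mult_right_mono) auto
      finally show ?thesis using dx C1(1) by (simp add: field_simps)
    qed
    define F where "F y = ennreal (dT ((1 / \<epsilon>) *\<^sub>R y) * norm (mollify_grad r G y)) * indicator E y" for y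
    define f where "f y = ennreal (dT ((1 / \<epsilon>) *\<^sub>R y) * norm (G y))" for y
    have fm[measurable]: "f \<in> borel_measurable borel" unfolding f_def by measurable
    have "continuous_on E (mollify_grad r G)" using mw(1) by (simp add: has_grad_on_def)
    moreover have Em[measurable]: "E \<in> sets borel" unfolding E_def by measurable
    ultimately have "(\<lambda>y. indicator E y *\<^sub>R mollify_grad r G y) \<in> borel_measurable borel"
      by (intro borel_measurable_continuous_on_indicator) auto
    then have "(\<lambda>y. ennreal (dT ((1 / \<epsilon>) *\<^sub>R y) * norm (indicator E y *\<^sub>R mollify_grad r G y))) \<in> borel_measurable borel"
      by measurable
    moreover have "F = (\<lambda>y. ennreal (dT ((1 / \<epsilon>) *\<^sub>R y) * norm (indicator E y *\<^sub>R mollify_grad r G y)))"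
      by (auto simp: F_def indicator_def)
    ultimately have Fm[measurable]: "F \<in> borel_measurable borel" by simp
    have FF: "F y \<le> ennreal (2 / ?N) * ball_mass f y r" for y
    proof (cases "y \<in> E")
      case True
      \<comment> \<open>Within \<open>cball y r\<close> the distance to the scaled holes drops by at
        most r, which is less than half of its value at y.\<close>
      have d: "ennreal (dT ((1 / \<epsilon>) *\<^sub>R y)) * (ennreal (norm (G z)) * indicator (cball y r) z) \<le> ennreal 2 * (f z * indicator (cball y r) z)" for z
      proof (cases "z \<in> cball y r")
        case zr: True
        have "dT ((1 / \<epsilon>) *\<^sub>R y) \<le> dT ((1 / \<epsilon>) *\<^sub>R z) + dist ((1 / \<epsilon>) *\<^sub>R y) ((1 / \<epsilon>) *\<^sub>R z)" by (rule dT_le)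
        also have "dist ((1 / \<epsilon>) *\<^sub>R y) ((1 / \<epsilon>) *\<^sub>R z) = dist y z / \<epsilon>" using e by (simp add: dist_norm scaleR_diff_right[symmetric])
        also have "\<dots> \<le> r / \<epsilon>" using zr e by (intro divide_right_mono) auto
        finally have "dT ((1 / \<epsilon>) *\<^sub>R y) \<le> 2 * dT ((1 / \<epsilon>) *\<^sub>R z)" using True by (simp add: E_def h_def)
        then have "dT ((1 / \<epsilon>) *\<^sub>R y) * norm (G z) \<le> 2 * (dT ((1 / \<epsilon>) *\<^sub>R z) * norm (G z))"
          using mult_right_mono[of "dT ((1 / \<epsilon>) *\<^sub>R y)" "2 * dT ((1 / \<epsilon>) *\<^sub>R z)" "norm (G z)"] by simp
        then have "ennreal (dT ((1 / \<epsilon>) *\<^sub>R y) * norm (G z)) \<le> ennreal (2 * (dT ((1 / \<epsilon>) *\<^sub>R z) * norm (G z)))" by (rule ennreal_leI)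
        then show ?thesis using zr by (simp add: f_def ennreal_mult infdist_nonneg)
      qed simp
      have "F y = ennreal (dT ((1 / \<epsilon>) *\<^sub>R y)) * ennreal (norm (mollify_grad r G y))"
        using True by (simp add: F_def ennreal_mult infdist_nonneg)
      also have "\<dots> \<le> ennreal (dT ((1 / \<epsilon>) *\<^sub>R y)) * (ennreal (1 / ?N) * ball_mass (\<lambda>y. ennreal (norm (G y))) y r)"
        by (intro mult_left_mono mw(2) True) auto
      also have "\<dots> = ennreal (1 / ?N) * (ennreal (dT ((1 / \<epsilon>) *\<^sub>R y)) * ball_mass (\<lambda>y. ennreal (norm (G y))) y r)"
        by (simp only: ac_simps)
      also have "ennreal (dT ((1 / \<epsilon>) *\<^sub>R y)) * ball_mass (\<lambda>y. ennreal (norm (G y))) y r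
          = (\<integral>\<^sup>+z. ennreal (dT ((1 / \<epsilon>) *\<^sub>R y)) * (ennreal (norm (G z)) * indicator (cball y r) z) \<partial>lborel)"
        unfolding ball_mass_def by (rule nn_integral_cmult[symmetric]) measurable
      also have "ennreal (1 / ?N) * \<dots> \<le> ennreal (1 / ?N) * (\<integral>\<^sup>+z. ennreal 2 * (f z * indicator (cball y r) z) \<partial>lborel)"
        by (intro mult_left_mono nn_integral_mono d) auto
      also have "(\<integral>\<^sup>+z. ennreal 2 * (f z * indicator (cball y r) z) \<partial>lborel) = ennreal 2 * ball_mass f y r"
        unfolding ball_mass_def by (rule nn_integral_cmult) measurable
      also have "ennreal (1 / ?N) * (ennreal 2 * ball_mass f y r) = ennreal (2 / ?N) * ball_mass f y r"
      proof -
        have "ennreal (1 / ?N) * ennreal 2 = ennreal (2 / ?N)" using N by (subst ennreal_mult[symmetric]) auto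
        then show ?thesis by (simp only: mult.assoc[symmetric])
      qed
      finally show ?thesis .
    qed (simp add: F_def)
    have "ennreal (dT ?x * \<bar>mollify r u x\<bar>) = ennreal (dT ?x * \<bar>V ?x\<bar>)" using xU e by (simp add: V_def)
    also have "\<dots> \<le> ennreal C1 * riesz (\<lambda>y. ennreal (dT y * norm (g y)) * indicator {y. h < dT y} y) ?x"
      by (rule C1(2)[OF xT hx reg suppV])
    also have "(\<lambda>y. ennreal (dT y * norm (g y)) * indicator {y. h < dT y} y) = (\<lambda>y. ennreal \<epsilon> * F (0 + \<epsilon> *\<^sub>R y))"
    proof
      fix y
      have "ennreal (dT y * (\<epsilon> * norm (mollify_grad r G (\<epsilon> *\<^sub>R y)))) = ennreal \<epsilon> * ennreal (dT y * norm (mollify_grad r G (\<epsilon> *\<^sub>R y)))"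
        using e by (subst ennreal_mult[symmetric]) (auto simp: infdist_nonneg mult_ac)
      then show "ennreal (dT y * norm (g y)) * indicator {y. h < dT y} y = ennreal \<epsilon> * F (0 + \<epsilon> *\<^sub>R y)"
        using e by (auto simp: g_def F_def U_def E_def indicator_def)
    qed
    also have "riesz (\<lambda>y. ennreal \<epsilon> * F (0 + \<epsilon> *\<^sub>R y)) ?x = riesz F x"
      using riesz_affine[OF Fm e, of 0 ?x] e by simp
    also have "ennreal C1 * riesz F x \<le> ennreal C1 * riesz (\<lambda>y. ennreal (2 / ?N) * ball_mass f y r) x"
      by (intro mult_left_mono riesz_mono FF) auto
    also have "riesz (\<lambda>y. ennreal (2 / ?N) * ball_mass f y r) x = ennreal (2 / ?N) * riesz (\<lambda>y. ball_mass f y r) x"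
      by (rule riesz_cmult) measurable
    also have "ennreal C1 * (ennreal (2 / ?N) * riesz (\<lambda>y. ball_mass f y r) x) \<le> ennreal C1 * (ennreal (2 / ?N) * (ennreal (r powr ?d * c) * riesz f x))"
    proof (intro mult_left_mono)
      have "r * (2 * r) powr (?d - 1) = r powr 1 * r powr (?d - 1) * 2 powr (?d - 1)" using r by (simp add: powr_mult)
      also have "r powr 1 * r powr (?d - 1) = r powr ?d" unfolding powr_add[symmetric] by simp
      finally have "?w * (r * (?d - 1) * (2 * r) powr (?d - 1) + 2 powr (?d - 1) * r powr ?d) = r powr ?d * c"
        by (simp add: c_def algebra_simps)
      then show "riesz (\<lambda>y. ball_mass f y r) x \<le> ennreal (r powr ?d * c) * riesz f x"
        using riesz_ball_mass[OF fm dim r, of x] by simp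
    qed auto
    also have "\<dots> = ennreal (C1 * (2 / ?N1 * c)) * riesz f x"
    proof -
      \<comment> \<open>The mass of the bump scales like r^d and cancels the r^d of
        \<open>riesz_ball_mass\<close>, so the constant is free of r.\<close>
      have "C1 * (2 / ?N1 * c) = C1 * (2 / ?N * (r powr ?d * c))"
        using r N1 bump_mass_scale[OF r, where 'a='a] by simp
      also have "ennreal \<dots> = ennreal C1 * (ennreal (2 / ?N) * ennreal (r powr ?d * c))"
      proof -
        have "ennreal (2 / ?N * (r powr ?d * c)) = ennreal (2 / ?N) * ennreal (r powr ?d * c)"
          using N c by (intro ennreal_mult) auto
        moreover have "ennreal (C1 * (2 / ?N * (r powr ?d * c))) = ennreal C1 * ennreal (2 / ?N * (r powr ?d * c))"
          using C1(1) N c by (intro ennreal_mult) auto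
        ultimately show ?thesis by (simp only:)
      qed
      finally show ?thesis by (simp only: mult.assoc)
    qed
    also have "\<dots> \<le> ennreal C * riesz f x" using C by (intro mult_right_mono ennreal_leI) auto
    finally show "ennreal (dT ?x * \<bar>mollify r u x\<bar>) \<le> ennreal C * riesz (\<lambda>y. ennreal (dT ((1 / \<epsilon>) *\<^sub>R y) * norm (G y))) x"
      by (simp add: f_def[abs_def])
  qed
qed

text \<open>The complement of the holes is exhausted by compact sets, on each of which u is
  integrable and has mollifications converging almost everywhere. At an interior point small bumps
  do not see the cut-off, so the bound for the mollified u passes to the limit, its right side being
  independent of r.\<close>

lemma weak_pointwise_bound:
  "\<exists>C>0. \<forall>\<epsilon> u G R. 0 < \<epsilon> \<longrightarrow> u \<in> borel_measurable borel \<longrightarrow> G \<in> borel_measurable borel \<longrightarrow>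
     weak_gradient (- (*\<^sub>R) \<epsilon> ` T) u G \<longrightarrow> (\<forall>y. R < norm y \<longrightarrow> u y = 0) \<longrightarrow>
     (AE x in lborel. x \<notin> (*\<^sub>R) \<epsilon> ` T \<longrightarrow>
       ennreal (dT ((1 / \<epsilon>) *\<^sub>R x) * \<bar>u x\<bar>) \<le> ennreal C * riesz (\<lambda>y. ennreal (dT ((1 / \<epsilon>) *\<^sub>R y) * norm (G y))) x)"
proof -
  obtain C where C: "0 < C" "\<And>\<epsilon> u G R r x. 0 < \<epsilon> \<Longrightarrow> 0 < r \<Longrightarrow> u \<in> borel_measurable borel \<Longrightarrow> G \<in> borel_measurable borel \<Longrightarrow>
     weak_gradient (- (*\<^sub>R) \<epsilon> ` T) u G \<Longrightarrow> (\<forall>y. R < norm y \<longrightarrow> u y = 0) \<Longrightarrow> C * r < \<epsilon> * dT ((1 / \<epsilon>) *\<^sub>R x) \<Longrightarrow>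
     ennreal (dT ((1 / \<epsilon>) *\<^sub>R x) * \<bar>mollify r u x\<bar>) \<le> ennreal C * riesz (\<lambda>y. ennreal (dT ((1 / \<epsilon>) *\<^sub>R y) * norm (G y))) x"
    using mollified_pointwise_bound by blast
  show ?thesis
  proof (intro exI[of _ C] conjI C(1) allI impI)
    fix \<epsilon> u G R
    assume e: "(0::real) < \<epsilon>" and um: "u \<in> borel_measurable borel" and Gm: "G \<in> borel_measurable borel"
      and wg: "weak_gradient (- (*\<^sub>R) \<epsilon> ` T) u G" and supp: "\<forall>y. R < norm y \<longrightarrow> u y = 0"
    note [measurable] = um Gm
    let ?Te = "(*\<^sub>R) \<epsilon> ` T"
    have cl: "closed ?Te" by (rule closed_scaling[OF closed])
    let ?P = "\<lambda>x. ennreal (dT ((1 / \<epsilon>) *\<^sub>R x) * \<bar>u x\<bar>) \<le> ennreal C * riesz (\<lambda>y. ennreal (dT ((1 / \<epsilon>) *\<^sub>R y) * norm (G y))) x"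
    define K where "K n = {x \<in> cball 0 (real n). 1 / real n \<le> infdist x ?Te}" for n :: nat
    \<comment> \<open>The index 0 is left out: 1 / 0 = 0 would put no distance between the set and
      the holes.\<close>
    have "AE x in lborel. x \<in> interior (K n) \<longrightarrow> ?P x" if n: "0 < n" for n :: nat
    proof -
      have "closed {x. 1 / real n \<le> infdist x ?Te}" by (intro closed_Collect_le continuous_intros)
      then have "compact (cball 0 (real n) \<inter> {x. 1 / real n \<le> infdist x ?Te})" by (intro compact_Int_closed compact_cball)
      then have Kc: "compact (K n)" by (simp add: K_def Int_def)
      have KS: "K n \<subseteq> - ?Te"
      proof
        fix x assume "x \<in> K n"
        then have "infdist x ?Te \<noteq> 0" using n by (auto simp: K_def)
        then show "x \<in> - ?Te" by (metis ComplI infdist_zero)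
      qed
      define v where "v y = indicator (K n) y * u y" for y
      have v: "integrable lborel v" unfolding v_def by (rule weak_gradient_integrable(1)[OF wg um Gm Kc KS])
      obtain r where r: "\<And>k::nat. 0 < r k" "r \<longlonglongrightarrow> 0" "AE x in lborel. (\<lambda>k. mollify (r k) v x) \<longlonglongrightarrow> v x"
        using mollify_AE[OF v] by blast
      show ?thesis using r(3)
      proof eventually_elim
        case (elim x)
        show ?case
        proof
          assume x: "x \<in> interior (K n)"
          then obtain s where s: "0 < s" "cball x s \<subseteq> K n" using mem_interior_cball by blast
          have xK: "x \<in> K n" using x interior_subset by blast
          then have xT: "x \<notin> ?Te" using KS by blast
          have "(1 / \<epsilon>) *\<^sub>R x \<notin> T"
          proof
            assume "(1 / \<epsilon>) *\<^sub>R x \<in> T"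
            then have "\<epsilon> *\<^sub>R ((1 / \<epsilon>) *\<^sub>R x) \<in> ?Te" by blast
            then show False using xT e by simp
          qed
          then have dx: "0 < dT ((1 / \<epsilon>) *\<^sub>R x)" using dT_pos_iff by blast
          have "eventually (\<lambda>k. r k < min s (\<epsilon> * dT ((1 / \<epsilon>) *\<^sub>R x) / C)) sequentially"
            using s dx e C(1) by (intro order_tendstoD(2)[OF r(2)]) auto
          then have ev: "eventually (\<lambda>k. ennreal (dT ((1 / \<epsilon>) *\<^sub>R x) * \<bar>mollify (r k) v x\<bar>) \<le> ennreal C * riesz (\<lambda>y. ennreal (dT ((1 / \<epsilon>) *\<^sub>R y) * norm (G y))) x) sequentially"
          proof eventually_elim
            case (elim k)
            have "u y * bump (r k) (y - x) = v y * bump (r k) (y - x)" for y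
            proof (cases "norm (y - x) < r k")
              case True
              then have "y \<in> cball x s" using elim by (simp add: dist_norm norm_minus_commute)
              then show ?thesis using s by (auto simp: v_def)
            qed (use bump_eq_0[OF r(1)[of k], of "y - x"] in simp)
            then have "(\<lambda>y. u y * bump (r k) (y - x)) = (\<lambda>y. v y * bump (r k) (y - x))" by (intro ext)
            then have "mollify (r k) v x = mollify (r k) u x" unfolding mollify_def by (simp only:)
            moreover have "C * r k < \<epsilon> * dT ((1 / \<epsilon>) *\<^sub>R x)" using elim C(1) by (simp add: field_simps)
            ultimately show ?case using C(2)[OF e r(1)[of k] um Gm wg supp] by simp
          qed
          have "(\<lambda>k. ennreal (dT ((1 / \<epsilon>) *\<^sub>R x) * \<bar>mollify (r k) v x\<bar>)) \<longlonglongrightarrow> ennreal (dT ((1 / \<epsilon>) *\<^sub>R x) * \<bar>v x\<bar>)"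
            by (intro tendsto_ennrealI tendsto_intros elim)
          from tendsto_upperbound[OF this ev] have "ennreal (dT ((1 / \<epsilon>) *\<^sub>R x) * \<bar>v x\<bar>) \<le> ennreal C * riesz (\<lambda>y. ennreal (dT ((1 / \<epsilon>) *\<^sub>R y) * norm (G y))) x"
            by simp
          then show "?P x" using xK by (simp add: v_def)
        qed
      qed
    qed
    then have "AE x in lborel. \<forall>n::nat. 0 < n \<longrightarrow> x \<in> interior (K n) \<longrightarrow> ?P x"
      by (subst AE_all_countable) (auto simp: )
    then show "AE x in lborel. x \<notin> ?Te \<longrightarrow> ?P x"
    proof eventually_elim
      case (elim x)
      show ?case
      proof
        assume x: "x \<notin> ?Te"
        have "?Te \<noteq> {}" using nonempty by simp
        then have d: "0 < infdist x ?Te" using x cl infdist_pos_not_in_closed by blast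
        obtain n :: nat where n: "max (norm x + 1) (2 / infdist x ?Te) < real n" using reals_Archimedean2 by blast
        have n0: "0 < real n" using n norm_ge_zero[of x] by linarith
        have nd: "1 / real n \<le> infdist x ?Te / 2" using n d n0 by (simp add: field_simps)
        have "ball x (min 1 (infdist x ?Te / 2)) \<subseteq> K n"
        proof
          fix y assume y: "y \<in> ball x (min 1 (infdist x ?Te / 2))"
          have "norm y \<le> norm x + dist x y" using norm_triangle_ineq2[of y x] by (simp add: dist_norm norm_minus_commute)
          then have "norm y \<le> real n" using y n by simp
          moreover have "infdist x ?Te \<le> infdist y ?Te + dist x y" by (rule infdist_triangle)
          then have "1 / real n \<le> infdist y ?Te" using y nd by simp
          ultimately show "y \<in> K n" by (simp add: K_def)
        qed
        then have "x \<in> interior (K n)" using d by (meson centre_in_ball interior_maximal min_less_iff_conj open_ball subsetD zero_less_one half_gt_zero)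
        then show "?P x" using elim n0 by simp
      qed
    qed
  qed
qed

end

section \<open>Complements of separated holes\<close>

text \<open>The Lipschitz bound is asked on the ball only, since a smooth graph function has bounded
  derivatives there but perhaps not on the whole space. The vector n points out of U.\<close>

definition local_graph :: "'a::euclidean_space set \<Rightarrow> 'a \<Rightarrow> 'a \<Rightarrow> ('a \<Rightarrow> real) \<Rightarrow> real \<Rightarrow> real \<Rightarrow> bool" where
  "local_graph U x n g L r \<longleftrightarrow> 0 < r \<and> 0 \<le> L \<and> norm n = 1 \<and> (\<forall>y t. g (y + t *\<^sub>R n) = g y) \<and>
     (\<forall>y\<in>ball x r. \<forall>z\<in>ball x r. \<bar>g y - g z\<bar> \<le> L * dist y z) \<and>
     U \<inter> ball x r = {y \<in> ball x r. y \<bullet> n < g y}"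

lemma local_graph_mono: "local_graph U x n g L r \<Longrightarrow> 0 < s \<Longrightarrow> s \<le> r \<Longrightarrow> local_graph U x n g L s"
  unfolding local_graph_def by (auto simp: set_eq_iff)

context
  fixes U :: "'a::euclidean_space set" and x n :: 'a and g :: "'a \<Rightarrow> real" and L r :: real
  assumes lg: "local_graph U x n g L r"
begin

lemma local_graph_facts:
  shows "0 < r" "0 \<le> L" "norm n = 1" "n \<bullet> n = 1" "g (y + t *\<^sub>R n) = g y"
    and "y \<in> ball x r \<Longrightarrow> z \<in> ball x r \<Longrightarrow> \<bar>g y - g z\<bar> \<le> L * dist y z"
    and "y \<in> ball x r \<Longrightarrow> y \<in> U \<longleftrightarrow> y \<bullet> n < g y"
  using lg unfolding local_graph_def by (auto simp: set_eq_iff norm_eq_1)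

lemma local_graph_closure:
  assumes y: "y \<in> ball x r"
  shows "y \<in> closure U \<longleftrightarrow> y \<bullet> n \<le> g y"
proof
  assume "y \<in> closure U"
  show "y \<bullet> n \<le> g y"
  proof (rule ccontr)
    assume "\<not> y \<bullet> n \<le> g y"
    then have d: "0 < y \<bullet> n - g y" by simp
    \<comment> \<open>A point of U within s of y cannot bridge the gap: height and graph together
      change by at most (1 + L) s, which is half of it.\<close>
    define s where "s = min (r - dist x y) ((y \<bullet> n - g y) / (2 * (1 + L)))"
    have s: "0 < s" "s \<le> r - dist x y" "s \<le> (y \<bullet> n - g y) / (2 * (1 + L))"
      using d y local_graph_facts(2) by (auto simp: s_def)
    obtain z where z: "z \<in> U" "dist z y < s" using \<open>y \<in> closure U\<close> s(1) by (auto simp: closure_approachable)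
    have zb: "z \<in> ball x r" using z s dist_triangle[of x z y] by (simp add: dist_commute)
    have "z \<bullet> n < g z" using local_graph_facts(7)[OF zb] z by simp
    also have "g z \<le> g y + L * dist z y" using local_graph_facts(6)[OF zb y] by linarith
    finally have "y \<bullet> n - g y < L * dist z y + (y - z) \<bullet> n" by (simp add: inner_diff_left)
    also have "(y - z) \<bullet> n \<le> norm (y - z) * norm n" by (rule norm_cauchy_schwarz)
    also have "norm (y - z) * norm n = dist z y" by (simp add: local_graph_facts(3) dist_norm norm_minus_commute)
    also have "L * dist z y + dist z y = (1 + L) * dist z y" by (simp add: algebra_simps)
    also have "\<dots> \<le> (1 + L) * ((y \<bullet> n - g y) / (2 * (1 + L)))" using z s local_graph_facts(2) by (intro mult_left_mono) auto
    also have "\<dots> = (y \<bullet> n - g y) / 2"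
    proof -
      have "k * (D / (2 * k)) = D / 2" if "0 < k" for k D :: real using that by simp
      then show ?thesis using local_graph_facts(2) by (simp only: add_pos_nonneg zero_less_one)
    qed
    finally show False using d by simp
  qed
next
  assume le: "y \<bullet> n \<le> g y"
  show "y \<in> closure U" unfolding closure_approachable
  proof (intro allI impI)
    fix e :: real assume e: "0 < e"
    define t where "t = min e (r - dist x y) / 2"
    have t: "0 < t" "t < e" "t < r - dist x y" using e y by (auto simp: t_def min_def)
    let ?z = "y + (- t) *\<^sub>R n"
    have dz: "dist ?z y = t" using t by (simp add: dist_norm local_graph_facts(3))
    have "dist x ?z \<le> dist x y + dist ?z y" by (rule dist_triangle2)
    then have zb: "?z \<in> ball x r" using dz t by simp
    have "?z \<bullet> n < g ?z" unfolding local_graph_facts(5) using le t by (simp add: inner_diff_left local_graph_facts(4))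
    then have "?z \<in> U" using local_graph_facts(7)[OF zb] by simp
    then show "\<exists>z\<in>U. dist z y < e" using dz t by (intro bexI[of _ ?z]) auto
  qed
qed

lemma local_graph_frontier_point:
  assumes x: "x \<in> frontier U" "open U"
  shows "x \<bullet> n = g x"
proof -
  have xb: "x \<in> ball x r" using local_graph_facts(1) by simp
  have "x \<in> closure U" "x \<notin> U" using x by (auto simp: frontier_def interior_open)
  then show ?thesis using local_graph_closure[OF xb] local_graph_facts(7)[OF xb] by simp
qed

text \<open>At \<open>y + t *\<^sub>R n\<close> the height above the graph exceeds t, and moving to
  a point on or below the graph closes this gap at rate at most 1 + L. Points w outside the ball are
  farther away than t in any case.\<close>

lemma local_graph_cone:
  assumes y: "y \<in> ball x (r / 4)" "y \<notin> closure U" and t: "0 \<le> t" "t \<le> r / 4" and w: "w \<in> closure U"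
  shows "t / (1 + L) \<le> dist (y + t *\<^sub>R n) w"
proof -
  note f = local_graph_facts
  let ?y = "y + t *\<^sub>R n"
  have "dist x ?y \<le> dist x y + dist ?y y" by (rule dist_triangle2)
  also have "dist ?y y = t" using t by (simp add: dist_norm f(3))
  finally have yd: "dist x ?y < r / 2" using y t by simp
  have tL: "t / (1 + L) \<le> t" using f(2) t by (simp add: divide_le_eq mult_le_cancel_left1 add_nonneg_pos)
  show ?thesis
  proof (cases "w \<in> ball x r")
    case True
    have yb: "y \<in> ball x r" "?y \<in> ball x r" using y yd f(1) by auto
    have "w \<bullet> n \<le> g w" using local_graph_closure[OF True] w by simp
    moreover have "g y < y \<bullet> n" using local_graph_closure[OF yb(1)] y by simp
    moreover have "g w \<le> g ?y + L * dist ?y w" using f(6)[OF True yb(2)] dist_commute[of w ?y] by simp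
    ultimately have "t \<le> L * dist ?y w + (?y - w) \<bullet> n" unfolding f(5) by (simp add: inner_diff_left inner_add_left f(4))
    also have "(?y - w) \<bullet> n \<le> norm (?y - w) * norm n" by (rule norm_cauchy_schwarz)
    also have "norm (?y - w) * norm n = dist ?y w" by (simp add: f(3) dist_norm)
    finally have "t \<le> (1 + L) * dist ?y w" by (simp add: algebra_simps)
    then show ?thesis using f(2) by (simp add: divide_le_eq add_nonneg_pos mult.commute)
  next
    case False
    have "dist x w \<le> dist x ?y + dist ?y w" by (rule dist_triangle)
    then have "t \<le> dist ?y w" using False yd t f(1) by simp
    then show ?thesis using tL by simp
  qed
qed

text \<open>Lift both points in the direction n, which keeps them above the graph, until the whole
  translated ball lies above the graph, and join them inside that ball.\<close>

lemma local_graph_outer_connected: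
  assumes x: "x \<in> frontier U" "open U" and s: "0 < s" "(4 + L) * s \<le> r"
    and y: "y \<in> ball x s" "y \<notin> closure U" and z: "z \<in> ball x s" "z \<notin> closure U"
  shows "\<exists>C. connected C \<and> y \<in> C \<and> z \<in> C \<and> C \<subseteq> ball x r - closure U"
proof -
  note f = local_graph_facts
  have gx: "x \<bullet> n = g x" by (rule local_graph_frontier_point[OF x])
  \<comment> \<open>Over \<open>ball x s\<close> the graph rises by at most L s above its value at x
    and the heights of points differ from that of x by less than s; one more s is reserve. The
    lifted points then stay within (3 + L) s of x.\<close>
  define h where "h = (2 + L) * s"
  have h: "0 < h" using f(2) s by (simp add: h_def add_pos_nonneg)
  have hs: "h + s < r"
  proof -
    have "h + s = (3 + L) * s" by (simp add: h_def algebra_simps)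
    also have "\<dots> < (4 + L) * s" using s by (intro mult_strict_right_mono) auto
    finally show ?thesis using s by linarith
  qed
  have sr: "s < r" using hs h by linarith
  have inb: "q + t *\<^sub>R n \<in> ball x r" if "q \<in> ball x s" "0 \<le> t" "t \<le> h" for q t
  proof -
    have "dist x (q + t *\<^sub>R n) \<le> dist x q + dist (q + t *\<^sub>R n) q" by (rule dist_triangle2)
    also have "dist (q + t *\<^sub>R n) q = t" using that by (simp add: dist_norm f(3))
    finally show ?thesis using that hs by simp
  qed
  have up: "q + t *\<^sub>R n \<in> ball x r - closure U" if "q \<in> ball x s" "q \<notin> closure U" "0 \<le> t" "t \<le> h" for q t
  proof -
    have qb: "q \<in> ball x r" using that sr by simp
    have "g q < q \<bullet> n" using local_graph_closure[OF qb] that by simp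
    then have "\<not> (q + t *\<^sub>R n) \<bullet> n \<le> g (q + t *\<^sub>R n)" unfolding f(5) using that by (simp add: inner_add_left f(4))
    then show ?thesis using local_graph_closure[OF inb[OF that(1,3,4)]] inb[OF that(1,3,4)] by simp
  qed
  have top: "q + h *\<^sub>R n \<in> ball x r - closure U" if q: "q \<in> ball x s" for q
  proof -
    have qb: "q \<in> ball x r" "x \<in> ball x r" using q sr f(1) by auto
    have "g q \<le> g x + L * dist q x" using f(6)[OF qb] by linarith
    also have "\<dots> \<le> g x + L * s" using q f(2) by (intro add_left_mono mult_left_mono) (auto simp: dist_commute)
    finally have 1: "g q \<le> x \<bullet> n + L * s" by (simp add: gx)
    have "(x - q) \<bullet> n \<le> norm (x - q) * norm n" by (rule norm_cauchy_schwarz)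
    also have "\<dots> < s" using q by (simp add: f(3) dist_norm)
    finally have 2: "x \<bullet> n < q \<bullet> n + s" by (simp add: inner_diff_left)
    have "h = s + L * s + s" by (simp add: h_def algebra_simps)
    then have "g q < q \<bullet> n + h" using 1 2 s by linarith
    then have "\<not> (q + h *\<^sub>R n) \<bullet> n \<le> g (q + h *\<^sub>R n)" unfolding f(5) by (simp add: inner_add_left f(4))
    then show ?thesis using local_graph_closure[OF inb[OF q]] inb[OF q] h by simp
  qed
  let ?A = "(\<lambda>t. y + t *\<^sub>R n) ` {0..h}" and ?B = "(\<lambda>t. z + t *\<^sub>R n) ` {0..h}" and ?M = "(\<lambda>q. q + h *\<^sub>R n) ` ball x s"
  have cA: "connected ?A" "connected ?B" "connected ?M"
    by (intro connected_continuous_image continuous_intros connected_Icc convex_connected convex_ball)+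
  have "y + h *\<^sub>R n \<in> ?A \<inter> ?M" using h y by auto
  then have "connected (?A \<union> ?M)" using connected_Un[OF cA(1,3)] by blast
  moreover have "z + h *\<^sub>R n \<in> (?A \<union> ?M) \<inter> ?B" using h z by auto
  ultimately have "connected (?A \<union> ?M \<union> ?B)" using connected_Un[OF _ cA(2)] by blast
  moreover have "y \<in> ?A" "z \<in> ?B" using h by (force simp: image_iff intro!: bexI[of _ 0])+
  moreover have "?A \<union> ?M \<union> ?B \<subseteq> ball x r - closure U" using up[OF y] up[OF z] top by auto
  ultimately show ?thesis by blast
qed

lemma local_graph_outer_approach:
  assumes x: "x \<in> frontier U" "open U" and y: "y \<in> ball x r" "y \<in> frontier U" and e: "0 < e"
  shows "\<exists>z\<in>ball y e. z \<in> ball x r \<and> z \<notin> closure U"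
proof -
  note f = local_graph_facts
  have "y \<in> closure U" "y \<notin> U" using y x by (auto simp: frontier_def interior_open)
  then have gy: "y \<bullet> n = g y" using local_graph_closure[OF y(1)] f(7)[OF y(1)] by simp
  define t where "t = min e (r - dist x y) / 2"
  have t: "0 < t" "t < e" "t < r - dist x y" using e y by (auto simp: t_def min_def)
  let ?z = "y + t *\<^sub>R n"
  have dz: "dist ?z y = t" using t by (simp add: dist_norm f(3))
  have "dist x ?z \<le> dist x y + dist ?z y" by (rule dist_triangle2)
  then have zb: "?z \<in> ball x r" using dz t by simp
  have "\<not> ?z \<bullet> n \<le> g ?z" unfolding f(5) using gy t by (simp add: inner_add_left f(4))
  then have "?z \<notin> closure U" using local_graph_closure[OF zb] by simp
  then show ?thesis using zb dz t by (intro bexI[of _ ?z]) (auto simp: dist_commute)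
qed

end

text \<open>Continuity bounds the partial derivatives on the compact closed ball, and convexity of
  the ball turns this into a Lipschitz bound.\<close>

lemma smooth_boundary_local_graph:
  assumes "smooth_boundary U" "x \<in> frontier U"
  shows "\<exists>n g L r. local_graph U x n g L r"
proof -
  obtain r n g where r: "0 < r" "norm n = 1" "smooth_on UNIV g" "\<forall>y t. g (y + t *\<^sub>R n) = g y"
    "U \<inter> ball x r = {y \<in> ball x r. y \<bullet> n < g y}"
    using assms unfolding smooth_boundary_def boundary_locally_graph_def by (elim ballE exE conjE) auto
  have "Ck (Suc 0) UNIV g" using r(3) unfolding smooth_on_def by blast
  then have d: "g differentiable_on UNIV" and c: "\<And>v. continuous_on UNIV (\<lambda>y. frechet_derivative g (at y) v)" by auto
  have "\<exists>M. \<forall>y\<in>cball x r. \<bar>frechet_derivative g (at y) b\<bar> \<le> M" for b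
  proof -
    have "bounded ((\<lambda>y. frechet_derivative g (at y) b) ` cball x r)"
      by (intro compact_imp_bounded compact_continuous_image continuous_on_subset[OF c]) auto
    then show ?thesis by (auto simp: bounded_iff)
  qed
  then obtain M where M: "\<And>b y. y \<in> cball x r \<Longrightarrow> \<bar>frechet_derivative g (at y) b\<bar> \<le> M b" by metis
  define L where "L = \<bar>\<Sum>b\<in>Basis. M b\<bar>"
  have der: "(g has_derivative frechet_derivative g (at y)) (at y)" for y
    using d by (auto simp: differentiable_on_def frechet_derivative_works)
  have on: "onorm (frechet_derivative g (at y)) \<le> L" if "y \<in> cball x r" for y
  proof (rule onorm_le)
    fix v
    have lin: "linear (frechet_derivative g (at y))" using der has_derivative_linear by blast
    have "frechet_derivative g (at y) v = frechet_derivative g (at y) (\<Sum>b\<in>Basis. (v \<bullet> b) *\<^sub>R b)" by (simp add: euclidean_representation)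
    also have "\<dots> = (\<Sum>b\<in>Basis. (v \<bullet> b) * frechet_derivative g (at y) b)" using lin by (simp add: linear_sum linear_scale)
    finally have "norm (frechet_derivative g (at y) v) \<le> (\<Sum>b\<in>Basis. \<bar>(v \<bullet> b) * frechet_derivative g (at y) b\<bar>)" by (simp add: sum_abs)
    also have "\<dots> \<le> (\<Sum>b\<in>Basis. norm v * M b)"
      unfolding abs_mult using M[OF that] Basis_le_norm by (intro sum_mono mult_mono) auto
    also have "\<dots> = (\<Sum>b\<in>Basis. M b) * norm v" by (simp add: sum_distrib_left mult.commute)
    also have "\<dots> \<le> L * norm v" unfolding L_def by (intro mult_right_mono) auto
    finally show "norm (frechet_derivative g (at y) v) \<le> L * norm v" .
  qed
  have lip: "\<bar>g y - g z\<bar> \<le> L * dist y z" if "y \<in> ball x r" "z \<in> ball x r" for y z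
  proof -
    have "norm (g y - g z) \<le> L * norm (y - z)"
      by (rule differentiable_bound[of "cball x r" g "\<lambda>y. frechet_derivative g (at y)"])
         (use that on in \<open>auto intro: has_derivative_at_withinI[OF der]\<close>)
    then show ?thesis by (simp add: dist_norm)
  qed
  have "local_graph U x n g L r" unfolding local_graph_def using r lip by (auto simp: L_def)
  then show ?thesis by blast
qed

lemma local_graph_translate:
  assumes "local_graph U x n g L r"
  shows "local_graph ((+) a ` U) (a + x) n (\<lambda>y. g (y - a) + a \<bullet> n) L r"
proof -
  note f = local_graph_facts[OF assms]
  have g: "g (y + t *\<^sub>R n - a) = g (y - a)" for y t using f(5)[of "y - a" t] by (simp add: algebra_simps)
  have b: "y \<in> ball (a + x) r \<longleftrightarrow> y - a \<in> ball x r" for y by (simp add: dist_norm algebra_simps)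
  have i: "y \<in> (+) a ` U \<longleftrightarrow> y - a \<in> U" for y by (force simp: image_iff)
  have "\<bar>g (y - a) - g (z - a)\<bar> \<le> L * dist y z" if "y \<in> ball (a + x) r" "z \<in> ball (a + x) r" for y z
    using f(6)[of "y - a" "z - a"] that b by (simp add: dist_norm)
  moreover have "y \<in> (+) a ` U \<longleftrightarrow> y \<bullet> n < g (y - a) + a \<bullet> n" if "y \<in> ball (a + x) r" for y
    using f(7)[of "y - a"] that unfolding b i by (simp add: inner_diff_left diff_less_eq)
  ultimately show ?thesis unfolding local_graph_def using f(1-3) g by (auto simp: set_eq_iff)
qed

text \<open>The index set may be infinite, as for all lattice translates; the common gap \<rho>
  makes the family locally finite, so every local question concerns a single hole.\<close>

locale separated_holes =
  fixes I :: "'i set" and hole :: "'i \<Rightarrow> 'a::euclidean_space set" and \<rho> :: real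
  assumes \<rho>: "0 < \<rho>"
    and open_hole: "\<And>h. h \<in> I \<Longrightarrow> open (hole h)"
    and separated: "\<And>h k x y. h \<in> I \<Longrightarrow> k \<in> I \<Longrightarrow> x \<in> closure (hole h) \<Longrightarrow> y \<in> closure (hole k) \<Longrightarrow> dist x y < \<rho> \<Longrightarrow> h = k"
    and connected_frontier: "\<And>h. h \<in> I \<Longrightarrow> connected (frontier (hole h))"
    and graph: "\<And>h x. h \<in> I \<Longrightarrow> x \<in> frontier (hole h) \<Longrightarrow> \<exists>n g L r. local_graph (hole h) x n g L r"
begin

definition "holes = (\<Union>h\<in>I. closure (hole h))"

text \<open>A ball of radius \<rho>/2 meets the closure of at most one hole, so locally the union is
  one closed set.\<close>

lemma closed_holes: "closed holes"
proof -
  have "open (- holes)" unfolding open_contains_ball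
  proof
    fix x assume x: "x \<in> - holes"
    show "\<exists>e>0. ball x e \<subseteq> - holes"
    proof (cases "ball x (\<rho> / 2) \<inter> holes = {}")
      case True
      then show ?thesis using \<rho> by (intro exI[of _ "\<rho> / 2"]) auto
    next
      case False
      then obtain h y where h: "h \<in> I" "y \<in> closure (hole h)" "y \<in> ball x (\<rho> / 2)" by (auto simp: holes_def)
      have "x \<in> - closure (hole h)" using x h by (auto simp: holes_def)
      then obtain e where e: "0 < e" "ball x e \<subseteq> - closure (hole h)"
        using open_contains_ball[of "- closure (hole h)"] by auto
      have "ball x (min e (\<rho> / 2)) \<subseteq> - holes"
      proof
        fix z assume z: "z \<in> ball x (min e (\<rho> / 2))"
        show "z \<in> - holes"
        proof
          assume "z \<in> holes"
          then obtain k where k: "k \<in> I" "z \<in> closure (hole k)" by (auto simp: holes_def)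
          have "dist y z \<le> dist x y + dist x z" by (rule dist_triangle3)
          then have "dist y z < \<rho>" using h z by simp
          then have "h = k" using separated[OF h(1) k(1) h(2) k(2)] by simp
          then show False using k z e by auto
        qed
      qed
      then show ?thesis using e \<rho> by (intro exI[of _ "min e (\<rho> / 2)"]) auto
    qed
  qed
  then show ?thesis by (simp add: closed_def)
qed

lemma not_in_frontier_iff:
  assumes "h \<in> I" "x \<in> closure (hole h)"
  shows "x \<in> frontier (hole h) \<longleftrightarrow> x \<notin> hole h"
  using assms open_hole by (auto simp: frontier_def interior_open)

text \<open>Off the holes the distance stays positive nearby and n = 0 works; inside a hole there is
  nothing to show; at a boundary point the graph supplies the cone.\<close>

lemma cone_property:
  assumes ne: "holes \<noteq> {}"
  shows "\<exists>n r c t0. norm n \<le> 1 \<and> 0 < r \<and> 0 < c \<and> 0 < t0 \<and>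
       (\<forall>y\<in>ball x r - holes. \<forall>t\<in>{0..t0}. c * t \<le> infdist (y + t *\<^sub>R n) holes)"
proof (cases "x \<in> holes")
  case False
  let ?d = "infdist x holes"
  have d: "0 < ?d" using False ne closed_holes infdist_pos_not_in_closed by blast
  show ?thesis
  proof (rule exI[of _ 0], rule exI[of _ "?d / 2"], rule exI[of _ "?d / 2"], rule exI[of _ 1], intro conjI ballI)
    fix y t assume y: "y \<in> ball x (?d / 2) - holes" and t: "t \<in> {0..1::real}"
    have "?d \<le> infdist y holes + dist x y" by (rule infdist_triangle)
    then have "?d / 2 \<le> infdist y holes" using y by simp
    moreover have "?d / 2 * t \<le> ?d / 2 * 1" using d t by (intro mult_left_mono) auto
    ultimately show "?d / 2 * t \<le> infdist (y + t *\<^sub>R 0) holes" by simp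
  qed (use d in auto)
next
  case True
  then obtain h where h: "h \<in> I" "x \<in> closure (hole h)" by (auto simp: holes_def)
  show ?thesis
  proof (cases "x \<in> hole h")
    case True
    then obtain e where e: "0 < e" "ball x e \<subseteq> hole h" using open_hole[OF h(1)] open_contains_ball by blast
    then have "ball x e - holes = {}" using h closure_subset by (fastforce simp: holes_def)
    then show ?thesis using e by (intro exI[of _ 0] exI[of _ e] exI[of _ 1]) auto
  next
    case False
    then have x: "x \<in> frontier (hole h)" using not_in_frontier_iff h by blast
    then obtain n g L r0 where lg0: "local_graph (hole h) x n g L r0" using graph h by blast
    \<comment> \<open>With r at most half the gap, the other holes stay farther away than the cone
      reaches.\<close>
    define r where "r = min r0 (\<rho> / 2)"
    have lg: "local_graph (hole h) x n g L r"
      using local_graph_facts(1)[OF lg0] \<rho> by (intro local_graph_mono[OF lg0]) (auto simp: r_def)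
    note f = local_graph_facts[OF lg]
    have r: "r \<le> \<rho> / 2" by (simp add: r_def)
    have L: "0 < 1 / (1 + L)" using f(2) by simp
    show ?thesis
    proof (rule exI[of _ n], rule exI[of _ "r / 4"], rule exI[of _ "1 / (1 + L)"], rule exI[of _ "r / 4"], intro conjI ballI)
      fix y t assume y: "y \<in> ball x (r / 4) - holes" and t: "t \<in> {0..r / 4}"
      let ?y = "y + t *\<^sub>R n"
      obtain w where w: "w \<in> holes" "infdist ?y holes = dist ?y w"
        using infdist_attains_inf[OF closed_holes ne] by blast
      have "1 / (1 + L) * t \<le> dist ?y w"
      proof (cases "w \<in> closure (hole h)")
        case True
        have "y \<notin> closure (hole h)" using y h by (auto simp: holes_def)
        then show ?thesis using local_graph_cone[OF lg _ _ _ _ True, of y t] y t by auto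
      next
        case False
        obtain k where k: "k \<in> I" "w \<in> closure (hole k)" using w by (auto simp: holes_def)
        have far: "\<not> dist x w < \<rho>" using separated[OF h(1) k(1) h(2) k(2)] k False by blast
        have "dist x ?y \<le> dist x y + dist ?y y" by (rule dist_triangle2)
        also have "dist ?y y = t" using t by (simp add: dist_norm f(3))
        finally have "dist x ?y \<le> r / 2" using y t by simp
        moreover have "dist x w \<le> dist x ?y + dist ?y w" by (rule dist_triangle)
        ultimately have "t \<le> dist ?y w" using far r t f(1) by simp
        moreover have "1 / (1 + L) * t \<le> 1 * t" using t f(2) by (intro mult_right_mono) auto
        ultimately show ?thesis by simp
      qed
      then show "1 / (1 + L) * t \<le> infdist ?y holes" using w by simp
    qed (use f L in auto)
  qed
qed

text \<open>The radius is shrunk twice: below \<rho> to keep other holes away, and by the factor 4 +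
  L so that two outside points can be joined above the graph within the larger ball.\<close>

lemma outer_part:
  assumes h: "h \<in> I" and x: "x \<in> frontier (hole h)"
  obtains s where "0 < s" "s \<le> \<rho>" "ball x s - closure (hole h) \<subseteq> - holes"
    "\<And>y z. y \<in> ball x s - closure (hole h) \<Longrightarrow> z \<in> ball x s - closure (hole h) \<Longrightarrow> \<exists>C. connected C \<and> y \<in> C \<and> z \<in> C \<and> C \<subseteq> - holes"
    "\<And>y e. y \<in> ball x s \<Longrightarrow> y \<in> frontier (hole h) \<Longrightarrow> 0 < e \<Longrightarrow> \<exists>z\<in>ball y e. z \<in> ball x s - closure (hole h)"
proof -
  obtain n g L r0 where lg0: "local_graph (hole h) x n g L r0" using graph h x by blast
  define r where "r = min r0 \<rho>"
  have lg: "local_graph (hole h) x n g L r"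
    using local_graph_facts(1)[OF lg0] \<rho> by (intro local_graph_mono[OF lg0]) (auto simp: r_def)
  note f = local_graph_facts[OF lg]
  have r: "r \<le> \<rho>" by (simp add: r_def)
  have xc: "x \<in> closure (hole h)" using x by (auto simp: frontier_def)
  have out: "ball x r - closure (hole h) \<subseteq> - holes"
  proof
    fix y assume y: "y \<in> ball x r - closure (hole h)"
    show "y \<in> - holes"
    proof
      assume "y \<in> holes"
      then obtain k where k: "k \<in> I" "y \<in> closure (hole k)" by (auto simp: holes_def)
      then have "h = k" using separated[OF h k(1) xc k(2)] y r by simp
      then show False using k y by blast
    qed
  qed
  define s where "s = r / (4 + L)"
  have s: "0 < s" "(4 + L) * s \<le> r" using f by (auto simp: s_def)
  have "1 * s \<le> (4 + L) * s" using s(1) f(2) by (intro mult_right_mono) auto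
  then have sr: "s \<le> r" using s(2) by linarith
  have lgs: "local_graph (hole h) x n g L s" by (rule local_graph_mono[OF lg s(1) sr])
  show thesis
  proof (rule that[of s])
    show "0 < s" "s \<le> \<rho>" using s sr r by auto
    show "ball x s - closure (hole h) \<subseteq> - holes" using out subset_ball[OF sr, of x] by blast
    show "\<exists>C. connected C \<and> y \<in> C \<and> z \<in> C \<and> C \<subseteq> - holes"
      if "y \<in> ball x s - closure (hole h)" "z \<in> ball x s - closure (hole h)" for y z
      using local_graph_outer_connected[OF lg x open_hole[OF h] s, of y z] that out by blast
    show "\<exists>z\<in>ball y e. z \<in> ball x s - closure (hole h)" if "y \<in> ball x s" "y \<in> frontier (hole h)" "0 < e" for y e
      using local_graph_outer_approach[OF lgs x open_hole[OF h] that] by blast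
  qed
qed

text \<open>A component of the complement, together with all holes that it touches, is open and closed,
  because a connected boundary is touched either everywhere or nowhere.\<close>
lemma connected_complement: "connected (- holes)"
proof -
  have "connected_component (- holes) a b" if a: "a \<in> - holes" and b: "b \<in> - holes" for a b
  proof -
    define W where "W = connected_component_set (- holes) a"
    have WD: "W \<subseteq> - holes" unfolding W_def by (rule connected_component_subset)
    have Wmax: "C \<subseteq> W" if "connected C" "C \<subseteq> - holes" "C \<inter> W \<noteq> {}" for C
      using that unfolding W_def
      by (metis connected_component_eq connected_component_maximal disjoint_iff)
    have opW: "open W" unfolding W_def using closed_holes by (intro open_connected_component) auto
    \<comment> \<open>Points just outside the hole are joined within the complement, so they all
      belong to the same component.\<close>
    have dich: "ball x s - closure (hole h) \<subseteq> W \<or> ball x s \<inter> W = {}"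
      if "ball x s - closure (hole h) \<subseteq> - holes" and hI: "h \<in> I"
        and conn: "\<And>y z. y \<in> ball x s - closure (hole h) \<Longrightarrow> z \<in> ball x s - closure (hole h) \<Longrightarrow> \<exists>C. connected C \<and> y \<in> C \<and> z \<in> C \<and> C \<subseteq> - holes"
      for x s h
    proof (cases "ball x s \<inter> W = {}")
      case False
      then obtain y where y: "y \<in> ball x s" "y \<in> W" by blast
      then have yo: "y \<in> ball x s - closure (hole h)" using WD hI by (auto simp: holes_def)
      have "z \<in> W" if z: "z \<in> ball x s - closure (hole h)" for z
      proof -
        obtain C where "connected C" "y \<in> C" "z \<in> C" "C \<subseteq> - holes" using conn[OF yo z] by blast
        then show ?thesis using Wmax[of C] y by blast
      qed
      then show ?thesis by blast
    qed simp
    define touched where "touched h \<longleftrightarrow> closure W \<inter> frontier (hole h) \<noteq> {}" for h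
    \<comment> \<open>The touched part of the boundary is relatively closed as an intersection; it
      is relatively open because near a touched point the whole outside belongs to W and accumulates
      at every boundary point nearby.\<close>
    have all: "frontier (hole h) \<subseteq> closure W" if h: "h \<in> I" and t: "touched h" for h
    proof -
      let ?F = "closure W \<inter> frontier (hole h)"
      have "openin (top_of_set (frontier (hole h))) ?F"
      proof (subst openin_subopen, intro ballI)
        fix x assume x: "x \<in> ?F"
        then have xf: "x \<in> frontier (hole h)" by blast
        obtain s where s: "0 < s" "s \<le> \<rho>" "ball x s - closure (hole h) \<subseteq> - holes"
          "\<And>y z. y \<in> ball x s - closure (hole h) \<Longrightarrow> z \<in> ball x s - closure (hole h) \<Longrightarrow> \<exists>C. connected C \<and> y \<in> C \<and> z \<in> C \<and> C \<subseteq> - holes"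
          "\<And>y e. y \<in> ball x s \<Longrightarrow> y \<in> frontier (hole h) \<Longrightarrow> 0 < e \<Longrightarrow> \<exists>z\<in>ball y e. z \<in> ball x s - closure (hole h)"
          using outer_part[OF h xf] by metis
        have "ball x s \<inter> W \<noteq> {}"
          using x s(1) by (auto simp: closure_approachable dist_commute disjoint_iff)
        then have o: "ball x s - closure (hole h) \<subseteq> W" using dich[OF s(3) h s(4)] by blast
        have "y \<in> closure W" if "y \<in> ball x s" "y \<in> frontier (hole h)" for y
          unfolding closure_approachable
        proof (intro allI impI)
          fix e :: real assume "0 < e"
          then show "\<exists>z\<in>W. dist z y < e" using s(5)[OF that, of e] o by (metis dist_commute mem_ball subsetD)
        qed
        then show "\<exists>T. openin (top_of_set (frontier (hole h))) T \<and> x \<in> T \<and> T \<subseteq> ?F"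
          using s(1) xf by (intro exI[of _ "frontier (hole h) \<inter> ball x s"]) (auto intro: openin_open_Int)
      qed
      moreover have "closedin (top_of_set (frontier (hole h))) ?F"
        by (metis closed_closure closedin_closed_Int inf_commute)
      ultimately have "?F = {} \<or> ?F = frontier (hole h)"
        using connected_frontier[OF h] unfolding connected_clopen by blast
      then show ?thesis using t by (auto simp: touched_def)
    qed
    define H where "H = W \<union> (\<Union>h\<in>{h\<in>I. touched h}. closure (hole h))"
    have dec: "\<exists>s>0. ball x s \<subseteq> H \<or> ball x s \<inter> H = {}" for x
    proof (cases "x \<in> holes")
      case False
      then obtain s where s: "0 < s" "ball x s \<subseteq> - holes" using closed_holes open_contains_ball[of "- holes"] by auto
      have "ball x s \<subseteq> W \<or> ball x s \<inter> W = {}" using Wmax[of "ball x s"] s by auto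
      moreover have "ball x s \<inter> closure (hole h) = {}" if "h \<in> I" for h using s that by (auto simp: holes_def)
      ultimately show ?thesis using s unfolding H_def by blast
    next
      case True
      then obtain h where h: "h \<in> I" "x \<in> closure (hole h)" by (auto simp: holes_def)
      have only: "k = h" if "k \<in> I" "y \<in> closure (hole k)" "y \<in> ball x \<rho>" for k y
        using separated[OF h(1) that(1) h(2) that(2)] that by simp
      show ?thesis
      proof (cases "x \<in> hole h")
        case True
        then obtain e where e: "0 < e" "ball x e \<subseteq> hole h" using open_hole[OF h(1)] open_contains_ball by blast
        let ?s = "min e \<rho>"
        have sub: "ball x ?s \<subseteq> closure (hole h)" using e closure_subset by fastforce
        show ?thesis
        proof (cases "touched h")
          case True
          then show ?thesis using sub h e \<rho> unfolding H_def by (intro exI[of _ ?s]) auto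
        next
          case False
          have "y \<notin> H" if y: "y \<in> ball x ?s" for y
          proof
            assume "y \<in> H"
            then consider "y \<in> W" | k where "k \<in> I" "touched k" "y \<in> closure (hole k)" unfolding H_def by blast
            then show False
            proof cases
              case 1
              moreover have "y \<in> holes" using sub y h(1) unfolding holes_def by blast
              ultimately show False using WD by blast
            next
              case 2
              then show False using only[OF 2(1,3)] y False by simp
            qed
          qed
          then show ?thesis using e \<rho> by (intro exI[of _ ?s]) auto
        qed
      next
        case False
        then have xf: "x \<in> frontier (hole h)" using not_in_frontier_iff h by blast
        obtain s where s: "0 < s" "s \<le> \<rho>" "ball x s - closure (hole h) \<subseteq> - holes"
          "\<And>y z. y \<in> ball x s - closure (hole h) \<Longrightarrow> z \<in> ball x s - closure (hole h) \<Longrightarrow> \<exists>C. connected C \<and> y \<in> C \<and> z \<in> C \<and> C \<subseteq> - holes"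
          "\<And>y e. y \<in> ball x s \<Longrightarrow> y \<in> frontier (hole h) \<Longrightarrow> 0 < e \<Longrightarrow> \<exists>z\<in>ball y e. z \<in> ball x s - closure (hole h)"
          using outer_part[OF h(1) xf] by metis
        have di: "ball x s - closure (hole h) \<subseteq> W \<or> ball x s \<inter> W = {}" by (rule dich[OF s(3) h(1) s(4)])
        show ?thesis
        proof (cases "touched h")
          case True
          then have "x \<in> closure W" using all[OF h(1)] xf by blast
          then have "ball x s \<inter> W \<noteq> {}" using s(1) by (auto simp: closure_approachable dist_commute disjoint_iff)
          then have "ball x s - closure (hole h) \<subseteq> W" using di by blast
          then have "ball x s \<subseteq> H" using True h unfolding H_def by blast
          then show ?thesis using s(1) by blast
        next
          case False
          have "ball x s \<inter> W = {}"
          proof (rule ccontr)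
            assume "ball x s \<inter> W \<noteq> {}"
            then have o: "ball x s - closure (hole h) \<subseteq> W" using di by blast
            have "x \<in> closure W" unfolding closure_approachable
            proof (intro allI impI)
              fix e :: real assume "0 < e"
              then show "\<exists>z\<in>W. dist z x < e" using s(5)[of x e] s(1) xf o by (metis centre_in_ball dist_commute mem_ball subsetD)
            qed
            then show False using False xf by (auto simp: touched_def)
          qed
          moreover have "ball x s \<inter> closure (hole k) = {}" if "k \<in> I" "touched k" for k
            using only[OF that(1)] s(2) that False by fastforce
          ultimately have "ball x s \<inter> H = {}" unfolding H_def by blast
          then show ?thesis using s(1) by blast
        qed
      qed
    qed
    have "open H" unfolding open_contains_ball using dec by (metis Int_iff centre_in_ball empty_iff)
    moreover have "open (- H)" unfolding open_contains_ball
    proof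
      fix x assume "x \<in> - H"
      then show "\<exists>e>0. ball x e \<subseteq> - H" using dec[of x] by (metis ComplD centre_in_ball disjoint_eq_subset_Compl subsetD)
    qed
    ultimately have "H = {} \<or> H = UNIV" using clopen by (metis closed_def)
    moreover have "a \<in> H" using a by (simp add: H_def W_def)
    ultimately have "b \<in> H" by auto
    then have "b \<in> W" using b by (auto simp: H_def holes_def)
    then show ?thesis by (simp add: W_def)
  qed
  then show ?thesis by (simp add: connected_iff_connected_component)
qed

end

section \<open>Perforated cells and the weighted Sobolev inequality\<close>

locale perforated_cell =
  fixes m :: nat and \<tau> :: "nat \<Rightarrow> 'a::euclidean_space set" and c0 :: real
  assumes c0: "0 < c0" and m: "0 < m"
    and hole_open: "\<And>i. i < m \<Longrightarrow> open (\<tau> i)" and hole_smooth: "\<And>i. i < m \<Longrightarrow> smooth_boundary (\<tau> i)"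
    and hole_frontier: "\<And>i. i < m \<Longrightarrow> connected (frontier (\<tau> i))"
    and hole_in_Y: "\<And>i. i < m \<Longrightarrow> \<tau> i \<subseteq> Ycell"
    and hole_dist_Y: "\<And>i. i < m \<Longrightarrow> setdist (\<tau> i) (frontier Ycell) \<ge> c0"
    and hole_dist: "\<And>i j. i < m \<Longrightarrow> j < m \<Longrightarrow> i \<noteq> j \<Longrightarrow> setdist (\<tau> i) (\<tau> j) \<ge> c0"
begin

text \<open>\<open>setdist\<close> to or from the empty set is 0 by convention, so the positive
  lower bound excludes empty holes.\<close>

lemma hole_nonempty: "i < m \<Longrightarrow> \<tau> i \<noteq> {}"
  using hole_dist_Y[of i] c0 by auto

lemma Ycell_iff: "y \<in> Ycell \<longleftrightarrow> (\<forall>b\<in>Basis. - 1 / 2 < y \<bullet> b \<and> y \<bullet> b < 1 / 2)"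
  by (auto simp: Ycell_def mem_box)

text \<open>A ball is connected: if it left the cell it would meet the frontier, at distance less
  than c0 from a point of the hole.\<close>

lemma ball_subset_Ycell:
  assumes "i < m" "s \<in> \<tau> i"
  shows "ball s c0 \<subseteq> Ycell"
proof (rule ccontr)
  assume "\<not> ball s c0 \<subseteq> Ycell"
  moreover have "s \<in> ball s c0 \<inter> Ycell" using assms(2) hole_in_Y[OF assms(1)] c0 by auto
  then have "ball s c0 \<inter> Ycell \<noteq> {}" by blast
  ultimately obtain f where f: "f \<in> ball s c0" "f \<in> frontier Ycell"
    using connected_Int_frontier[of "ball s c0" "Ycell"] by auto
  have "setdist (\<tau> i) (frontier Ycell) \<le> dist s f" using assms f by (intro setdist_le_dist)
  then show False using f hole_dist_Y[OF assms(1)] by simp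
qed

lemma closure_hole_subset: "i < m \<Longrightarrow> closure (\<tau> i) \<subseteq> Ycell"
proof
  fix t assume i: "i < m" and "t \<in> closure (\<tau> i)"
  then obtain s where s: "s \<in> \<tau> i" "dist s t < c0" using c0 by (auto simp: closure_approachable)
  then have "t \<in> ball s c0" by simp
  then show "t \<in> Ycell" using ball_subset_Ycell[OF i s(1)] by blast
qed

section \<open>The periodic array of holes\<close>

lemma lattice_Ycell_eq:
  assumes "t \<in> Ycell" "t + z \<in> Ycell" "z \<in> lattice"
  shows "z = (0::'a)"
proof (rule euclidean_eqI)
  fix b :: 'a assume b: "b \<in> Basis"
  obtain k :: int where k: "z \<bullet> b = of_int k" using assms(3) b by (auto simp: lattice_def elim: Ints_cases)
  have "- 1 / 2 < t \<bullet> b" "t \<bullet> b < 1 / 2" "- 1 / 2 < t \<bullet> b + of_int k" "t \<bullet> b + of_int k < 1 / 2"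
    using assms b k by (auto simp: Ycell_iff inner_add_left)
  then have "- 1 < (of_int k :: real)" "(of_int k :: real) < 1" by linarith+
  then have "k = 0" by linarith
  then show "z \<bullet> b = 0 \<bullet> b" using k by simp
qed

definition "hole h = (+) (snd h) ` \<tau> (fst h)"

definition "T = perforation 1 (holes_union m \<tau>)"

text \<open>Within one cell this is the assumed separation. For different cells, the ball of radius
  c0 about a hole point stays in its own open cell, and translates of the open cell by different
  lattice vectors are disjoint.\<close>

lemma hole_points_far:
  assumes i: "i < m" "z \<in> lattice" and j: "j < m" "w \<in> lattice" and ne: "(i, z) \<noteq> (j, w)"
    and s: "s \<in> \<tau> i" and t: "t \<in> \<tau> j"
  shows "c0 \<le> dist (z + s) (w + t)"
proof (cases "z = w")
  case True
  then have "c0 \<le> setdist (\<tau> i) (\<tau> j)" using hole_dist i j ne by auto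
  also have "\<dots> \<le> dist s t" using s t by (rule setdist_le_dist)
  finally show ?thesis using True by simp
next
  case False
  show ?thesis
  proof (rule ccontr)
    assume "\<not> c0 \<le> dist (z + s) (w + t)"
    then have "t + (w - z) \<in> ball s c0" by (simp add: dist_norm algebra_simps)
    then have "t + (w - z) \<in> Ycell" using ball_subset_Ycell[OF i(1) s] by blast
    then have "w - z = 0" using lattice_Ycell_eq[of t "w - z"] t j hole_in_Y lattice_diff[OF j(2) i(2)] by blast
    then show False using False by simp
  qed
qed

lemma separated_holes: "separated_holes ({..<m} \<times> lattice) hole c0"
proof
  show "0 < c0" by (rule c0)
  fix h assume h: "h \<in> {..<m} \<times> (lattice :: 'a set)"
  then have i: "fst h < m" by auto
  show "open (hole h)" unfolding hole_def using hole_open[OF i] by (rule open_translation)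
  show "connected (frontier (hole h))"
    unfolding hole_def frontier_translation
    by (intro connected_continuous_image hole_frontier[OF i] continuous_intros)
  show "\<exists>n g L r. local_graph (hole h) x n g L r" if xf: "x \<in> frontier (hole h)" for x
  proof -
    obtain y where y: "y \<in> frontier (\<tau> (fst h))" "x = snd h + y"
      using xf unfolding hole_def frontier_translation by blast
    then show ?thesis
      using smooth_boundary_local_graph[OF hole_smooth[OF i] y(1)] local_graph_translate[where a="snd h"] unfolding hole_def by blast
  qed
  fix k x y assume k: "k \<in> {..<m} \<times> lattice" and x: "x \<in> closure (hole h)" and y: "y \<in> closure (hole k)" and d: "dist x y < c0"
  show "h = k"
  proof (rule ccontr)
    assume ne: "h \<noteq> k"
    \<comment> \<open>Separation is known for points of the open holes, so the missing distance is
      shared between the approximations of x and y.\<close>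
    have e: "0 < (c0 - dist x y) / 2" using d by simp
    obtain x' where x': "x' \<in> hole h" "dist x' x < (c0 - dist x y) / 2" using x e closure_approachable by metis
    obtain y' where y': "y' \<in> hole k" "dist y' y < (c0 - dist x y) / 2" using y e closure_approachable by metis
    have "dist x' y' \<le> dist x' x + dist x y + dist y y'"
      using dist_triangle[of x' y' x] dist_triangle[of x y' y] by linarith
    then have "dist x' y' < c0" using x' y' by (simp add: dist_commute)
    moreover obtain s t where "s \<in> \<tau> (fst h)" "x' = snd h + s" "t \<in> \<tau> (fst k)" "y' = snd k + t"
      using x' y' by (auto simp: hole_def)
    moreover have "(fst h, snd h) \<noteq> (fst k, snd k)" using ne by (metis prod.collapse)
    ultimately show False using hole_points_far[of "fst h" "snd h" "fst k" "snd k" s t] h k by auto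
  qed
qed

sublocale separated_holes "{..<m} \<times> lattice" hole c0
  by (rule separated_holes)

lemma holes_eq: "holes = T"
proof -
  have "closure (hole h) = (+) (snd h) ` closure (\<tau> (fst h))" for h
    unfolding hole_def by (rule closure_translation)
  then show ?thesis unfolding holes_def T_def perforation_def scaled_copy_def holes_union_def by (auto simp: image_iff) fastforce+
qed

lemma mem_T_iff: "x \<in> T \<longleftrightarrow> (\<exists>i<m. \<exists>z\<in>lattice. \<exists>t\<in>closure (\<tau> i). x = z + t)"
  unfolding T_def perforation_def scaled_copy_def holes_union_def by auto

lemma holes_union_subset: "holes_union m \<tau> \<subseteq> T"
proof
  fix t assume "t \<in> holes_union m \<tau>"
  then obtain i where "i < m" "t \<in> closure (\<tau> i)" by (auto simp: holes_union_def)
  then show "t \<in> T" unfolding mem_T_iff using lattice_0 by force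
qed

lemma T_nonempty: "T \<noteq> {}" "holes_union m \<tau> \<noteq> {}"
proof -
  have "closure (\<tau> 0) \<noteq> {}" using hole_nonempty[OF m] by simp
  then show "holes_union m \<tau> \<noteq> {}" using m by (auto simp: holes_union_def)
  then show "T \<noteq> {}" using holes_union_subset by blast
qed

lemma Compl_T_nonempty: "- T \<noteq> {}"
proof -
  \<comment> \<open>A corner of the cell: its coordinates are half-integers, while a hole point
    differs from some lattice point by less than 1/2 in each coordinate.\<close>
  have "(1 / 2) *\<^sub>R One \<notin> T"
  proof
    assume "(1 / 2) *\<^sub>R One \<in> T"
    then obtain i z t where i: "i < m" "z \<in> lattice" "t \<in> closure (\<tau> i)" "(1 / 2) *\<^sub>R One = z + t"
      unfolding mem_T_iff by blast
    obtain b :: 'a where b: "b \<in> Basis" using nonempty_Basis by blast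
    obtain k :: int where k: "z \<bullet> b = of_int k" using i(2) b by (auto simp: lattice_def elim: Ints_cases)
    have "((1 / 2) *\<^sub>R One) \<bullet> b = 1 / 2" using b by simp
    then have "of_int k + t \<bullet> b = 1 / 2" using i(4) k by (simp add: inner_add_left)
    moreover have "- 1 / 2 < t \<bullet> b" "t \<bullet> b < 1 / 2" using closure_hole_subset[OF i(1)] i(3) b by (auto simp: Ycell_iff)
    ultimately have "0 < (of_int k :: real)" "(of_int k :: real) < 1" by linarith+
    then show False by simp
  qed
  then show ?thesis by blast
qed

text \<open>On the line the frontier of a bounded open set contains the two extreme points of its
  closure. Being connected, it would contain everything between them, hence points of the open hole
  itself.\<close>

lemma dim_ge_2: "2 \<le> DIM('a)"
proof (rule ccontr)
  assume "\<not> 2 \<le> DIM('a)"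
  then have "DIM('a) = 1" using DIM_positive[where 'a='a] by linarith
  then obtain b where B: "(Basis :: 'a set) = {b}" by (auto simp: card_1_singleton_iff)
  have rep: "x = (x \<bullet> b) *\<^sub>R b" for x :: 'a
  proof -
    have "(\<Sum>b\<in>{b}. (x \<bullet> b) *\<^sub>R b) = x" using euclidean_representation[of x] unfolding B .
    then show ?thesis by simp
  qed
  let ?U = "\<tau> 0" let ?F = "(\<lambda>x. x \<bullet> b) ` frontier ?U"
  have bd: "bounded ?U" using hole_in_Y[OF m] bounded_box bounded_subset unfolding Ycell_def by blast
  have cc: "compact (closure ?U)" using bd by (simp add: compact_closure)
  have ne: "closure ?U \<noteq> {}" using hole_nonempty[OF m] by simp
  have cont: "continuous_on (closure ?U) (\<lambda>x. x \<bullet> b)" by (intro continuous_intros)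
  obtain p where p: "p \<in> closure ?U" "\<And>y. y \<in> closure ?U \<Longrightarrow> y \<bullet> b \<le> p \<bullet> b"
    using continuous_attains_sup[OF cc ne cont] by blast
  obtain q where q: "q \<in> closure ?U" "\<And>y. y \<in> closure ?U \<Longrightarrow> q \<bullet> b \<le> y \<bullet> b"
    using continuous_attains_inf[OF cc ne cont] by blast
  have "b \<in> Basis" unfolding B by simp
  then have "norm b = 1" and bb: "b \<bullet> b = 1" by (simp_all add: inner_same_Basis)
  \<comment> \<open>The sign \<sigma> treats the maximum and the minimum at once.\<close>
  have notin: "x \<notin> ?U" if "\<And>y. y \<in> closure ?U \<Longrightarrow> \<sigma> * (y \<bullet> b) \<le> \<sigma> * (x \<bullet> b)" "\<bar>\<sigma>\<bar> = 1" for x \<sigma>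
  proof
    assume "x \<in> ?U"
    then obtain e where e: "0 < e" "ball x e \<subseteq> ?U" using hole_open[OF m] open_contains_ball by blast
    have "x + (\<sigma> * (e / 2)) *\<^sub>R b \<in> ball x e" using e that(2) \<open>norm b = 1\<close> by (simp add: dist_norm abs_mult)
    then have "x + (\<sigma> * (e / 2)) *\<^sub>R b \<in> closure ?U" using e closure_subset by blast
    from that(1)[OF this] have "\<sigma> * (\<sigma> * (e / 2)) \<le> 0"
      using bb by (simp add: inner_add_left algebra_simps)
    moreover have "\<sigma> * \<sigma> = 1" using that(2) by (metis abs_mult_self_eq mult_1)
    then have "\<sigma> * (\<sigma> * (e / 2)) = e / 2" by (simp only: mult.assoc[symmetric] mult_1_left)
    ultimately show False using e by simp
  qed
  have pf: "p \<in> frontier ?U" and qf: "q \<in> frontier ?U"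
    using p q notin[of 1 p] notin[of "-1" q] hole_open[OF m] by (auto simp: frontier_def interior_open)
  have "connected ?F" using hole_frontier[OF m] by (intro connected_continuous_image continuous_intros)
  then have iv: "is_interval ?F" by (simp add: is_interval_connected_1)
  obtain y where y: "y \<in> ?U" using hole_nonempty[OF m] by blast
  then have "q \<bullet> b \<le> y \<bullet> b" "y \<bullet> b \<le> p \<bullet> b" using p q closure_subset by blast+
  then have "y \<bullet> b \<in> ?F" using iv pf qf unfolding is_interval_1 by blast
  then obtain x where "x \<in> frontier ?U" "x \<bullet> b = y \<bullet> b" by auto
  then have "y \<in> frontier ?U" using rep[of x] rep[of y] by simp
  then show False using y hole_open[OF m] by (simp add: frontier_def interior_open)
qed

lemma periodic_cone_domain: "periodic_cone_domain T"
proof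
  show "2 \<le> DIM('a)" by (rule dim_ge_2)
  show "closed T" using closed_holes by (simp add: holes_eq)
  show "T \<noteq> {}" by (rule T_nonempty)
  show "- T \<noteq> {}" by (rule Compl_T_nonempty)
  show "connected (- T)" using connected_complement by (simp add: holes_eq)
  show "x + z \<in> T" if z: "z \<in> lattice" and "x \<in> T" for x z
  proof -
    obtain i w t where "i < m" "w \<in> lattice" "t \<in> closure (\<tau> i)" "x = w + t" using \<open>x \<in> T\<close> unfolding mem_T_iff by blast
    moreover have "x + z = (w + z) + t" using \<open>x = w + t\<close> by simp
    ultimately show ?thesis unfolding mem_T_iff using lattice_add z by blast
  qed
  show "\<exists>n r c t0. norm n \<le> 1 \<and> 0 < r \<and> 0 < c \<and> 0 < t0 \<and> (\<forall>x\<in>ball x0 r - T. \<forall>t\<in>{0..t0}. c * t \<le> infdist (x + t *\<^sub>R n) T)" for x0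
    using cone_property[of x0] T_nonempty by (simp add: holes_eq)
qed

sublocale pcd: periodic_cone_domain T
  by (rule periodic_cone_domain)

text \<open>If a nearest point of T lies in the own cell there is nothing to lose. Otherwise y is at
  least c0 away from T, while some hole of the own cell is within distance d; hence the ratio
  d/c0.\<close>

lemma infdist_holes_union_le:
  assumes y: "y \<in> Ycell"
  shows "infdist y (holes_union m \<tau>) \<le> max 1 (DIM('a) / c0) * infdist y T"
proof -
  let ?K = "max 1 (DIM('a) / c0)"
  obtain a where a: "a \<in> T" "infdist y T = dist y a" using infdist_attains_inf[OF pcd.closed T_nonempty(1)] by blast
  then obtain i z t where i: "i < m" "z \<in> lattice" "t \<in> closure (\<tau> i)" "a = z + t" unfolding mem_T_iff by blast
  show ?thesis
  proof (cases "z = 0")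
    case True
    then have "a \<in> holes_union m \<tau>" using i by (auto simp: holes_union_def)
    then have "infdist y (holes_union m \<tau>) \<le> 1 * infdist y T" using infdist_le[of a _ y] a by simp
    also have "\<dots> \<le> ?K * infdist y T" by (intro mult_right_mono) (use infdist_nonneg[of y T] in auto)
    finally show ?thesis .
  next
    case False
    have "c0 \<le> dist y a"
    proof (rule ccontr)
      assume "\<not> c0 \<le> dist y a"
      then have "0 < c0 - dist y a" by simp
      then obtain s where s: "s \<in> \<tau> i" "dist s t < c0 - dist y a" using i(3) closure_approachable by blast
      have "dist s (y - z) \<le> dist s t + dist t (y - z)" by (rule dist_triangle)
      also have "dist t (y - z) = dist y a" unfolding i(4) by (simp add: dist_norm norm_minus_commute algebra_simps)
      finally have "y - z \<in> ball s c0" using s by simp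
      then have "y + (- z) \<in> Ycell" using ball_subset_Ycell[OF i(1) s(1)] by auto
      then have "- z = 0" using lattice_Ycell_eq[OF y _ lattice_uminus[OF i(2)]] by blast
      then show False using False by simp
    qed
    then have far: "c0 \<le> infdist y T" using a by simp
    obtain t0 where t0: "t0 \<in> holes_union m \<tau>" using T_nonempty(2) by blast
    then have t0Y: "t0 \<in> Ycell" using closure_hole_subset by (auto simp: holes_union_def)
    have "infdist y (holes_union m \<tau>) \<le> dist y t0" by (rule infdist_le[OF t0])
    also have "\<dots> \<le> (\<Sum>b\<in>Basis. \<bar>(y - t0) \<bullet> b\<bar>)" unfolding dist_norm by (rule norm_le_l1)
    also have "\<dots> \<le> (\<Sum>b\<in>(Basis::'a set). 1)"
    proof (rule sum_mono)
      fix b :: 'a assume "b \<in> Basis"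
      then have "- 1 / 2 < y \<bullet> b" "y \<bullet> b < 1 / 2" "- 1 / 2 < t0 \<bullet> b" "t0 \<bullet> b < 1 / 2" using y t0Y by (auto simp: Ycell_iff)
      then show "\<bar>(y - t0) \<bullet> b\<bar> \<le> 1" unfolding inner_diff_left by linarith
    qed
    also have "\<dots> = DIM('a) / c0 * c0" using c0 by simp
    also have "\<dots> \<le> ?K * infdist y T" using far c0 infdist_nonneg[of y T] by (intro mult_mono) auto
    finally show ?thesis .
  qed
qed

section \<open>From the distance to the given weight\<close>

lemma perforation_eq: "perforation \<epsilon> (holes_union m \<tau>) = (*\<^sub>R) \<epsilon> ` T"
  unfolding T_def perforation_def scaled_copy_def by (auto simp: image_iff)

text \<open>The weight is compared with the distance on the open cell only; the faces of the scaled
  cells form a null set, so the comparison holds almost everywhere.\<close>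

lemma AE_grid:
  assumes "0 < \<epsilon>"
  shows "AE x in lborel. \<forall>b\<in>Basis. \<forall>k::int. (x::'a) \<bullet> b \<noteq> \<epsilon> * (of_int k - 1 / 2)"
proof -
  have "AE x in lborel. (x::'a) \<bullet> b \<noteq> c" if "b \<in> Basis" for b c
  proof -
    have "{x::'a. x \<bullet> b = c} \<in> null_sets lborel"
      using negligible_standard_hyperplane[OF that, of c] by (auto simp: negligible_iff_null_sets null_sets_completion_iff)
    from AE_not_in[OF this] show ?thesis by simp
  qed
  then show ?thesis
    by (subst AE_ball_countable) (auto simp: AE_all_countable countable_finite)
qed

lemma weight_comparison:
  fixes \<phi> :: "'a \<Rightarrow> real"
  assumes periodic: "\<And>y z. z \<in> lattice \<Longrightarrow> y \<notin> perforation 1 (holes_union m \<tau>) \<Longrightarrow> \<phi> (y + z) = \<phi> y"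
    and dist: "\<exists>c C. c > 0 \<and> C > 0 \<and> (\<forall>y \<in> Ycell - holes_union m \<tau>.
                     c * infdist y (holes_union m \<tau>) \<le> \<phi> y \<and> \<phi> y \<le> C * infdist y (holes_union m \<tau>))"
  obtains c C where "0 < c" "0 < C"
    "\<And>\<epsilon>. 0 < \<epsilon> \<Longrightarrow> AE x in lborel. x \<notin> (*\<^sub>R) \<epsilon> ` T \<longrightarrow>
       c * infdist ((1 / \<epsilon>) *\<^sub>R x) T \<le> phi_eps \<phi> \<epsilon> x \<and> phi_eps \<phi> \<epsilon> x \<le> C * infdist ((1 / \<epsilon>) *\<^sub>R x) T"
proof -
  obtain c C where c: "0 < c" "0 < C" "\<And>y. y \<in> Ycell - holes_union m \<tau> \<Longrightarrow> c * infdist y (holes_union m \<tau>) \<le> \<phi> y \<and> \<phi> y \<le> C * infdist y (holes_union m \<tau>)"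
    using dist by blast
  let ?K = "max 1 (DIM('a) / c0)"
  show thesis
  proof (rule that[of c "C * ?K"])
    show "0 < c" "0 < C * ?K" using c by auto
    fix \<epsilon> :: real assume e: "0 < \<epsilon>"
    show "AE x in lborel. x \<notin> (*\<^sub>R) \<epsilon> ` T \<longrightarrow>
       c * infdist ((1 / \<epsilon>) *\<^sub>R x) T \<le> phi_eps \<phi> \<epsilon> x \<and> phi_eps \<phi> \<epsilon> x \<le> C * ?K * infdist ((1 / \<epsilon>) *\<^sub>R x) T"
      using AE_grid[OF e]
    proof eventually_elim
      case (elim x)
      show ?case
      proof
        assume x: "x \<notin> (*\<^sub>R) \<epsilon> ` T"
        let ?x = "(1 / \<epsilon>) *\<^sub>R x"
        \<comment> \<open>The cell is centred at 0, hence the shift by 1/2 before rounding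
          down.\<close>
        define z where "z = lattice_floor (?x + (1 / 2) *\<^sub>R One)"
        have z: "z \<in> lattice" unfolding z_def by (rule lattice_floor_lattice)
        define y where "y = ?x - z"
        have yx: "y + z = ?x" by (simp add: y_def)
        have "y \<in> Ycell" unfolding Ycell_iff
        proof
          fix b :: 'a assume b: "b \<in> Basis"
          have zb: "z \<bullet> b = of_int \<lfloor>?x \<bullet> b + 1 / 2\<rfloor>"
            using b by (simp add: z_def lattice_floor_inner inner_add_left)
          have "?x \<bullet> b + 1 / 2 \<noteq> of_int k" for k :: int
          proof
            assume "?x \<bullet> b + 1 / 2 = of_int k"
            then have "x \<bullet> b = \<epsilon> * (of_int k - 1 / 2)" using e by (simp add: field_simps)
            then show False using elim b by blast
          qed
          then have "of_int \<lfloor>?x \<bullet> b + 1 / 2\<rfloor> < ?x \<bullet> b + 1 / 2"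
            using of_int_floor_le[of "?x \<bullet> b + 1 / 2"] by (simp add: order_less_le)
          moreover have "?x \<bullet> b + 1 / 2 < of_int \<lfloor>?x \<bullet> b + 1 / 2\<rfloor> + 1" by linarith
          ultimately show "- 1 / 2 < y \<bullet> b \<and> y \<bullet> b < 1 / 2" unfolding y_def inner_diff_left zb by linarith
        qed
        have xT: "?x \<notin> T"
        proof
          assume "?x \<in> T"
          then have "\<epsilon> *\<^sub>R ?x \<in> (*\<^sub>R) \<epsilon> ` T" by blast
          then show False using x e by simp
        qed
        then have yT: "y \<notin> T" using pcd.periodic[OF z, of y] yx by auto
        then have yh: "y \<in> Ycell - holes_union m \<tau>" using \<open>y \<in> Ycell\<close> holes_union_subset by blast
        have ph: "phi_eps \<phi> \<epsilon> x = \<phi> y"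
          using periodic[OF z] yT yx unfolding phi_eps_def T_def by metis
        have d: "infdist ?x T = infdist y T" using pcd.dT_translate[OF z, of y] yx by simp
        have "infdist y T \<le> infdist y (holes_union m \<tau>)"
          using T_nonempty holes_union_subset by (intro infdist_mono)
        then have "c * infdist y T \<le> \<phi> y" using c(3)[OF yh] mult_left_mono[of "infdist y T" "infdist y (holes_union m \<tau>)" c] c(1) by linarith
        moreover have "\<phi> y \<le> C * (?K * infdist y T)"
          using c(3)[OF yh] mult_left_mono[OF infdist_holes_union_le[OF \<open>y \<in> Ycell\<close>], of C] c(2) by linarith
        ultimately show "c * infdist ?x T \<le> phi_eps \<phi> \<epsilon> x \<and> phi_eps \<phi> \<epsilon> x \<le> C * ?K * infdist ?x T"
          unfolding ph d by (simp only: mult.assoc)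
      qed
    qed
  qed
qed

end

text \<open>Weak gradients are given for Lebesgue measurable functions, whereas the potential
  estimates are for Borel ones; this permits the passage to Borel representatives.\<close>

lemma weak_gradient_cong_AE:
  fixes u u' :: "'a::euclidean_space \<Rightarrow> real" and G G' :: "'a \<Rightarrow> 'a"
  assumes wg: "weak_gradient S u G" and S[measurable]: "S \<in> sets borel"
    and [measurable]: "u \<in> borel_measurable lebesgue" "u' \<in> borel_measurable lebesgue"
      "\<And>b. b \<in> Basis \<Longrightarrow> (\<lambda>x. G x \<bullet> b) \<in> borel_measurable lebesgue"
      "\<And>b. b \<in> Basis \<Longrightarrow> (\<lambda>x. G' x \<bullet> b) \<in> borel_measurable lebesgue"
    and u: "AE x in lebesgue. u x = u' x" and G: "AE x in lebesgue. G x = G' x"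
  shows "weak_gradient S u' G'"
proof -
  have Sl[measurable]: "S \<in> sets lebesgue" using S by auto
  show ?thesis unfolding weak_gradient_def
  proof (intro conjI allI impI ballI)
    fix K :: "'a set" assume K: "compact K \<and> K \<subseteq> S"
    then have K_sets[measurable]: "K \<in> sets lebesgue" by (simp add: lmeasurable_compact fmeasurableD)
    have i: "set_integrable lebesgue K u" "\<And>b. b \<in> Basis \<Longrightarrow> set_integrable lebesgue K (\<lambda>x. G x \<bullet> b)"
      using wg K unfolding weak_gradient_def by blast+
    show "set_integrable lebesgue K u'"
      unfolding set_integrable_def by (rule integrable_cong_AE_imp[OF i(1)[unfolded set_integrable_def]]) (measurable, use u in eventually_elim, simp)
    fix b :: 'a assume b: "b \<in> Basis"
    note [measurable] = assms(5,6)[OF b]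
    show "set_integrable lebesgue K (\<lambda>x. G' x \<bullet> b)"
      unfolding set_integrable_def by (rule integrable_cong_AE_imp[OF i(2)[OF b, unfolded set_integrable_def]])
        (intro borel_measurable_scaleR borel_measurable_indicator K_sets assms(6)[OF b], use G in eventually_elim, simp)
  next
    fix \<psi> :: "'a \<Rightarrow> real" and b :: 'a assume \<psi>: "test_function S \<psi>" and b: "b \<in> Basis"
    note [measurable] = assms(5,6)[OF b]
    have "Ck 0 UNIV \<psi>" "Ck (Suc 0) UNIV \<psi>" using \<psi> unfolding test_function_def smooth_on_def by blast+
    then have "continuous_on UNIV \<psi>" "continuous_on UNIV (\<lambda>x. frechet_derivative \<psi> (at x) b)" by auto
    then have "\<psi> \<in> borel_measurable borel" "(\<lambda>x. frechet_derivative \<psi> (at x) b) \<in> borel_measurable borel"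
      by (auto intro: borel_measurable_continuous_onI)
    then have [measurable]: "\<psi> \<in> borel_measurable lebesgue" "(\<lambda>x. frechet_derivative \<psi> (at x) b) \<in> borel_measurable lebesgue"
      by (auto intro: measurable_completion)
    have "(LINT x:S|lebesgue. u' x * frechet_derivative \<psi> (at x) b) = (LINT x:S|lebesgue. u x * frechet_derivative \<psi> (at x) b)"
      unfolding set_lebesgue_integral_def using u by (intro integral_cong_AE) (auto elim!: eventually_mono)
    also have "\<dots> = - (LINT x:S|lebesgue. (G x \<bullet> b) * \<psi> x)" using wg \<psi> b unfolding weak_gradient_def by blast
    also have "(LINT x:S|lebesgue. (G x \<bullet> b) * \<psi> x) = (LINT x:S|lebesgue. (G' x \<bullet> b) * \<psi> x)"
      unfolding set_lebesgue_integral_def using G by (intro integral_cong_AE) (auto elim!: eventually_mono)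
    finally show "(LINT x:S|lebesgue. u' x * frechet_derivative \<psi> (at x) b) = - (LINT x:S|lebesgue. (G' x \<bullet> b) * \<psi> x)" .
  qed
qed

text \<open>A weak gradient provides integrability on compact subsets only; measurability follows by
  exhausting the complement of F.\<close>

lemma measurable_of_set_integrable_compact:
  fixes v :: "'a::euclidean_space \<Rightarrow> real"
  assumes F: "closed F" "F \<noteq> {}" and v: "\<And>K. compact K \<Longrightarrow> K \<subseteq> - F \<Longrightarrow> set_integrable lebesgue K v"
    and 0: "\<And>x. x \<in> F \<Longrightarrow> v x = 0"
  shows "v \<in> borel_measurable lebesgue"
proof (rule borel_measurable_LIMSEQ_metric)
  define K where "K n = cball (0::'a) (real (Suc n)) \<inter> {x. 1 / real (Suc n) \<le> infdist x F}" for n :: nat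
  have "closed {x. 1 / real (Suc n) \<le> infdist x F}" for n by (intro closed_Collect_le continuous_intros)
  then have "compact (K n)" for n unfolding K_def by (intro compact_Int_closed compact_cball)
  moreover have "K n \<subseteq> - F" for n
  proof
    fix x assume "x \<in> K n"
    then have "infdist x F \<noteq> 0" by (auto simp: K_def)
    then show "x \<in> - F" by (metis ComplI infdist_zero)
  qed
  ultimately have "set_integrable lebesgue (K n) v" for n using v by blast
  then show "(\<lambda>x. indicator (K n) x *\<^sub>R v x) \<in> borel_measurable lebesgue" for n
    unfolding set_integrable_def by (rule borel_measurable_integrable)
  fix x :: 'a assume "x \<in> space lebesgue"
  show "(\<lambda>n. indicator (K n) x *\<^sub>R v x) \<longlonglongrightarrow> v x"
  proof (cases "x \<in> F")
    case True
    then show ?thesis using 0 by simp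
  next
    case False
    then have d: "0 < infdist x F" using F infdist_pos_not_in_closed by blast
    obtain N :: nat where N: "max (norm x) (1 / infdist x F) < real N" using reals_Archimedean2 by blast
    have "x \<in> K n" if "N \<le> n" for n
    proof -
      have n: "max (norm x) (1 / infdist x F) < real (Suc n)" using N that by linarith
      then have "1 < real (Suc n) * infdist x F" using d by (simp add: divide_less_eq)
      then have "1 / real (Suc n) \<le> infdist x F" by (simp add: divide_le_eq mult.commute)
      then show ?thesis using n by (simp add: K_def)
    qed
    then have "eventually (\<lambda>n. indicator (K n) x *\<^sub>R v x = v x) sequentially"
      by (auto simp: eventually_sequentially intro!: exI[of _ N])
    then show ?thesis by (rule tendsto_eventually)
  qed
qed

context perforated_cell
begin

text \<open>Connects the Lebesgue measurable data with the Borel pointwise bound: u0 and f0 are the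
  distance times |u| and |G|, for Borel representatives cut off to a ball, and the constants c and C
  exchange distance and weight.\<close>

lemma key_estimate:
  fixes \<phi> :: "'a \<Rightarrow> real"
  assumes c: "0 < c" "0 < C" "\<And>\<epsilon>. 0 < \<epsilon> \<Longrightarrow> AE x in lborel. x \<notin> (*\<^sub>R) \<epsilon> ` T \<longrightarrow>
       c * infdist ((1 / \<epsilon>) *\<^sub>R x) T \<le> phi_eps \<phi> \<epsilon> x \<and> phi_eps \<phi> \<epsilon> x \<le> C * infdist ((1 / \<epsilon>) *\<^sub>R x) T"
    and C1: "\<And>\<epsilon> u G R. 0 < \<epsilon> \<Longrightarrow> u \<in> borel_measurable borel \<Longrightarrow> G \<in> borel_measurable borel \<Longrightarrow>
     weak_gradient (- (*\<^sub>R) \<epsilon> ` T) u G \<Longrightarrow> (\<forall>y. R < norm y \<longrightarrow> u y = 0) \<Longrightarrow>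
     (AE x in lborel. x \<notin> (*\<^sub>R) \<epsilon> ` T \<longrightarrow>
       ennreal (infdist ((1 / \<epsilon>) *\<^sub>R x) T * \<bar>u x\<bar>) \<le> ennreal C1 * riesz (\<lambda>y. ennreal (infdist ((1 / \<epsilon>) *\<^sub>R y) T * norm (G y))) x)"
    and e: "0 < \<epsilon>" and \<Omega>: "\<Omega> \<subseteq> cball 0 R" and p: "1 < p"
    and W: "W1p_weighted_0 p (phi_eps \<phi> \<epsilon>) \<Omega> (perforation \<epsilon> (holes_union m \<tau>)) u G"
  defines "S \<equiv> \<Omega> - perforation \<epsilon> (holes_union m \<tau>)"
  obtains u0 f0 :: "'a \<Rightarrow> real" where "u0 \<in> borel_measurable borel" "f0 \<in> borel_measurable borel"
    "\<And>x. 0 \<le> u0 x" "\<And>x. 0 \<le> f0 x" "\<And>x. x \<notin> cball 0 R \<Longrightarrow> u0 x = 0" "\<And>x. x \<notin> cball 0 R \<Longrightarrow> f0 x = 0"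
    "AE x in lborel. ennreal (u0 x) \<le> ennreal C1 * riesz f0 x"
    "AE x in lebesgue. indicator S x * \<bar>phi_eps \<phi> \<epsilon> x * u x\<bar> \<le> C * u0 x"
    "(\<integral>\<^sup>+x. ennreal (f0 x powr p) \<partial>lborel) \<le> ennreal (c powr - p * (LINT x:S|lebesgue. (\<bar>phi_eps \<phi> \<epsilon> x\<bar> * norm (G x)) powr p))"
    "(\<lambda>x. indicator S x * \<bar>phi_eps \<phi> \<epsilon> x * u x\<bar>) \<in> borel_measurable lebesgue"
proof -
  let ?w = "phi_eps \<phi> \<epsilon>" let ?Te = "(*\<^sub>R) \<epsilon> ` T" let ?d = "\<lambda>x. infdist ((1 / \<epsilon>) *\<^sub>R x) T"
  have Te: "perforation \<epsilon> (holes_union m \<tau>) = ?Te" by (rule perforation_eq)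
  have cl: "closed ?Te" by (rule closed_scaling[OF pcd.closed])
  have Te0: "?Te \<noteq> {}" using T_nonempty by simp
  define U where "U x = (if x \<in> S then u x else 0)" for x
  define H where "H x = (if x \<in> S then G x else 0)" for x
  have UT: "x \<in> ?Te \<Longrightarrow> x \<notin> S" for x by (simp add: S_def Te)
  have SO: "x \<in> S \<Longrightarrow> x \<in> cball 0 R" for x using \<Omega> by (auto simp: S_def)
  have wg: "weak_gradient (- ?Te) U H"
    using W unfolding W1p_weighted_0_def Te U_def[abs_def] H_def[abs_def] S_def Compl_eq_Diff_UNIV by blast
  have Um: "U \<in> borel_measurable lebesgue"
    by (rule measurable_of_set_integrable_compact[OF cl Te0])
       (use wg UT in \<open>auto simp: weak_gradient_def U_def\<close>)
  have Hm: "(\<lambda>x. H x \<bullet> b) \<in> borel_measurable lebesgue" if "b \<in> Basis" for b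
    by (rule measurable_of_set_integrable_compact[OF cl Te0])
       (use wg UT that in \<open>auto simp: weak_gradient_def H_def\<close>)
  obtain U1 where U1: "U1 \<in> borel_measurable borel" "AE x in lborel. U x = U1 x"
    using completion_ex_borel_measurable_real[OF Um] by auto
  have "\<forall>b\<in>Basis. \<exists>h. h \<in> borel_measurable borel \<and> (AE x in lborel. H x \<bullet> b = h x)"
    using completion_ex_borel_measurable_real[OF Hm] by fastforce
  then obtain h where h: "\<And>b. b \<in> Basis \<Longrightarrow> h b \<in> borel_measurable borel" "\<And>b. b \<in> Basis \<Longrightarrow> AE x in lborel. H x \<bullet> b = h b x"
    by metis
  \<comment> \<open>The Borel representative may be nonzero on a null set outside the ball, but the
    pointwise bound asks for vanishing everywhere there; hence the explicit cut-off.\<close>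
  define V where "V x = indicator (cball 0 R) x * U1 x" for x
  define g where "g x = indicator (cball 0 R) x *\<^sub>R (\<Sum>b\<in>Basis. h b x *\<^sub>R b)" for x :: 'a
  have Vm[measurable]: "V \<in> borel_measurable borel" unfolding V_def[abs_def] using U1 by measurable
  have gm[measurable]: "g \<in> borel_measurable borel" unfolding g_def[abs_def] using h(1) by measurable
  have UV: "AE x in lborel. U x = V x"
    using U1(2)
  proof eventually_elim
    case (elim x)
    show "U x = V x"
    proof (cases "x \<in> cball 0 R")
      case True
      then show ?thesis using elim by (simp add: V_def)
    next
      case False
      then have "x \<notin> S" using SO by blast
      then show ?thesis using False by (simp add: V_def U_def)
    qed
  qed
  have "AE x in lborel. \<forall>b\<in>Basis. H x \<bullet> b = h b x"
    using h(2) by (subst AE_ball_countable) (auto simp: countable_finite)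
  then have Hg: "AE x in lborel. H x = g x"
  proof eventually_elim
    case (elim x)
    have "H x = (\<Sum>b\<in>Basis. (H x \<bullet> b) *\<^sub>R b)" by (rule euclidean_representation[symmetric])
    also have "\<dots> = (\<Sum>b\<in>Basis. h b x *\<^sub>R b)" using elim by (intro sum.cong) auto
    finally have eq: "H x = (\<Sum>b\<in>Basis. h b x *\<^sub>R b)" .
    show "H x = g x"
    proof (cases "x \<in> cball 0 R")
      case True
      then show ?thesis using eq by (simp add: g_def)
    next
      case False
      then have "x \<notin> S" using SO by blast
      then show ?thesis using False by (simp add: g_def H_def)
    qed
  qed
  note UVl = AE_completion[OF UV] and Hgl = AE_completion[OF Hg]
  have Vl: "V \<in> borel_measurable lebesgue" by (rule measurable_completion) simp
  have gl: "(\<lambda>x. g x \<bullet> b) \<in> borel_measurable lebesgue" for b by (rule measurable_completion) simp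
  have wg': "weak_gradient (- ?Te) V g"
    by (rule weak_gradient_cong_AE[OF wg _ Um Vl Hm gl UVl Hgl]) (use cl in auto)
  define u0 where "u0 x = ?d x * \<bar>V x\<bar>" for x
  define f0 where "f0 x = ?d x * norm (g x)" for x
  have d0: "0 \<le> ?d x" for x by (rule infdist_nonneg)
  have dTe: "?d x = 0" if "x \<in> ?Te" for x
  proof -
    have "(1 / \<epsilon>) *\<^sub>R x \<in> T" using that e by auto
    then show ?thesis by (rule infdist_zero)
  qed
  have cmp: "AE x in lebesgue. x \<notin> ?Te \<longrightarrow> c * ?d x \<le> ?w x \<and> ?w x \<le> C * ?d x" by (rule AE_completion[OF c(3)[OF e]])
  show thesis
  proof (rule that[of u0 f0])
    show "u0 \<in> borel_measurable borel" "f0 \<in> borel_measurable borel" unfolding u0_def[abs_def] f0_def[abs_def] by measurable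
    show "0 \<le> u0 x" "0 \<le> f0 x" for x using d0[of x] by (auto simp: u0_def f0_def)
    show "u0 x = 0" "f0 x = 0" if "x \<notin> cball 0 R" for x using that by (auto simp: u0_def f0_def V_def g_def)
    have "\<forall>y. R < norm y \<longrightarrow> V y = 0" by (auto simp: V_def)
    from C1[OF e Vm gm wg' this] show "AE x in lborel. ennreal (u0 x) \<le> ennreal C1 * riesz f0 x"
    proof eventually_elim
      case (elim x)
      show ?case
      proof (cases "x \<in> ?Te")
        case True
        then show ?thesis by (simp only: u0_def dTe mult_zero_left ennreal_0 zero_le)
      next
        case False
        then show ?thesis using elim by (simp only: u0_def f0_def) simp
      qed
    qed
    show "AE x in lebesgue. indicator S x * \<bar>?w x * u x\<bar> \<le> C * u0 x"
      using cmp UVl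
    proof eventually_elim
      case (elim x)
      show ?case
      proof (cases "x \<in> S")
        case True
        then have "x \<notin> ?Te" using UT by blast
        then have w: "c * ?d x \<le> ?w x" "?w x \<le> C * ?d x" using elim by auto
        have "0 \<le> c * ?d x" using c d0[of x] by simp
        then have "\<bar>?w x\<bar> \<le> C * ?d x" using w by linarith
        then have "\<bar>?w x\<bar> * \<bar>V x\<bar> \<le> (C * ?d x) * \<bar>V x\<bar>" by (intro mult_right_mono) auto
        moreover have "u x = V x" using elim(2) True by (simp add: U_def)
        ultimately show ?thesis using True by (simp add: u0_def abs_mult mult.assoc)
      qed (use c d0[of x] in \<open>simp add: u0_def\<close>)
    qed
    have int: "integrable lebesgue (\<lambda>x. indicator S x *\<^sub>R ((\<bar>?w x\<bar> * norm (G x)) powr p))"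
      "integrable lebesgue (\<lambda>x. indicator S x *\<^sub>R (\<bar>?w x * u x\<bar> powr p))"
      using W unfolding W1p_weighted_0_def set_integrable_def S_def by auto
    have [measurable]: "f0 \<in> borel_measurable borel" by fact
    have "(\<integral>\<^sup>+x. ennreal (f0 x powr p) \<partial>lborel) = (\<integral>\<^sup>+x. ennreal (f0 x powr p) \<partial>lebesgue)"
      by (rule nn_integral_completion[symmetric])
    also have "\<dots> \<le> (\<integral>\<^sup>+x. ennreal (c powr - p * (indicator S x *\<^sub>R ((\<bar>?w x\<bar> * norm (G x)) powr p))) \<partial>lebesgue)"
    proof (rule nn_integral_mono_AE)
      show "AE x in lebesgue. ennreal (f0 x powr p) \<le> ennreal (c powr - p * (indicator S x *\<^sub>R ((\<bar>?w x\<bar> * norm (G x)) powr p)))"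
        using cmp Hgl
      proof eventually_elim
        case (elim x)
        show ?case
        proof (cases "x \<in> S")
          case True
          then have "x \<notin> ?Te" using UT by blast
          then have "c * ?d x \<le> \<bar>?w x\<bar>" using elim by auto
          then have "c * ?d x * norm (g x) \<le> \<bar>?w x\<bar> * norm (G x)"
            using elim(2) True by (simp add: H_def mult_right_mono)
          then have "(c * f0 x) powr p \<le> (\<bar>?w x\<bar> * norm (G x)) powr p"
            using c d0[of x] p by (intro powr_mono2) (auto simp: f0_def mult.assoc)
          then have "c powr - p * (c * f0 x) powr p \<le> c powr - p * (\<bar>?w x\<bar> * norm (G x)) powr p" by (intro mult_left_mono) auto
          moreover have "c powr - p * (c * f0 x) powr p = f0 x powr p"
            using c d0[of x] by (simp add: powr_mult f0_def powr_minus)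
          ultimately show ?thesis using True by (intro ennreal_leI) simp
        next
          case False
          then have "g x = 0" using elim(2) by (simp add: H_def)
          then have "f0 x powr p = 0" by (simp add: f0_def)
          then show ?thesis by simp
        qed
      qed
    qed
    also have "\<dots> = ennreal (LINT x|lebesgue. c powr - p * (indicator S x *\<^sub>R ((\<bar>?w x\<bar> * norm (G x)) powr p)))"
      using int(1) by (intro nn_integral_eq_integral) auto
    also have "(LINT x|lebesgue. c powr - p * (indicator S x *\<^sub>R ((\<bar>?w x\<bar> * norm (G x)) powr p)))
       = c powr - p * (LINT x:S|lebesgue. (\<bar>?w x\<bar> * norm (G x)) powr p)"
      unfolding set_lebesgue_integral_def by (rule integral_mult_right_zero)
    finally show "(\<integral>\<^sup>+x. ennreal (f0 x powr p) \<partial>lborel) \<le> ennreal (c powr - p * (LINT x:S|lebesgue. (\<bar>?w x\<bar> * norm (G x)) powr p))" .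
    \<comment> \<open>Measurability is known for the p-th power; the root of order p recovers the
      function, as it is nonnegative.\<close>
    have "(\<lambda>x. (indicator S x *\<^sub>R (\<bar>?w x * u x\<bar> powr p)) powr (1 / p)) \<in> borel_measurable lebesgue"
      using borel_measurable_integrable[OF int(2)] by measurable
    moreover have "(indicator S x *\<^sub>R (\<bar>?w x * u x\<bar> powr p)) powr (1 / p) = indicator S x * \<bar>?w x * u x\<bar>" for x
      using p by (auto simp: indicator_def powr_powr)
    ultimately show "(\<lambda>x. indicator S x * \<bar>?w x * u x\<bar>) \<in> borel_measurable lebesgue" by simp
  qed
qed

end

text \<open>The norm of the gradient may vanish, so the functions are normalised by an arbitrary N
  above it, and N is finally lowered to the norm.\<close>

lemma le_mult_of_gt:
  fixes x y B :: real
  assumes "\<And>N. x < N \<Longrightarrow> y \<le> B * N" "0 < B"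
  shows "y \<le> B * x"
proof (rule field_le_epsilon)
  fix e :: real assume "0 < e"
  then have "y \<le> B * (x + e / B)" using assms by (intro assms(1)) auto
  then show "y \<le> B * x + e" using assms(2) by (simp add: distrib_left)
qed

lemma powr_le_of_gt:
  assumes "0 \<le> P" "P powr (1 / p) < N" "(1::real) < p"
  shows "0 < N" "P \<le> N powr p"
proof -
  show N: "0 < N" using assms(2) powr_ge_zero[of P "1 / p"] by linarith
  have "(P powr (1 / p)) powr p \<le> N powr p" using assms by (intro powr_mono2) auto
  then show "P \<le> N powr p" using assms by (simp add: powr_powr)
qed

theorem theorem2p6:
  fixes \<Omega> :: "'a::euclidean_space set"
    and m :: nat and \<tau> \<tau>' :: "nat \<Rightarrow> 'a set"
    and c0 \<alpha> p :: real and \<phi> :: "'a \<Rightarrow> real"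
  assumes c0: "c0 > 0"
    and holes_open: "\<And>i. i < m \<Longrightarrow> open (\<tau> i) \<and> smooth_boundary (\<tau> i) \<and> connected (frontier (\<tau> i))"
    and holes_in_Y: "\<And>i. i < m \<Longrightarrow> \<tau> i \<subseteq> Ycell"
    and holes_disj: "\<And>i j. i < m \<Longrightarrow> j < m \<Longrightarrow> i \<noteq> j \<Longrightarrow> \<tau> i \<inter> \<tau> j = {}"
    and holes_dist_Y: "\<And>i. i < m \<Longrightarrow> setdist (\<tau> i) (frontier Ycell) \<ge> c0"
    and holes_dist: "\<And>i j. i < m \<Longrightarrow> j < m \<Longrightarrow> i \<noteq> j \<Longrightarrow> setdist (\<tau> i) (\<tau> j) \<ge> c0"
    and ext_open: "\<And>i. i < m \<Longrightarrow> open (\<tau>' i) \<and> smooth_boundary (\<tau>' i) \<and> \<tau> i \<subseteq> \<tau>' i"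
    and ext_dist: "\<And>i j. i < m \<Longrightarrow> j < m \<Longrightarrow> i \<noteq> j \<Longrightarrow> setdist (\<tau>' i) (\<tau>' j) \<ge> c0 / 4"
    and ext_dist_Y: "\<And>i. i < m \<Longrightarrow> setdist (\<tau>' i) (frontier Ycell) \<ge> c0 / 4"
    and ext_dist_hole: "\<And>i. i < m \<Longrightarrow> setdist (frontier (\<tau>' i)) (\<tau> i) \<ge> c0 / 4"
    and phi_periodic: "\<And>y z. z \<in> lattice \<Longrightarrow> y \<notin> perforation 1 (holes_union m \<tau>) \<Longrightarrow>
                         \<phi> (y + z) = \<phi> y"
    and phi_pos: "\<And>y. y \<notin> perforation 1 (holes_union m \<tau>) \<Longrightarrow> \<phi> y > 0"
    and phi_dist: "\<exists>c C. c > 0 \<and> C > 0 \<and> (\<forall>y \<in> Ycell - holes_union m \<tau>.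
                     c * infdist y (holes_union m \<tau>) \<le> \<phi> y \<and> \<phi> y \<le> C * infdist y (holes_union m \<tau>))"
    and alpha: "0 < \<alpha>" "\<alpha> \<le> 1"
    and phi_reg: "C1_alpha_closure \<alpha> (Ycell - holes_union m \<tau>) \<phi>"
    and Omega: "bounded \<Omega>" "lipschitz_domain \<Omega>"
    and p: "1 < p"
  shows
    "(p < real DIM('a) \<longrightarrow>
       (\<exists>C>0. \<forall>\<epsilon>. 0 < \<epsilon> \<and> \<epsilon> < 1 \<and>
                  admissible_eps c0 \<Omega> (holes_union m \<tau>) (holes_union m \<tau>') \<epsilon> \<longrightarrow>
          (\<forall>u G. W1p_weighted_0 p (phi_eps \<phi> \<epsilon>) \<Omega> (perforation \<epsilon> (holes_union m \<tau>)) u G \<longrightarrow>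
             (let q = 1 / (1 / p - 1 / real DIM('a));
                  S = \<Omega> - perforation \<epsilon> (holes_union m \<tau>) in
              set_integrable lebesgue S (\<lambda>x. \<bar>phi_eps \<phi> \<epsilon> x * u x\<bar> powr q) \<and>
              (LINT x:S|lebesgue. \<bar>phi_eps \<phi> \<epsilon> x * u x\<bar> powr q) powr (1 / q)
                \<le> C * (LINT x:S|lebesgue. (\<bar>phi_eps \<phi> \<epsilon> x\<bar> * norm (G x)) powr p) powr (1 / p)))))
     \<and>
     (p > real DIM('a) \<longrightarrow>
       (\<exists>C>0. \<forall>\<epsilon>. 0 < \<epsilon> \<and> \<epsilon> < 1 \<and>
                  admissible_eps c0 \<Omega> (holes_union m \<tau>) (holes_union m \<tau>') \<epsilon> \<longrightarrow>
          (\<forall>u G. W1p_weighted_0 p (phi_eps \<phi> \<epsilon>) \<Omega> (perforation \<epsilon> (holes_union m \<tau>)) u G \<longrightarrow>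
             (let S = \<Omega> - perforation \<epsilon> (holes_union m \<tau>) in
              AE x in lebesgue. x \<in> S \<longrightarrow>
                \<bar>phi_eps \<phi> \<epsilon> x * u x\<bar>
                  \<le> C * (LINT x:S|lebesgue. (\<bar>phi_eps \<phi> \<epsilon> x\<bar> * norm (G x)) powr p) powr (1 / p)))))"
proof -
  \<comment> \<open>Without holes \<open>infdist\<close> is 0 by convention, and the upper bound on
    \<phi> contradicts its positivity.\<close>
  have mpos: "0 < m"
  proof (rule ccontr)
    assume "\<not> 0 < m"
    then have m0: "holes_union m \<tau> = {}" by (simp add: holes_union_def)
    have P: "perforation 1 (holes_union m \<tau>) = {}" by (simp add: m0 perforation_def scaled_copy_def)
    have Y: "(0::'a) \<in> Ycell - holes_union m \<tau>" by (auto simp: Ycell_def mem_box m0)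
    obtain C where "\<phi> 0 \<le> C * infdist 0 (holes_union m \<tau>)" using phi_dist Y by blast
    then have "\<phi> 0 \<le> 0" by (simp add: m0 infdist_def)
    then show False using phi_pos[of 0] P by simp
  qed
  interpret pc: perforated_cell m \<tau> c0
    using c0 mpos holes_open holes_in_Y holes_dist_Y holes_dist by unfold_locales auto
  let ?d = "real DIM('a)"
  obtain c C where c: "0 < c" "0 < C"
    "\<And>\<epsilon>. 0 < \<epsilon> \<Longrightarrow> AE x in lborel. x \<notin> (*\<^sub>R) \<epsilon> ` pc.T \<longrightarrow>
       c * infdist ((1 / \<epsilon>) *\<^sub>R x) pc.T \<le> phi_eps \<phi> \<epsilon> x \<and> phi_eps \<phi> \<epsilon> x \<le> C * infdist ((1 / \<epsilon>) *\<^sub>R x) pc.T"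
    using pc.weight_comparison[OF phi_periodic phi_dist] by blast
  obtain C1 where C1: "0 < C1" "\<And>\<epsilon> u G R. 0 < \<epsilon> \<Longrightarrow> u \<in> borel_measurable borel \<Longrightarrow> G \<in> borel_measurable borel \<Longrightarrow>
     weak_gradient (- (*\<^sub>R) \<epsilon> ` pc.T) u G \<Longrightarrow> (\<forall>y. R < norm y \<longrightarrow> u y = 0) \<Longrightarrow>
     (AE x in lborel. x \<notin> (*\<^sub>R) \<epsilon> ` pc.T \<longrightarrow>
       ennreal (infdist ((1 / \<epsilon>) *\<^sub>R x) pc.T * \<bar>u x\<bar>) \<le> ennreal C1 * riesz (\<lambda>y. ennreal (infdist ((1 / \<epsilon>) *\<^sub>R y) pc.T * norm (G y))) x)"
    using pc.pcd.weak_pointwise_bound by blast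
  obtain R where R: "0 < R" "\<Omega> \<subseteq> cball 0 R"
  proof -
    obtain R where "0 < R" "\<forall>x\<in>\<Omega>. norm x \<le> R" using Omega(1) bounded_pos by blast
    then show thesis by (intro that[of R]) auto
  qed
  \<comment> \<open>Multiplying by c/N gives a density with p-th power integral at most 1, as the
    estimates for the potential require; all constants reappear in the factor
    \<open>C * C1 / c * N\<close>.\<close>
  have scaled: "\<exists>f v. f \<in> borel_measurable borel \<and> v \<in> borel_measurable borel \<and> (\<forall>x. 0 \<le> f x) \<and> (\<forall>x. 0 \<le> v x) \<and>
      (\<forall>x. x \<notin> cball 0 R \<longrightarrow> f x = 0) \<and> (\<integral>\<^sup>+x. ennreal (f x powr p) \<partial>lborel) \<le> 1 \<and> (AE x in lborel. ennreal (v x) \<le> riesz f x) \<and>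
      (AE x in lebesgue. indicator S x * \<bar>phi_eps \<phi> \<epsilon> x * u x\<bar> \<le> C * C1 / c * N * v x) \<and>
      (\<lambda>x. indicator S x * \<bar>phi_eps \<phi> \<epsilon> x * u x\<bar>) \<in> borel_measurable lebesgue"
    if e: "0 < \<epsilon>" and W: "W1p_weighted_0 p (phi_eps \<phi> \<epsilon>) \<Omega> (perforation \<epsilon> (holes_union m \<tau>)) u G"
      and S: "S = \<Omega> - perforation \<epsilon> (holes_union m \<tau>)"
      and N: "0 < N" "(LINT x:S|lebesgue. (\<bar>phi_eps \<phi> \<epsilon> x\<bar> * norm (G x)) powr p) \<le> N powr p"
    for \<epsilon> u G S and N :: real
  proof -
    obtain u0 f0 :: "'a \<Rightarrow> real" where uf: "u0 \<in> borel_measurable borel" "f0 \<in> borel_measurable borel"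
    "\<And>x. 0 \<le> u0 x" "\<And>x. 0 \<le> f0 x" "\<And>x. x \<notin> cball 0 R \<Longrightarrow> u0 x = 0" "\<And>x. x \<notin> cball 0 R \<Longrightarrow> f0 x = 0"
    "AE x in lborel. ennreal (u0 x) \<le> ennreal C1 * riesz f0 x"
    "AE x in lebesgue. indicator S x * \<bar>phi_eps \<phi> \<epsilon> x * u x\<bar> \<le> C * u0 x"
    "(\<integral>\<^sup>+x. ennreal (f0 x powr p) \<partial>lborel) \<le> ennreal (c powr - p * (LINT x:S|lebesgue. (\<bar>phi_eps \<phi> \<epsilon> x\<bar> * norm (G x)) powr p))"
    "(\<lambda>x. indicator S x * \<bar>phi_eps \<phi> \<epsilon> x * u x\<bar>) \<in> borel_measurable lebesgue"
    proof (rule pc.key_estimate[where ?C1.0 = C1, OF c(1,2) _ _ e R(2) p W], goal_cases)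
      case 1
      show ?case by (rule c(3)) (fact 1)
    next
      case (2 \<delta> w H r)
      show ?case by (rule C1(2)) (fact 2)+
    next
      case (3 u0 f0)
      show ?case by (rule that[OF 3(2-11)[folded S]])
    qed
    note [measurable] = uf(1,2)
    define k where "k = c / N"
    have k: "0 < k" using c N by (simp add: k_def)
    have kc: "k powr p = c powr p * N powr - p" unfolding k_def using powr_divide[of c N p] c N by (simp add: powr_minus_divide)
    show ?thesis
    proof (rule exI[of _ "\<lambda>x. k * f0 x"], rule exI[of _ "\<lambda>x. k / C1 * u0 x"], intro conjI allI impI)
      show "(\<lambda>x. k * f0 x) \<in> borel_measurable borel" "(\<lambda>x. k / C1 * u0 x) \<in> borel_measurable borel" by measurable
      show "0 \<le> k * f0 x" "0 \<le> k / C1 * u0 x" for x using k C1(1) uf by auto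
      show "k * f0 x = 0" if "x \<notin> cball 0 R" for x using uf(6)[OF that] by simp
      have "(\<integral>\<^sup>+x. ennreal ((k * f0 x) powr p) \<partial>lborel) = (\<integral>\<^sup>+x. ennreal (k powr p) * ennreal (f0 x powr p) \<partial>lborel)"
        using k uf(4) by (intro nn_integral_cong) (simp add: powr_mult ennreal_mult)
      also have "\<dots> = ennreal (k powr p) * (\<integral>\<^sup>+x. ennreal (f0 x powr p) \<partial>lborel)" by (rule nn_integral_cmult) measurable
      also have "\<dots> \<le> ennreal (k powr p) * ennreal (c powr - p * N powr p)"
        using uf(9) N(2) by (intro mult_left_mono order_trans[OF uf(9)] ennreal_leI) auto
      also have "\<dots> = ennreal (k powr p * (c powr - p * N powr p))" by (rule ennreal_mult[symmetric]) auto
      also have "k powr p * (c powr - p * N powr p) = (c powr p * c powr - p) * (N powr - p * N powr p)" by (simp add: kc)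
      also have "\<dots> = 1" using c N by (simp add: powr_minus)
      finally show "(\<integral>\<^sup>+x. ennreal ((k * f0 x) powr p) \<partial>lborel) \<le> 1" by simp
      show "AE x in lborel. ennreal (k / C1 * u0 x) \<le> riesz (\<lambda>x. ennreal (k * f0 x)) x"
        using uf(7)
      proof eventually_elim
        case (elim x)
        have "riesz (\<lambda>x. ennreal (k * f0 x)) x = riesz (\<lambda>x. ennreal k * ennreal (f0 x)) x"
          using k uf(4) by (simp add: ennreal_mult)
        also have "\<dots> = ennreal k * riesz f0 x" by (rule riesz_cmult) measurable
        finally have r: "riesz (\<lambda>x. ennreal (k * f0 x)) x = ennreal k * riesz f0 x" .
        have "ennreal (k / C1 * u0 x) = ennreal (k / C1) * ennreal (u0 x)" using k C1(1) uf(3) by (intro ennreal_mult) auto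
        also have "\<dots> \<le> ennreal (k / C1) * (ennreal C1 * riesz f0 x)" by (intro mult_left_mono elim) auto
        also have "\<dots> = ennreal (k / C1 * C1) * riesz f0 x" using k C1(1) by (subst ennreal_mult) (auto simp: mult.assoc)
        also have "k / C1 * C1 = k" using C1(1) by simp
        finally show ?case unfolding r .
      qed
      show "AE x in lebesgue. indicator S x * \<bar>phi_eps \<phi> \<epsilon> x * u x\<bar> \<le> C * C1 / c * N * (k / C1 * u0 x)"
        using uf(8)
      proof eventually_elim
        case (elim x)
        have "C * C1 / c * N * (k / C1 * u0 x) = C * u0 x" using c C1(1) N by (simp add: k_def)
        then show ?case using elim by simp
      qed
    qed (rule uf(10))
  qed
  let ?P = "\<lambda>\<epsilon> G. LINT x:(\<Omega> - perforation \<epsilon> (holes_union m \<tau>))|lebesgue. (\<bar>phi_eps \<phi> \<epsilon> x\<bar> * norm (G x)) powr p"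
  have P0: "0 \<le> ?P \<epsilon> G" for \<epsilon> G unfolding set_lebesgue_integral_def by (intro Bochner_Integration.integral_nonneg) auto
  show ?thesis
  proof (intro conjI impI)
    assume pd: "p < ?d"
    define q where "q = 1 / (1 / p - 1 / ?d)"
    have q: "0 < q" using p pd by (simp add: q_def frac_less2)
    obtain K where K: "0 \<le> K" "\<And>(f :: 'a \<Rightarrow> real) (v :: 'a \<Rightarrow> real). f \<in> borel_measurable borel \<Longrightarrow> v \<in> borel_measurable borel \<Longrightarrow>
      (\<forall>y. 0 \<le> f y) \<Longrightarrow> (\<forall>y. 0 \<le> v y) \<Longrightarrow> (\<integral>\<^sup>+y. ennreal (f y powr p) \<partial>lborel) \<le> 1 \<Longrightarrow>
      (AE x in lborel. ennreal (v x) \<le> riesz f x) \<Longrightarrow> (\<integral>\<^sup>+x. ennreal (v x powr q) \<partial>lborel) \<le> ennreal K"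
      using riesz_HLS[OF p pd] unfolding q_def by blast
    \<comment> \<open>Since K may be 0, the added 1 keeps B positive.\<close>
    define B where "B = C * C1 / c * (K + 1) powr (1 / q)"
    have A: "0 < C * C1 / c" using c C1 by simp
    have B: "0 < B" unfolding B_def using K(1) by (intro mult_pos_pos[OF A]) simp
    show "\<exists>C>0. \<forall>\<epsilon>. 0 < \<epsilon> \<and> \<epsilon> < 1 \<and>
                  admissible_eps c0 \<Omega> (holes_union m \<tau>) (holes_union m \<tau>') \<epsilon> \<longrightarrow>
          (\<forall>u G. W1p_weighted_0 p (phi_eps \<phi> \<epsilon>) \<Omega> (perforation \<epsilon> (holes_union m \<tau>)) u G \<longrightarrow>
             (let q = 1 / (1 / p - 1 / ?d);
                  S = \<Omega> - perforation \<epsilon> (holes_union m \<tau>) in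
              set_integrable lebesgue S (\<lambda>x. \<bar>phi_eps \<phi> \<epsilon> x * u x\<bar> powr q) \<and>
              (LINT x:S|lebesgue. \<bar>phi_eps \<phi> \<epsilon> x * u x\<bar> powr q) powr (1 / q)
                \<le> C * (LINT x:S|lebesgue. (\<bar>phi_eps \<phi> \<epsilon> x\<bar> * norm (G x)) powr p) powr (1 / p)))"
    proof (rule exI[of _ B], rule conjI[OF B], intro allI impI, elim conjE)
      fix \<epsilon> u G assume e: "0 < \<epsilon>" and W: "W1p_weighted_0 p (phi_eps \<phi> \<epsilon>) \<Omega> (perforation \<epsilon> (holes_union m \<tau>)) u G"
      define S where "S = \<Omega> - perforation \<epsilon> (holes_union m \<tau>)"
      let ?v = "\<lambda>x. indicator S x * \<bar>phi_eps \<phi> \<epsilon> x * u x\<bar>"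
      have vq: "indicator S x *\<^sub>R (\<bar>phi_eps \<phi> \<epsilon> x * u x\<bar> powr q) = ?v x powr q" for x
        by (simp add: indicator_def)
      have est: "?v \<in> borel_measurable lebesgue \<and> (\<integral>\<^sup>+x. ennreal (?v x powr q) \<partial>lebesgue) \<le> ennreal ((B * N) powr q)"
        if N: "0 < N" "?P \<epsilon> G \<le> N powr p" for N
      proof -
        obtain f v where fv: "f \<in> borel_measurable borel" "v \<in> borel_measurable borel" "\<forall>x. 0 \<le> f x" "\<forall>x. 0 \<le> v x"
          "(\<integral>\<^sup>+x. ennreal (f x powr p) \<partial>lborel) \<le> 1" "AE x in lborel. ennreal (v x) \<le> riesz f x"
          "AE x in lebesgue. ?v x \<le> C * C1 / c * N * v x" "?v \<in> borel_measurable lebesgue"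
          using scaled[OF e W S_def N[folded S_def]] by blast
        note [measurable] = fv(2)
        let ?A = "C * C1 / c * N"
        have A': "0 < ?A" by (rule mult_pos_pos[OF A N(1)])
        have "(\<integral>\<^sup>+x. ennreal (?v x powr q) \<partial>lebesgue) \<le> (\<integral>\<^sup>+x. ennreal (?A powr q) * ennreal (v x powr q) \<partial>lebesgue)"
        proof (rule nn_integral_mono_AE)
          show "AE x in lebesgue. ennreal (?v x powr q) \<le> ennreal (?A powr q) * ennreal (v x powr q)"
            using fv(7)
          proof eventually_elim
            case (elim x)
            have "?v x powr q \<le> (?A * v x) powr q" using elim q by (intro powr_mono2) auto
            also have "\<dots> = ?A powr q * v x powr q" using powr_mult[of ?A "v x" q] A' fv(4) by simp
            finally show ?case by (subst ennreal_mult[symmetric]) (auto intro: ennreal_leI)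
          qed
        qed
        also have "\<dots> = (\<integral>\<^sup>+x. ennreal (?A powr q) * ennreal (v x powr q) \<partial>lborel)" by (rule nn_integral_completion)
        also have "\<dots> = ennreal (?A powr q) * (\<integral>\<^sup>+x. ennreal (v x powr q) \<partial>lborel)" by (rule nn_integral_cmult) measurable
        also have "\<dots> \<le> ennreal (?A powr q) * ennreal (K + 1)"
          using K(2)[OF fv(1-6)] K(1) by (intro mult_left_mono order_trans[OF _ ennreal_leI[of K "K + 1"]]) auto
        also have "\<dots> = ennreal (?A powr q * (K + 1))" using K(1) by (intro ennreal_mult[symmetric]) auto
        also have "?A powr q * (K + 1) = (B * N) powr q"
        proof -
          have "B * N = ?A * (K + 1) powr (1 / q)" by (simp add: B_def)
          then have "(B * N) powr q = ?A powr q * ((K + 1) powr (1 / q)) powr q" using A' by (simp only: powr_mult powr_ge_zero less_imp_le)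
          then show ?thesis using q K(1) by (simp add: powr_powr)
        qed
        finally show ?thesis using fv(8) by blast
      qed
      define N0 where "N0 = ?P \<epsilon> G powr (1 / p)"
      have ok: "0 < N" "?P \<epsilon> G \<le> N powr p" if "N0 < N" for N
        using powr_le_of_gt[OF P0 that[unfolded N0_def] p] by auto
      have vm: "?v \<in> borel_measurable lebesgue" using est[OF ok(1,2)[of "N0 + 1"]] by simp
      have fin: "(\<integral>\<^sup>+x. ennreal (?v x powr q) \<partial>lebesgue) < \<infinity>"
        using est[OF ok(1,2)[of "N0 + 1"]] by (auto intro: order_le_less_trans)
      have "integrable lebesgue (\<lambda>x. ?v x powr q)"
      proof (rule integrableI_bounded)
        show "(\<lambda>x. ?v x powr q) \<in> borel_measurable lebesgue" using vm by measurable
        show "(\<integral>\<^sup>+x. ennreal (norm (?v x powr q)) \<partial>lebesgue) < \<infinity>" using fin by simp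
      qed
      then have int: "set_integrable lebesgue S (\<lambda>x. \<bar>phi_eps \<phi> \<epsilon> x * u x\<bar> powr q)"
        unfolding set_integrable_def vq .
      have L: "(LINT x:S|lebesgue. \<bar>phi_eps \<phi> \<epsilon> x * u x\<bar> powr q) = (LINT x|lebesgue. ?v x powr q)"
        unfolding set_lebesgue_integral_def vq ..
      have "(LINT x|lebesgue. ?v x powr q) powr (1 / q) \<le> B * N" if N: "N0 < N" for N
      proof -
        have BN: "0 < B * N" using B ok(1)[OF N] by simp
        have "ennreal (LINT x|lebesgue. ?v x powr q) = (\<integral>\<^sup>+x. ennreal (?v x powr q) \<partial>lebesgue)"
          using \<open>integrable lebesgue (\<lambda>x. ?v x powr q)\<close> by (intro nn_integral_eq_integral[symmetric]) auto
        also have "\<dots> \<le> ennreal ((B * N) powr q)" using est[OF ok[OF N]] by blast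
        finally have "(LINT x|lebesgue. ?v x powr q) \<le> (B * N) powr q" by (subst (asm) ennreal_le_iff) auto
        then have "(LINT x|lebesgue. ?v x powr q) powr (1 / q) \<le> ((B * N) powr q) powr (1 / q)"
          using q by (intro powr_mono2 Bochner_Integration.integral_nonneg) auto
        also have "\<dots> = B * N" using BN q by (simp add: powr_powr)
        finally show ?thesis .
      qed
      then have "(LINT x|lebesgue. ?v x powr q) powr (1 / q) \<le> B * N0" using B by (rule le_mult_of_gt)
      then show "let q = 1 / (1 / p - 1 / ?d);
                  S = \<Omega> - perforation \<epsilon> (holes_union m \<tau>) in
              set_integrable lebesgue S (\<lambda>x. \<bar>phi_eps \<phi> \<epsilon> x * u x\<bar> powr q) \<and>
              (LINT x:S|lebesgue. \<bar>phi_eps \<phi> \<epsilon> x * u x\<bar> powr q) powr (1 / q)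
                \<le> B * (LINT x:S|lebesgue. (\<bar>phi_eps \<phi> \<epsilon> x\<bar> * norm (G x)) powr p) powr (1 / p)"
        using int L unfolding Let_def q_def[symmetric] S_def[symmetric] N0_def[folded S_def, symmetric] by simp
    qed
  next
    assume pd: "?d < p"
    \<comment> \<open>Both x and the support of f lie in \<open>cball 0 R\<close>, so the support
      lies in \<open>cball x (2 * R)\<close>.\<close>
    define K where "K = (unit_ball_vol ?d + 1) * (1 / (1 - ?d / p) + 1 / (?d - 1)) * (2 * R) powr (1 - ?d / p)"
    have K: "0 < K"
    proof -
      have "0 < 1 / (1 - ?d / p)" using pd p by simp
      moreover have "0 < 1 / (?d - 1)" using pc.dim_ge_2 by simp
      ultimately show ?thesis using R(1) unfolding K_def by (intro mult_pos_pos add_pos_pos add_nonneg_pos) auto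
    qed
    define B where "B = C * C1 / c * K"
    have B: "0 < B" using c C1 K by (simp add: B_def)
    show "\<exists>C>0. \<forall>\<epsilon>. 0 < \<epsilon> \<and> \<epsilon> < 1 \<and>
                  admissible_eps c0 \<Omega> (holes_union m \<tau>) (holes_union m \<tau>') \<epsilon> \<longrightarrow>
          (\<forall>u G. W1p_weighted_0 p (phi_eps \<phi> \<epsilon>) \<Omega> (perforation \<epsilon> (holes_union m \<tau>)) u G \<longrightarrow>
             (let S = \<Omega> - perforation \<epsilon> (holes_union m \<tau>) in
              AE x in lebesgue. x \<in> S \<longrightarrow>
                \<bar>phi_eps \<phi> \<epsilon> x * u x\<bar>
                  \<le> C * (LINT x:S|lebesgue. (\<bar>phi_eps \<phi> \<epsilon> x\<bar> * norm (G x)) powr p) powr (1 / p)))"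
    proof (rule exI[of _ B], rule conjI[OF B], intro allI impI, elim conjE)
      fix \<epsilon> u G assume e: "0 < \<epsilon>" and W: "W1p_weighted_0 p (phi_eps \<phi> \<epsilon>) \<Omega> (perforation \<epsilon> (holes_union m \<tau>)) u G"
      define S where "S = \<Omega> - perforation \<epsilon> (holes_union m \<tau>)"
      define N0 where "N0 = ?P \<epsilon> G powr (1 / p)"
      have "AE x in lebesgue. x \<in> S \<longrightarrow> \<bar>phi_eps \<phi> \<epsilon> x * u x\<bar> \<le> B * N" if NN: "N0 < N" for N
      proof -
        have N: "0 < N" "?P \<epsilon> G \<le> N powr p" using powr_le_of_gt[OF P0 NN[unfolded N0_def] p] by auto
        obtain f v where fv: "f \<in> borel_measurable borel" "v \<in> borel_measurable borel" "\<forall>x. 0 \<le> f x" "\<forall>x. 0 \<le> v x"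
          "\<forall>x. x \<notin> cball 0 R \<longrightarrow> f x = 0"
          "(\<integral>\<^sup>+x. ennreal (f x powr p) \<partial>lborel) \<le> 1" "AE x in lborel. ennreal (v x) \<le> riesz f x"
          "AE x in lebesgue. indicator S x * \<bar>phi_eps \<phi> \<epsilon> x * u x\<bar> \<le> C * C1 / c * N * v x"
          using scaled[OF e W S_def N[folded S_def]] by blast
        show ?thesis using AE_completion[OF fv(7)] fv(8)
        proof eventually_elim
          case (elim x)
          show ?case
          proof
            assume x: "x \<in> S"
            then have xR: "norm x \<le> R" using R(2) by (auto simp: S_def)
            have "riesz f x \<le> ennreal K" unfolding K_def
            proof (rule riesz_bound_of_support[OF fv(1) _ p pd pc.dim_ge_2 _ fv(6)])
              show "f y = 0" if "y \<notin> cball x (2 * R)" for y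
              proof -
                have "dist x y \<le> norm x + norm y" unfolding dist_norm by (rule norm_triangle_ineq4)
                then have "y \<notin> cball 0 R" using that xR by auto
                then show ?thesis using fv(5) by blast
              qed
            qed (use fv(3) R in auto)
            then have "ennreal (v x) \<le> ennreal K" using elim(1) by (rule order_trans[rotated])
            then have "v x \<le> K" using K by (subst (asm) ennreal_le_iff) auto
            then have "C * C1 / c * N * v x \<le> C * C1 / c * N * K" using c C1 N by (intro mult_left_mono) auto
            then show "\<bar>phi_eps \<phi> \<epsilon> x * u x\<bar> \<le> B * N" using elim(2) x by (simp add: B_def mult_ac)
          qed
        qed
      qed
      \<comment> \<open>The exceptional null set depends on N, so N runs through a sequence
        decreasing to the norm.\<close>
      then have "AE x in lebesgue. \<forall>k::nat. x \<in> S \<longrightarrow> \<bar>phi_eps \<phi> \<epsilon> x * u x\<bar> \<le> B * (N0 + 1 / Suc k)"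
        by (subst AE_all_countable) auto
      then have "AE x in lebesgue. x \<in> S \<longrightarrow> \<bar>phi_eps \<phi> \<epsilon> x * u x\<bar> \<le> B * N0"
      proof eventually_elim
        case (elim x)
        show ?case
        proof
          assume x: "x \<in> S"
          have "(\<lambda>k. B * (N0 + 1 / real (Suc k))) \<longlonglongrightarrow> B * (N0 + 0)"
            by (intro tendsto_intros LIMSEQ_Suc[OF lim_1_over_n])
          then show "\<bar>phi_eps \<phi> \<epsilon> x * u x\<bar> \<le> B * N0"
            using elim x by (intro LIMSEQ_le_const[of "\<lambda>k. B * (N0 + 1 / real (Suc k))"]) auto
        qed
      qed
      then show "let S = \<Omega> - perforation \<epsilon> (holes_union m \<tau>) in
              AE x in lebesgue. x \<in> S \<longrightarrow>
                \<bar>phi_eps \<phi> \<epsilon> x * u x\<bar>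
                  \<le> B * (LINT x:S|lebesgue. (\<bar>phi_eps \<phi> \<epsilon> x\<bar> * norm (G x)) powr p) powr (1 / p)"
        unfolding Let_def S_def N0_def .
    qed
  qed
qed

end
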